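(* Let $S$ and $T$ be $\Pi^1_1$-sound recursively enumerable theories extending $\mathsf{ACA}_0$. Then \[ |S|_{\Pi^1_1}\le |T|_{\Pi^1_1} \iff \operatorname{rank}^{\Sigma^1_1}_{\Pi^1_1}(S)\le \operatorname{rank}^{\Sigma^1_1}_{\Pi^1_1}(T). \]
   Context: Theories are sets of sentences of second-order arithmetic; "true" means true in the standard model. For a complexity class $\Gamma$, $\mathsf{RFN}_\Gamma(T)$ is the sentence $\forall^0 \phi\in\Gamma\,[\mathsf{Prv}_T(\phi)\to \mathsf{True}_\Gamma(\phi)]$ ($\mathsf{True}_\Gamma$ a fixed universal $\Gamma$-formula). $T$ is $\Gamma$-sound if every $\Gamma$-sentence provable in $T$ is true. $T\vdash^{\Gamma}\phi$ means there is a true $\Gamma$-sentence $\theta$ with $T+\theta\vdash\phi$. $|T|_{\Pi^1_1}=\sup\{\alpha : \alpha\text{ a recursive well-order and } T\vdash \mathsf{WO}(\alpha)\}$. On the class of $\Pi^1_1$-sound r.e. extensions of $\mathsf{ACA}_0$ define $S\prec^{\Sigma^1_1}_{\Pi^1_1} T$ iff $T\vdash^{\Sigma^1_1}\mathsf{RFN}_{\Pi^1_1}(S)$; this relation is well-founded (a known fact), and $\operatorname{rank}^{\Sigma^1_1}_{\Pi^1_1}(T)$ denotes the rank of $T$ in it. *)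

theory Defs
  imports Main "HOL-Library.Nat_Bijection"
begin

section \<open>Second-order arithmetic\<close>

text \<open>Formulas use de Bruijn indices, with separate index spaces for number variables
  and set variables: \<open>AllN\<close> binds number variable 0 and \<open>AllS\<close> binds set variable 0
  of its body.\<close>

datatype tm = Var nat | Zero | One | Plus tm tm | Times tm tm

datatype fm = Equal tm tm | Less tm tm | Mem tm nat | Falsum | Imp fm fm | AllN fm | AllS fm

abbreviation "Neg p \<equiv> Imp p Falsum"
abbreviation "Or p q \<equiv> Imp (Neg p) q"
abbreviation "And p q \<equiv> Neg (Imp p (Neg q))"
abbreviation "Iff p q \<equiv> And (Imp p q) (Imp q p)"
abbreviation "ExN p \<equiv> Neg (AllN (Neg p))"
abbreviation "ExS p \<equiv> Neg (AllS (Neg p))"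

primrec num :: "nat \<Rightarrow> tm" where
  "num 0 = Zero"
| "num (Suc n) = Plus (num n) One"

text \<open>\<open>tm_bd n t\<close>: all variables of \<open>t\<close> are below \<open>n\<close>.
  \<open>fm_bd n s p\<close>: all free number (set) variables of \<open>p\<close> are below \<open>n\<close> (below \<open>s\<close>).\<close>

primrec tm_bd :: "nat \<Rightarrow> tm \<Rightarrow> bool" where
  "tm_bd n (Var i) \<longleftrightarrow> i < n"
| "tm_bd n Zero \<longleftrightarrow> True"
| "tm_bd n One \<longleftrightarrow> True"
| "tm_bd n (Plus t u) \<longleftrightarrow> tm_bd n t \<and> tm_bd n u"
| "tm_bd n (Times t u) \<longleftrightarrow> tm_bd n t \<and> tm_bd n u"

primrec fm_bd :: "nat \<Rightarrow> nat \<Rightarrow> fm \<Rightarrow> bool" where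
  "fm_bd n s (Equal t u) \<longleftrightarrow> tm_bd n t \<and> tm_bd n u"
| "fm_bd n s (Less t u) \<longleftrightarrow> tm_bd n t \<and> tm_bd n u"
| "fm_bd n s (Mem t i) \<longleftrightarrow> tm_bd n t \<and> i < s"
| "fm_bd n s Falsum \<longleftrightarrow> True"
| "fm_bd n s (Imp p q) \<longleftrightarrow> fm_bd n s p \<and> fm_bd n s q"
| "fm_bd n s (AllN p) \<longleftrightarrow> fm_bd (Suc n) s p"
| "fm_bd n s (AllS p) \<longleftrightarrow> fm_bd n (Suc s) p"

definition sentence :: "fm \<Rightarrow> bool" where
  "sentence p \<longleftrightarrow> fm_bd 0 0 p"

primrec tm_lift :: "nat \<Rightarrow> tm \<Rightarrow> tm" where
  "tm_lift c (Var i) = Var (if i < c then i else Suc i)"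
| "tm_lift c Zero = Zero"
| "tm_lift c One = One"
| "tm_lift c (Plus t u) = Plus (tm_lift c t) (tm_lift c u)"
| "tm_lift c (Times t u) = Times (tm_lift c t) (tm_lift c u)"

primrec fm_liftN :: "nat \<Rightarrow> fm \<Rightarrow> fm" where
  "fm_liftN c (Equal t u) = Equal (tm_lift c t) (tm_lift c u)"
| "fm_liftN c (Less t u) = Less (tm_lift c t) (tm_lift c u)"
| "fm_liftN c (Mem t i) = Mem (tm_lift c t) i"
| "fm_liftN c Falsum = Falsum"
| "fm_liftN c (Imp p q) = Imp (fm_liftN c p) (fm_liftN c q)"
| "fm_liftN c (AllN p) = AllN (fm_liftN (Suc c) p)"
| "fm_liftN c (AllS p) = AllS (fm_liftN c p)"

primrec fm_liftS :: "nat \<Rightarrow> fm \<Rightarrow> fm" where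
  "fm_liftS c (Equal t u) = Equal t u"
| "fm_liftS c (Less t u) = Less t u"
| "fm_liftS c (Mem t i) = Mem t (if i < c then i else Suc i)"
| "fm_liftS c Falsum = Falsum"
| "fm_liftS c (Imp p q) = Imp (fm_liftS c p) (fm_liftS c q)"
| "fm_liftS c (AllN p) = AllN (fm_liftS c p)"
| "fm_liftS c (AllS p) = AllS (fm_liftS (Suc c) p)"

text \<open>Substitution for variable \<open>k\<close>; the variables above \<open>k\<close> move down by one.\<close>

primrec tm_subst :: "nat \<Rightarrow> tm \<Rightarrow> tm \<Rightarrow> tm" where
  "tm_subst k r (Var i) = (if i < k then Var i else if i = k then r else Var (i - 1))"
| "tm_subst k r Zero = Zero"
| "tm_subst k r One = One"
| "tm_subst k r (Plus t u) = Plus (tm_subst k r t) (tm_subst k r u)"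
| "tm_subst k r (Times t u) = Times (tm_subst k r t) (tm_subst k r u)"

primrec fm_substN :: "nat \<Rightarrow> tm \<Rightarrow> fm \<Rightarrow> fm" where
  "fm_substN k r (Equal t u) = Equal (tm_subst k r t) (tm_subst k r u)"
| "fm_substN k r (Less t u) = Less (tm_subst k r t) (tm_subst k r u)"
| "fm_substN k r (Mem t i) = Mem (tm_subst k r t) i"
| "fm_substN k r Falsum = Falsum"
| "fm_substN k r (Imp p q) = Imp (fm_substN k r p) (fm_substN k r q)"
| "fm_substN k r (AllN p) = AllN (fm_substN (Suc k) (tm_lift 0 r) p)"
| "fm_substN k r (AllS p) = AllS (fm_substN k r p)"

primrec fm_substS :: "nat \<Rightarrow> nat \<Rightarrow> fm \<Rightarrow> fm" where
  "fm_substS k j (Equal t u) = Equal t u"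
| "fm_substS k j (Less t u) = Less t u"
| "fm_substS k j (Mem t i) = Mem t (if i < k then i else if i = k then j else i - 1)"
| "fm_substS k j Falsum = Falsum"
| "fm_substS k j (Imp p q) = Imp (fm_substS k j p) (fm_substS k j q)"
| "fm_substS k j (AllN p) = AllN (fm_substS k j p)"
| "fm_substS k j (AllS p) = AllS (fm_substS (Suc k) (Suc j) p)"

subsection \<open>Truth in the standard model\<close>

primrec tm_val :: "(nat \<Rightarrow> nat) \<Rightarrow> tm \<Rightarrow> nat" where
  "tm_val e (Var i) = e i"
| "tm_val e Zero = 0"
| "tm_val e One = 1"
| "tm_val e (Plus t u) = tm_val e t + tm_val e u"
| "tm_val e (Times t u) = tm_val e t * tm_val e u"

primrec sat :: "(nat \<Rightarrow> nat) \<Rightarrow> (nat \<Rightarrow> nat set) \<Rightarrow> fm \<Rightarrow> bool" where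
  "sat e E (Equal t u) \<longleftrightarrow> tm_val e t = tm_val e u"
| "sat e E (Less t u) \<longleftrightarrow> tm_val e t < tm_val e u"
| "sat e E (Mem t i) \<longleftrightarrow> tm_val e t \<in> E i"
| "sat e E Falsum \<longleftrightarrow> False"
| "sat e E (Imp p q) \<longleftrightarrow> (sat e E p \<longrightarrow> sat e E q)"
| "sat e E (AllN p) \<longleftrightarrow> (\<forall>n. sat (case_nat n e) E p)"
| "sat e E (AllS p) \<longleftrightarrow> (\<forall>X. sat e (case_nat X E) p)"

definition true_sentence :: "fm \<Rightarrow> bool" where
  "true_sentence p \<longleftrightarrow> sentence p \<and> sat (\<lambda>_. 0) (\<lambda>_. {}) p"

subsection \<open>Formula classes\<close>

inductive Delta00 :: "fm \<Rightarrow> bool" where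
  "Delta00 (Equal t u)"
| "Delta00 (Less t u)"
| "Delta00 (Mem t i)"
| "Delta00 Falsum"
| "Delta00 p \<Longrightarrow> Delta00 q \<Longrightarrow> Delta00 (Imp p q)"
| "Delta00 p \<Longrightarrow> Delta00 (AllN (Imp (Less (Var 0) (tm_lift 0 t)) p))"

inductive Sigma01 :: "fm \<Rightarrow> bool" where
  "Delta00 p \<Longrightarrow> Sigma01 p"
| "Sigma01 p \<Longrightarrow> Sigma01 (ExN p)"

primrec arithmetical :: "fm \<Rightarrow> bool" where
  "arithmetical (Equal t u) \<longleftrightarrow> True"
| "arithmetical (Less t u) \<longleftrightarrow> True"
| "arithmetical (Mem t i) \<longleftrightarrow> True"
| "arithmetical Falsum \<longleftrightarrow> True"
| "arithmetical (Imp p q) \<longleftrightarrow> arithmetical p \<and> arithmetical q"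
| "arithmetical (AllN p) \<longleftrightarrow> arithmetical p"
| "arithmetical (AllS p) \<longleftrightarrow> False"

inductive Pi11 :: "fm \<Rightarrow> bool" where
  "arithmetical p \<Longrightarrow> Pi11 p"
| "Pi11 p \<Longrightarrow> Pi11 (AllS p)"

inductive Sigma11 :: "fm \<Rightarrow> bool" where
  "arithmetical p \<Longrightarrow> Sigma11 p"
| "Sigma11 p \<Longrightarrow> Sigma11 (ExS p)"

subsection \<open>Provability\<close>

text \<open>A Hilbert calculus for two-sorted first-order logic with equality on numbers.
  Generalisation is unrestricted because the members of a theory are sentences.\<close>

inductive proves :: "fm set \<Rightarrow> fm \<Rightarrow> bool" (infix \<open>\<turnstile>\<close> 50) for T where
  Ax: "p \<in> T \<Longrightarrow> T \<turnstile> p"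
| MP: "T \<turnstile> Imp p q \<Longrightarrow> T \<turnstile> p \<Longrightarrow> T \<turnstile> q"
| GenN: "T \<turnstile> p \<Longrightarrow> T \<turnstile> AllN p"
| GenS: "T \<turnstile> p \<Longrightarrow> T \<turnstile> AllS p"
| AxK: "T \<turnstile> Imp p (Imp q p)"
| AxS: "T \<turnstile> Imp (Imp p (Imp q r)) (Imp (Imp p q) (Imp p r))"
| AxDN: "T \<turnstile> Imp (Neg (Neg p)) p"
| InstN: "T \<turnstile> Imp (AllN p) (fm_substN 0 t p)"
| VacN: "T \<turnstile> Imp p (AllN (fm_liftN 0 p))"
| DistN: "T \<turnstile> Imp (AllN (Imp p q)) (Imp (AllN p) (AllN q))"
| InstS: "T \<turnstile> Imp (AllS p) (fm_substS 0 i p)"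
| VacS: "T \<turnstile> Imp p (AllS (fm_liftS 0 p))"
| DistS: "T \<turnstile> Imp (AllS (Imp p q)) (Imp (AllS p) (AllS q))"
| EqRefl: "T \<turnstile> Equal t t"
| EqSubst: "T \<turnstile> Imp (Equal t u) (Imp (fm_substN 0 t p) (fm_substN 0 u p))"

text \<open>Provability from \<open>T\<close> together with a true \<open>\<Sigma>\<^sup>1\<^sub>1\<close> sentence.\<close>

definition provesS11 :: "fm set \<Rightarrow> fm \<Rightarrow> bool" (infix \<open>\<turnstile>\<^sub>S\<^sub>1\<^sub>1\<close> 50) where
  "T \<turnstile>\<^sub>S\<^sub>1\<^sub>1 p \<longleftrightarrow> (\<exists>q. Sigma11 q \<and> true_sentence q \<and> insert q T \<turnstile> p)"

definition Pi11_sound :: "fm set \<Rightarrow> bool" where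
  "Pi11_sound T \<longleftrightarrow> (\<forall>p. Pi11 p \<and> sentence p \<and> T \<turnstile> p \<longrightarrow> true_sentence p)"

subsection \<open>The theory \<open>ACA\<^sub>0\<close>\<close>

definition basic_axioms :: "fm set" where
  "basic_axioms =
    {AllN (Neg (Equal (Plus (Var 0) One) Zero)),
     AllN (AllN (Imp (Equal (Plus (Var 1) One) (Plus (Var 0) One)) (Equal (Var 1) (Var 0)))),
     AllN (Equal (Plus (Var 0) Zero) (Var 0)),
     AllN (AllN (Equal (Plus (Var 1) (Plus (Var 0) One)) (Plus (Plus (Var 1) (Var 0)) One))),
     AllN (Equal (Times (Var 0) Zero) Zero),
     AllN (AllN (Equal (Times (Var 1) (Plus (Var 0) One)) (Plus (Times (Var 1) (Var 0)) (Var 1)))),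
     AllN (Neg (Less (Var 0) Zero)),
     AllN (AllN (Iff (Less (Var 1) (Plus (Var 0) One))
                     (Or (Less (Var 1) (Var 0)) (Equal (Var 1) (Var 0)))))}"

definition induction_axiom :: fm where
  "induction_axiom =
    AllS (Imp (And (Mem Zero 0) (AllN (Imp (Mem (Var 0) 0) (Mem (Plus (Var 0) One) 0))))
              (AllN (Mem (Var 0) 0)))"

definition arith_comprehension :: "fm set" where
  "arith_comprehension =
    {(AllS ^^ m) ((AllN ^^ n) (ExS (AllN (Iff (Mem (Var 0) 0) (fm_liftS 0 p))))) | m n p.
       arithmetical p \<and> fm_bd (Suc n) m p}"

definition ACA0 :: "fm set" where
  "ACA0 = basic_axioms \<union> {induction_axiom} \<union> arith_comprehension"

section \<open>Recursive functions and r.e. theories\<close>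

datatype recf = ZeroF | SucF | Proj nat | Comp recf "recf list" | PrimRec recf recf | Mu recf

inductive computes :: "recf \<Rightarrow> nat list \<Rightarrow> nat \<Rightarrow> bool" where
  "computes ZeroF xs 0"
| "computes SucF [x] (Suc x)"
| "i < length xs \<Longrightarrow> computes (Proj i) xs (xs ! i)"
| "list_all2 (\<lambda>g y. computes g xs y) gs ys \<Longrightarrow> computes f ys z \<Longrightarrow> computes (Comp f gs) xs z"
| "computes f xs y \<Longrightarrow> computes (PrimRec f g) (0 # xs) y"
| "computes (PrimRec f g) (n # xs) r \<Longrightarrow> computes g (n # r # xs) y \<Longrightarrow> computes (PrimRec f g) (Suc n # xs) y"
| "computes f (n # xs) 0 \<Longrightarrow> \<forall>m<n. \<exists>y. computes f (m # xs) (Suc y) \<Longrightarrow> computes (Mu f) xs n"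

definition rec_enumerable :: "nat set \<Rightarrow> bool" where
  "rec_enumerable A \<longleftrightarrow> (\<exists>f. \<forall>x. x \<in> A \<longleftrightarrow> (\<exists>y. computes f [x] y))"

definition recursive_rel :: "(nat \<times> nat) set \<Rightarrow> bool" where
  "recursive_rel R \<longleftrightarrow> (\<exists>f. \<forall>x y. computes f [x, y] (if (x, y) \<in> R then 1 else 0))"

text \<open>Goedel numbers.\<close>

primrec tm_code :: "tm \<Rightarrow> nat" where
  "tm_code (Var i) = prod_encode (0, i)"
| "tm_code Zero = prod_encode (1, 0)"
| "tm_code One = prod_encode (2, 0)"
| "tm_code (Plus t u) = prod_encode (3, prod_encode (tm_code t, tm_code u))"
| "tm_code (Times t u) = prod_encode (4, prod_encode (tm_code t, tm_code u))"

primrec fm_code :: "fm \<Rightarrow> nat" where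
  "fm_code (Equal t u) = prod_encode (0, prod_encode (tm_code t, tm_code u))"
| "fm_code (Less t u) = prod_encode (1, prod_encode (tm_code t, tm_code u))"
| "fm_code (Mem t i) = prod_encode (2, prod_encode (tm_code t, i))"
| "fm_code Falsum = prod_encode (3, 0)"
| "fm_code (Imp p q) = prod_encode (4, prod_encode (fm_code p, fm_code q))"
| "fm_code (AllN p) = prod_encode (5, fm_code p)"
| "fm_code (AllS p) = prod_encode (6, fm_code p)"

text \<open>The \<open>\<Pi>\<^sup>1\<^sub>1\<close>-sound r.e. extensions of \<open>ACA\<^sub>0\<close>.\<close>

definition sound_re_extension :: "fm set \<Rightarrow> bool" where
  "sound_re_extension T \<longleftrightarrow>
     (\<forall>p\<in>T. sentence p) \<and> rec_enumerable (fm_code ` T) \<and> (\<forall>p\<in>ACA0. T \<turnstile> p) \<and> Pi11_sound T"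

section \<open>Arithmetisation\<close>

text \<open>The syntactic notions are arithmetised uniformly. Each of them is the least relation
  closed under finitely many Horn clauses, and a tuple belongs to it iff it ends a finite
  sequence in which every entry follows from earlier ones by a clause. Such sequences are coded
  with Goedel's beta function.

  Arguments of clauses are patterns, i.e. terms extended by the pairing function
  \<open>prod_encode\<close>; \<open>PV k\<close> is the \<open>k\<close>-th variable of the clause.\<close>

datatype pat = PV nat | PN nat | PPlus pat pat | PTimes pat pat | PPair pat pat

type_synonym clause = "pat list \<times> pat" \<comment> \<open>premises and conclusion\<close>

subsection \<open>From clauses to formulas\<close>

abbreviation lifts :: "nat \<Rightarrow> tm \<Rightarrow> tm" where
  "lifts n \<equiv> tm_lift 0 ^^ n"

text \<open>\<open>z = prod_encode (x, y)\<close>, since \<open>2 * prod_encode (x, y) = (x + y) * (x + y + 1) + 2 * x\<close>.\<close>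

definition pair_fm :: "tm \<Rightarrow> tm \<Rightarrow> tm \<Rightarrow> fm" where
  "pair_fm z x y =
     Equal (Plus z z) (Plus (Times (Plus x y) (Plus (Plus x y) One)) (Plus x x))"

text \<open>\<open>r\<close> is the remainder of \<open>a\<close> modulo \<open>1 + (i + 1) * b\<close>.\<close>

definition beta_fm :: "tm \<Rightarrow> tm \<Rightarrow> tm \<Rightarrow> tm \<Rightarrow> fm" where
  "beta_fm a b i r =
     (let m = Plus One (Times (Plus i One) b)
      in And (Less r m)
             (ExN (Equal (lifts 1 a) (Plus (Times (Var 0) (lifts 1 m)) (lifts 1 r)))))"

text \<open>\<open>pat_fm p d u\<close>: the value of \<open>p\<close> is \<open>u\<close>, where \<open>PV k\<close> stands for the number variable
  with index \<open>d + k\<close>.\<close>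

primrec pat_fm :: "pat \<Rightarrow> nat \<Rightarrow> tm \<Rightarrow> fm" where
  "pat_fm (PV k) d u = Equal u (Var (d + k))"
| "pat_fm (PN c) d u = Equal u (num c)"
| "pat_fm (PPlus p q) d u = ExN (ExN (And (pat_fm p (d + 2) (Var 1))
     (And (pat_fm q (d + 2) (Var 0)) (Equal (lifts 2 u) (Plus (Var 1) (Var 0))))))"
| "pat_fm (PTimes p q) d u = ExN (ExN (And (pat_fm p (d + 2) (Var 1))
     (And (pat_fm q (d + 2) (Var 0)) (Equal (lifts 2 u) (Times (Var 1) (Var 0))))))"
| "pat_fm (PPair p q) d u = ExN (ExN (And (pat_fm p (d + 2) (Var 1))
     (And (pat_fm q (d + 2) (Var 0)) (pair_fm (lifts 2 u) (Var 1) (Var 0)))))"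

text \<open>A strict upper bound on the variables of a pattern, and of a clause.\<close>

primrec pat_bound :: "pat \<Rightarrow> nat" where
  "pat_bound (PV k) = Suc k"
| "pat_bound (PN c) = 0"
| "pat_bound (PPlus p q) = max (pat_bound p) (pat_bound q)"
| "pat_bound (PTimes p q) = max (pat_bound p) (pat_bound q)"
| "pat_bound (PPair p q) = max (pat_bound p) (pat_bound q)"

definition clause_bound :: "clause \<Rightarrow> nat" where
  "clause_bound c = foldr max (map pat_bound (snd c # fst c)) 0"

text \<open>\<open>clause_fm a b i g c\<close>: the number \<open>g\<close> follows by clause \<open>c\<close> from entries with index
  below \<open>i\<close> of the sequence coded by \<open>a\<close>, \<open>b\<close>.\<close>

definition clause_fm :: "tm \<Rightarrow> tm \<Rightarrow> tm \<Rightarrow> tm \<Rightarrow> clause \<Rightarrow> fm" where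
  "clause_fm a b i g c =
     (let m = clause_bound c in
      (ExN ^^ m) (foldr And
        (map (\<lambda>p. ExN (ExN (And (Less (Var 1) (lifts (m + 2) i))
                (And (beta_fm (lifts (m + 2) a) (lifts (m + 2) b) (Var 1) (Var 0))
                     (pat_fm p 2 (Var 0)))))) (fst c))
        (pat_fm (snd c) 0 (lifts m g))))"

text \<open>\<open>derivable_fm G cs f\<close>: there is a sequence ending with \<open>f\<close> each entry of which satisfies
  \<open>G\<close> or follows by a clause in \<open>cs\<close> from earlier entries. The only free variable of
  \<open>G\<close> is the number variable 0.\<close>

definition derivable_fm :: "fm \<Rightarrow> clause list \<Rightarrow> tm \<Rightarrow> fm" where
  "derivable_fm G cs f =
     ExN (ExN (ExN (And (beta_fm (Var 2) (Var 1) (Var 0) (lifts 3 f))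
       (AllN (Imp (Less (Var 0) (Plus (Var 1) One))
         (ExN (And (beta_fm (Var 4) (Var 3) (Var 1) (Var 0))
           (Or G (foldr Or (map (clause_fm (Var 4) (Var 3) (Var 1) (Var 0)) cs) Falsum)))))))))"

subsection \<open>Clauses for the syntax and for provability\<close>

abbreviation "pSuc x \<equiv> PPlus x (PN 1)"

abbreviation "pVar x \<equiv> PPair (PN 0) x"
abbreviation "pZero \<equiv> PPair (PN 1) (PN 0)"
abbreviation "pOne \<equiv> PPair (PN 2) (PN 0)"
abbreviation "pPlus x y \<equiv> PPair (PN 3) (PPair x y)"
abbreviation "pTimes x y \<equiv> PPair (PN 4) (PPair x y)"

abbreviation "pEqual x y \<equiv> PPair (PN 0) (PPair x y)"
abbreviation "pLess x y \<equiv> PPair (PN 1) (PPair x y)"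
abbreviation "pMem x y \<equiv> PPair (PN 2) (PPair x y)"
abbreviation "pFalsum \<equiv> PPair (PN 3) (PN 0)"
abbreviation "pImp x y \<equiv> PPair (PN 4) (PPair x y)"
abbreviation "pAllN x \<equiv> PPair (PN 5) x"
abbreviation "pAllS x \<equiv> PPair (PN 6) x"

abbreviation "pNil \<equiv> PN 0"
abbreviation "pCons x e \<equiv> pSuc (PPair x e)"

text \<open>The relations defined by the clauses; the argument order is that of the corresponding
  HOL function, followed by its result. \<open>rAr\<close> is boundedness restricted to arithmetical
  formulas. \<open>rMatrix s p q\<close>: \<open>p\<close> is a \<open>\<Pi>\<^sup>1\<^sub>1\<close> formula without free number variables, with free
  set variables below \<open>s\<close>, and with arithmetical matrix \<open>q\<close>. \<open>rNth e n x\<close> and \<open>rVal t e x\<close>: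
  the value of variable \<open>n\<close>, of term \<open>t\<close>, under the list \<open>e\<close> is \<open>x\<close>. \<open>rSub p q\<close>: \<open>q\<close> is a
  subformula of the arithmetical formula \<open>p\<close>.\<close>

abbreviation "rel3 k x y z \<equiv> PPair (PN k) (PPair x (PPair y z))"
abbreviation "rel4 k x y z w \<equiv> PPair (PN k) (PPair x (PPair y (PPair z w)))"

abbreviation "rLt x y \<equiv> PPair (PN 0) (PPair x y)"
abbreviation "rTm n t \<equiv> PPair (PN 1) (PPair n t)"
abbreviation "rFm \<equiv> rel3 2"
abbreviation "rAr \<equiv> rel3 3"
abbreviation "rMatrix \<equiv> rel3 4"
abbreviation "rLift \<equiv> rel3 5"
abbreviation "rLiftN \<equiv> rel3 6"
abbreviation "rLiftS \<equiv> rel3 7"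
abbreviation "rSubst \<equiv> rel4 8"
abbreviation "rSubstN \<equiv> rel4 9"
abbreviation "rSubstS \<equiv> rel4 10"
abbreviation "rNth \<equiv> rel3 11"
abbreviation "rVal \<equiv> rel3 12"
abbreviation "rSub p q \<equiv> PPair (PN 13) (PPair p q)"
abbreviation "rPrv p \<equiv> PPair (PN 14) p"

definition lt_clauses :: "clause list" where
  "lt_clauses = (let x = PV 0; y = PV 1 in
    [([], rLt (PN 0) (pSuc y)),
     ([rLt x y], rLt (pSuc x) (pSuc y))])"

definition bd_clauses :: "clause list" where
  "bd_clauses = (let n = PV 0; s = PV 1; t = PV 2; u = PV 3; i = PV 4; p = PV 5; q = PV 6 in
    [([rLt i n], rTm n (pVar i)),
     ([], rTm n pZero),
     ([], rTm n pOne),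
     ([rTm n t, rTm n u], rTm n (pPlus t u)),
     ([rTm n t, rTm n u], rTm n (pTimes t u)),

     ([rTm n t, rTm n u], rFm n s (pEqual t u)),
     ([rTm n t, rTm n u], rFm n s (pLess t u)),
     ([rTm n t, rLt i s], rFm n s (pMem t i)),
     ([], rFm n s pFalsum),
     ([rFm n s p, rFm n s q], rFm n s (pImp p q)),
     ([rFm (pSuc n) s p], rFm n s (pAllN p)),
     ([rFm n (pSuc s) p], rFm n s (pAllS p)),

     ([rTm n t, rTm n u], rAr n s (pEqual t u)),
     ([rTm n t, rTm n u], rAr n s (pLess t u)),
     ([rTm n t, rLt i s], rAr n s (pMem t i)),
     ([], rAr n s pFalsum),
     ([rAr n s p, rAr n s q], rAr n s (pImp p q)),
     ([rAr (pSuc n) s p], rAr n s (pAllN p)),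

     ([rAr (PN 0) s p], rMatrix s p p),
     ([rMatrix (pSuc s) p q], rMatrix s (pAllS p) q)])"

definition lift_clauses :: "clause list" where
  "lift_clauses = (let c = PV 0; t = PV 1; u = PV 2; t' = PV 3; u' = PV 4; i = PV 5;
      p = PV 6; q = PV 7; p' = PV 8; q' = PV 9 in
    [([rLt i c], rLift c (pVar i) (pVar i)),
     ([rLt c (pSuc i)], rLift c (pVar i) (pVar (pSuc i))),
     ([], rLift c pZero pZero),
     ([], rLift c pOne pOne),
     ([rLift c t t', rLift c u u'], rLift c (pPlus t u) (pPlus t' u')),
     ([rLift c t t', rLift c u u'], rLift c (pTimes t u) (pTimes t' u')),

     ([rLift c t t', rLift c u u'], rLiftN c (pEqual t u) (pEqual t' u')),
     ([rLift c t t', rLift c u u'], rLiftN c (pLess t u) (pLess t' u')),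
     ([rLift c t t'], rLiftN c (pMem t i) (pMem t' i)),
     ([], rLiftN c pFalsum pFalsum),
     ([rLiftN c p p', rLiftN c q q'], rLiftN c (pImp p q) (pImp p' q')),
     ([rLiftN (pSuc c) p p'], rLiftN c (pAllN p) (pAllN p')),
     ([rLiftN c p p'], rLiftN c (pAllS p) (pAllS p')),

     ([], rLiftS c (pEqual t u) (pEqual t u)),
     ([], rLiftS c (pLess t u) (pLess t u)),
     ([rLt i c], rLiftS c (pMem t i) (pMem t i)),
     ([rLt c (pSuc i)], rLiftS c (pMem t i) (pMem t (pSuc i))),
     ([], rLiftS c pFalsum pFalsum),
     ([rLiftS c p p', rLiftS c q q'], rLiftS c (pImp p q) (pImp p' q')),
     ([rLiftS c p p'], rLiftS c (pAllN p) (pAllN p')),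
     ([rLiftS (pSuc c) p p'], rLiftS c (pAllS p) (pAllS p'))])"

definition subst_clauses :: "clause list" where
  "subst_clauses = (let k = PV 0; r = PV 1; t = PV 2; u = PV 3; t' = PV 4; u' = PV 5; i = PV 6;
      p = PV 7; q = PV 8; p' = PV 9; q' = PV 10; r' = PV 11; j = PV 12 in
    [([rLt i k], rSubst k r (pVar i) (pVar i)),
     ([], rSubst k r (pVar k) r),
     ([rLt k (pSuc i)], rSubst k r (pVar (pSuc i)) (pVar i)),
     ([], rSubst k r pZero pZero),
     ([], rSubst k r pOne pOne),
     ([rSubst k r t t', rSubst k r u u'], rSubst k r (pPlus t u) (pPlus t' u')),
     ([rSubst k r t t', rSubst k r u u'], rSubst k r (pTimes t u) (pTimes t' u')),

     ([rSubst k r t t', rSubst k r u u'], rSubstN k r (pEqual t u) (pEqual t' u')),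
     ([rSubst k r t t', rSubst k r u u'], rSubstN k r (pLess t u) (pLess t' u')),
     ([rSubst k r t t'], rSubstN k r (pMem t i) (pMem t' i)),
     ([], rSubstN k r pFalsum pFalsum),
     ([rSubstN k r p p', rSubstN k r q q'], rSubstN k r (pImp p q) (pImp p' q')),
     ([rLift (PN 0) r r', rSubstN (pSuc k) r' p p'], rSubstN k r (pAllN p) (pAllN p')),
     ([rSubstN k r p p'], rSubstN k r (pAllS p) (pAllS p')),

     ([], rSubstS k j (pEqual t u) (pEqual t u)),
     ([], rSubstS k j (pLess t u) (pLess t u)),
     ([rLt i k], rSubstS k j (pMem t i) (pMem t i)),
     ([], rSubstS k j (pMem t k) (pMem t j)),
     ([rLt k (pSuc i)], rSubstS k j (pMem t (pSuc i)) (pMem t i)),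
     ([], rSubstS k j pFalsum pFalsum),
     ([rSubstS k j p p', rSubstS k j q q'], rSubstS k j (pImp p q) (pImp p' q')),
     ([rSubstS k j p p'], rSubstS k j (pAllN p) (pAllN p')),
     ([rSubstS (pSuc k) (pSuc j) p p'], rSubstS k j (pAllS p) (pAllS p'))])"

definition val_clauses :: "clause list" where
  "val_clauses = (let e = PV 0; x = PV 1; y = PV 2; n = PV 3; t = PV 4; u = PV 5 in
    [([], rNth (pCons x e) (PN 0) x),
     ([rNth e n x], rNth (pCons y e) (pSuc n) x),
     ([rNth e n x], rVal (pVar n) e x),
     ([], rVal pZero e (PN 0)),
     ([], rVal pOne e (PN 1)),
     ([rVal t e x, rVal u e y], rVal (pPlus t u) e (PPlus x y)),
     ([rVal t e x, rVal u e y], rVal (pTimes t u) e (PTimes x y))])"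

definition sub_clauses :: "clause list" where
  "sub_clauses = (let r = PV 0; p = PV 1; q = PV 2 in
    [([], rSub r r),
     ([rSub r (pImp p q)], rSub r p),
     ([rSub r (pImp p q)], rSub r q),
     ([rSub r (pAllN p)], rSub r p)])"

definition prv_clauses :: "clause list" where
  "prv_clauses = (let n = PV 0; s = PV 1; p = PV 2; q = PV 3; r = PV 4; t = PV 5; u = PV 6;
      i = PV 7 in
    [([rPrv (pImp p q), rPrv p], rPrv q),
     ([rPrv p], rPrv (pAllN p)),
     ([rPrv p], rPrv (pAllS p)),
     ([rFm n s p, rFm n s q], rPrv (pImp p (pImp q p))),
     ([rFm n s p, rFm n s q, rFm n s r],
        rPrv (pImp (pImp p (pImp q r)) (pImp (pImp p q) (pImp p r)))),
     ([rFm n s p], rPrv (pImp (pImp (pImp p pFalsum) pFalsum) p)),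
     ([rFm n s p, rTm n t, rSubstN (PN 0) t p q], rPrv (pImp (pAllN p) q)),
     ([rFm n s p, rLiftN (PN 0) p q], rPrv (pImp p (pAllN q))),
     ([rFm n s p, rFm n s q], rPrv (pImp (pAllN (pImp p q)) (pImp (pAllN p) (pAllN q)))),
     ([rFm n s p, rSubstS (PN 0) i p q], rPrv (pImp (pAllS p) q)),
     ([rFm n s p, rLiftS (PN 0) p q], rPrv (pImp p (pAllS q))),
     ([rFm n s p, rFm n s q], rPrv (pImp (pAllS (pImp p q)) (pImp (pAllS p) (pAllS q)))),
     ([rTm n t], rPrv (pEqual t t)),
     ([rFm n s p, rTm n t, rTm n u, rSubstN (PN 0) t p q, rSubstN (PN 0) u p r],
        rPrv (pImp (pEqual t u) (pImp q r)))])"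

definition clauses :: "clause list" where
  "clauses = lt_clauses @ bd_clauses @ lift_clauses @ subst_clauses @ val_clauses @ sub_clauses
     @ prv_clauses"

text \<open>\<open>rel_fm G f\<close>: the tuple \<open>f\<close> is derivable, where \<open>PV k\<close> in \<open>f\<close> stands for the number
  variable \<open>k\<close>.\<close>

definition rel_fm :: "fm \<Rightarrow> pat \<Rightarrow> fm" where
  "rel_fm G f = ExN (And (pat_fm f 1 (Var 0)) (derivable_fm G clauses (Var 0)))"

abbreviation syn_fm :: "pat \<Rightarrow> fm" where
  "syn_fm \<equiv> rel_fm Falsum"

text \<open>Let \<open>\<sigma>\<close> be a formula whose only free variable is the number variable 0, defining the
  Goedel numbers of a set of axioms. \<open>prv_fm \<sigma>\<close> says of the number variable 0 that it is (the
  Goedel number of a formula) provable from these axioms.\<close>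

definition prv_fm :: "fm \<Rightarrow> fm" where
  "prv_fm \<sigma> = rel_fm (ExN (And (pat_fm (rPrv (PV 0)) 0 (Var 1)) \<sigma>)) (rPrv (PV 0))"

subsection \<open>The universal \<open>\<Pi>\<^sup>1\<^sub>1\<close> formula and uniform reflection\<close>

text \<open>\<open>mem_fm p i\<close>: the value of \<open>p\<close>, where \<open>PV k\<close> stands for the number variable \<open>k\<close>, is in
  the set variable \<open>i\<close>. \<open>is_fm p k\<close>: the value of \<open>p\<close> is the number variable \<open>k\<close>.\<close>

definition mem_fm :: "pat \<Rightarrow> nat \<Rightarrow> fm" where
  "mem_fm p i = ExN (And (pat_fm p 1 (Var 0)) (Mem (Var 0) i))"

definition is_fm :: "pat \<Rightarrow> nat \<Rightarrow> fm" where
  "is_fm p k = pat_fm p 0 (Var k)"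

text \<open>\<open>satclass_fm\<close>: the set variable 0 is a satisfaction class for the subformulas of the
  arithmetical formula coded by the number variable 0, where the set variable 1 codes the
  assignment to the set variables, by sections. So \<open>(z, e)\<close> belongs to the class iff \<open>z\<close> is
  satisfied when its number variables are interpreted by the list \<open>e\<close>. The class is only
  constrained on subformulas, so that \<open>ACA\<^sub>0\<close> proves that it exists for each formula of a
  fixed logical complexity.

  In the six conditions, the innermost bound variables are the components of the formula,
  and then come \<open>e\<close> and \<open>z\<close>.\<close>

definition satclass_fm :: fm where
  "satclass_fm =
    AllN (AllN (Imp (syn_fm (rSub (PV 2) (PV 1)))
     (And (AllN (AllN (Imp (is_fm (pEqual (PV 1) (PV 0)) 3)
            (Iff (mem_fm (PPair (PV 3) (PV 2)) 0)
                 (ExN (And (syn_fm (rVal (PV 2) (PV 3) (PV 0)))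
                           (syn_fm (rVal (PV 1) (PV 3) (PV 0)))))))))
     (And (AllN (AllN (Imp (is_fm (pLess (PV 1) (PV 0)) 3)
            (Iff (mem_fm (PPair (PV 3) (PV 2)) 0)
                 (ExN (ExN (And (syn_fm (rVal (PV 3) (PV 4) (PV 1)))
                           (And (syn_fm (rVal (PV 2) (PV 4) (PV 0)))
                                (Less (Var 1) (Var 0))))))))))
     (And (AllN (AllN (Imp (is_fm (pMem (PV 1) (PV 0)) 3)
            (Iff (mem_fm (PPair (PV 3) (PV 2)) 0)
                 (ExN (And (syn_fm (rVal (PV 2) (PV 3) (PV 0)))
                           (mem_fm (PPair (PV 1) (PV 0)) 1)))))))
     (And (Imp (is_fm pFalsum 1) (Neg (mem_fm (PPair (PV 1) (PV 0)) 0)))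
     (And (AllN (AllN (Imp (is_fm (pImp (PV 1) (PV 0)) 3)
            (Iff (mem_fm (PPair (PV 3) (PV 2)) 0)
                 (Imp (mem_fm (PPair (PV 1) (PV 2)) 0) (mem_fm (PPair (PV 0) (PV 2)) 0))))))
          (AllN (Imp (is_fm (pAllN (PV 0)) 2)
            (Iff (mem_fm (PPair (PV 2) (PV 1)) 0)
                 (AllN (mem_fm (PPair (PV 1) (pCons (PV 0) (PV 2))) 0)))))))))))) "

text \<open>\<open>Pi11_sentence_fm\<close> says that the number variable 0 is a \<open>\<Pi>\<^sup>1\<^sub>1\<close> sentence; the universal
  formula \<open>Pi11_true_fm\<close>, itself \<open>\<Pi>\<^sup>1\<^sub>1\<close>, says that it is a true one: for all assignments to the
  leading set quantifiers and all satisfaction classes, the matrix is satisfied.\<close>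

definition Pi11_sentence_fm :: fm where
  "Pi11_sentence_fm = ExN (syn_fm (rMatrix (PN 0) (PV 1) (PV 0)))"

definition Pi11_true_fm :: fm where
  "Pi11_true_fm =
     AllS (AllS (AllN (Imp (syn_fm (rMatrix (PN 0) (PV 1) (PV 0)))
       (Imp satclass_fm (mem_fm (PPair (PV 0) pNil) 0)))))"

definition RFN_Pi11 :: "fm \<Rightarrow> fm" where
  "RFN_Pi11 \<sigma> = AllN (Imp Pi11_sentence_fm (Imp (prv_fm \<sigma>) Pi11_true_fm))"

text \<open>\<open>\<sigma>\<close> is a \<open>\<Sigma>\<^sup>0\<^sub>1\<close> definition of the axioms of \<open>S\<close>.\<close>

definition numerates :: "fm \<Rightarrow> fm set \<Rightarrow> bool" where
  "numerates \<sigma> S \<longleftrightarrow>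
     Sigma01 \<sigma> \<and> fm_bd 1 0 \<sigma> \<and> (\<forall>x. sat (\<lambda>_. x) (\<lambda>_. {}) \<sigma> \<longleftrightarrow> x \<in> fm_code ` S)"

text \<open>The reflection sentence of \<open>S\<close> depends on a choice of \<open>\<sigma>\<close>. The relation below does not:
  if \<open>\<sigma>\<close> and \<open>\<sigma>'\<close> define the same set, their equivalence is a true arithmetical sentence, so
  it can be added to the \<open>\<Sigma>\<^sup>1\<^sub>1\<close> sentence allowed in \<open>\<turnstile>\<^sub>S\<^sub>1\<^sub>1\<close>.\<close>

definition reflects :: "fm set \<Rightarrow> fm set \<Rightarrow> bool" (infix \<open>\<prec>\<^sub>R\<close> 50) where
  "S \<prec>\<^sub>R T \<longleftrightarrow> sound_re_extension S \<and> sound_re_extension T \<and>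
     (\<exists>\<sigma>. numerates \<sigma> S \<and> T \<turnstile>\<^sub>S\<^sub>1\<^sub>1 RFN_Pi11 \<sigma>)"

section \<open>Countable ordinals\<close>

text \<open>Isomorphism types of well-orders on sets of natural numbers. Well-orders are reflexive
  relations, as in the library.\<close>

quotient_type ord = "nat rel" / partial: "\<lambda>r s. (r, s) \<in> ordIso"
proof (rule part_equivpI)
  show "\<exists>r::nat rel. (r, r) \<in> ordIso"
    using ordIso_reflexive[of "{} :: nat rel"] by fastforce
  show "symp (\<lambda>r s :: nat rel. (r, s) \<in> ordIso)"
    by (auto intro: sympI ordIso_symmetric)
  show "transp (\<lambda>r s :: nat rel. (r, s) \<in> ordIso)"
    by (auto intro: transpI ordIso_transitive)
qed

lift_definition otype :: "nat rel \<Rightarrow> ord" is "\<lambda>r. if Well_order r then r else {}"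
  by (auto intro!: ordIso_reflexive)

instantiation ord :: wellorder
begin

lift_definition less_eq_ord :: "ord \<Rightarrow> ord \<Rightarrow> bool" is "\<lambda>r s. (r, s) \<in> ordLeq"
  by (meson ordIso_ordLeq_trans ordIso_symmetric ordLeq_ordIso_trans)

lift_definition less_ord :: "ord \<Rightarrow> ord \<Rightarrow> bool" is "\<lambda>r s. (r, s) \<in> ordLess"
  by (meson ordIso_ordLess_trans ordIso_symmetric ordLess_ordIso_trans)

instance
proof
  fix a b c :: ord
  show "a < b \<longleftrightarrow> a \<le> b \<and> \<not> b \<le> a"
    by transfer (metis not_ordLess_ordLeq ordIso_reflexive ordLess_imp_ordLeq
        ordLeq_iff_ordLess_or_ordIso ordIso_iff_ordLeq)
  show "a \<le> a"
    by transfer (simp add: ordIso_imp_ordLeq)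
  show "a \<le> b \<Longrightarrow> b \<le> c \<Longrightarrow> a \<le> c"
    by transfer (rule ordLeq_transitive)
  show "a \<le> b \<Longrightarrow> b \<le> a \<Longrightarrow> a = b"
    by transfer (simp add: ordIso_iff_ordLeq)
  show "a \<le> b \<or> b \<le> a"
    by transfer (metis ordIso_imp_ordLeq ordLeq_Well_order_simp ordLeq_total)
next
  have "wf {(x, y :: ord). x < y}"
    using wf_inv_image[OF wf_ordLess, of rep_ord]
    by (simp add: inv_image_def less_ord_def)
  fix P :: "ord \<Rightarrow> bool" and a
  assume "\<And>x. (\<And>y. y < x \<Longrightarrow> P y) \<Longrightarrow> P x"
  with \<open>wf _\<close> show "P a"
    by (induction a rule: wf_induct_rule) auto
qed

end

text \<open>Least upper bounds and ranks below are least elements of a class of upper bounds; they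
  exist, since countable sets of countable ordinals are bounded.\<close>

section \<open>Proof-theoretic ordinals and reflection ranks\<close>

text \<open>Simultaneous substitution of \<open>t\<close>, \<open>u\<close> for the number variables 0, 1.\<close>

definition inst2 :: "fm \<Rightarrow> tm \<Rightarrow> tm \<Rightarrow> fm" where
  "inst2 A t u = fm_substN 0 t (fm_substN 1 (tm_lift 0 u) A)"

text \<open>For a formula \<open>A\<close> with free number variables 0 and 1, \<open>WO A\<close> says that \<open>A\<close> is a
  (reflexive) linear order on its field in which every nonempty set has a least element.\<close>

definition LO :: "fm \<Rightarrow> fm" where
  "LO A =
    And (AllN (AllN (Imp (inst2 A (Var 1) (Var 0))
                         (And (inst2 A (Var 1) (Var 1)) (inst2 A (Var 0) (Var 0))))))
   (And (AllN (AllN (Imp (And (inst2 A (Var 1) (Var 0)) (inst2 A (Var 0) (Var 1)))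
                         (Equal (Var 1) (Var 0)))))
   (And (AllN (AllN (AllN (Imp (And (inst2 A (Var 2) (Var 1)) (inst2 A (Var 1) (Var 0)))
                               (inst2 A (Var 2) (Var 0))))))
        (AllN (AllN (Imp (And (inst2 A (Var 1) (Var 1)) (inst2 A (Var 0) (Var 0)))
                         (Or (inst2 A (Var 1) (Var 0)) (inst2 A (Var 0) (Var 1))))))))"

definition WO :: "fm \<Rightarrow> fm" where
  "WO A = AllS (And (LO A)
     (Imp (ExN (And (Mem (Var 0) 0) (inst2 A (Var 0) (Var 0))))
          (ExN (And (And (Mem (Var 0) 0) (inst2 A (Var 0) (Var 0)))
                    (AllN (Imp (And (Mem (Var 0) 0) (inst2 A (Var 0) (Var 0)))
                               (inst2 A (Var 1) (Var 0))))))))"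

text \<open>\<open>A\<close> is a \<open>\<Sigma>\<^sup>0\<^sub>1\<close> presentation of the recursive well-order \<open>r\<close>.\<close>

definition presents :: "fm \<Rightarrow> nat rel \<Rightarrow> bool" where
  "presents A r \<longleftrightarrow> Well_order r \<and> recursive_rel r \<and> Sigma01 A \<and> fm_bd 2 0 A \<and>
     (\<forall>x y. (x, y) \<in> r \<longleftrightarrow> sat (case_nat x (\<lambda>_. y)) (\<lambda>_. {}) A)"

definition pt_ordinal :: "fm set \<Rightarrow> ord" where
  "pt_ordinal T = (LEAST b. \<forall>A r. presents A r \<and> T \<turnstile> WO A \<longrightarrow> otype r \<le> b)"

text \<open>The rank is the least ordinal above the ranks of all predecessors.\<close>

definition reflection_rank :: "fm set \<Rightarrow> ord" where
  "reflection_rank = wfrec {(S, T). S \<prec>\<^sub>R T}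
     (\<lambda>rk T. LEAST b. \<forall>S. S \<prec>\<^sub>R T \<longrightarrow> rk S < b)"

end

theory Submission
  imports Defs "HOL-Library.Countable_Set" "HOL-Number_Theory.Cong"
begin

text \<open>The theorem follows from the equivalence \<open>S \<prec>\<^sub>R T \<longleftrightarrow> |S| < |T|\<close>, since the rank is determined
  by the set of predecessors. All formal derivations are replaced by model-theoretic arguments, by
  completeness.

  Both directions rest on a boundedness theorem. For an arithmetical formula \<open>p\<close>, the attempts to
  build sets satisfying \<open>p\<close> together with a descending sequence through one of them, \<open>Z\<close>, form a
  tree with a \<open>\<Delta>\<^sup>0\<^sub>0\<close> Kleene--Brouwer order, and in every model of \<open>ACA\<^sub>0\<close> this order is ill-founded
  iff such sets and such a sequence exist. So if \<open>T\<close> proves that there are none, then \<open>T\<close> proves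
  the order well-founded; and if sets satisfying \<open>p\<close>, with \<open>Z\<close> a well-order, really exist then the
  order is at least as long as \<open>Z\<close>. Hence \<open>Z\<close> is at most \<open>|T|\<close>.

  If \<open>|S| < |T|\<close>, apply this to the statement that \<open>n\<close> codes an \<open>S\<close>-provable \<open>\<Pi>\<^sup>1\<^sub>1\<close> sentence with a
  counterexample. For each standard \<open>n\<close> the Kleene--Brouwer order is at most \<open>|S|\<close>, so it embeds in
  a well-order whose well-foundedness is provable in \<open>T\<close>. That there is a sequence of such
  embeddings is a true \<open>\<Sigma>\<^sup>1\<^sub>1\<close> sentence, and together with \<open>T\<close> it implies the reflection principle.

  Conversely, suppose that \<open>T\<close> with a true \<open>\<Sigma>\<^sup>1\<^sub>1\<close> sentence proves reflection for \<open>S\<close>. Then it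
  proves that there is no descending sequence in the sum of all \<open>S\<close>-provable well-orders, followed
  by a last element: such a sequence ends in one summand, say with code \<open>n\<close>, and contradicts the
  \<open>\<Pi>\<^sup>1\<^sub>1\<close> sentence with code \<open>n\<close>. By boundedness this sum, which is longer than \<open>|S|\<close>, is at most
  \<open>|T|\<close>.\<close>

section \<open>Models and completeness\<close>

text \<open>Two obstacles shape the proof. Reflection is uniform, so in a nonstandard model the
  reflected sentence may have a nonstandard code, out of reach of external induction on formulas. If
  |S| < |T|, this is met by a single set embedding the orders for all \<open>n\<close> at once. In
  the converse direction, reflection is applied only to sentences whose satisfaction class is
  arithmetical in a truth class for set-free formulas, which boundedness admits as a parameter. The
  other obstacle is that \<open>ACA0\<close> would have to verify the arithmetised syntax. The
  required facts are true and arithmetical, so they join the side formulas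
  (\<open>facts_fm\<close>), and only elementary arithmetic is developed inside models. Hence two
  pairings: \<open>pJ\<close>, whose properties hold in all models of \<open>ACA0\<close>, for trees
  and sequences, and Cantor pairing \<open>pr\<close>, dictated by the syntax, with properties taken
  from \<open>facts_fm\<close>. The order has to be so simple because \<open>pt_ordinal\<close>
  counts recursive orders with Sigma01 presentations. This is why truth values and counterexamples
  for the subformulas are recorded along the branches of the tree: checking a node needs only
  bounded quantifiers.\<close>

datatype 'a model = Model (mz: 'a) (mo: 'a) (mp: "'a \<Rightarrow> 'a \<Rightarrow> 'a") (mt: "'a \<Rightarrow> 'a \<Rightarrow> 'a")
  (ml: "'a \<Rightarrow> 'a \<Rightarrow> bool") (ms: "'a set set")

primrec mval :: "'a model \<Rightarrow> (nat \<Rightarrow> 'a) \<Rightarrow> tm \<Rightarrow> 'a" where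
  "mval M e (Var i) = e i"
| "mval M e Zero = mz M"
| "mval M e One = mo M"
| "mval M e (Plus t u) = mp M (mval M e t) (mval M e u)"
| "mval M e (Times t u) = mt M (mval M e t) (mval M e u)"

primrec msat :: "'a model \<Rightarrow> (nat \<Rightarrow> 'a) \<Rightarrow> (nat \<Rightarrow> 'a set) \<Rightarrow> fm \<Rightarrow> bool" where
  "msat M e E (Equal t u) \<longleftrightarrow> mval M e t = mval M e u"
| "msat M e E (Less t u) \<longleftrightarrow> ml M (mval M e t) (mval M e u)"
| "msat M e E (Mem t i) \<longleftrightarrow> mval M e t \<in> E i"
| "msat M e E Falsum \<longleftrightarrow> False"
| "msat M e E (Imp p q) \<longleftrightarrow> (msat M e E p \<longrightarrow> msat M e E q)"
| "msat M e E (AllN p) \<longleftrightarrow> (\<forall>n. msat M (case_nat n e) E p)"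
| "msat M e E (AllS p) \<longleftrightarrow> (\<forall>X\<in>ms M. msat M e (case_nat X E) p)"

definition stdm :: "nat model" where
  "stdm = Model 0 1 (+) (*) (<) UNIV"

lemma stdm_simps [simp]: "mz stdm = 0" "mo stdm = 1" "mp stdm = (+)" "mt stdm = (*)"
  "ml stdm = (<)" "ms stdm = UNIV"
  by (simp_all add: stdm_def)

lemma mval_stdm [simp]: "mval stdm e t = tm_val e t"
  by (induction t) auto

lemma msat_stdm [simp]: "msat stdm e E p = sat e E p"
  by (induction p arbitrary: e E) auto

text \<open>The number sort is the whole type, the set sort only \<open>ms M\<close>. Without a
  member of \<open>ms M\<close> no assignment would qualify and every theory would hold
  vacuously.\<close>

definition mods :: "'a model \<Rightarrow> fm set \<Rightarrow> bool" where
  "mods M T \<longleftrightarrow> ms M \<noteq> {} \<and> (\<forall>p\<in>T. \<forall>e E. range E \<subseteq> ms M \<longrightarrow> msat M e E p)"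

subsection \<open>Simultaneous substitution\<close>

primrec tsub :: "(nat \<Rightarrow> tm) \<Rightarrow> tm \<Rightarrow> tm" where
  "tsub \<tau> (Var i) = \<tau> i"
| "tsub \<tau> Zero = Zero"
| "tsub \<tau> One = One"
| "tsub \<tau> (Plus t u) = Plus (tsub \<tau> t) (tsub \<tau> u)"
| "tsub \<tau> (Times t u) = Times (tsub \<tau> t) (tsub \<tau> u)"

definition upN :: "(nat \<Rightarrow> tm) \<Rightarrow> nat \<Rightarrow> tm" where
  "upN \<tau> = case_nat (Var 0) (tm_lift 0 \<circ> \<tau>)"

definition upS :: "(nat \<Rightarrow> nat) \<Rightarrow> nat \<Rightarrow> nat" where
  "upS \<upsilon> = case_nat 0 (Suc \<circ> \<upsilon>)"

text \<open>Lifting and substitution in both sorts are instances of this one operation, so their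
  commutation laws all reduce to \<open>fsub_fsub\<close>.\<close>

primrec fsub :: "(nat \<Rightarrow> tm) \<Rightarrow> (nat \<Rightarrow> nat) \<Rightarrow> fm \<Rightarrow> fm" where
  "fsub \<tau> \<upsilon> (Equal t u) = Equal (tsub \<tau> t) (tsub \<tau> u)"
| "fsub \<tau> \<upsilon> (Less t u) = Less (tsub \<tau> t) (tsub \<tau> u)"
| "fsub \<tau> \<upsilon> (Mem t i) = Mem (tsub \<tau> t) (\<upsilon> i)"
| "fsub \<tau> \<upsilon> Falsum = Falsum"
| "fsub \<tau> \<upsilon> (Imp p q) = Imp (fsub \<tau> \<upsilon> p) (fsub \<tau> \<upsilon> q)"
| "fsub \<tau> \<upsilon> (AllN p) = AllN (fsub (upN \<tau>) \<upsilon> p)"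
| "fsub \<tau> \<upsilon> (AllS p) = AllS (fsub \<tau> (upS \<upsilon>) p)"

lemma tm_lift_tsub: "tm_lift c t = tsub (\<lambda>i. Var (if i < c then i else Suc i)) t"
  by (induction t) auto

lemma tm_subst_tsub: "tm_subst k r t = tsub (\<lambda>i. if i < k then Var i else if i = k then r else Var (i - 1)) t"
  by (induction t) auto

lemma tsub_tsub: "tsub \<tau> (tsub \<tau>' t) = tsub (tsub \<tau> \<circ> \<tau>') t"
  by (induction t) auto

lemma tsub_Var [simp]: "tsub Var t = t"
  by (induction t) auto

lemma upN_comp: "tsub (upN \<tau>) \<circ> upN \<tau>' = upN (tsub \<tau> \<circ> \<tau>')"
  by (auto simp: fun_eq_iff upN_def tm_lift_tsub tsub_tsub comp_def split: nat.split)

lemma upS_comp: "upS \<upsilon> \<circ> upS \<upsilon>' = upS (\<upsilon> \<circ> \<upsilon>')"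
  by (auto simp: fun_eq_iff upS_def split: nat.split)

lemma upN_Var [simp]: "upN Var = Var"
  by (auto simp: fun_eq_iff upN_def split: nat.split)

lemma upS_id [simp]: "upS id = id" "upS (\<lambda>i. i) = (\<lambda>i. i)"
  by (auto simp: fun_eq_iff upS_def split: nat.split)

lemma fsub_fsub: "fsub \<tau> \<upsilon> (fsub \<tau>' \<upsilon>' p) = fsub (tsub \<tau> \<circ> \<tau>') (\<upsilon> \<circ> \<upsilon>') p"
  by (induction p arbitrary: \<tau> \<tau>' \<upsilon> \<upsilon>') (auto simp: tsub_tsub upN_comp upS_comp)

lemma fsub_Var [simp]: "fsub Var id p = p"
  by (induction p) auto

lemma fm_liftN_fsub: "fm_liftN c p = fsub (\<lambda>i. Var (if i < c then i else Suc i)) id p"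
proof (induction p arbitrary: c)
  case (AllN p)
  have "upN (\<lambda>i. Var (if i < c then i else Suc i)) = (\<lambda>i. Var (if i < Suc c then i else Suc i))"
    by (auto simp: fun_eq_iff upN_def split: nat.split)
  then show ?case using AllN by simp
qed (auto simp: tm_lift_tsub)

lemma fm_liftS_fsub: "fm_liftS c p = fsub Var (\<lambda>i. if i < c then i else Suc i) p"
proof (induction p arbitrary: c)
  case (AllS p)
  have "upS (\<lambda>i. if i < c then i else Suc i) = (\<lambda>i. if i < Suc c then i else Suc i)"
    by (auto simp: fun_eq_iff upS_def split: nat.split)
  then show ?case using AllS by simp
qed auto

lemma fm_substN_fsub:
  "fm_substN k r p = fsub (\<lambda>i. if i < k then Var i else if i = k then r else Var (i - 1)) id p"
proof (induction p arbitrary: k r)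
  case (AllN p)
  have "upN (\<lambda>i. if i < k then Var i else if i = k then r else Var (i - 1))
      = (\<lambda>i. if i < Suc k then Var i else if i = Suc k then tm_lift 0 r else Var (i - 1))"
    by (auto simp: fun_eq_iff upN_def split: nat.split)
  then show ?case using AllN by simp
qed (auto simp: tm_subst_tsub)

lemma fm_substS_fsub:
  "fm_substS k j p = fsub Var (\<lambda>i. if i < k then i else if i = k then j else i - 1) p"
proof (induction p arbitrary: k j)
  case (AllS p)
  have "upS (\<lambda>i. if i < k then i else if i = k then j else i - 1)
      = (\<lambda>i. if i < Suc k then i else if i = Suc k then Suc j else i - 1)"
    by (auto simp: fun_eq_iff upS_def split: nat.split)
  then show ?case using AllS by simp
qed auto

lemma fm_substN_0: "fm_substN 0 t p = fsub (case_nat t Var) id p"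
proof -
  have "(\<lambda>i. if i < 0 then Var i else if i = 0 then t else Var (i - 1)) = case_nat t Var"
    by (auto simp: fun_eq_iff split: nat.split)
  then show ?thesis by (simp add: fm_substN_fsub)
qed

lemma fm_substS_0: "fm_substS 0 j p = fsub Var (case_nat j id) p"
proof -
  have "(\<lambda>i. if i < 0 then i else if i = 0 then j else i - 1) = case_nat j id"
    by (auto simp: fun_eq_iff split: nat.split)
  then show ?thesis by (simp add: fm_substS_fsub)
qed

lemma fm_liftN_0: "fm_liftN 0 p = fsub (Var \<circ> Suc) id p"
  by (simp add: fm_liftN_fsub comp_def)

lemma fm_liftS_0: "fm_liftS 0 p = fsub Var Suc p"
  by (simp add: fm_liftS_fsub)

lemma mval_tsub: "mval M e (tsub \<tau> t) = mval M (\<lambda>i. mval M e (\<tau> i)) t"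
  by (induction t) auto

lemma mval_lift [simp]: "mval M (case_nat x e) (tm_lift 0 t) = mval M e t"
  by (induction t) auto

lemma msat_fsub: "msat M e E (fsub \<tau> \<upsilon> p) = msat M (\<lambda>i. mval M e (\<tau> i)) (\<lambda>i. E (\<upsilon> i)) p"
proof (induction p arbitrary: \<tau> \<upsilon> e E)
  case (AllN p)
  have "(\<lambda>i. mval M (case_nat n e) (upN \<tau> i)) = case_nat n (\<lambda>i. mval M e (\<tau> i))" for n
    by (auto simp: fun_eq_iff upN_def split: nat.split)
  then show ?case using AllN by simp
next
  case (AllS p)
  have "(\<lambda>i. case_nat X E (upS \<upsilon> i)) = case_nat X (\<lambda>i. E (\<upsilon> i))" for X
    by (auto simp: fun_eq_iff upS_def split: nat.split)
  then show ?case using AllS by simp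
qed (auto simp: mval_tsub)

lemma mval_cong: "tm_bd n t \<Longrightarrow> (\<And>i. i < n \<Longrightarrow> e i = e' i) \<Longrightarrow> mval M e t = mval M e' t"
  by (induction t) auto

lemma msat_cong:
  "fm_bd n s p \<Longrightarrow> (\<And>i. i < n \<Longrightarrow> e i = e' i) \<Longrightarrow> (\<And>i. i < s \<Longrightarrow> E i = E' i)
    \<Longrightarrow> msat M e E p = msat M e' E' p"
proof (induction p arbitrary: n s e e' E E')
  case (Imp p q)
  then show ?case using Imp.IH[of n s e e' E E'] by auto
next
  case (AllN p)
  have "msat M (case_nat x e) E p = msat M (case_nat x e') E' p" for x
    by (rule AllN.IH[of "Suc n" s]) (use AllN.prems in \<open>auto split: nat.split\<close>)
  then show ?case by simp
next
  case (AllS p)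
  have "msat M e (case_nat X E) p = msat M e' (case_nat X E') p" for X
    by (rule AllS.IH[of n "Suc s"]) (use AllS.prems in \<open>auto split: nat.split\<close>)
  then show ?case by simp
qed (auto cong: mval_cong)

lemma msat_sentence: "sentence p \<Longrightarrow> msat M e E p = msat M e' E' p"
  by (rule msat_cong) (auto simp: sentence_def)

lemma tsub_cong: "tm_bd n t \<Longrightarrow> (\<And>i. i < n \<Longrightarrow> \<tau> i = \<tau>' i) \<Longrightarrow> tsub \<tau> t = tsub \<tau>' t"
  by (induction t) auto

lemma fsub_cong:
  "fm_bd n s p \<Longrightarrow> (\<And>i. i < n \<Longrightarrow> \<tau> i = \<tau>' i) \<Longrightarrow> (\<And>i. i < s \<Longrightarrow> \<upsilon> i = \<upsilon>' i)
    \<Longrightarrow> fsub \<tau> \<upsilon> p = fsub \<tau>' \<upsilon>' p"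
proof (induction p arbitrary: n s \<tau> \<tau>' \<upsilon> \<upsilon>')
  case (Imp p q)
  then show ?case using Imp.IH[of n s \<tau> \<tau>' \<upsilon> \<upsilon>'] by auto
next
  case (AllN p)
  have "fsub (upN \<tau>) \<upsilon> p = fsub (upN \<tau>') \<upsilon>' p"
    by (rule AllN.IH[of "Suc n" s]) (use AllN.prems in \<open>auto simp: upN_def split: nat.split\<close>)
  then show ?case by simp
next
  case (AllS p)
  have "fsub \<tau> (upS \<upsilon>) p = fsub \<tau>' (upS \<upsilon>') p"
    by (rule AllS.IH[of n "Suc s"]) (use AllS.prems in \<open>auto simp: upS_def split: nat.split\<close>)
  then show ?case by simp
qed (auto intro: tsub_cong)

lemma fsub_sentence: "sentence p \<Longrightarrow> fsub \<tau> \<upsilon> p = p"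
  using fsub_cong[of 0 0 p \<tau> Var \<upsilon> id] by (simp add: sentence_def)

lemma tm_bd_mono: "tm_bd n t \<Longrightarrow> n \<le> n' \<Longrightarrow> tm_bd n' t"
  by (induction t) auto

lemma fm_bd_mono: "fm_bd n s p \<Longrightarrow> n \<le> n' \<Longrightarrow> s \<le> s' \<Longrightarrow> fm_bd n' s' p"
proof (induction p arbitrary: n s n' s')
  case (Imp p q)
  then show ?case using Imp.IH[of n s n' s'] by auto
next
  case (AllN p)
  then show ?case using AllN.IH[of "Suc n" s "Suc n'" s'] by simp
next
  case (AllS p)
  then show ?case using AllS.IH[of n "Suc s" n' "Suc s'"] by simp
qed (auto intro: tm_bd_mono)

lemma ex_tm_bd2: "\<exists>n. tm_bd n t \<and> tm_bd n u"
proof -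
  have "\<exists>n. tm_bd n t" for t
  proof (induction t)
    case (Plus t u)
    then obtain m n where "tm_bd m t" "tm_bd n u" by blast
    then show ?case by (intro exI[of _ "max m n"]) (auto intro: tm_bd_mono)
  next
    case (Times t u)
    then obtain m n where "tm_bd m t" "tm_bd n u" by blast
    then show ?case by (intro exI[of _ "max m n"]) (auto intro: tm_bd_mono)
  qed auto
  then obtain m n where "tm_bd m t" "tm_bd n u" by blast
  then show ?thesis by (intro exI[of _ "max m n"]) (auto intro: tm_bd_mono)
qed

lemma ex_fm_bd: "\<exists>n. fm_bd n n p"
proof (induction p)
  case (Mem t i)
  obtain n where "tm_bd n t" using ex_tm_bd2 by blast
  then have "tm_bd (n + Suc i) t" by (rule tm_bd_mono) simp
  then show ?case by (auto intro!: exI[of _ "n + Suc i"])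
next
  case (Imp p q)
  then obtain m n where "fm_bd m m p" "fm_bd n n q" by blast
  then show ?case by (intro exI[of _ "max m n"]) (auto intro: fm_bd_mono)
next
  case (AllN p)
  then obtain n where "fm_bd n n p" by blast
  then show ?case by (intro exI[of _ n]) (auto intro: fm_bd_mono)
next
  case (AllS p)
  then obtain n where "fm_bd n n p" by blast
  then show ?case by (intro exI[of _ n]) (auto intro: fm_bd_mono)
qed (auto simp: ex_tm_bd2)

subsection \<open>Soundness\<close>

lemma msat_substN_0: "msat M e E (fm_substN 0 t p) = msat M (case_nat (mval M e t) e) E p"
proof -
  have "(\<lambda>i. mval M e (case_nat t Var i)) = case_nat (mval M e t) e"
    by (auto simp: fun_eq_iff split: nat.split)
  then show ?thesis by (simp add: fm_substN_0 msat_fsub)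
qed

lemma msat_substS_0: "msat M e E (fm_substS 0 j p) = msat M e (case_nat (E j) E) p"
proof -
  have "(\<lambda>i. E (case_nat j id i)) = case_nat (E j) E"
    by (auto simp: fun_eq_iff split: nat.split)
  then show ?thesis by (simp add: fm_substS_0 msat_fsub)
qed

lemma msat_liftN_0 [simp]: "msat M (case_nat x e) E (fm_liftN 0 p) = msat M e E p"
  by (simp add: fm_liftN_0 msat_fsub)

lemma msat_liftS_0 [simp]: "msat M e (case_nat X E) (fm_liftS 0 p) = msat M e E p"
  by (simp add: fm_liftS_0 msat_fsub)

theorem soundness:
  assumes "T \<turnstile> p" "mods M T" "range E \<subseteq> ms M"
  shows "msat M e E p"
  using assms(1,3)
proof (induction arbitrary: e E rule: proves.induct)
  case (Ax p)
  then show ?case using assms(2) by (auto simp: mods_def)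
next
  case (GenS p)
  have "range (case_nat X E) \<subseteq> ms M" if "X \<in> ms M" for X
    using that GenS.prems by (auto simp: image_subset_iff split: nat.split)
  then show ?case using GenS by auto
next
  case (InstS p i)
  then show ?case by (auto simp: msat_substS_0)
qed (auto simp: msat_substN_0)

text \<open>The axiom schemes are closed under substitution and sentences are unaffected by it. This
  permits renaming a fresh variable before generalising over it.\<close>

lemma proves_fsub:
  assumes "\<forall>p\<in>T. sentence p" "T \<turnstile> p"
  shows "T \<turnstile> fsub \<tau> \<upsilon> p"
  using assms(2)
proof (induction arbitrary: \<tau> \<upsilon> rule: proves.induct)
  case (Ax p)
  then show ?case using assms(1) by (simp add: fsub_sentence proves.Ax)
next
  case (MP p q)
  then show ?case by (metis fsub.simps(5) proves.MP)
next
  case (InstN p t)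
  have *: "tsub \<tau> \<circ> case_nat t Var = tsub (case_nat (tsub \<tau> t) Var) \<circ> upN \<tau>"
    by (auto simp: fun_eq_iff upN_def tm_lift_tsub tsub_tsub comp_def split: nat.split)
  have "fsub \<tau> \<upsilon> (fm_substN 0 t p) = fm_substN 0 (tsub \<tau> t) (fsub (upN \<tau>) \<upsilon> p)"
    by (simp add: fm_substN_0 fsub_fsub *)
  then show ?case by (simp add: proves.InstN)
next
  case (VacN p)
  have "tsub (upN \<tau>) \<circ> (Var \<circ> Suc) = tsub (Var \<circ> Suc) \<circ> \<tau>"
    by (auto simp: fun_eq_iff upN_def tm_lift_tsub comp_def)
  then have "fsub (upN \<tau>) \<upsilon> (fm_liftN 0 p) = fm_liftN 0 (fsub \<tau> \<upsilon> p)"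
    by (simp add: fm_liftN_0 fsub_fsub)
  then show ?case by (simp add: proves.VacN)
next
  case (InstS p i)
  have "fsub \<tau> \<upsilon> (fm_substS 0 i p) = fm_substS 0 (\<upsilon> i) (fsub \<tau> (upS \<upsilon>) p)"
  proof -
    have "\<upsilon> \<circ> case_nat i id = case_nat (\<upsilon> i) id \<circ> upS \<upsilon>"
      by (auto simp: fun_eq_iff upS_def split: nat.split)
    moreover have "tsub Var \<circ> \<tau> = tsub \<tau> \<circ> Var" by (auto simp: fun_eq_iff)
    ultimately show ?thesis by (simp add: fm_substS_0 fsub_fsub)
  qed
  then show ?case by (simp add: proves.InstS)
next
  case (VacS p)
  have "upS \<upsilon> \<circ> Suc = Suc \<circ> \<upsilon>"
    by (auto simp: fun_eq_iff upS_def)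
  moreover have "tsub Var \<circ> \<tau> = tsub \<tau> \<circ> Var" by (auto simp: fun_eq_iff)
  ultimately have "fsub \<tau> (upS \<upsilon>) (fm_liftS 0 p) = fm_liftS 0 (fsub \<tau> \<upsilon> p)"
    by (simp add: fm_liftS_0 fsub_fsub)
  then show ?case by (simp add: proves.VacS)
next
  case (EqSubst t u p)
  have *: "fsub \<tau> \<upsilon> (fm_substN 0 t p) = fm_substN 0 (tsub \<tau> t) (fsub (upN \<tau>) \<upsilon> p)" for t
  proof -
    have "tsub \<tau> \<circ> case_nat t Var = tsub (case_nat (tsub \<tau> t) Var) \<circ> upN \<tau>"
      by (auto simp: fun_eq_iff upN_def tm_lift_tsub tsub_tsub comp_def split: nat.split)
    then show ?thesis by (simp add: fm_substN_0 fsub_fsub)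
  qed
  show ?case by (simp add: * proves.EqSubst)
qed (auto intro: proves.AxK proves.AxS proves.AxDN proves.GenN proves.GenS proves.DistN proves.DistS proves.EqRefl)

subsection \<open>Derivability by detachment\<close>

text \<open>Hypotheses in \<open>G\<close> may have free variables, over which generalisation would
  be unsound. Only detachment acts on them, and theorems of \<open>T\<close> enter ready-made; so
  the deduction theorem needs no side condition.\<close>

inductive pd :: "fm set \<Rightarrow> fm set \<Rightarrow> fm \<Rightarrow> bool" for T G where
  hyp: "p \<in> G \<Longrightarrow> pd T G p"
| thmI: "T \<turnstile> p \<Longrightarrow> pd T G p"
| mp: "pd T G (Imp p q) \<Longrightarrow> pd T G p \<Longrightarrow> pd T G q"

lemma pd_empty: "pd T {} p \<Longrightarrow> T \<turnstile> p"
  by (induction rule: pd.induct) (auto dest: proves.MP)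

lemma pd_mono: "pd T G p \<Longrightarrow> G \<subseteq> H \<Longrightarrow> pd T H p"
proof (induction rule: pd.induct)
  case (mp p q)
  then show ?case by (blast intro: pd.mp)
qed (auto intro: pd.hyp pd.thmI)

lemma Imp_refl: "T \<turnstile> Imp p p"
  by (meson proves.AxK proves.AxS proves.MP)

lemma pd_deduct: "pd T (insert a G) p \<Longrightarrow> pd T G (Imp a p)"
proof (induction rule: pd.induct)
  case (hyp p)
  then show ?case by (metis Imp_refl insertE pd.hyp pd.mp pd.thmI proves.AxK)
next
  case (thmI p)
  then show ?case by (meson pd.mp pd.thmI proves.AxK)
next
  case (mp p q)
  then show ?case by (meson pd.mp pd.thmI proves.AxS)
qed

lemma pd_contr: "pd T (insert (Neg p) G) Falsum \<Longrightarrow> pd T G p"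
  by (meson pd.mp pd.thmI pd_deduct proves.AxDN)

lemma pd_finite: "pd T (\<Union>n. G n) p \<Longrightarrow> (\<And>n. G n \<subseteq> G (Suc n)) \<Longrightarrow> \<exists>n. pd T (G n) p"
proof (induction rule: pd.induct)
  case (mp p q)
  then obtain m n where "pd T (G m) (Imp p q)" "pd T (G n) p" by blast
  moreover have "G m \<subseteq> G (max m n)" "G n \<subseteq> G (max m n)"
    using mp.prems lift_Suc_mono_le[of G] by auto
  ultimately show ?case by (meson pd.mp pd_mono)
qed (auto intro: pd.hyp pd.thmI)

lemma pd_fsub:
  assumes "\<forall>p\<in>T. sentence p" "pd T G p" shows "pd T (fsub \<tau> \<upsilon> ` G) (fsub \<tau> \<upsilon> p)"
  using assms(2)
proof (induction rule: pd.induct)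
  case (mp p q)
  then show ?case by (metis fsub.simps(5) pd.mp)
qed (auto intro: pd.hyp pd.thmI proves_fsub[OF assms(1)])

text \<open>\<open>VacN\<close> generalises each lifted hypothesis, and \<open>DistN\<close> carries
  the quantifier through detachment.\<close>

lemma pd_AllN: "pd T (fm_liftN 0 ` G) p \<Longrightarrow> pd T G (AllN p)"
proof (induction rule: pd.induct)
  case (hyp p)
  then show ?case by (metis imageE pd.hyp pd.thmI pd.mp proves.VacN)
next
  case (mp p q)
  then show ?case by (meson pd.mp pd.thmI proves.DistN)
qed (rule pd.thmI, erule proves.GenN)

lemma pd_AllS: "pd T (fm_liftS 0 ` G) p \<Longrightarrow> pd T G (AllS p)"
proof (induction rule: pd.induct)
  case (hyp p)
  then show ?case by (metis imageE pd.hyp pd.thmI pd.mp proves.VacS)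
next
  case (mp p q)
  then show ?case by (meson pd.mp pd.thmI proves.DistS)
qed (rule pd.thmI, erule proves.GenS)

text \<open>An index \<open>y\<close> above all free variables acts as a fresh constant: the
  renaming \<open>\<rho>\<close> moves it to 0 and everything else up, which turns the hypotheses
  into their lifts and the instance back into \<open>p\<close>.\<close>

lemma pd_fresh:
  assumes T: "\<forall>p\<in>T. sentence p" and bd: "\<forall>q\<in>insert p G. fm_bd y y q"
  shows "pd T G (fm_substN 0 (Var y) p) \<Longrightarrow> pd T G (AllN p)"
    and "pd T G (fm_substS 0 y p) \<Longrightarrow> pd T G (AllS p)"
proof -
  assume *: "pd T G (fm_substN 0 (Var y) p)"
  define \<rho> where "\<rho> = (\<lambda>i. Var (if i = y then 0 else Suc i))"
  have 1: "fsub \<rho> id q = fm_liftN 0 q" if "q \<in> G" for q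
    unfolding fm_liftN_0 by (rule fsub_cong[of y y]) (use that bd in \<open>auto simp: \<rho>_def\<close>)
  have "fsub \<rho> id (fm_substN 0 (Var y) p) = fsub Var id p"
    unfolding fm_substN_0 fsub_fsub
    by (rule fsub_cong[of y y]) (use bd in \<open>auto simp: \<rho>_def split: nat.split\<close>)
  then have "pd T (fsub \<rho> id ` G) p"
    using pd_fsub[OF T *, of \<rho> id] by simp
  then have "pd T (fm_liftN 0 ` G) p" using 1 by (simp cong: image_cong)
  then show "pd T G (AllN p)" by (rule pd_AllN)
next
  assume *: "pd T G (fm_substS 0 y p)"
  define \<rho> where "\<rho> = (\<lambda>i. if i = y then 0 else Suc i)"
  have 1: "fsub Var \<rho> q = fm_liftS 0 q" if "q \<in> G" for q
    unfolding fm_liftS_0 by (rule fsub_cong[of y y]) (use that bd in \<open>auto simp: \<rho>_def\<close>)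
  have "fsub Var \<rho> (fm_substS 0 y p) = fsub Var id p"
    unfolding fm_substS_0 fsub_fsub
    by (rule fsub_cong[of y y]) (use bd in \<open>auto simp: \<rho>_def split: nat.split\<close>)
  then have "pd T (fsub Var \<rho> ` G) p"
    using pd_fsub[OF T *, of Var \<rho>] by simp
  then have "pd T (fm_liftS 0 ` G) p" using 1 by (simp cong: image_cong)
  then show "pd T G (AllS p)" by (rule pd_AllS)
qed

instance tm :: countable by countable_datatype
instance fm :: countable by countable_datatype

subsection \<open>Completeness\<close>

definition con :: "fm set \<Rightarrow> fm set \<Rightarrow> bool" where
  "con T G \<longleftrightarrow> \<not> pd T G Falsum"

text \<open>Finiteness of \<open>G\<close> leaves a variable above all free ones, and this variable
  can witness the failure of a universal formula. So variables serve as Henkin constants and the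
  language is not extended.\<close>

lemma henkin_step:
  assumes T: "\<forall>p\<in>T. sentence p" and G: "finite G" "con T G"
  shows "\<exists>H. finite H \<and> G \<subseteq> H \<and> con T H \<and> (p \<in> H \<or> Neg p \<in> H \<and>
     (\<forall>q. p = AllN q \<longrightarrow> (\<exists>t. Neg (fm_substN 0 t q) \<in> H)) \<and>
     (\<forall>q. p = AllS q \<longrightarrow> (\<exists>j. Neg (fm_substS 0 j q) \<in> H)))"
proof (cases "con T (insert p G)")
  case True
  then show ?thesis using G by (intro exI[of _ "insert p G"]) auto
next
  case False
  define G' where "G' = insert (Neg p) G"
  have np: "pd T G (Neg p)" using False by (simp add: con_def pd_deduct)
  have "con T G'"
    unfolding con_def G'_def using np G(2) by (meson con_def pd.mp pd_deduct)
  have fin: "finite G'" using G by (simp add: G'_def)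
  have "\<exists>y. \<forall>q\<in>insert r G'. fm_bd y y q" for r
  proof -
    have "finite (insert r G')" using fin by simp
    then show ?thesis
    proof (induction rule: finite_induct)
      case (insert q F)
      then obtain y where y: "\<forall>q\<in>F. fm_bd y y q" by blast
      obtain z where z: "fm_bd z z q" using ex_fm_bd by blast
      show ?case using y z by (intro exI[of _ "max y z"]) (auto intro: fm_bd_mono)
    qed auto
  qed
  then obtain y where y: "\<And>r. \<forall>q\<in>insert r G'. fm_bd (y r) (y r) q" by metis
  have not_p: "\<not> pd T G' p"
    using \<open>con T G'\<close> by (metis G'_def con_def insertI1 pd.hyp pd.mp)
  show ?thesis
  proof (cases p)
    case (AllN q)
    have "con T (insert (Neg (fm_substN 0 (Var (y q)) q)) G')"
      unfolding con_def using not_p AllN pd_contr pd_fresh(1)[OF T y] by blast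
    then show ?thesis using fin AllN
      by (intro exI[of _ "insert (Neg (fm_substN 0 (Var (y q)) q)) G'"]) (auto simp: G'_def)
  next
    case (AllS q)
    have "con T (insert (Neg (fm_substS 0 (y q) q)) G')"
      unfolding con_def using not_p AllS pd_contr pd_fresh(2)[OF T y] by blast
    then show ?thesis using fin AllS
      by (intro exI[of _ "insert (Neg (fm_substS 0 (y q) q)) G'"]) (auto simp: G'_def)
  qed (use fin \<open>con T G'\<close> in \<open>auto simp: G'_def intro!: exI[of _ G']\<close>)
qed

lemma henkin_set:
  assumes T: "\<forall>p\<in>T. sentence p" and G: "finite G" "con T G"
  obtains H where "G \<subseteq> H" "con T H" "\<And>p. p \<in> H \<or> Neg p \<in> H"
    "\<And>q. Neg (AllN q) \<in> H \<Longrightarrow> \<exists>t. Neg (fm_substN 0 t q) \<in> H"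
    "\<And>q. Neg (AllS q) \<in> H \<Longrightarrow> \<exists>j. Neg (fm_substS 0 j q) \<in> H"
proof -
  define R where "R = (\<lambda>n G H. G \<subseteq> H \<and> (let p = from_nat n :: fm in p \<in> H \<or> Neg p \<in> H \<and>
     (\<forall>q. p = AllN q \<longrightarrow> (\<exists>t. Neg (fm_substN 0 t q) \<in> H)) \<and>
     (\<forall>q. p = AllS q \<longrightarrow> (\<exists>j. Neg (fm_substS 0 j q) \<in> H))))"
  have "\<exists>F. \<forall>n. (finite (F n) \<and> con T (F n) \<and> (n = 0 \<longrightarrow> F n = G)) \<and> R n (F n) (F (Suc n))"
  proof (rule dependent_nat_choice)
    show "\<exists>H. finite H \<and> con T H \<and> (0 = (0::nat) \<longrightarrow> H = G)" using G by blast
    show "\<exists>H'. (finite H' \<and> con T H' \<and> (Suc n = 0 \<longrightarrow> H' = G)) \<and> R n H H'"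
      if "finite H \<and> con T H \<and> (n = 0 \<longrightarrow> H = G)" for H n
      using henkin_step[OF T, of H "from_nat n"] that by (simp add: R_def Let_def) blast
  qed
  then obtain F where F: "\<And>n. con T (F n)" "F 0 = G" "\<And>n. R n (F n) (F (Suc n))"
    by blast
  have mono: "\<And>n. F n \<subseteq> F (Suc n)" using F(3) by (simp add: R_def)
  define H where "H = (\<Union>n. F n)"
  have con: "con T H"
    unfolding con_def H_def using pd_finite[of T F Falsum] mono F(1) by (auto simp: con_def)
  have FH: "F n \<subseteq> H" for n by (auto simp: H_def)
  have dec: "p \<in> H \<or> Neg p \<in> H \<and>
     (\<forall>q. p = AllN q \<longrightarrow> (\<exists>t. Neg (fm_substN 0 t q) \<in> H)) \<and>
     (\<forall>q. p = AllS q \<longrightarrow> (\<exists>j. Neg (fm_substS 0 j q) \<in> H))" for p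
    using F(3)[of "to_nat p"] FH[of "Suc (to_nat p)"] unfolding R_def Let_def from_nat_to_nat
    by blast
  have incons: "\<not> (p \<in> H \<and> Neg p \<in> H)" for p
    using con by (meson con_def pd.hyp pd.mp)
  show ?thesis
    by (rule that[of H]) (use con dec incons F(2) FH[of 0] in \<open>blast+\<close>)
qed

text \<open>Henkin's term model, transferred to the carrier \<open>nat\<close> so that later
  arguments concern models over one type. The axioms in \<open>basic_axioms\<close> make the
  numerals pairwise distinct; hence there are infinitely many term classes, and these can be
  enumerated by all of \<open>nat\<close>.\<close>

theorem completeness:
  assumes T: "\<forall>p\<in>T. sentence p" and aca: "\<forall>p\<in>basic_axioms. T \<turnstile> p"
    and all: "\<And>(M :: nat model) e E. mods M T \<Longrightarrow> range E \<subseteq> ms M \<Longrightarrow> msat M e E p"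
  shows "T \<turnstile> p"
proof (rule ccontr)
  assume "\<not> T \<turnstile> p"
  then have "con T {Neg p}"
    unfolding con_def using pd_contr pd_empty by blast
  from henkin_set[OF T _ this] obtain H where H: "Neg p \<in> H" "con T H"
    "\<And>p. p \<in> H \<or> Neg p \<in> H"
    "\<And>q. Neg (AllN q) \<in> H \<Longrightarrow> \<exists>t. Neg (fm_substN 0 t q) \<in> H"
    "\<And>q. Neg (AllS q) \<in> H \<Longrightarrow> \<exists>j. Neg (fm_substS 0 j q) \<in> H"
    by (metis finite.emptyI finite.insertI insert_subset)
  have cl: "q \<in> H" if "pd T H q" for q
    using that H(2,3) by (meson con_def pd.hyp pd.mp)
  have thmI: "T \<turnstile> q \<Longrightarrow> q \<in> H" for q by (blast intro: cl pd.thmI)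
  have mp: "Imp q r \<in> H \<Longrightarrow> q \<in> H \<Longrightarrow> r \<in> H" for q r by (meson cl pd.hyp pd.mp)
  have neg: "Neg q \<in> H \<longleftrightarrow> q \<notin> H" for q
    using H(2,3) by (meson con_def pd.hyp pd.mp)
  have fal: "Falsum \<notin> H" using H(2) con_def pd.hyp by blast
  have imp: "Imp q r \<in> H \<longleftrightarrow> (q \<in> H \<longrightarrow> r \<in> H)" for q r
  proof
    assume "q \<in> H \<longrightarrow> r \<in> H"
    show "Imp q r \<in> H"
    proof (cases "r \<in> H")
      case True
      then show ?thesis using mp proves.AxK thmI by blast
    next
      case False
      then have "q \<notin> H" using \<open>q \<in> H \<longrightarrow> r \<in> H\<close> by blast
      then have "pd T (insert q H) r"
        using neg by (meson insertCI pd.hyp pd.mp pd.thmI proves.AxDN proves.AxK)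
      then show ?thesis by (intro cl pd_deduct)
    qed
  qed (use mp in blast)
  have alln: "AllN q \<in> H \<longleftrightarrow> (\<forall>t. fm_substN 0 t q \<in> H)" for q
    using H(4) neg mp proves.InstN thmI by blast
  have alls: "AllS q \<in> H \<longleftrightarrow> (\<forall>t. fm_substS 0 t q \<in> H)" for q
    using H(5) neg mp proves.InstS thmI by blast
  have esub: "Equal t u \<in> H \<Longrightarrow> fm_substN 0 t q \<in> H \<Longrightarrow> fm_substN 0 u q \<in> H" for t u q
    using mp proves.EqSubst thmI by blast
  have sl [simp]: "tm_subst 0 t (tm_lift 0 u) = u" for t u
    by (induction u) auto
  have refl: "Equal t t \<in> H" for t using proves.EqRefl thmI by blast
  have sym: "Equal t u \<in> H \<Longrightarrow> Equal u t \<in> H" for t u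
    using esub[of t u "Equal (Var 0) (tm_lift 0 t)"] refl by simp
  have trans: "Equal t u \<in> H \<Longrightarrow> Equal u v \<in> H \<Longrightarrow> Equal t v \<in> H" for t u v
    using esub[of u v "Equal (tm_lift 0 t) (Var 0)"] by simp
  have cong2: "Equal (F t u) (F t' u') \<in> H" if "Equal t t' \<in> H" "Equal u u' \<in> H"
    and F: "F = Plus \<or> F = Times" for F t t' u u'
  proof -
    have "Equal (F t u) (F t' u) \<in> H"
      using esub[OF that(1), of "Equal (tm_lift 0 (F t u)) (F (Var 0) (tm_lift 0 u))"] refl F
      by auto
    moreover have "Equal (F t' u) (F t' u') \<in> H"
      using esub[OF that(2), of "Equal (tm_lift 0 (F t' u)) (F (tm_lift 0 t') (Var 0))"] refl F
      by auto
    ultimately show ?thesis by (rule trans)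
  qed
  have less: "Less t u \<in> H \<Longrightarrow> Less t' u' \<in> H" if "Equal t t' \<in> H" "Equal u u' \<in> H"
    for t t' u u'
  proof -
    assume "Less t u \<in> H"
    then have "Less t' u \<in> H" using esub[OF that(1), of "Less (Var 0) (tm_lift 0 u)"] by simp
    then show "Less t' u' \<in> H" using esub[OF that(2), of "Less (tm_lift 0 t') (Var 0)"] by simp
  qed
  have mem: "Mem t j \<in> H \<Longrightarrow> Mem u j \<in> H" if "Equal t u \<in> H" for t u j
    using esub[OF that, of "Mem (Var 0) j"] by simp
  define cls where "cls = (\<lambda>t. {u. Equal t u \<in> H})"
  have cls: "cls t = cls u \<longleftrightarrow> Equal t u \<in> H" for t u
    unfolding cls_def using refl sym trans by blast
  have suc: "Equal (Plus t One) Zero \<notin> H" for t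
  proof -
    have "AllN (Neg (Equal (Plus (Var 0) One) Zero)) \<in> H"
      using aca thmI by (auto simp: basic_axioms_def)
    then have "fm_substN 0 t (Neg (Equal (Plus (Var 0) One) Zero)) \<in> H"
      unfolding alln by blast
    then show ?thesis using neg by simp
  qed
  have inj: "Equal (Plus t One) (Plus u One) \<in> H \<Longrightarrow> Equal t u \<in> H" for t u
  proof -
    assume *: "Equal (Plus t One) (Plus u One) \<in> H"
    let ?p = "Imp (Equal (Plus (Var 1) One) (Plus (Var 0) One)) (Equal (Var 1) (Var 0))"
    have "AllN (AllN ?p) \<in> H" using aca thmI by (auto simp: basic_axioms_def)
    then have "AllN (fm_substN 1 (tm_lift 0 t) ?p) \<in> H"
      using alln[of "AllN ?p"] by (simp del: One_nat_def)
    then have "fm_substN 0 u (fm_substN 1 (tm_lift 0 t) ?p) \<in> H" unfolding alln by blast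
    then show "Equal t u \<in> H" using * imp by simp
  qed
  have "inj (\<lambda>n. cls (num n))"
  proof -
    have "Equal (num m) (num n) \<in> H \<Longrightarrow> m = n" for m n
    proof (induction m arbitrary: n)
      case 0
      then show ?case using suc sym by (cases n) auto
    next
      case (Suc m)
      then show ?case using suc inj by (cases n) auto
    qed
    then show ?thesis by (auto intro!: injI simp: cls)
  qed
  then have "infinite (range (\<lambda>n. cls (num n)))" by (rule range_inj_infinite)
  then have "infinite (range cls)" by (rule contrapos_nn) (auto elim!: finite_subset[rotated])
  then have bij: "bij_betw (to_nat_on (range cls)) (range cls) UNIV"
    by (intro to_nat_on_infinite) auto
  define val where "val = (\<lambda>t. to_nat_on (range cls) (cls t))"
  have val: "val t = val u \<longleftrightarrow> Equal t u \<in> H" for t u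
    unfolding val_def cls[symmetric] by (rule inj_on_eq_iff[OF bij_betw_imp_inj_on[OF bij]]) auto
  have surj: "\<exists>t. val t = n" for n
  proof -
    have "n \<in> to_nat_on (range cls) ` range cls" using bij_betw_imp_surj_on[OF bij] by simp
    then show ?thesis by (auto simp: val_def)
  qed
  define rp where "rp = (\<lambda>n. SOME t. val t = n)"
  have rp [simp]: "val (rp n) = n" for n unfolding rp_def using surj[of n] by (rule someI_ex)
  have rpe: "Equal (rp (val t)) t \<in> H" "Equal t (rp (val t)) \<in> H" for t
    using val[of "rp (val t)" t] sym rp[of "val t"] by blast+
  \<comment> \<open>The sets of the model are exactly those named by a set variable, so that a set
    quantifier ranges over the instances in \<open>alls\<close>.\<close>
  define setv where "setv = (\<lambda>j. {val t | t. Mem t j \<in> H})"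
  define M where "M = Model (val Zero) (val One) (\<lambda>x y. val (Plus (rp x) (rp y)))
    (\<lambda>x y. val (Times (rp x) (rp y))) (\<lambda>x y. Less (rp x) (rp y) \<in> H) (range setv)"
  have mv: "mval M (\<lambda>i. val (\<tau> i)) t = val (tsub \<tau> t)" for \<tau> t
  proof (induction t)
    case (Plus t u)
    then show ?case by (simp add: M_def) (simp add: val cong2 rpe)
  next
    case (Times t u)
    then show ?case by (simp add: M_def) (simp add: val cong2 rpe)
  qed (simp_all add: M_def)
  have vless: "ml M (val x) (val y) \<longleftrightarrow> Less x y \<in> H" for x y
    using less[OF rpe(1) rpe(1), of x y] less[OF rpe(2) rpe(2), of x y] by (auto simp: M_def)
  have vset: "val x \<in> setv i \<longleftrightarrow> Mem x i \<in> H" for x i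
    unfolding setv_def using mem[of _ x i] refl[of x] val[of x] sym[of x] by blast
  \<comment> \<open>The truth lemma needs arbitrary substitutions, because each quantifier replaces
    \<open>\<tau>\<close> by \<open>case_nat t \<tau>\<close> or \<open>\<upsilon>\<close> by
    \<open>case_nat t \<upsilon>\<close>.\<close>
  have truth: "msat M (\<lambda>i. val (\<tau> i)) (\<lambda>i. setv (\<upsilon> i)) q \<longleftrightarrow> fsub \<tau> \<upsilon> q \<in> H" for \<tau> \<upsilon> q
  proof (induction q arbitrary: \<tau> \<upsilon>)
    case (AllN q)
    have *: "fm_substN 0 t (fsub (upN \<tau>) \<upsilon> q) = fsub (case_nat t \<tau>) \<upsilon> q" for t
    proof -
      have "tsub (case_nat t Var) \<circ> upN \<tau> = case_nat t \<tau>"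
        by (auto simp: fun_eq_iff upN_def tm_lift_tsub tsub_tsub comp_def split: nat.split)
      then show ?thesis by (simp add: fm_substN_0 fsub_fsub)
    qed
    have c: "case_nat (val t) (\<lambda>i. val (\<tau> i)) = (\<lambda>i. val (case_nat t \<tau> i))" for t
      by (auto simp: fun_eq_iff split: nat.split)
    have "msat M (\<lambda>i. val (\<tau> i)) (\<lambda>i. setv (\<upsilon> i)) (AllN q)
        \<longleftrightarrow> (\<forall>t. msat M (case_nat (val t) (\<lambda>i. val (\<tau> i))) (\<lambda>i. setv (\<upsilon> i)) q)"
      unfolding msat.simps using surj by metis
    also have "\<dots> \<longleftrightarrow> (\<forall>t. fm_substN 0 t (fsub (upN \<tau>) \<upsilon> q) \<in> H)"
      unfolding * c AllN ..
    finally show ?case unfolding fsub.simps alln .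
  next
    case (AllS q)
    have *: "fm_substS 0 t (fsub \<tau> (upS \<upsilon>) q) = fsub \<tau> (case_nat t \<upsilon>) q" for t
    proof -
      have "case_nat t id \<circ> upS \<upsilon> = case_nat t \<upsilon>" "tsub Var \<circ> \<tau> = \<tau>"
        by (auto simp: fun_eq_iff upS_def split: nat.split)
      then show ?thesis by (simp add: fm_substS_0 fsub_fsub)
    qed
    have c: "case_nat (setv t) (\<lambda>i. setv (\<upsilon> i)) = (\<lambda>i. setv (case_nat t \<upsilon> i))" for t
      by (auto simp: fun_eq_iff split: nat.split)
    have "msat M (\<lambda>i. val (\<tau> i)) (\<lambda>i. setv (\<upsilon> i)) (AllS q)
        \<longleftrightarrow> (\<forall>t. msat M (\<lambda>i. val (\<tau> i)) (case_nat (setv t) (\<lambda>i. setv (\<upsilon> i))) q)"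
      by (simp add: M_def)
    also have "\<dots> \<longleftrightarrow> (\<forall>t. fm_substS 0 t (fsub \<tau> (upS \<upsilon>) q) \<in> H)"
      unfolding * c AllS ..
    finally show ?case unfolding fsub.simps alls .
  qed (simp_all add: mv val vless vset fal imp)
  have nonempty: "ms M \<noteq> {}" by (simp add: M_def)
  have "mods M T"
    unfolding mods_def
  proof (intro conjI ballI allI impI nonempty)
    fix q e E assume q: "q \<in> T"
    have "q \<in> H" using q thmI proves.Ax by blast
    then have "msat M (\<lambda>i. val (Var i)) (\<lambda>i. setv (id i)) q" by (simp only: truth fsub_Var)
    then show "msat M e E q" using msat_sentence q T by blast
  qed
  moreover have "range (\<lambda>i. setv (id i)) \<subseteq> ms M" by (auto simp: M_def)
  ultimately have "msat M (\<lambda>i. val (Var i)) (\<lambda>i. setv (id i)) p" by (rule all)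
  then have "p \<in> H" by (simp only: truth fsub_Var)
  then show False using H(1) neg by blast
qed

section \<open>Models of arithmetical comprehension\<close>

definition mix :: "(nat \<Rightarrow> 'b) \<Rightarrow> (nat \<Rightarrow> 'b) \<Rightarrow> nat \<Rightarrow> 'b" where
  "mix e c i = (if even i then e (i div 2) else c (i div 2))"

lemma range_mix: "range e \<subseteq> A \<Longrightarrow> range c \<subseteq> A \<Longrightarrow> range (mix e c) \<subseteq> A"
  by (auto simp: mix_def)

lemma arithmetical_fsub [simp]: "arithmetical (fsub \<tau> \<upsilon> p) = arithmetical p"
  by (induction p arbitrary: \<tau> \<upsilon>) auto

locale aca =
  fixes M :: "'a model"
  assumes M_aca: "mods M ACA0"
begin

abbreviation zer ("\<zero>") where "\<zero> \<equiv> mz M"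
abbreviation one' ("\<one>") where "\<one> \<equiv> mo M"
abbreviation add' (infixl "\<oplus>" 65) where "x \<oplus> y \<equiv> mp M x y"
abbreviation mul' (infixl "\<otimes>" 70) where "x \<otimes> y \<equiv> mt M x y"
abbreviation lt' (infix "\<lhd>" 50) where "x \<lhd> y \<equiv> ml M x y"
abbreviation le' (infix "\<unlhd>" 50) where "x \<unlhd> y \<equiv> ml M x y \<or> x = y"
abbreviation suc where "suc x \<equiv> x \<oplus> \<one>"

lemma ms_ne: "ms M \<noteq> {}"
  using M_aca by (simp add: mods_def)

lemma sat_ax: "p \<in> ACA0 \<Longrightarrow> range E \<subseteq> ms M \<Longrightarrow> msat M e E p"
  using M_aca by (simp add: mods_def)

subsection \<open>Definable predicates\<close>

text \<open>In \<open>dfn\<close> and \<open>tdf\<close> the even variables of the formula stand for the arguments and the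
  odd ones for parameters, so that parameters of two formulas can be merged by renaming.\<close>

definition dfn :: "((nat \<Rightarrow> 'a) \<Rightarrow> bool) \<Rightarrow> bool" where
  "dfn P \<longleftrightarrow> (\<exists>p c E. arithmetical p \<and> range E \<subseteq> ms M \<and> (\<forall>e. P e = msat M (mix e c) E p))"

definition tdf :: "((nat \<Rightarrow> 'a) \<Rightarrow> 'a) \<Rightarrow> bool" where
  "tdf f \<longleftrightarrow> (\<exists>t c. \<forall>e. f e = mval M (mix e c) t)"

definition renl :: "nat \<Rightarrow> nat" where
  "renl i = (if even i then i else 2 * (2 * (i div 2)) + 1)"

definition renr :: "nat \<Rightarrow> nat" where
  "renr i = (if even i then i else 2 * (2 * (i div 2) + 1) + 1)"

lemma mix_renl: "mix e (mix c d) (renl i) = mix e c i"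
  by (cases "even i") (auto simp: mix_def renl_def elim!: oddE)

lemma mix_renr: "mix e (mix c d) (renr i) = mix e d i"
  by (cases "even i") (auto simp: mix_def renr_def elim!: oddE)

lemma tdf_var: "tdf (\<lambda>e. e i)"
  unfolding tdf_def by (rule exI[of _ "Var (2 * i)"]) (simp add: mix_def)

lemma tdf_const: "tdf (\<lambda>e. a)"
  unfolding tdf_def by (intro exI[of _ "Var 1"] exI[of _ "\<lambda>_. a"]) (simp add: mix_def)

lemma tdf_merge:
  assumes "tdf f" "tdf g"
  obtains t u c where "\<And>e. f e = mval M (mix e c) t" "\<And>e. g e = mval M (mix e c) u"
proof -
  obtain t c u d where "\<forall>e. f e = mval M (mix e c) t" "\<forall>e. g e = mval M (mix e d) u"
    using assms unfolding tdf_def by blast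
  then show ?thesis
    by (intro that[of "mix c d" "tsub (Var \<circ> renl) t" "tsub (Var \<circ> renr) u"])
      (simp_all add: mval_tsub mix_renl mix_renr)
qed

lemma tdf_add: assumes "tdf f" "tdf g" shows "tdf (\<lambda>e. f e \<oplus> g e)"
proof -
  obtain t u c where "\<And>e. f e = mval M (mix e c) t" "\<And>e. g e = mval M (mix e c) u"
    using assms by (rule tdf_merge) blast
  then show ?thesis unfolding tdf_def by (intro exI[of _ "Plus t u"] exI[of _ c]) simp
qed

lemma tdf_mul: assumes "tdf f" "tdf g" shows "tdf (\<lambda>e. f e \<otimes> g e)"
proof -
  obtain t u c where "\<And>e. f e = mval M (mix e c) t" "\<And>e. g e = mval M (mix e c) u"
    using assms by (rule tdf_merge) blast
  then show ?thesis unfolding tdf_def by (intro exI[of _ "Times t u"] exI[of _ c]) simp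
qed

lemma dfn_eq: assumes "tdf f" "tdf g" shows "dfn (\<lambda>e. f e = g e)"
proof -
  obtain t u c where "\<And>e. f e = mval M (mix e c) t" "\<And>e. g e = mval M (mix e c) u"
    using assms by (rule tdf_merge) blast
  moreover obtain Y where "Y \<in> ms M" using ms_ne by blast
  ultimately show ?thesis unfolding dfn_def
    by (intro exI[of _ "Equal t u"] exI[of _ c] exI[of _ "\<lambda>_. Y"]) auto
qed

lemma dfn_less: assumes "tdf f" "tdf g" shows "dfn (\<lambda>e. f e \<lhd> g e)"
proof -
  obtain t u c where "\<And>e. f e = mval M (mix e c) t" "\<And>e. g e = mval M (mix e c) u"
    using assms by (rule tdf_merge) blast
  moreover obtain Y where "Y \<in> ms M" using ms_ne by blast
  ultimately show ?thesis unfolding dfn_def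
    by (intro exI[of _ "Less t u"] exI[of _ c] exI[of _ "\<lambda>_. Y"]) auto
qed

lemma dfn_mem:
  assumes "Y \<in> ms M" "tdf f" shows "dfn (\<lambda>e. f e \<in> Y)"
proof -
  obtain t c where "\<forall>e. f e = mval M (mix e c) t" using assms(2) by (auto simp: tdf_def)
  then show ?thesis unfolding dfn_def using assms(1)
    by (intro exI[of _ "Mem t 0"] exI[of _ c] exI[of _ "\<lambda>_. Y"]) auto
qed

lemma dfn_imp:
  assumes "dfn P" "dfn Q" shows "dfn (\<lambda>e. P e \<longrightarrow> Q e)"
proof -
  obtain p c E where "arithmetical p" "range E \<subseteq> ms M" "\<forall>e. P e = msat M (mix e c) E p"
    using assms(1) unfolding dfn_def by blast
  moreover obtain q d F where
    "arithmetical q" "range F \<subseteq> ms M" "\<forall>e. Q e = msat M (mix e d) F q"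
    using assms(2) unfolding dfn_def by blast
  moreover have "mix E F (2 * i) = E i" "mix E F (2 * i + 1) = F i" for i
    by (simp_all add: mix_def)
  ultimately show ?thesis
    unfolding dfn_def
    by (intro exI[of _ "Imp (fsub (Var \<circ> renl) (\<lambda>i. 2 * i) p) (fsub (Var \<circ> renr) (\<lambda>i. 2 * i + 1) q)"]
        exI[of _ "mix c d"] exI[of _ "mix E F"])
      (simp add: msat_fsub mix_renl mix_renr range_mix)
qed

lemma dfn_const: "dfn (\<lambda>e. B)"
proof (cases B)
  case True
  then show ?thesis using ms_ne unfolding dfn_def
    by (force intro: exI[of _ "Imp Falsum Falsum"])
next
  case False
  then show ?thesis using ms_ne unfolding dfn_def by (force intro: exI[of _ Falsum])
qed

text \<open>A quantifier shifts all indices by one and thereby swaps the parities of arguments and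
  parameters; this renaming restores the layout of \<open>mix\<close> with the bound variable as
  argument 0.\<close>

definition renq :: "nat \<Rightarrow> nat" where
  "renq i = (if i = 0 then 0 else if even i then i - 1 else Suc i)"

lemma mix_renq: "case_nat x (mix e c) (renq i) = mix (case_nat x e) c i"
  unfolding renq_def mix_def by (cases i) (auto split: nat.split elim: oddE evenE)

lemma dfn_all:
  assumes "dfn (\<lambda>e. P (e 0) (\<lambda>i. e (Suc i)))" shows "dfn (\<lambda>e. \<forall>x. P x e)"
proof -
  obtain p c E where p: "arithmetical p" "range E \<subseteq> ms M"
    "\<forall>e. P (e 0) (\<lambda>i. e (Suc i)) = msat M (mix e c) E p"
    using assms unfolding dfn_def by blast
  have "P x e = msat M (mix (case_nat x e) c) E p" for x e
    using p(3)[rule_format, of "case_nat x e"] by simp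
  then show ?thesis using p(1,2) unfolding dfn_def
    by (intro exI[of _ "AllN (fsub (Var \<circ> renq) id p)"] exI[of _ c] exI[of _ E])
      (simp add: msat_fsub mix_renq)
qed

lemma dfn_neg: "dfn P \<Longrightarrow> dfn (\<lambda>e. \<not> P e)"
  using dfn_imp[OF _ dfn_const, of P False] by simp

lemma dfn_disj: "dfn P \<Longrightarrow> dfn Q \<Longrightarrow> dfn (\<lambda>e. P e \<or> Q e)"
  using dfn_imp[OF dfn_neg, of P Q] by (simp add: disj_imp)

lemma dfn_conj: "dfn P \<Longrightarrow> dfn Q \<Longrightarrow> dfn (\<lambda>e. P e \<and> Q e)"
  using dfn_neg[OF dfn_disj[OF dfn_neg dfn_neg], of P Q] by simp

lemma dfn_iff: "dfn P \<Longrightarrow> dfn Q \<Longrightarrow> dfn (\<lambda>e. P e \<longleftrightarrow> Q e)"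
  using dfn_conj[OF dfn_imp dfn_imp, of P Q Q P] by (simp add: iff_conv_conj_imp)

lemma dfn_ex: "dfn (\<lambda>e. P (e 0) (\<lambda>i. e (Suc i))) \<Longrightarrow> dfn (\<lambda>e. \<exists>x. P x e)"
  using dfn_neg[OF dfn_all[of "\<lambda>x e. \<not> P x e"]] dfn_neg by simp

lemma dfn_bex:
  "finite A \<Longrightarrow> (\<And>i. i \<in> A \<Longrightarrow> dfn (P i)) \<Longrightarrow> dfn (\<lambda>e. \<exists>i\<in>A. P i e)"
proof (induction A rule: finite_induct)
  case empty
  then show ?case using dfn_const[of False] by simp
next
  case (insert a A)
  then show ?case using dfn_disj[of "P a" "\<lambda>e. \<exists>i\<in>A. P i e"] by simp
qed

lemmas dfn_intros = dfn_eq dfn_less dfn_mem dfn_all dfn_ex dfn_neg dfn_conj dfn_disj dfn_iff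
  dfn_imp tdf_var tdf_add tdf_mul

lemma dfn_sub:
  assumes "dfn P" "\<And>i. tdf (\<tau> i)" shows "dfn (\<lambda>e. P (\<lambda>i. \<tau> i e))"
proof -
  obtain p c E where p: "arithmetical p" "range E \<subseteq> ms M" "\<forall>e. P e = msat M (mix e c) E p"
    using assms(1) unfolding dfn_def by blast
  obtain t d where t: "\<And>i e. \<tau> i e = mval M (mix e (d i)) (t i)"
    using assms(2) unfolding tdf_def by metis
  \<comment> \<open>All parameter lists are packed into one by pairing: list 0 belongs to
    \<open>P\<close>, list \<open>Suc i\<close> to the term for \<open>\<tau> i\<close>.\<close>
  define C where "C = (\<lambda>j. case prod_decode j of (0, j) \<Rightarrow> c j | (Suc i, j) \<Rightarrow> d i j)"
  define r where "r = (\<lambda>i k. if even k then k else 2 * prod_encode (Suc i, k div 2) + 1)"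
  define \<sigma> where "\<sigma> = (\<lambda>k. if even k then tsub (Var \<circ> r (k div 2)) (t (k div 2))
     else Var (2 * prod_encode (0, k div 2) + 1))"
  have r: "mix e C (r i k) = mix e (d i) k" for e i k
    by (simp add: mix_def r_def C_def)
  have "mval M (mix e C) (\<sigma> k) = mix (\<lambda>i. \<tau> i e) c k" for e k
  proof (cases "even k")
    case True
    then have "mval M (mix e C) (\<sigma> k) = \<tau> (k div 2) e" by (simp add: \<sigma>_def mval_tsub r t)
    then show ?thesis using True by (simp add: mix_def)
  qed (simp add: \<sigma>_def mix_def C_def)
  then show ?thesis using p unfolding dfn_def
    by (intro exI[of _ "fsub \<sigma> id p"] exI[of _ C] exI[of _ E]) (simp add: msat_fsub)
qed

lemma dfn1: "dfn (\<lambda>e. Q (e 0)) \<Longrightarrow> tdf f \<Longrightarrow> dfn (\<lambda>e. Q (f e))"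
  using dfn_sub[of "\<lambda>e. Q (e 0)" "\<lambda>i. f"] by simp

lemma dfn2: "dfn (\<lambda>e. Q (e 0) (e (Suc 0))) \<Longrightarrow> tdf f \<Longrightarrow> tdf g \<Longrightarrow> dfn (\<lambda>e. Q (f e) (g e))"
  using dfn_sub[of "\<lambda>e. Q (e 0) (e (Suc 0))" "\<lambda>i. if i = 0 then f else g"] by auto

lemma dfn3: "dfn (\<lambda>e. Q (e 0) (e (Suc 0)) (e (Suc (Suc 0)))) \<Longrightarrow> tdf f \<Longrightarrow> tdf g \<Longrightarrow> tdf h
    \<Longrightarrow> dfn (\<lambda>e. Q (f e) (g e) (h e))"
  using dfn_sub[of "\<lambda>e. Q (e 0) (e (Suc 0)) (e (Suc (Suc 0)))"
      "\<lambda>i. if i = 0 then f else if i = Suc 0 then g else h"] by auto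

lemma msat_AllN_pow: "(\<And>e. msat M e E ((AllN ^^ n) q)) \<Longrightarrow> msat M e E q"
proof (induction n arbitrary: e)
  case (Suc n)
  have "msat M e E ((AllN ^^ n) q)" for e
  proof -
    have "case_nat (e 0) (\<lambda>i. e (Suc i)) = e" by (auto simp: fun_eq_iff split: nat.split)
    then show ?thesis
      using Suc.prems[of "\<lambda>i. e (Suc i)"] unfolding funpow.simps o_apply msat.simps by metis
  qed
  then show ?case by (rule Suc.IH)
qed simp

lemma msat_AllS_pow:
  "(\<And>E. range E \<subseteq> ms M \<Longrightarrow> msat M e E ((AllS ^^ n) q)) \<Longrightarrow> range E \<subseteq> ms M \<Longrightarrow> msat M e E q"
proof (induction n arbitrary: E)
  case (Suc n)
  have "msat M e E ((AllS ^^ n) q)" if "range E \<subseteq> ms M" for E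
  proof -
    have "msat M e (\<lambda>i. E (Suc i)) ((AllS ^^ Suc n) q)" by (rule Suc.prems(1)) (use that in auto)
    moreover have "E 0 \<in> ms M" using that by auto
    moreover have "case_nat (E 0) (\<lambda>i. E (Suc i)) = E" by (auto simp: fun_eq_iff split: nat.split)
    ultimately show ?thesis unfolding funpow.simps o_apply msat.simps by metis
  qed
  then show ?case using Suc.prems(2) by (rule Suc.IH)
qed simp

lemma comprehension:
  assumes p: "arithmetical p" and E: "range E \<subseteq> ms M"
  shows "{x. msat M (case_nat x e) E p} \<in> ms M"
proof -
  obtain n where "fm_bd n n p" using ex_fm_bd by blast
  then have bd: "fm_bd (Suc n) n p" by (rule fm_bd_mono) auto
  let ?q = "ExS (AllN (Iff (Mem (Var 0) 0) (fm_liftS 0 p)))"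
  have "(AllS ^^ n) ((AllN ^^ n) ?q) \<in> ACA0"
    unfolding ACA0_def arith_comprehension_def using p bd by blast
  then have "msat M e E ((AllS ^^ n) ((AllN ^^ n) ?q))" if "range E \<subseteq> ms M" for e E
    using M_aca that by (simp add: mods_def)
  then have "msat M e E ((AllN ^^ n) ?q)" for e using E by (rule msat_AllS_pow)
  then have "msat M e E ?q" by (rule msat_AllN_pow)
  then obtain X where "X \<in> ms M" "\<forall>x. x \<in> X \<longleftrightarrow> msat M (case_nat x e) E p"
    by auto
  moreover from this have "X = {x. msat M (case_nat x e) E p}" by auto
  ultimately show ?thesis by simp
qed

text \<open>Together with the closure rules for \<open>dfn\<close>, this forms sets of the model
  from HOL predicates without writing comprehension formulas by hand.\<close>

lemma compI: assumes "dfn (\<lambda>e. P (e 0))" shows "{x. P x} \<in> ms M"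
proof -
  obtain p c E where p: "arithmetical p" "range E \<subseteq> ms M" "\<forall>e. P (e 0) = msat M (mix e c) E p"
    using assms unfolding dfn_def by blast
  have "P x = msat M (case_nat x (mix (\<lambda>_. \<zero>) c)) E (fsub (Var \<circ> renq) id p)" for x
    using p(3)[rule_format, of "case_nat x (\<lambda>_. \<zero>)"] by (simp add: msat_fsub mix_renq)
  moreover have "{x. msat M (case_nat x (mix (\<lambda>_. \<zero>) c)) E (fsub (Var \<circ> renq) id p)} \<in> ms M"
    by (rule comprehension) (use p in auto)
  ultimately show ?thesis by simp
qed

lemma induct:
  assumes "dfn (\<lambda>e. P (e 0))" "P \<zero>" "\<And>x. P x \<Longrightarrow> P (suc x)"
  shows "P x"
proof -
  have "{x. P x} \<in> ms M" by (rule compI) fact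
  moreover obtain Y where "Y \<in> ms M" using ms_ne by blast
  then have "msat M e (\<lambda>_. Y) induction_axiom" for e
    using M_aca by (intro sat_ax) (auto simp: ACA0_def)
  ultimately have "\<forall>x. x \<in> {x. P x}"
    using assms(2,3) unfolding induction_axiom_def by force
  then show ?thesis by simp
qed

subsection \<open>Arithmetic in the model\<close>

lemma basic: "p \<in> basic_axioms \<Longrightarrow> msat M e (\<lambda>_. SOME Y. Y \<in> ms M) p"
  by (rule sat_ax) (use ms_ne in \<open>auto simp: ACA0_def some_in_eq\<close>)

lemma suc_ne [simp]: "suc x \<noteq> \<zero>" "\<zero> \<noteq> suc x"
  using basic[of "AllN (Neg (Equal (Plus (Var 0) One) Zero))"] by (auto simp: basic_axioms_def)

lemma suc_inj [simp]: "suc x = suc y \<longleftrightarrow> x = y"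
  using basic[of "AllN (AllN (Imp (Equal (Plus (Var 1) One) (Plus (Var 0) One)) (Equal (Var 1) (Var 0))))"]
  by (auto simp: basic_axioms_def)

lemma add_0 [simp]: "x \<oplus> \<zero> = x"
  using basic[of "AllN (Equal (Plus (Var 0) Zero) (Var 0))"] by (auto simp: basic_axioms_def)

lemma add_suc: "x \<oplus> suc y = suc (x \<oplus> y)"
  using basic[of "AllN (AllN (Equal (Plus (Var 1) (Plus (Var 0) One)) (Plus (Plus (Var 1) (Var 0)) One)))"]
  by (auto simp: basic_axioms_def)

lemma mul_0 [simp]: "x \<otimes> \<zero> = \<zero>"
  using basic[of "AllN (Equal (Times (Var 0) Zero) Zero)"] by (auto simp: basic_axioms_def)

lemma mul_suc: "x \<otimes> suc y = x \<otimes> y \<oplus> x"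
  using basic[of "AllN (AllN (Equal (Times (Var 1) (Plus (Var 0) One)) (Plus (Times (Var 1) (Var 0)) (Var 1))))"]
  by (auto simp: basic_axioms_def)

lemma not_less_0 [simp]: "\<not> x \<lhd> \<zero>"
  using basic[of "AllN (Neg (Less (Var 0) Zero))"] by (auto simp: basic_axioms_def)

lemma less_suc: "x \<lhd> suc y \<longleftrightarrow> x \<lhd> y \<or> x = y"
  using basic[of "AllN (AllN (Iff (Less (Var 1) (Plus (Var 0) One)) (Or (Less (Var 1) (Var 0)) (Equal (Var 1) (Var 0)))))"]
  by (auto simp: basic_axioms_def)

lemma add_assoc: "x \<oplus> y \<oplus> z = x \<oplus> (y \<oplus> z)"
  by (rule induct[where x = z]) (intro dfn_intros tdf_const, simp_all add: add_suc)

lemma add_0_left [simp]: "\<zero> \<oplus> x = x"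
  by (rule induct[where x = x]) (intro dfn_intros tdf_const, simp_all add: add_suc)

lemma suc_add: "suc x \<oplus> y = suc (x \<oplus> y)"
  by (rule induct[where x = y]) (intro dfn_intros tdf_const, simp_all add: add_suc)

lemma add_comm: "x \<oplus> y = y \<oplus> x"
  by (rule induct[where x = y]) (intro dfn_intros tdf_const, simp_all add: add_suc suc_add)

lemma mul_0_left [simp]: "\<zero> \<otimes> x = \<zero>"
  by (rule induct[where x = x]) (intro dfn_intros tdf_const, simp_all add: mul_suc)

lemma add_left_comm: "x \<oplus> (y \<oplus> z) = y \<oplus> (x \<oplus> z)"
  by (metis add_assoc add_comm)

lemma suc_mul: "suc x \<otimes> y = x \<otimes> y \<oplus> y"
  by (rule induct[where x = y]) (intro dfn_intros tdf_const, simp_all add: mul_suc, simp_all add: add_assoc add_left_comm add_comm)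

lemma mul_comm: "x \<otimes> y = y \<otimes> x"
  by (rule induct[where x = y]) (intro dfn_intros tdf_const, simp_all add: mul_suc suc_mul)

lemma distrib_left: "x \<otimes> (y \<oplus> z) = x \<otimes> y \<oplus> x \<otimes> z"
  by (rule induct[where x = z]) (intro dfn_intros tdf_const, simp_all add: mul_suc add_suc, simp add: add_assoc)

lemma mul_assoc: "x \<otimes> y \<otimes> z = x \<otimes> (y \<otimes> z)"
  by (rule induct[where x = z]) (intro dfn_intros tdf_const, simp_all add: mul_suc, simp add: distrib_left)

lemma distrib_right: "(y \<oplus> z) \<otimes> x = y \<otimes> x \<oplus> z \<otimes> x"
  by (metis distrib_left mul_comm)

lemma mul_left_comm: "x \<otimes> (y \<otimes> z) = y \<otimes> (x \<otimes> z)"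
  by (metis mul_assoc mul_comm)

lemma mul_1 [simp]: "x \<otimes> \<one> = x" "\<one> \<otimes> x = x"
  using mul_suc[of x \<zero>] mul_comm[of \<one> x] by simp_all

lemmas ring = add_assoc add_comm add_left_comm mul_assoc mul_comm mul_left_comm
  distrib_left distrib_right

lemma add_cancel [simp]: "z \<oplus> x = z \<oplus> y \<longleftrightarrow> x = y"
proof -
  have "x \<oplus> z = y \<oplus> z \<longrightarrow> x = y"
    by (rule induct[where x = z]) (intro dfn_intros tdf_const, simp_all add: add_assoc[symmetric])
  then show ?thesis by (auto simp: add_comm)
qed

lemma add_cancel_right [simp]: "x \<oplus> z = y \<oplus> z \<longleftrightarrow> x = y"
  using add_cancel[of z x y] by (simp only: add_comm)

lemma zero_or_suc: "x = \<zero> \<or> (\<exists>y. x = suc y)"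
  by (rule induct[where x = x]) (intro dfn_intros tdf_const, auto)

lemma add_eq_0 [simp]: "x \<oplus> y = \<zero> \<longleftrightarrow> x = \<zero> \<and> y = \<zero>"
  by (metis add_0 add_suc suc_ne(1) zero_or_suc)

lemma one_ne [simp]: "\<one> \<noteq> \<zero>" "\<zero> \<noteq> \<one>"
  using suc_ne[of \<zero>] by simp_all

text \<open>The axioms tie the order only to the successor. Induction on \<open>y\<close> ties it to
  addition, from which linearity, transitivity and monotonicity follow.\<close>

lemma less_iff: "x \<lhd> y \<longleftrightarrow> (\<exists>z. y = x \<oplus> suc z)"
proof (rule induct[where x = y])
  show "dfn (\<lambda>e. (x \<lhd> e 0) = (\<exists>z. e 0 = x \<oplus> suc z))"
    by (intro dfn_intros tdf_const)
  show "(x \<lhd> \<zero>) = (\<exists>z. \<zero> = x \<oplus> suc z)" by (simp add: add_suc)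
  fix y assume IH: "(x \<lhd> y) = (\<exists>z. y = x \<oplus> suc z)"
  show "(x \<lhd> suc y) = (\<exists>z. suc y = x \<oplus> suc z)"
    unfolding less_suc IH add_suc suc_inj by (metis add_0 add_suc zero_or_suc)
qed

lemma le_iff: "x \<unlhd> y \<longleftrightarrow> (\<exists>z. y = x \<oplus> z)"
  unfolding less_iff by (metis add_0 zero_or_suc)

lemma less_linear: "x \<lhd> y \<or> x = y \<or> y \<lhd> x"
proof (rule induct[where x = y])
  show "dfn (\<lambda>e. x \<lhd> e 0 \<or> x = e 0 \<or> e 0 \<lhd> x)" by (intro dfn_intros tdf_const)
  show "x \<lhd> \<zero> \<or> x = \<zero> \<or> \<zero> \<lhd> x" using zero_or_suc[of x] by (auto simp: less_iff)
  fix y assume "x \<lhd> y \<or> x = y \<or> y \<lhd> x"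
  then show "x \<lhd> suc y \<or> x = suc y \<or> suc y \<lhd> x"
  proof (elim disjE)
    assume "y \<lhd> x"
    then obtain z where z: "x = y \<oplus> suc z" unfolding less_iff by blast
    show ?thesis
    proof (cases "z = \<zero>")
      case False
      then obtain w where "z = suc w" using zero_or_suc by blast
      with z have "x = suc y \<oplus> suc w" using add_suc[of y "suc w"] suc_add[of y "suc w"] by simp
      then show ?thesis unfolding less_iff by blast
    qed (use z in \<open>simp add: add_suc\<close>)
  qed (auto simp: less_suc)
qed

lemma less_trans': "x \<lhd> y \<Longrightarrow> y \<lhd> z \<Longrightarrow> x \<lhd> z"
  unfolding less_iff by (metis add_assoc add_suc)

lemma less_irrefl' [simp]: "\<not> x \<lhd> x"
  unfolding less_iff by (metis add_0 add_cancel suc_ne(1))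

interpretation ord: linorder le' lt'
  by unfold_locales (use less_linear less_trans' less_irrefl' in blast)+

lemmas leq_trans = ord.order_trans and less_leq_trans = ord.less_le_trans

lemma leq_antisym: "x \<unlhd> y \<Longrightarrow> y \<unlhd> x \<Longrightarrow> x = y"
  using less_trans' less_irrefl' by blast

lemma less_add_mono [simp]: "z \<oplus> x \<lhd> z \<oplus> y \<longleftrightarrow> x \<lhd> y"
  unfolding less_iff by (simp add: add_assoc)

lemma le_add [simp]: "x \<unlhd> x \<oplus> y" "y \<unlhd> x \<oplus> y"
  unfolding le_iff using add_comm by blast+

lemma suc_le: "suc x \<unlhd> y \<longleftrightarrow> x \<lhd> y"
  by (metis less_linear less_suc ord.less_asym)

lemma zero_le [simp]: "\<zero> \<unlhd> x"
  unfolding le_iff by simp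

lemma less_self_suc [simp]: "x \<lhd> suc x"
  by (simp add: less_suc)

lemma strong_induct:
  assumes "dfn (\<lambda>e. P (e 0))" "\<And>x. (\<And>y. y \<lhd> x \<Longrightarrow> P y) \<Longrightarrow> P x"
  shows "P x"
proof -
  have "\<forall>y. y \<lhd> x \<longrightarrow> P y"
  proof (rule induct[where x = x])
    show "dfn (\<lambda>e. \<forall>y. y \<lhd> e 0 \<longrightarrow> P y)"
      by (intro dfn_intros tdf_const dfn1[OF assms(1)])
  qed (use assms(2) in \<open>auto simp: less_suc\<close>)
  then show ?thesis using assms(2) by blast
qed

lemma least:
  assumes "dfn (\<lambda>e. P (e 0))" "P x"
  obtains y where "P y" "\<And>z. P z \<Longrightarrow> y \<unlhd> z"
proof -
  have "\<exists>y. P y \<and> (\<forall>z. P z \<longrightarrow> y \<unlhd> z)"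
  proof (rule ccontr)
    assume *: "\<not> ?thesis"
    have "\<not> P x" for x
      by (rule strong_induct[where x = x])
        (use assms(1) in \<open>rule dfn_neg\<close>, use * ord.not_less in blast)
    then show False using assms(2) by blast
  qed
  then show ?thesis using that by blast
qed


subsection \<open>Coding\<close>

definition pJ :: "'a \<Rightarrow> 'a \<Rightarrow> 'a" where
  "pJ x y = (x \<oplus> y) \<otimes> (x \<oplus> y) \<oplus> x"

lemma tdf_pJ: "tdf f \<Longrightarrow> tdf g \<Longrightarrow> tdf (\<lambda>e. pJ (f e) (g e))"
  unfolding pJ_def by (intro tdf_add tdf_mul)

lemma less_add_suc [simp]: "x \<lhd> x \<oplus> suc y"
  unfolding less_iff by blast

text \<open>With s the sum of \<open>x\<close> and \<open>y\<close>, the next square lies 2s + 1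
  above s squared, while \<open>x\<close> adds at most s. So the sum of the components decides the
  comparison.\<close>

lemma pJ_strict:
  assumes "x \<oplus> y \<lhd> x' \<oplus> y'" shows "pJ x y \<lhd> pJ x' y'"
proof -
  obtain d where d: "x' \<oplus> y' = (x \<oplus> y) \<oplus> suc d" using assms less_iff by blast
  have "(s \<oplus> suc d) \<otimes> (s \<oplus> suc d) \<oplus> x'
     = s \<otimes> s \<oplus> suc (s \<oplus> (s \<oplus> (d \<otimes> s \<oplus> (d \<otimes> s \<oplus> (d \<otimes> d \<oplus> (d \<oplus> (d \<oplus> x')))))))" for s
    by (simp add: distrib_left distrib_right) (simp add: ring)
  then have "pJ x' y' = (x \<oplus> y) \<otimes> (x \<oplus> y) \<oplus> suc ((x \<oplus> y) \<oplus> ((x \<oplus> y) \<oplus> (d \<otimes> (x \<oplus> y) \<oplus> (d \<otimes> (x \<oplus> y) \<oplus> (d \<otimes> d \<oplus> (d \<oplus> (d \<oplus> x')))))))"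
    by (simp add: pJ_def d)
  also have "\<dots> = pJ x y \<oplus> suc (y \<oplus> ((x \<oplus> y) \<oplus> (d \<otimes> (x \<oplus> y) \<oplus> (d \<otimes> (x \<oplus> y) \<oplus> (d \<otimes> d \<oplus> (d \<oplus> (d \<oplus> x')))))))"
    unfolding pJ_def by (simp add: add_assoc)
  finally show ?thesis by simp
qed

lemma pJ_inj [simp]: "pJ x y = pJ x' y' \<longleftrightarrow> x = x' \<and> y = y'"
proof
  assume *: "pJ x y = pJ x' y'"
  then have "x \<oplus> y = x' \<oplus> y'"
    using pJ_strict[of x y x' y'] pJ_strict[of x' y' x y] less_linear[of "x \<oplus> y" "x' \<oplus> y'"]
    by auto
  with * show "x = x' \<and> y = y'" by (auto simp: pJ_def)
qed auto

lemma le_mul: "y \<noteq> \<zero> \<Longrightarrow> x \<unlhd> x \<otimes> y"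
proof -
  assume "y \<noteq> \<zero>"
  then obtain z where "y = suc z" using zero_or_suc by blast
  then have "x \<otimes> y = x \<otimes> z \<oplus> x" by (simp add: mul_suc)
  then show ?thesis by simp
qed

lemma le_sq: "x \<unlhd> x \<otimes> x"
  using le_mul[of x x] by (cases "x = \<zero>") auto

lemma le_pJ: "x \<unlhd> pJ x y" "y \<unlhd> pJ x y"
proof -
  show "x \<unlhd> pJ x y" unfolding pJ_def by simp
  show "y \<unlhd> pJ x y" unfolding pJ_def
    by (rule ord.order_trans[OF le_add(2) ord.order_trans[OF le_sq le_add(1)]])
qed

lemma pJ_mono: "y \<lhd> z \<Longrightarrow> pJ x y \<lhd> pJ x z"
  by (intro pJ_strict) simp

definition dv :: "'a \<Rightarrow> 'a \<Rightarrow> bool" where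
  "dv m a \<longleftrightarrow> (\<exists>q. a = q \<otimes> m)"

lemma dv_mult: "dv m a \<Longrightarrow> dv m (a \<otimes> b)" "dv m a \<Longrightarrow> dv m (b \<otimes> a)" "dv m (m \<otimes> b)" "dv m (b \<otimes> m)"
  unfolding dv_def using mul_assoc mul_comm by metis+

lemma dv_diff:
  assumes "dv m u" "dv m (u \<oplus> v)" shows "dv m v"
proof -
  obtain p q where p: "u = p \<otimes> m" and q: "u \<oplus> v = q \<otimes> m" using assms by (auto simp: dv_def)
  consider d where "q = p \<oplus> d" | d where "p = q \<oplus> suc d"
    using less_linear[of p q] le_iff[of p q] less_iff[of q p] by blast
  then show ?thesis
  proof cases
    case 1
    then have "u \<oplus> v = u \<oplus> d \<otimes> m" using p q by (simp add: distrib_right)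
    then show ?thesis by (auto simp: dv_def)
  next
    case 2
    then have "q \<otimes> m \<oplus> \<zero> = q \<otimes> m \<oplus> (suc d \<otimes> m \<oplus> v)"
      using p q by (simp add: distrib_right add_assoc)
    then have "v = \<zero>" unfolding add_cancel by (metis add_eq_0)
    then show ?thesis by (auto simp: dv_def intro: exI[of _ \<zero>])
  qed
qed

text \<open>Goedel's moduli 1 + (x + 1) b, here used for coding by divisibility instead of
  remainders.\<close>

definition md :: "'a \<Rightarrow> 'a \<Rightarrow> 'a" where
  "md b x = suc (suc x \<otimes> b)"

lemma tdf_md: "tdf f \<Longrightarrow> tdf g \<Longrightarrow> tdf (\<lambda>e. md (f e) (g e))"
  unfolding md_def by (intro tdf_add tdf_mul tdf_const)

text \<open>Coprimality of the modulus to \<open>b\<close>, without gcd: c times the modulus is (x +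
  1) c b + c.\<close>

lemma md_coprime: assumes "dv (md b x) (c \<otimes> b)" shows "dv (md b x) c"
proof -
  have "c \<otimes> md b x = suc x \<otimes> (c \<otimes> b) \<oplus> c"
    unfolding md_def by (simp only: mul_suc[of c "suc x \<otimes> b"]) (simp only: mul_left_comm)
  then show ?thesis
    using dv_diff[of "md b x" "suc x \<otimes> (c \<otimes> b)" c] dv_mult(2)[OF assms] dv_mult(4) by metis
qed

lemma md_add: "md b (x \<oplus> d) = md b x \<oplus> d \<otimes> b"
  unfolding md_def by (simp add: distrib_right ring)

text \<open>Two moduli differ by d b with 0 < d and d at most \<open>K\<close>, so d divides
  \<open>b\<close>. A modulus that divides a d b divides a d by \<open>md_coprime\<close>, hence a
  b, hence \<open>a\<close> by \<open>md_coprime\<close> again.\<close>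

lemma md_prime:
  assumes b: "\<And>i. i \<noteq> \<zero> \<Longrightarrow> i \<unlhd> K \<Longrightarrow> dv i b" and "x \<lhd> K" "j \<lhd> K" "x \<noteq> j"
    and "dv (md b x) (a \<otimes> md b j)"
  shows "dv (md b x) a"
proof -
  have main: "dv (md b x) a" if d: "dv (md b x) (a \<otimes> (d \<otimes> b))" "d \<noteq> \<zero>" "d \<unlhd> K" for d
  proof -
    have "dv (md b x) (a \<otimes> d)" using d(1) by (intro md_coprime[of b x "a \<otimes> d"]) (simp add: mul_assoc)
    moreover obtain q where "b = q \<otimes> d" using b[OF d(2,3)] by (auto simp: dv_def)
    ultimately have "dv (md b x) (a \<otimes> b)" using dv_mult(2)[of "md b x" "a \<otimes> d" q] by (simp add: mul_left_comm)
    then show ?thesis by (rule md_coprime)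
  qed
  consider d where "j = x \<oplus> suc d" | d where "x = j \<oplus> suc d"
    using less_linear[of x j] \<open>x \<noteq> j\<close> less_iff by blast
  then show ?thesis
  proof cases
    case 1
    then have "suc d \<unlhd> j" by simp
    then have "suc d \<unlhd> K" using \<open>j \<lhd> K\<close> by (metis less_trans')
    moreover have "a \<otimes> md b j = a \<otimes> md b x \<oplus> a \<otimes> (suc d \<otimes> b)"
      unfolding 1 md_add distrib_left ..
    then have "dv (md b x) (a \<otimes> (suc d \<otimes> b))"
      using assms(5) dv_diff dv_mult(4) by metis
    ultimately show ?thesis using main suc_ne by blast
  next
    case 2
    then have "suc d \<unlhd> x" by simp
    then have "suc d \<unlhd> K" using \<open>x \<lhd> K\<close> by (metis less_trans')
    moreover have "a \<otimes> md b x = a \<otimes> md b j \<oplus> a \<otimes> (suc d \<otimes> b)"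
      unfolding 2 md_add distrib_left ..
    then have "dv (md b x) (a \<otimes> (suc d \<otimes> b))"
      using assms(5) dv_diff dv_mult(4) by metis
    ultimately show ?thesis using main suc_ne by blast
  qed
qed

lemma dfn_dv: "tdf f \<Longrightarrow> tdf g \<Longrightarrow> dfn (\<lambda>e. dv (f e) (g e))"
  by (rule dfn2) (unfold dv_def, intro dfn_intros)

lemma ex_multiple: "\<exists>b. b \<noteq> \<zero> \<and> (\<forall>i. i \<noteq> \<zero> \<and> i \<unlhd> k \<longrightarrow> dv i b)"
proof (rule induct[where x = k])
  show "dfn (\<lambda>e. \<exists>b. b \<noteq> \<zero> \<and> (\<forall>i. i \<noteq> \<zero> \<and> i \<unlhd> e 0 \<longrightarrow> dv i b))"
    by (intro dfn_intros tdf_const dfn_dv)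
  show "\<exists>b. b \<noteq> \<zero> \<and> (\<forall>i. i \<noteq> \<zero> \<and> i \<unlhd> \<zero> \<longrightarrow> dv i b)"
    by (intro exI[of _ \<one>]) (use suc_ne[of \<zero>] in auto)
  fix k assume "\<exists>b. b \<noteq> \<zero> \<and> (\<forall>i. i \<noteq> \<zero> \<and> i \<unlhd> k \<longrightarrow> dv i b)"
  then obtain b where b: "b \<noteq> \<zero>" "\<And>i. i \<noteq> \<zero> \<Longrightarrow> i \<unlhd> k \<Longrightarrow> dv i b" by blast
  show "\<exists>b. b \<noteq> \<zero> \<and> (\<forall>i. i \<noteq> \<zero> \<and> i \<unlhd> suc k \<longrightarrow> dv i b)"
  proof (intro exI[of _ "b \<otimes> suc k"] conjI allI impI)
    show "b \<otimes> suc k \<noteq> \<zero>" using b(1) by (simp add: mul_suc)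
    fix i assume i: "i \<noteq> \<zero> \<and> i \<unlhd> suc k"
    then show "dv i (b \<otimes> suc k)"
      using b(2) dv_mult less_suc by blast
  qed
qed

text \<open>\<open>a\<close> is the product of the moduli \<open>md b x\<close> over the
  \<open>x\<close> in \<open>Y\<close> below \<open>K\<close>. It is built factor by factor in an
  internal induction, where \<open>md_prime\<close> shows that a new factor brings in no other
  modulus.\<close>

lemma code_set0:
  assumes "Y \<in> ms M"
  shows "\<exists>a b. a \<noteq> \<zero> \<and> (\<forall>x. x \<lhd> K \<longrightarrow> (x \<in> Y \<longleftrightarrow> dv (md b x) a))"
proof -
  obtain b where b: "b \<noteq> \<zero>" "\<And>i. i \<noteq> \<zero> \<Longrightarrow> i \<unlhd> K \<Longrightarrow> dv i b" using ex_multiple by blast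
  \<comment> \<open>The induction starts with the empty product 1, which must code the empty
    set.\<close>
  have md_1: "\<not> dv (md b x) \<one>" for x
  proof
    assume "dv (md b x) \<one>"
    then obtain q where q: "\<one> = q \<otimes> md b x" by (auto simp: dv_def)
    have "q \<noteq> \<zero>" using q suc_ne[of \<zero>] by auto
    then have "md b x \<unlhd> \<one>" using le_mul[of q "md b x"] q by (simp add: mul_comm)
    moreover have "suc x \<otimes> b \<noteq> \<zero>" using b(1) by (simp add: suc_mul)
    then have "\<one> \<lhd> md b x" unfolding md_def less_iff
      using zero_or_suc[of "suc x \<otimes> b"] by (metis add_comm)
    ultimately show False by (metis less_trans' less_irrefl')
  qed
  have "j \<unlhd> K \<longrightarrow> (\<exists>a. a \<noteq> \<zero> \<and> (\<forall>x. x \<lhd> K \<longrightarrow> (x \<in> Y \<and> x \<lhd> j \<longleftrightarrow> dv (md b x) a)))" for j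
  proof (rule induct[where x = j])
    show "dfn (\<lambda>e. e 0 \<unlhd> K \<longrightarrow> (\<exists>a. a \<noteq> \<zero> \<and> (\<forall>x. x \<lhd> K \<longrightarrow> (x \<in> Y \<and> x \<lhd> e 0 \<longleftrightarrow> dv (md b x) a))))"
      by (intro dfn_intros tdf_const dfn_dv tdf_md assms)
    show "\<zero> \<unlhd> K \<longrightarrow> (\<exists>a. a \<noteq> \<zero> \<and> (\<forall>x. x \<lhd> K \<longrightarrow> (x \<in> Y \<and> x \<lhd> \<zero> \<longleftrightarrow> dv (md b x) a)))"
      using md_1 suc_ne[of \<zero>] by (intro impI exI[of _ \<one>]) auto
    fix j assume IH: "j \<unlhd> K \<longrightarrow> (\<exists>a. a \<noteq> \<zero> \<and> (\<forall>x. x \<lhd> K \<longrightarrow> (x \<in> Y \<and> x \<lhd> j \<longleftrightarrow> dv (md b x) a)))"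
    show "suc j \<unlhd> K \<longrightarrow> (\<exists>a. a \<noteq> \<zero> \<and> (\<forall>x. x \<lhd> K \<longrightarrow> (x \<in> Y \<and> x \<lhd> suc j \<longleftrightarrow> dv (md b x) a)))"
    proof
      assume "suc j \<unlhd> K"
      then have j: "j \<lhd> K" using suc_le by blast
      then obtain a where a: "a \<noteq> \<zero>" "\<And>x. x \<lhd> K \<Longrightarrow> (x \<in> Y \<and> x \<lhd> j \<longleftrightarrow> dv (md b x) a)"
        using IH by blast
      show "\<exists>a. a \<noteq> \<zero> \<and> (\<forall>x. x \<lhd> K \<longrightarrow> (x \<in> Y \<and> x \<lhd> suc j \<longleftrightarrow> dv (md b x) a))"
      proof (cases "j \<in> Y")
        case True
        have "x \<in> Y \<and> x \<lhd> suc j \<longleftrightarrow> dv (md b x) (a \<otimes> md b j)" if "x \<lhd> K" for x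
          using a(2)[OF that] True md_prime[OF b(2) that j, of a] dv_mult
          by (metis less_suc)
        moreover have "a \<otimes> md b j \<noteq> \<zero>" using a(1) by (simp add: md_def mul_suc)
        ultimately show ?thesis by blast
      next
        case False
        then show ?thesis using a less_suc by (intro exI[of _ a]) blast
      qed
    qed
  qed
  from this[of K] show ?thesis by auto
qed

text \<open>\<open>Rn u c x\<close>: the number \<open>u\<close> codes a finite relation containing \<open>(c, x)\<close>.\<close>

definition Rn :: "'a \<Rightarrow> 'a \<Rightarrow> 'a \<Rightarrow> bool" where
  "Rn u c x \<longleftrightarrow> (\<exists>K a b. u = pJ K (pJ a b) \<and> pJ c x \<lhd> K \<and> a \<noteq> \<zero> \<and> dv (md b (pJ c x)) a)"

lemma dfn_Rn: "tdf f \<Longrightarrow> tdf g \<Longrightarrow> tdf h \<Longrightarrow> dfn (\<lambda>e. Rn (f e) (g e) (h e))"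
  by (rule dfn3) (unfold Rn_def, intro dfn_intros dfn_dv tdf_md tdf_pJ tdf_const)

lemma Rn_less: assumes "Rn u c x" shows "c \<lhd> u" "x \<lhd> u"
  using assms le_pJ ord.le_less_trans ord.less_le_trans unfolding Rn_def by meson+

lemma Rn_code:
  assumes "H \<in> ms M" shows "\<exists>u. \<forall>c x. Rn u c x \<longleftrightarrow> pJ c x \<lhd> K \<and> pJ c x \<in> H"
proof -
  obtain a b where ab: "a \<noteq> \<zero>" "\<And>x. x \<lhd> K \<Longrightarrow> (x \<in> H \<longleftrightarrow> dv (md b x) a)"
    using code_set0[OF assms] by blast
  then show ?thesis unfolding Rn_def by (intro exI[of _ "pJ K (pJ a b)"]) auto
qed

definition funn :: "'a set \<Rightarrow> 'a \<Rightarrow> bool" where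
  "funn H k \<longleftrightarrow> (\<forall>c. c \<lhd> k \<longrightarrow> (\<exists>x. pJ c x \<in> H)) \<and>
     (\<forall>c x y. c \<lhd> k \<longrightarrow> pJ c x \<in> H \<longrightarrow> pJ c y \<in> H \<longrightarrow> x = y)"

text \<open>A collection argument: internal induction bounds the pairs with first component below
  \<open>k\<close>, and a bounded part of a set has a code.\<close>

lemma Rn_fun:
  assumes H: "H \<in> ms M" and f: "funn H k"
  shows "\<exists>u. \<forall>c x. Rn u c x \<longleftrightarrow> c \<lhd> k \<and> pJ c x \<in> H"
proof -
  have "j \<unlhd> k \<longrightarrow> (\<exists>K. \<forall>c x. c \<lhd> j \<longrightarrow> pJ c x \<in> H \<longrightarrow> pJ c x \<lhd> K)" for j
  proof (rule induct[where x = j])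
    show "dfn (\<lambda>e. e 0 \<unlhd> k \<longrightarrow> (\<exists>K. \<forall>c x. c \<lhd> e 0 \<longrightarrow> pJ c x \<in> H \<longrightarrow> pJ c x \<lhd> K))"
      by (intro dfn_intros tdf_const tdf_pJ H)
    fix j assume IH: "j \<unlhd> k \<longrightarrow> (\<exists>K. \<forall>c x. c \<lhd> j \<longrightarrow> pJ c x \<in> H \<longrightarrow> pJ c x \<lhd> K)"
    show "suc j \<unlhd> k \<longrightarrow> (\<exists>K. \<forall>c x. c \<lhd> suc j \<longrightarrow> pJ c x \<in> H \<longrightarrow> pJ c x \<lhd> K)"
    proof
      assume "suc j \<unlhd> k"
      then have j: "j \<lhd> k" using suc_le by blast
      then obtain K where K: "\<And>c x. c \<lhd> j \<Longrightarrow> pJ c x \<in> H \<Longrightarrow> pJ c x \<lhd> K" using IH by blast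
      obtain x where x: "pJ j x \<in> H" "\<And>y. pJ j y \<in> H \<Longrightarrow> y = x" using f j unfolding funn_def by blast
      have "pJ c y \<lhd> K \<oplus> suc (pJ j x)" if "c \<lhd> suc j" "pJ c y \<in> H" for c y
      proof (cases "c = j")
        case True
        then have "pJ c y \<lhd> suc (pJ j x)" using x(2) that by (simp add: less_suc)
        moreover have "suc (pJ j x) \<unlhd> K \<oplus> suc (pJ j x)" by simp
        ultimately show ?thesis by (metis less_trans')
      next
        case False
        then have "pJ c y \<lhd> K" using K that less_suc by blast
        also have "K \<lhd> K \<oplus> suc (pJ j x)" by simp
        finally show ?thesis .
      qed
      then show "\<exists>K. \<forall>c x. c \<lhd> suc j \<longrightarrow> pJ c x \<in> H \<longrightarrow> pJ c x \<lhd> K" by blast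
    qed
  qed simp
  then obtain K where K: "\<And>c x. c \<lhd> k \<Longrightarrow> pJ c x \<in> H \<Longrightarrow> pJ c x \<lhd> K" by blast
  have "{y. y \<in> H \<and> (\<exists>c x. y = pJ c x \<and> c \<lhd> k)} \<in> ms M"
    by (intro compI dfn_intros tdf_const tdf_pJ H)
  from Rn_code[OF this, of K] obtain u where
    "\<forall>c x. Rn u c x \<longleftrightarrow> pJ c x \<lhd> K \<and> pJ c x \<in> H \<and> c \<lhd> k" by auto
  then show ?thesis using K by (intro exI[of _ u]) blast
qed

end

lemma mods_stdm: "aca stdm"
proof
  show "mods stdm ACA0"
    unfolding mods_def
  proof (intro conjI ballI allI impI)
    fix p e E assume "p \<in> ACA0"
    then consider "p \<in> basic_axioms" | "p = induction_axiom" | "p \<in> arith_comprehension"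
      by (auto simp: ACA0_def)
    then show "msat stdm e E p"
    proof cases
      case 1
      then show ?thesis by (auto simp: basic_axioms_def less_Suc_eq)
    next
      case 2
      have "P n" if "P 0" "\<forall>n. P n \<longrightarrow> P (Suc n)" for P and n :: nat
        using that by (induction n) auto
      then show ?thesis using 2 by (auto simp: induction_axiom_def)
    next
      case 3
      then obtain m n q where p: "p = (AllS ^^ m) ((AllN ^^ n) (ExS (AllN (Iff (Mem (Var 0) 0) (fm_liftS 0 q)))))"
        by (auto simp: arith_comprehension_def)
      have N: "sat e E ((AllN ^^ n) r)" if "\<And>e. sat e E r" for e E n r
        using that by (induction n arbitrary: e) auto
      have S: "sat e E ((AllS ^^ n) r)" if "\<And>E. sat e E r" for e E n r
        using that by (induction n arbitrary: E) auto
      have "sat e E (ExS (AllN (Iff (Mem (Var 0) 0) (fm_liftS 0 q))))" for e E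
        using msat_liftS_0[of stdm, unfolded msat_stdm] by (auto intro!: exI[of _ "{x. sat (case_nat x e) E q}"])
      then show ?thesis unfolding p msat_stdm by (intro S N)
    qed
  qed simp
qed

section \<open>Trees of partial functions and their Kleene--Brouwer orders\<close>

lemma tm_bd_lift [simp]: "tm_bd (Suc n) (tm_lift 0 t) = tm_bd n t"
  by (induction t) auto

abbreviation BAll :: "tm \<Rightarrow> fm \<Rightarrow> fm" where
  "BAll t p \<equiv> AllN (Imp (Less (Var 0) (tm_lift 0 t)) p)"

abbreviation BEx :: "tm \<Rightarrow> fm \<Rightarrow> fm" where
  "BEx t p \<equiv> Neg (BAll t (Neg p))"

abbreviation tsuc :: "tm \<Rightarrow> tm" where "tsuc t \<equiv> Plus t One"

text \<open>Opaque copies of the defined connectives, so that the simplifier evaluates them as such.\<close>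

definition fAnd where "fAnd p q = And p q"
definition fOr where "fOr p q = Or p q"
definition fIff where "fIff p q = Iff p q"
definition fEx where "fEx p = ExN p"
definition fBEx where "fBEx t p = BEx t p"

lemmas f_defs = fAnd_def fOr_def fIff_def fEx_def fBEx_def

lemma msat_f [simp]:
  "msat M e E (fAnd p q) \<longleftrightarrow> msat M e E p \<and> msat M e E q"
  "msat M e E (fOr p q) \<longleftrightarrow> msat M e E p \<or> msat M e E q"
  "msat M e E (fIff p q) \<longleftrightarrow> (msat M e E p \<longleftrightarrow> msat M e E q)"
  "msat M e E (fEx p) \<longleftrightarrow> (\<exists>x. msat M (case_nat x e) E p)"
  "msat M e E (fBEx t p) \<longleftrightarrow> (\<exists>x. ml M x (mval M e t) \<and> msat M (case_nat x e) E p)"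
  by (auto simp: f_defs)

lemma fm_bd_f [simp]:
  "fm_bd n s (fAnd p q) \<longleftrightarrow> fm_bd n s p \<and> fm_bd n s q"
  "fm_bd n s (fOr p q) \<longleftrightarrow> fm_bd n s p \<and> fm_bd n s q"
  "fm_bd n s (fIff p q) \<longleftrightarrow> fm_bd n s p \<and> fm_bd n s q"
  "fm_bd n s (fEx p) \<longleftrightarrow> fm_bd (Suc n) s p"
  "fm_bd n s (fBEx t p) \<longleftrightarrow> tm_bd n t \<and> fm_bd (Suc n) s p"
  by (auto simp: f_defs)

lemma arithmetical_f [simp]:
  "arithmetical (fAnd p q) \<longleftrightarrow> arithmetical p \<and> arithmetical q"
  "arithmetical (fOr p q) \<longleftrightarrow> arithmetical p \<and> arithmetical q"
  "arithmetical (fIff p q) \<longleftrightarrow> arithmetical p \<and> arithmetical q"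
  "arithmetical (fEx p) \<longleftrightarrow> arithmetical p"
  "arithmetical (fBEx t p) \<longleftrightarrow> arithmetical p"
  by (auto simp: f_defs)

lemma Delta00_f [intro!, simp]:
  "Delta00 p \<Longrightarrow> Delta00 q \<Longrightarrow> Delta00 (fAnd p q)"
  "Delta00 p \<Longrightarrow> Delta00 q \<Longrightarrow> Delta00 (fOr p q)"
  "Delta00 p \<Longrightarrow> Delta00 q \<Longrightarrow> Delta00 (fIff p q)"
  "Delta00 p \<Longrightarrow> Delta00 (fBEx t p)"
  unfolding f_defs by (intro Delta00.intros; assumption)+

definition Jt :: "tm \<Rightarrow> tm \<Rightarrow> tm" where
  "Jt x y = Plus (Times (Plus x y) (Plus x y)) x"

definition mdt :: "tm \<Rightarrow> tm \<Rightarrow> tm" where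
  "mdt b x = tsuc (Times (tsuc x) b)"

definition dv_fm :: "tm \<Rightarrow> tm \<Rightarrow> fm" where
  "dv_fm m a = fBEx (tsuc a) (Equal (lifts 1 a) (Times (Var 0) (lifts 1 m)))"

definition Rn_fm :: "tm \<Rightarrow> tm \<Rightarrow> tm \<Rightarrow> fm" where
  "Rn_fm u c x = fBEx (tsuc u) (fBEx (tsuc (lifts 1 u)) (fBEx (tsuc (lifts 2 u))
     (fAnd (Equal (lifts 3 u) (Jt (Var 2) (Jt (Var 1) (Var 0))))
     (fAnd (Less (Jt (lifts 3 c) (lifts 3 x)) (Var 2))
     (fAnd (Neg (Equal (Var 1) Zero)) (dv_fm (mdt (Var 0) (Jt (lifts 3 c) (lifts 3 x))) (Var 1)))))))"

lemma tm_bd_Jt [simp]: "tm_bd n (Jt x y) \<longleftrightarrow> tm_bd n x \<and> tm_bd n y"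
  by (auto simp: Jt_def)

lemma Delta00_BAll [simp]: "Delta00 p \<Longrightarrow> Delta00 (BAll t p)"
  by (rule Delta00.intros)

lemma Delta00_simps [intro!, simp]: "Delta00 (Equal t u)" "Delta00 (Less t u)" "Delta00 Falsum"
  "Delta00 (Mem t i)" "Delta00 p \<Longrightarrow> Delta00 q \<Longrightarrow> Delta00 (Imp p q)"
  by (auto intro: Delta00.intros)

lemma Rn_fm_Delta00 [intro!, simp]: "Delta00 (Rn_fm u c x)"
  unfolding Rn_fm_def dv_fm_def by (intro Delta00_BAll Delta00_simps Delta00_f)

lemmas lifts_simps = numeral_2_eq_2 numeral_3_eq_3 eval_nat_numeral

lemma Rn_fm_bd [simp]: "fm_bd n s (Rn_fm u c x) \<longleftrightarrow> tm_bd n u \<and> tm_bd n c \<and> tm_bd n x"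
  by (auto simp: Rn_fm_def dv_fm_def mdt_def lifts_simps)

lemma Delta00_arithmetical: "Delta00 p \<Longrightarrow> arithmetical p"
  by (induction rule: Delta00.induct) auto

text \<open>A constraint \<open>(m, L, Q)\<close> on a relation \<open>R\<close>, quantified over \<open>m\<close> variables: if \<open>R\<close> holds
  for all pairs in \<open>L\<close> then \<open>Q\<close>.\<close>

type_synonym con = "nat \<times> (tm \<times> tm) list \<times> fm"

definition wf_con :: "con \<Rightarrow> bool" where
  "wf_con = (\<lambda>(m, L, Q). Delta00 Q \<and> fm_bd m 0 Q \<and> (\<forall>(c, v)\<in>set L. tm_bd m c \<and> tm_bd m v))"

primrec ball :: "nat \<Rightarrow> tm \<Rightarrow> fm \<Rightarrow> fm" where
  "ball 0 k q = q"
| "ball (Suc m) k q = BAll k (ball m (tm_lift 0 k) q)"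

definition con_fm :: "tm \<Rightarrow> tm \<Rightarrow> con \<Rightarrow> fm" where
  "con_fm u k = (\<lambda>(m, L, Q). ball m k (foldr (\<lambda>(c, v) r. Imp (Rn_fm (lifts m u) c v) r) L Q))"

text \<open>All quantifiers are bounded in terms of \<open>u\<close>, since a code exceeds the
  arguments and values of the relation that it codes (\<open>Rn_less\<close>). The unbounded reading
  is \<open>node\<close>.\<close>

definition node_fm :: "con list \<Rightarrow> tm \<Rightarrow> tm \<Rightarrow> fm" where
  "node_fm Ks r u = fBEx (tsuc u)
     (fAnd (BAll (tsuc (lifts 1 u)) (fIff (fBEx (lifts 2 u) (Rn_fm (lifts 3 u) (Var 1) (Var 0)))
             (Less (Var 0) (Var 1))))
     (fAnd (BAll (lifts 1 u) (BAll (lifts 2 u) (BAll (lifts 3 u)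
             (Imp (Rn_fm (lifts 4 u) (Var 2) (Var 1)) (Imp (Rn_fm (lifts 4 u) (Var 2) (Var 0))
               (Equal (Var 1) (Var 0)))))))
     (fAnd (BAll (lifts 1 u) (Imp (Rn_fm (lifts 2 u) (lifts 2 r) (Var 0)) (Equal (Var 0) Zero)))
     (fAnd (BAll (lifts 1 u) (Neg (BAll (lifts 2 u) (BAll (lifts 3 u)
             (fIff (Rn_fm (Var 2) (Var 1) (Var 0)) (Rn_fm (lifts 4 u) (Var 1) (Var 0)))))))
       (foldr (\<lambda>K q. fAnd (con_fm (lifts 1 u) (Var 0) K) q) Ks (Equal Zero Zero))))))"

definition kb_fm :: "tm \<Rightarrow> tm \<Rightarrow> fm" where
  "kb_fm u v = fBEx u (fAnd
     (BAll (Var 0) (BAll (Plus (lifts 2 u) (lifts 2 v))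
        (fIff (Rn_fm (lifts 3 u) (Var 1) (Var 0)) (Rn_fm (lifts 3 v) (Var 1) (Var 0)))))
     (fBEx (lifts 1 u) (fAnd (Rn_fm (lifts 2 u) (Var 1) (Var 0))
        (BAll (lifts 2 v) (Imp (Rn_fm (lifts 3 v) (Var 2) (Var 0)) (Less (Var 1) (Var 0)))))))"

definition KB_fm :: "con list \<Rightarrow> tm \<Rightarrow> tm \<Rightarrow> tm \<Rightarrow> fm" where
  "KB_fm Ks r u v = fAnd (node_fm Ks r u) (fAnd (node_fm Ks r v) (fOr (kb_fm u v) (Equal u v)))"

lemma Delta00_ball [intro!, simp]: "Delta00 q \<Longrightarrow> Delta00 (ball m k q)"
  by (induction m arbitrary: k) (simp_all del: tm_lift.simps)

lemma Delta00_con_fm: "wf_con K \<Longrightarrow> Delta00 (con_fm u k K)"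
proof -
  assume "wf_con K"
  moreover obtain m L Q where K: "K = (m, L, Q)" by (cases K)
  ultimately have "Delta00 Q" by (simp add: wf_con_def)
  then have "Delta00 (foldr (\<lambda>(c, v) r. Imp (Rn_fm t c v) r) L Q)" for t
    by (induction L) auto
  then show ?thesis by (simp add: con_fm_def K)
qed

lemma fm_bd_ball: "tm_bd n k \<Longrightarrow> fm_bd n s (ball m k q) \<longleftrightarrow> fm_bd (n + m) s q"
  by (induction m arbitrary: k n) auto

lemma tm_bd_lifts [simp]: "tm_bd (n + m) (lifts m t) \<longleftrightarrow> tm_bd n t"
  by (induction m) auto

lemma fm_bd_con_fm: "wf_con K \<Longrightarrow> tm_bd n u \<Longrightarrow> tm_bd n k \<Longrightarrow> fm_bd n s (con_fm u k K)"
proof -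
  assume "wf_con K" and u: "tm_bd n u" "tm_bd n k"
  moreover obtain m L Q where K: "K = (m, L, Q)" by (cases K)
  ultimately have *: "fm_bd m 0 Q" "\<forall>(c, v)\<in>set L. tm_bd m c \<and> tm_bd m v" by (auto simp: wf_con_def)
  have "fm_bd (n + m) s Q" using *(1) by (rule fm_bd_mono) auto
  moreover have "tm_bd m t \<Longrightarrow> tm_bd (n + m) t" for t by (erule tm_bd_mono) simp
  ultimately have "fm_bd (n + m) s (foldr (\<lambda>(c, v) r. Imp (Rn_fm (lifts m u) c v) r) L Q)"
    using *(2) u by (induction L) auto
  then show ?thesis using u by (simp add: con_fm_def K fm_bd_ball)
qed

lemma Delta00_node_fm: "\<forall>K\<in>set Ks. wf_con K \<Longrightarrow> Delta00 (node_fm Ks r u)"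
proof -
  assume "\<forall>K\<in>set Ks. wf_con K"
  then have "Delta00 (foldr (\<lambda>K q. fAnd (con_fm t k K) q) Ks (Equal Zero Zero))" for t k
    by (induction Ks) (auto intro: Delta00_con_fm)
  then show ?thesis unfolding node_fm_def by (intro Delta00_BAll Delta00_simps Delta00_f Rn_fm_Delta00)
qed

lemma fm_bd_node_fm: "\<forall>K\<in>set Ks. wf_con K \<Longrightarrow> tm_bd n u \<Longrightarrow> tm_bd n r \<Longrightarrow> fm_bd n s (node_fm Ks r u)"
proof -
  assume "\<forall>K\<in>set Ks. wf_con K" and u: "tm_bd n u" "tm_bd n r"
  then have "fm_bd (Suc n) s (foldr (\<lambda>K q. fAnd (con_fm (tm_lift 0 u) (Var 0) K) q) Ks (Equal Zero Zero))"
    by (induction Ks) (auto intro: fm_bd_con_fm)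
  then show ?thesis using u unfolding node_fm_def by (simp add: lifts_simps)
qed

lemma Delta00_KB_fm: "\<forall>K\<in>set Ks. wf_con K \<Longrightarrow> Delta00 (KB_fm Ks r u v)"
  unfolding KB_fm_def kb_fm_def
  by (intro Delta00_BAll Delta00_simps Delta00_f Rn_fm_Delta00 Delta00_node_fm) auto

lemma fm_bd_KB_fm:
  "\<forall>K\<in>set Ks. wf_con K \<Longrightarrow> tm_bd n u \<Longrightarrow> tm_bd n v \<Longrightarrow> tm_bd n r \<Longrightarrow> fm_bd n s (KB_fm Ks r u v)"
  unfolding KB_fm_def kb_fm_def by (simp add: lifts_simps fm_bd_node_fm)

section \<open>Meaning of the tree formulas inside a model\<close>

context aca
begin

lemma mval_Jt [simp]: "mval M e (Jt x y) = pJ (mval M e x) (mval M e y)"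
  by (simp add: Jt_def pJ_def)

lemma mval_mdt [simp]: "mval M e (mdt b x) = md (mval M e b) (mval M e x)"
  by (simp add: mdt_def md_def)

text \<open>The bound on the quotient is harmless because a quotient by a nonzero number is at most
  the dividend.\<close>

lemma msat_dv_fm [simp]:
  assumes "mval M e m \<noteq> \<zero>"
  shows "msat M e E (dv_fm m a) \<longleftrightarrow> dv (mval M e m) (mval M e a)"
proof -
  have "q \<lhd> suc (q \<otimes> mval M e m)" for q
    using le_mul[OF assms] by (auto simp: less_suc)
  then show ?thesis unfolding dv_fm_def dv_def by auto metis
qed

lemma md_ne [simp]: "md b x \<noteq> \<zero>"
  unfolding md_def by (rule suc_ne)

lemma msat_Rn_fm [simp]:
  "msat M e E (Rn_fm u c x) \<longleftrightarrow> Rn (mval M e u) (mval M e c) (mval M e x)"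
proof -
  have 1: "x \<lhd> suc (pJ x y)" "x' \<lhd> suc (pJ y (pJ x' y'))" "x' \<lhd> suc (pJ y (pJ y' x'))" for x y x' y'
  proof -
    show "x \<lhd> suc (pJ x y)" using le_pJ(1)[of x y] by (auto simp: less_suc)
    show "x' \<lhd> suc (pJ y (pJ x' y'))"
      using leq_trans[OF le_pJ(1)[of x' y'] le_pJ(2)[of "pJ x' y'" y]] by (simp only: less_suc)
    show "x' \<lhd> suc (pJ y (pJ y' x'))"
      using leq_trans[OF le_pJ(2)[of x' y'] le_pJ(2)[of "pJ y' x'" y]] by (simp only: less_suc)
  qed
  show ?thesis unfolding Rn_fm_def Rn_def
    by (simp add: lifts_simps) (metis 1)
qed

lemma mval_lifts: "(\<And>i. e' (i + m) = e i) \<Longrightarrow> mval M e' (lifts m t) = mval M e t"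
proof (induction m arbitrary: e')
  case 0
  then show ?case by simp
next
  case (Suc m)
  have "e' = case_nat (e' 0) (\<lambda>i. e' (Suc i))" by (auto simp: fun_eq_iff split: nat.split)
  then have "mval M e' (lifts (Suc m) t) = mval M (\<lambda>i. e' (Suc i)) (lifts m t)"
    by (metis mval_lift funpow.simps(2) o_apply)
  also have "\<dots> = mval M e t" by (rule Suc.IH) (use Suc.prems in simp)
  finally show ?case .
qed

lemma msat_ball: "msat M e E (ball m k q) \<longleftrightarrow>
   (\<forall>e'. (\<forall>i<m. e' i \<lhd> mval M e k) \<and> (\<forall>i. e' (i + m) = e i) \<longrightarrow> msat M e' E q)"
proof (induction m arbitrary: e k)
  case 0
  have "(\<forall>i. e' i = e i) \<longleftrightarrow> e' = e" for e' by (auto simp: fun_eq_iff)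
  then show ?case by simp
next
  case (Suc m)
  have *: "(\<forall>i. e' (i + m) = case_nat x e i) \<longleftrightarrow> e' m = x \<and> (\<forall>i. e' (i + Suc m) = e i)" for e' x
    by (auto split: nat.split)
  show ?case unfolding ball.simps msat.simps Suc.IH mval_lift *
    by (auto simp: less_Suc_eq)
qed

definition csat :: "('a \<Rightarrow> 'a \<Rightarrow> bool) \<Rightarrow> 'a \<Rightarrow> con \<Rightarrow> bool" where
  "csat R k = (\<lambda>(m, L, Q). \<forall>e. (\<forall>i<m. e i \<lhd> k) \<longrightarrow>
     (\<forall>(c, v)\<in>set L. R (mval M e c) (mval M e v)) \<longrightarrow> msat M e (\<lambda>_. {}) Q)"

lemma msat_con_fm:
  assumes "wf_con K"
  shows "msat M e E (con_fm u k K) \<longleftrightarrow> csat (Rn (mval M e u)) (mval M e k) K"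
proof -
  obtain m L Q where K: "K = (m, L, Q)" by (cases K)
  have bd: "fm_bd m 0 Q" "\<And>c v. (c, v) \<in> set L \<Longrightarrow> tm_bd m c \<and> tm_bd m v"
    using assms by (auto simp: wf_con_def K)
  have "msat M e' E (foldr (\<lambda>(c, v) r. Imp (Rn_fm t c v) r) L Q) \<longleftrightarrow>
     ((\<forall>(c, v)\<in>set L. Rn (mval M e' t) (mval M e' c) (mval M e' v)) \<longrightarrow> msat M e' E Q)" for e' t
    by (induction L) auto
  then have *: "msat M e E (con_fm u k K) \<longleftrightarrow> (\<forall>e'. (\<forall>i<m. e' i \<lhd> mval M e k) \<and> (\<forall>i. e' (i + m) = e i) \<longrightarrow>
     ((\<forall>(c, v)\<in>set L. Rn (mval M e u) (mval M e' c) (mval M e' v)) \<longrightarrow> msat M e' E Q))"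
    unfolding con_fm_def K by (auto simp: msat_ball mval_lifts)
  have E: "msat M e' E Q = msat M e' (\<lambda>_. {}) Q" for e' by (rule msat_cong[OF bd(1)]) auto
  show ?thesis unfolding * E
  proof
    assume H: "csat (Rn (mval M e u)) (mval M e k) K"
    show "\<forall>e'. (\<forall>i<m. e' i \<lhd> mval M e k) \<and> (\<forall>i. e' (i + m) = e i) \<longrightarrow>
     ((\<forall>(c, v)\<in>set L. Rn (mval M e u) (mval M e' c) (mval M e' v)) \<longrightarrow> msat M e' (\<lambda>_. {}) Q)"
      using H by (auto simp: csat_def K)
  next
    assume H: "\<forall>e'. (\<forall>i<m. e' i \<lhd> mval M e k) \<and> (\<forall>i. e' (i + m) = e i) \<longrightarrow>
     ((\<forall>(c, v)\<in>set L. Rn (mval M e u) (mval M e' c) (mval M e' v)) \<longrightarrow> msat M e' (\<lambda>_. {}) Q)"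
    show "csat (Rn (mval M e u)) (mval M e k) K"
      unfolding csat_def K prod.case
    proof (intro allI impI)
      fix d assume d: "\<forall>i<m. d i \<lhd> mval M e k" "\<forall>(c, v)\<in>set L. Rn (mval M e u) (mval M d c) (mval M d v)"
      define e' where "e' = (\<lambda>i. if i < m then d i else e (i - m))"
      have eq: "tm_bd m t \<Longrightarrow> mval M e' t = mval M d t" for t
        by (rule mval_cong) (auto simp: e'_def)
      have "\<forall>(c, v)\<in>set L. Rn (mval M e u) (mval M e' c) (mval M e' v)"
        using d(2) bd(2) eq by fastforce
      moreover have "(\<forall>i<m. e' i \<lhd> mval M e k) \<and> (\<forall>i. e' (i + m) = e i)"
        using d(1) by (auto simp: e'_def)
      ultimately have "msat M e' (\<lambda>_. {}) Q" using H by blast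
      moreover have "msat M e' (\<lambda>_. {}) Q = msat M d (\<lambda>_. {}) Q"
        by (rule msat_cong[OF bd(1)]) (auto simp: e'_def)
      ultimately show "msat M d (\<lambda>_. {}) Q" by simp
    qed
  qed
qed

text \<open>The last conjunct admits only the least code of each finite function; otherwise two
  codes of one function would be incomparable under \<open>kb\<close>. Constraints are tested only
  for variables below the length \<open>k\<close>, which keeps the test bounded and becomes the full
  constraint along a path.\<close>

definition node :: "con list \<Rightarrow> 'a \<Rightarrow> 'a \<Rightarrow> bool" where
  "node Ks r u \<longleftrightarrow> (\<exists>k. (\<forall>c. (\<exists>x. Rn u c x) \<longleftrightarrow> c \<lhd> k) \<and> (\<forall>K\<in>set Ks. csat (Rn u) k K)) \<and>
     (\<forall>c x y. Rn u c x \<longrightarrow> Rn u c y \<longrightarrow> x = y) \<and> (\<forall>x. Rn u r x \<longrightarrow> x = \<zero>) \<and>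
     (\<forall>w. w \<lhd> u \<longrightarrow> \<not> (\<forall>c x. Rn w c x \<longleftrightarrow> Rn u c x))"

text \<open>Kleene--Brouwer order: at the first difference \<open>c\<close> the sequence
  \<open>v\<close> may be undefined, in which case the inner condition is vacuous. So proper
  extensions come earlier.\<close>

definition kb :: "'a \<Rightarrow> 'a \<Rightarrow> bool" where
  "kb u v \<longleftrightarrow> (\<exists>c. (\<forall>d x. d \<lhd> c \<longrightarrow> (Rn u d x \<longleftrightarrow> Rn v d x)) \<and>
     (\<exists>x. Rn u c x \<and> (\<forall>y. Rn v c y \<longrightarrow> x \<lhd> y)))"

lemma msat_node_fm [simp]:
  assumes "\<forall>K\<in>set Ks. wf_con K"
  shows "msat M e E (node_fm Ks r u) \<longleftrightarrow> node Ks (mval M e r) (mval M e u)"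
proof -
  let ?u = "mval M e u" and ?r = "mval M e r"
  have cons: "msat M e' E (foldr (\<lambda>K q. fAnd (con_fm t k K) q) Ks (Equal Zero Zero)) \<longleftrightarrow>
     (\<forall>K\<in>set Ks. csat (Rn (mval M e' t)) (mval M e' k) K)" for e' t k
    using assms by (induction Ks) (auto simp: msat_con_fm)
  have b: "Rn ?u c x \<Longrightarrow> c \<lhd> ?u \<and> x \<lhd> ?u" for c x using Rn_less by blast
  have b': "w \<lhd> ?u \<Longrightarrow> Rn w c x \<Longrightarrow> c \<lhd> ?u \<and> x \<lhd> ?u" for w c x using Rn_less less_trans' by blast
  have dom: "(\<forall>c. c \<lhd> suc ?u \<longrightarrow> ((\<exists>x. x \<lhd> ?u \<and> Rn ?u c x) \<longleftrightarrow> c \<lhd> k)) \<and> k \<lhd> suc ?u \<longleftrightarrow>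
      (\<forall>c. (\<exists>x. Rn ?u c x) \<longleftrightarrow> c \<lhd> k)" for k
  proof
    assume *: "\<forall>c. (\<exists>x. Rn ?u c x) \<longleftrightarrow> c \<lhd> k"
    have "\<not> ?u \<lhd> k" using * b less_irrefl' by blast
    then have "k \<lhd> suc ?u" using less_linear less_suc by blast
    then show "(\<forall>c. c \<lhd> suc ?u \<longrightarrow> ((\<exists>x. x \<lhd> ?u \<and> Rn ?u c x) \<longleftrightarrow> c \<lhd> k)) \<and> k \<lhd> suc ?u"
      using * b by blast
  next
    assume *: "(\<forall>c. c \<lhd> suc ?u \<longrightarrow> ((\<exists>x. x \<lhd> ?u \<and> Rn ?u c x) \<longleftrightarrow> c \<lhd> k)) \<and> k \<lhd> suc ?u"
    then have "c \<lhd> k \<Longrightarrow> c \<lhd> suc ?u" for c using less_trans' by blast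
    then show "\<forall>c. (\<exists>x. Rn ?u c x) \<longleftrightarrow> c \<lhd> k" using * b less_suc by blast
  qed
  have "msat M e E (node_fm Ks r u) \<longleftrightarrow> (\<exists>k. k \<lhd> suc ?u \<and>
     (\<forall>c. c \<lhd> suc ?u \<longrightarrow> ((\<exists>x. x \<lhd> ?u \<and> Rn ?u c x) \<longleftrightarrow> c \<lhd> k)) \<and>
     (\<forall>c. c \<lhd> ?u \<longrightarrow> (\<forall>x. x \<lhd> ?u \<longrightarrow> (\<forall>y. y \<lhd> ?u \<longrightarrow> Rn ?u c x \<longrightarrow> Rn ?u c y \<longrightarrow> x = y))) \<and>
     (\<forall>x. x \<lhd> ?u \<longrightarrow> Rn ?u ?r x \<longrightarrow> x = \<zero>) \<and>
     (\<forall>w. w \<lhd> ?u \<longrightarrow> \<not> (\<forall>c. c \<lhd> ?u \<longrightarrow> (\<forall>x. x \<lhd> ?u \<longrightarrow> (Rn w c x \<longleftrightarrow> Rn ?u c x)))) \<and>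
     (\<forall>K\<in>set Ks. csat (Rn ?u) k K))"
    unfolding node_fm_def by (simp add: cons lifts_simps)
  also have "\<dots> \<longleftrightarrow> node Ks ?r ?u"
  proof -
    have 1: "(\<forall>c. c \<lhd> ?u \<longrightarrow> (\<forall>x. x \<lhd> ?u \<longrightarrow> (\<forall>y. y \<lhd> ?u \<longrightarrow> Rn ?u c x \<longrightarrow> Rn ?u c y \<longrightarrow> x = y)))
       \<longleftrightarrow> (\<forall>c x y. Rn ?u c x \<longrightarrow> Rn ?u c y \<longrightarrow> x = y)" using b by blast
    have 2: "(\<forall>x. x \<lhd> ?u \<longrightarrow> Rn ?u ?r x \<longrightarrow> x = \<zero>) \<longleftrightarrow> (\<forall>x. Rn ?u ?r x \<longrightarrow> x = \<zero>)" using b by blast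
    have 3: "(\<forall>w. w \<lhd> ?u \<longrightarrow> \<not> (\<forall>c. c \<lhd> ?u \<longrightarrow> (\<forall>x. x \<lhd> ?u \<longrightarrow> (Rn w c x \<longleftrightarrow> Rn ?u c x)))) \<longleftrightarrow>
       (\<forall>w. w \<lhd> ?u \<longrightarrow> \<not> (\<forall>c x. Rn w c x \<longleftrightarrow> Rn ?u c x))" using b b' by blast
    show ?thesis unfolding node_def dom[symmetric] 1 2 3 by blast
  qed
  finally show ?thesis .
qed

lemma msat_kb_fm [simp]: "msat M e E (kb_fm u v) \<longleftrightarrow> kb (mval M e u) (mval M e v)"
proof -
  let ?u = "mval M e u" and ?v = "mval M e v"
  have b: "Rn w c x \<Longrightarrow> c \<lhd> w \<and> x \<lhd> w" for w c x using Rn_less by blast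
  have "Rn ?u c x \<Longrightarrow> x \<lhd> ?u \<oplus> ?v" "Rn ?v c x \<Longrightarrow> x \<lhd> ?u \<oplus> ?v" for c x
    using b le_add less_leq_trans by meson+
  then have "(\<forall>d. d \<lhd> c \<longrightarrow> (\<forall>x. x \<lhd> ?u \<oplus> ?v \<longrightarrow> (Rn ?u d x \<longleftrightarrow> Rn ?v d x))) \<longleftrightarrow>
      (\<forall>d x. d \<lhd> c \<longrightarrow> (Rn ?u d x \<longleftrightarrow> Rn ?v d x))" for c by blast
  moreover have "msat M e E (kb_fm u v) \<longleftrightarrow> (\<exists>c. c \<lhd> ?u \<and>
     (\<forall>d. d \<lhd> c \<longrightarrow> (\<forall>x. x \<lhd> ?u \<oplus> ?v \<longrightarrow> (Rn ?u d x \<longleftrightarrow> Rn ?v d x))) \<and>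
     (\<exists>x. x \<lhd> ?u \<and> Rn ?u c x \<and> (\<forall>y. y \<lhd> ?v \<longrightarrow> Rn ?v c y \<longrightarrow> x \<lhd> y)))"
    unfolding kb_fm_def by (simp add: lifts_simps)
  moreover have "(\<forall>y. y \<lhd> ?v \<longrightarrow> Rn ?v c y \<longrightarrow> x \<lhd> y) \<longleftrightarrow> (\<forall>y. Rn ?v c y \<longrightarrow> x \<lhd> y)" for c x
    using b by blast
  moreover have "c \<lhd> ?u \<and> A \<and> (\<exists>x. x \<lhd> ?u \<and> Rn ?u c x \<and> B x) \<longleftrightarrow> A \<and> (\<exists>x. Rn ?u c x \<and> B x)" for c A B
    using b by blast
  ultimately show ?thesis unfolding kb_def by (simp only:)
qed

definition KB :: "con list \<Rightarrow> 'a \<Rightarrow> 'a \<Rightarrow> 'a \<Rightarrow> bool" where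
  "KB Ks r u v \<longleftrightarrow> node Ks r u \<and> node Ks r v \<and> (kb u v \<or> u = v)"

lemma msat_KB_fm [simp]:
  "\<forall>K\<in>set Ks. wf_con K \<Longrightarrow> msat M e E (KB_fm Ks r u v) \<longleftrightarrow> KB Ks (mval M e r) (mval M e u) (mval M e v)"
  by (auto simp: KB_fm_def KB_def)

lemma node_set: "\<forall>K\<in>set Ks. wf_con K \<Longrightarrow> {u. node Ks r u} \<in> ms M"
proof -
  assume "\<forall>K\<in>set Ks. wf_con K"
  moreover obtain Y where "Y \<in> ms M" using ms_ne by blast
  ultimately show ?thesis
    using comprehension[of "node_fm Ks (Var 1) (Var 0)" "\<lambda>_. Y" "\<lambda>_. r"]
    by (auto intro!: Delta00_arithmetical Delta00_node_fm)
qed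

lemma kb_irrefl [simp]: "\<not> kb u u"
  by (auto simp: kb_def)

lemma kb_trans: assumes "kb u v" "kb v w" shows "kb u w"
proof -
  obtain c x where c: "\<And>d x. d \<lhd> c \<Longrightarrow> Rn u d x \<longleftrightarrow> Rn v d x" "Rn u c x" "\<And>y. Rn v c y \<Longrightarrow> x \<lhd> y"
    using assms(1) unfolding kb_def by blast
  obtain d y where d: "\<And>e x. e \<lhd> d \<Longrightarrow> Rn v e x \<longleftrightarrow> Rn w e x" "Rn v d y" "\<And>z. Rn w d z \<Longrightarrow> y \<lhd> z"
    using assms(2) unfolding kb_def by blast
  consider "c \<lhd> d" | "c = d" | "d \<lhd> c" using less_linear by blast
  then show ?thesis
  proof cases
    case 1
    show ?thesis unfolding kb_def
      by (rule exI[of _ c]) (metis 1 c d(1) less_trans')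
  next
    case 2
    show ?thesis unfolding kb_def
      by (rule exI[of _ c]) (metis 2 c d less_trans')
  next
    case 3
    show ?thesis unfolding kb_def
      by (rule exI[of _ d]) (metis 3 c(1) d less_trans')
  qed
qed

text \<open>Distinct nodes code distinct functions, since nodes are least codes; the internal least
  number principle yields the first difference.\<close>

lemma kb_total: assumes u: "node Ks r u" and v: "node Ks r v" shows "kb u v \<or> u = v \<or> kb v u"
proof (cases "u = v")
  case False
  then have "\<not> (\<forall>c x. Rn u c x \<longleftrightarrow> Rn v c x)"
    using u v less_linear[of u v] unfolding node_def by metis
  then obtain c where c: "\<exists>x. Rn u c x \<noteq> Rn v c x" by blast
  have "dfn (\<lambda>e. \<exists>x. Rn u (e 0) x \<noteq> Rn v (e 0) x)"
    by (intro dfn_intros tdf_const dfn_Rn)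
  then obtain c where c: "\<exists>x. Rn u c x \<noteq> Rn v c x" "\<And>d. (\<exists>x. Rn u d x \<noteq> Rn v d x) \<Longrightarrow> c \<unlhd> d"
    using c least[of "\<lambda>c. \<exists>x. Rn u c x \<noteq> Rn v c x" c] by blast
  have agree: "d \<lhd> c \<Longrightarrow> Rn u d x \<longleftrightarrow> Rn v d x" for d x
    using c(2) less_irrefl' less_trans' by blast
  have fu: "\<And>x y. Rn u c x \<Longrightarrow> Rn u c y \<Longrightarrow> x = y" and fv: "\<And>x y. Rn v c x \<Longrightarrow> Rn v c y \<Longrightarrow> x = y"
    using u v unfolding node_def by blast+
  show ?thesis
  proof (cases "\<exists>x y. Rn u c x \<and> Rn v c y")
    case True
    then obtain x y where xy: "Rn u c x" "Rn v c y" by blast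
    then have "x \<noteq> y" using c(1) fu fv by blast
    then have "x \<lhd> y \<or> y \<lhd> x" using less_linear by blast
    then show ?thesis unfolding kb_def using agree xy fu fv by metis
  next
    case False
    then show ?thesis unfolding kb_def using agree c(1) by metis
  qed
qed simp

end

section \<open>Infinite paths and ill-founded Kleene--Brouwer orders\<close>

context aca
begin

definition pcon :: "'a set \<Rightarrow> con \<Rightarrow> bool" where
  "pcon H = (\<lambda>(m, L, Q). \<forall>e. (\<forall>(c, v)\<in>set L. pJ (mval M e c) (mval M e v) \<in> H) \<longrightarrow> msat M e (\<lambda>_. {}) Q)"

definition total :: "'a set \<Rightarrow> bool" where
  "total H \<longleftrightarrow> H \<in> ms M \<and> (\<forall>c. \<exists>!x. pJ c x \<in> H)"

definition path :: "con list \<Rightarrow> 'a \<Rightarrow> 'a set \<Rightarrow> bool" where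
  "path Ks r H \<longleftrightarrow> total H \<and> (\<forall>K\<in>set Ks. pcon H K) \<and> pJ r \<zero> \<in> H"

lemma node_of:
  assumes H: "total H" and K: "\<forall>K\<in>set Ks. csat (\<lambda>c v. c \<lhd> k \<and> pJ c v \<in> H) k K" and r: "pJ r \<zero> \<in> H"
  shows "\<exists>u. node Ks r u \<and> (\<forall>c x. Rn u c x \<longleftrightarrow> c \<lhd> k \<and> pJ c x \<in> H)"
proof -
  let ?P = "\<lambda>u. \<forall>c x. Rn u c x \<longleftrightarrow> c \<lhd> k \<and> pJ c x \<in> H"
  have Hm: "H \<in> ms M" using H by (simp add: total_def)
  have "funn H k" using H unfolding total_def funn_def by blast
  then obtain u0 where u0: "?P u0" using Rn_fun[OF Hm] by blast
  have "dfn (\<lambda>e. ?P (e 0))" by (intro dfn_intros tdf_const dfn_Rn tdf_pJ Hm)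
  then obtain u where u: "?P u" "\<And>w. ?P w \<Longrightarrow> u \<unlhd> w" using least[of ?P u0] u0 by blast
  have "Rn u = (\<lambda>c v. c \<lhd> k \<and> pJ c v \<in> H)" using u(1) by (simp add: fun_eq_iff)
  moreover have "\<not> (\<forall>c x. Rn w c x \<longleftrightarrow> Rn u c x)" if "w \<lhd> u" for w
  proof
    assume "\<forall>c x. Rn w c x \<longleftrightarrow> Rn u c x"
    then have "u \<unlhd> w" using u by simp
    then show False using that less_trans' less_irrefl' by blast
  qed
  moreover have "\<forall>c. (\<exists>x. Rn u c x) \<longleftrightarrow> c \<lhd> k" using u(1) H unfolding total_def by blast
  moreover have "\<forall>c x y. Rn u c x \<longrightarrow> Rn u c y \<longrightarrow> x = y" using u(1) H unfolding total_def by blast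
  moreover have "\<forall>x. Rn u r x \<longrightarrow> x = \<zero>" using u(1) r H unfolding total_def by blast
  ultimately have "node Ks r u"
    unfolding node_def using K by auto
  then show ?thesis using u(1) by blast
qed

lemma pcon_csat: "pcon H K \<Longrightarrow> csat (\<lambda>c v. c \<lhd> k \<and> pJ c v \<in> H) k K"
  by (cases K) (force simp: pcon_def csat_def)

text \<open>The finite initial segments of a path are nodes, and each precedes the shorter
  ones.\<close>

lemma path_illfounded:
  assumes wf: "\<forall>K\<in>set Ks. wf_con K" and p: "path Ks r H"
  shows "\<exists>Y\<in>ms M. Y \<noteq> {} \<and> (\<forall>u\<in>Y. node Ks r u \<and> (\<exists>v\<in>Y. kb v u))"
proof -
  have H: "total H" "H \<in> ms M" using p by (auto simp: path_def total_def)
  let ?P = "\<lambda>k u. \<forall>c x. Rn u c x \<longleftrightarrow> c \<lhd> k \<and> pJ c x \<in> H"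
  have ex: "\<exists>u. node Ks r u \<and> ?P k u" for k
    using p by (intro node_of) (auto simp: path_def pcon_csat)
  define Y where "Y = {u. u \<in> {u. node Ks r u} \<and> (\<exists>k. ?P k u)}"
  have "Y \<in> ms M" unfolding Y_def
    by (intro compI dfn_intros tdf_const dfn_Rn tdf_pJ H node_set wf)
  moreover obtain u0 where "node Ks r u0" "?P \<zero> u0" using ex by blast
  then have "u0 \<in> Y" unfolding Y_def by blast
  moreover have "\<exists>v\<in>Y. kb v u" if "u \<in> Y" for u
  proof -
    obtain k where k: "?P k u" using \<open>u \<in> Y\<close> by (auto simp: Y_def)
    obtain v where v: "node Ks r v" "?P (suc k) v" using ex by blast
    obtain x where "pJ k x \<in> H" using H(1) unfolding total_def by blast
    then have "kb v u" unfolding kb_def using k v(2)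
      by (intro exI[of _ k]) (auto simp: less_suc intro!: exI[of _ x])
    then show ?thesis using v by (auto simp: Y_def)
  qed
  moreover have "node Ks r u" if "u \<in> Y" for u using that by (auto simp: Y_def)
  ultimately show ?thesis by (intro bexI[of _ Y]) auto
qed

definition Ag :: "'a \<Rightarrow> 'a \<Rightarrow> 'a \<Rightarrow> bool" where
  "Ag y s c \<longleftrightarrow> (\<forall>d x. d \<lhd> c \<longrightarrow> (Rn y d x \<longleftrightarrow> Rn s d x))"

lemma dfn_Ag: "tdf f \<Longrightarrow> tdf g \<Longrightarrow> tdf h \<Longrightarrow> dfn (\<lambda>e. Ag (f e) (g e) (h e))"
  by (rule dfn3) (unfold Ag_def, intro dfn_intros dfn_Rn tdf_const)

text \<open>\<open>lm Y s k\<close>: \<open>s\<close> codes the leftmost sequence of length \<open>k\<close> among the beginnings of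
  members of \<open>Y\<close>.\<close>

definition lm :: "'a set \<Rightarrow> 'a \<Rightarrow> 'a \<Rightarrow> bool" where
  "lm Y s k \<longleftrightarrow> (\<forall>c. (\<exists>x. Rn s c x) \<longleftrightarrow> c \<lhd> k) \<and>
     (\<forall>c w. Rn s c w \<longrightarrow> (\<exists>y. y \<in> Y \<and> Ag y s c \<and> Rn y c w) \<and>
        (\<forall>y x. y \<in> Y \<longrightarrow> Ag y s c \<longrightarrow> Rn y c x \<longrightarrow> w \<unlhd> x))"

lemma dfn_lm: "Y \<in> ms M \<Longrightarrow> tdf f \<Longrightarrow> tdf g \<Longrightarrow> dfn (\<lambda>e. lm Y (f e) (g e))"
  by (rule dfn2) (unfold lm_def, intro dfn_intros dfn_Rn dfn_Ag tdf_const, assumption+)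

lemma lm_le:
  assumes "lm Y s k" "lm Y s' k'" "Ag s s' c" "Rn s c x" "Rn s' c y" shows "y \<unlhd> x"
proof -
  obtain u where "u \<in> Y" "Ag u s c" "Rn u c x" using assms(1,4) unfolding lm_def by blast
  moreover from this have "Ag u s' c" using assms(3) unfolding Ag_def by blast
  ultimately show ?thesis using assms(2,5) unfolding lm_def by blast
qed

lemma lm_fun: "lm Y s k \<Longrightarrow> Rn s c x \<Longrightarrow> Rn s c y \<Longrightarrow> x = y"
  using lm_le[of Y s k s k c] by (intro leq_antisym) (auto simp: Ag_def)

text \<open>Induction on the position: as long as two leftmost sequences agree, each bounds the next
  value of the other.\<close>

lemma lm_unique:
  assumes "lm Y s k" "lm Y s' k'" "c \<lhd> k" "c \<lhd> k'"
  shows "Rn s c x \<longleftrightarrow> Rn s' c x"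
proof -
  have "c \<lhd> k \<longrightarrow> c \<lhd> k' \<longrightarrow> (\<forall>x. Rn s c x \<longleftrightarrow> Rn s' c x)"
  proof (rule strong_induct[where x = c])
    show "dfn (\<lambda>e. e 0 \<lhd> k \<longrightarrow> e 0 \<lhd> k' \<longrightarrow> (\<forall>x. Rn s (e 0) x \<longleftrightarrow> Rn s' (e 0) x))"
      by (intro dfn_intros tdf_const dfn_Rn)
    fix c assume IH: "\<And>d. d \<lhd> c \<Longrightarrow> d \<lhd> k \<longrightarrow> d \<lhd> k' \<longrightarrow> (\<forall>x. Rn s d x \<longleftrightarrow> Rn s' d x)"
    show "c \<lhd> k \<longrightarrow> c \<lhd> k' \<longrightarrow> (\<forall>x. Rn s c x \<longleftrightarrow> Rn s' c x)"
    proof (intro impI)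
      assume c: "c \<lhd> k" "c \<lhd> k'"
      have "Ag s s' c" unfolding Ag_def using IH c less_trans' by blast
      then have ag: "Ag s' s c" unfolding Ag_def by blast
      obtain w w' where w: "Rn s c w" "Rn s' c w'" using assms(1,2) c unfolding lm_def by blast
      have "w = w'"
        by (rule leq_antisym)
          (rule lm_le[OF assms(2,1) ag w(2,1)], rule lm_le[OF assms(1,2) \<open>Ag s s' c\<close> w])
      then show "\<forall>x. Rn s c x \<longleftrightarrow> Rn s' c x"
        using w lm_fun[OF assms(1)] lm_fun[OF assms(2)] by blast
    qed
  qed
  then show ?thesis using assms(3,4) by blast
qed

text \<open>The leftmost path exists without any appeal to Pi11 comprehension: being leftmost among
  beginnings of members of the given set \<open>Y\<close> is arithmetical, so arithmetical induction
  on the length suffices.\<close>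

lemma illfounded_lm:
  assumes Y: "Y \<in> ms M" "Y \<noteq> {}" and n: "\<forall>u\<in>Y. node Ks r u \<and> (\<exists>v\<in>Y. kb v u)"
  shows "\<exists>s. lm Y s k \<and> (\<exists>y. y \<in> Y \<and> Ag y s k)"
proof (rule induct[where x = k])
  show "dfn (\<lambda>e. \<exists>s. lm Y s (e 0) \<and> (\<exists>y. y \<in> Y \<and> Ag y s (e 0)))"
    by (intro dfn_intros dfn_lm dfn_Ag tdf_const Y)
  obtain Z where "Z \<in> ms M" using ms_ne by blast
  then obtain s where s: "\<forall>c x. \<not> Rn s c x" using Rn_code[of Z \<zero>] by auto
  moreover obtain y where "y \<in> Y" using Y(2) by blast
  ultimately show "\<exists>s. lm Y s \<zero> \<and> (\<exists>y. y \<in> Y \<and> Ag y s \<zero>)"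
    by (intro exI[of _ s] conjI exI[of _ y]) (simp_all add: lm_def Ag_def)
  fix k assume "\<exists>s. lm Y s k \<and> (\<exists>y. y \<in> Y \<and> Ag y s k)"
  then obtain s y where s: "lm Y s k" and y: "y \<in> Y" "Ag y s k" by blast
  have sf: "Rn s c x \<Longrightarrow> Rn s c x' \<Longrightarrow> x = x'" for c x x' using lm_fun[OF s] .
  have sd: "(\<exists>x. Rn s c x) \<longleftrightarrow> c \<lhd> k" for c using s unfolding lm_def by blast
  \<comment> \<open>Otherwise some \<open>v\<close> in \<open>Y\<close> comes before the given
    \<open>y\<close>. A first difference below \<open>k\<close> contradicts leftmostness, one at
    \<open>k\<close> means that \<open>v\<close> is defined there, and one above \<open>k\<close>
    leaves a gap in the domain of \<open>v\<close>.\<close>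
  have "\<exists>y w. y \<in> Y \<and> Ag y s k \<and> Rn y k w"
  proof (rule ccontr)
    assume no: "\<not> ?thesis"
    obtain v where v: "v \<in> Y" "kb v y" using n y by blast
    obtain c x where c: "\<And>d z. d \<lhd> c \<Longrightarrow> Rn v d z \<longleftrightarrow> Rn y d z" "Rn v c x" "\<And>z. Rn y c z \<Longrightarrow> x \<lhd> z"
      using v(2) unfolding kb_def by blast
    have dom: "\<exists>j. \<forall>c. (\<exists>x. Rn u c x) \<longleftrightarrow> c \<lhd> j" if "u \<in> Y" for u
      using n that unfolding node_def by blast
    consider "c \<lhd> k" | "c = k" | "k \<lhd> c" using less_linear by blast
    then show False
    proof cases
      case 1
      then obtain w where w: "Rn s c w" using sd by blast
      then have "x \<lhd> w" using c(3) y(2) 1 unfolding Ag_def by blast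
      moreover have "Ag v s c" using c(1) y(2) 1 less_trans' unfolding Ag_def by blast
      then have "w \<unlhd> x" using s w v(1) c(2) unfolding lm_def by blast
      ultimately show False using less_trans' less_irrefl' by blast
    next
      case 2
      then have "Ag v s k" using c(1) y(2) unfolding Ag_def by blast
      then show False using no v(1) c(2) 2 by blast
    next
      case 3
      then have "\<not> (\<exists>z. Rn v k z)" using c(1) no y by blast
      then show False using dom[OF v(1)] c(2) 3 less_trans' by blast
    qed
  qed
  then obtain w0 where "\<exists>y. y \<in> Y \<and> Ag y s k \<and> Rn y k w0" by blast
  moreover have "dfn (\<lambda>e. \<exists>y. y \<in> Y \<and> Ag y s k \<and> Rn y k (e 0))"
    by (intro dfn_intros dfn_Rn dfn_Ag tdf_const Y)
  ultimately obtain w where w: "\<exists>y. y \<in> Y \<and> Ag y s k \<and> Rn y k w"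
    "\<And>x. \<exists>y. y \<in> Y \<and> Ag y s k \<and> Rn y k x \<Longrightarrow> w \<unlhd> x"
    using least[of "\<lambda>w. \<exists>y. y \<in> Y \<and> Ag y s k \<and> Rn y k w" w0] by blast
  \<comment> \<open>The sequence coded by \<open>s\<close>, prolonged at \<open>k\<close> by the
    least possible value \<open>w\<close>.\<close>
  define H where "H = {z. \<exists>d x. z = pJ d x \<and> (Rn s d x \<or> d = k \<and> x = w)}"
  have H: "H \<in> ms M" unfolding H_def by (intro compI dfn_intros dfn_Rn tdf_pJ tdf_const)
  have Hin: "pJ d x \<in> H \<longleftrightarrow> Rn s d x \<or> d = k \<and> x = w" for d x by (auto simp: H_def)
  have ns: "\<not> Rn s k x" for x using sd[of k] by auto
  have "funn H (suc k)"
    unfolding funn_def Hin using sd sf ns by (metis less_suc)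
  then obtain s' where s': "\<And>c x. Rn s' c x \<longleftrightarrow> c \<lhd> suc k \<and> (Rn s c x \<or> c = k \<and> x = w)"
    using Rn_fun[OF H, of "suc k"] unfolding Hin by blast
  have lt: "Rn s c x \<Longrightarrow> c \<lhd> k" for c x using sd by blast
  have R: "Rn s' c x \<longleftrightarrow> Rn s c x \<or> c = k \<and> x = w" for c x
    using s' lt less_suc by blast
  have ag: "c \<unlhd> k \<Longrightarrow> Ag y s' c \<longleftrightarrow> Ag y s c" for c y
    unfolding Ag_def R using ns less_trans' less_irrefl' by metis
  have "lm Y s' (suc k)"
    unfolding lm_def
  proof (intro conjI allI impI)
    show "(\<exists>x. Rn s' c x) \<longleftrightarrow> c \<lhd> suc k" for c
      unfolding R less_suc using sd by blast
    fix c x assume *: "Rn s' c x"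
    then have le: "c \<unlhd> k" using R lt by blast
    show "\<exists>y. y \<in> Y \<and> Ag y s' c \<and> Rn y c x"
      unfolding ag[OF le] using * w(1) s unfolding R lm_def by blast
    show "x \<unlhd> z" if "y \<in> Y" "Ag y s' c" "Rn y c z" for y z
    proof (cases "c = k")
      case True
      then have "x = w" using * ns R by blast
      then show ?thesis using that w(2) True ag by blast
    next
      case False
      then have "Rn s c x" using * R by blast
      then show ?thesis using s that unfolding ag[OF le] lm_def by blast
    qed
  qed
  moreover obtain y where y: "y \<in> Y" "Ag y s k" "Rn y k w" using w(1) by blast
  have "x = w" if "Rn y k x" for x
    using n y(1,3) that unfolding node_def by blast
  then have "Ag y s' (suc k)"
    using y(2,3) ns unfolding Ag_def R less_suc by blast
  ultimately show "\<exists>s. lm Y s (suc k) \<and> (\<exists>y. y \<in> Y \<and> Ag y s (suc k))" using y(1) by blast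
qed

lemma finite_bound: "finite A \<Longrightarrow> \<exists>k. \<forall>a\<in>A. a \<lhd> k"
proof (induction A rule: finite_induct)
  case (insert a A)
  then obtain k where "\<forall>a\<in>A. a \<lhd> k" by blast
  moreover have "a \<lhd> k \<oplus> suc a" "b \<lhd> k \<Longrightarrow> b \<lhd> k \<oplus> suc a" for b
    using le_add(2)[of "suc a" k] less_self_suc[of a] less_add_suc[of k a] less_trans' by metis+
  ultimately show ?case by (intro exI[of _ "k \<oplus> suc a"]) auto
qed simp

text \<open>The leftmost sequences of all lengths form one total function. An instance of a
  constraint involves finitely many values, so a sufficiently long member of \<open>Y\<close> that
  agrees with this function already verifies it.\<close>

lemma illfounded_path:
  assumes Y: "Y \<in> ms M" "Y \<noteq> {}" and n: "\<forall>u\<in>Y. node Ks r u \<and> (\<exists>v\<in>Y. kb v u)"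
  shows "\<exists>H. path Ks r H"
proof -
  define H where "H = {z. \<exists>c x s k. z = pJ c x \<and> c \<lhd> k \<and> lm Y s k \<and> Rn s c x}"
  have Hm: "H \<in> ms M" unfolding H_def by (intro compI dfn_intros dfn_Rn dfn_lm tdf_pJ tdf_const Y)
  have Hin: "pJ c x \<in> H \<longleftrightarrow> Rn s c x" if "c \<lhd> k" "lm Y s k" for c x s k
    proof
    assume "pJ c x \<in> H"
    then obtain s' k' where *: "c \<lhd> k'" "lm Y s' k'" "Rn s' c x" unfolding H_def by auto
    then show "Rn s c x" using lm_unique[OF *(2) that(2) *(1) that(1)] by simp
  next
    assume "Rn s c x"
    then show "pJ c x \<in> H" using that unfolding H_def by blast
  qed
  have tot: "total H" unfolding total_def
  proof (intro conjI allI Hm)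
    fix c
    obtain s where s: "lm Y s (suc c)" using illfounded_lm[OF assms, of "suc c"] by blast
    then obtain x where "Rn s c x" unfolding lm_def using less_self_suc[of c] by blast
    then show "\<exists>!x. pJ c x \<in> H"
      unfolding Hin[OF less_self_suc s] using lm_fun[OF s] by blast
  qed
  have ap: "\<exists>y j. k \<unlhd> j \<and> (\<forall>c. (\<exists>x. Rn y c x) \<longleftrightarrow> c \<lhd> j) \<and> (\<forall>K\<in>set Ks. csat (Rn y) j K) \<and>
      (\<forall>x. Rn y r x \<longrightarrow> x = \<zero>) \<and> (\<forall>c x. c \<lhd> k \<longrightarrow> (Rn y c x \<longleftrightarrow> pJ c x \<in> H))" for k
  proof -
    obtain s y where s: "lm Y s k" "y \<in> Y" "Ag y s k" using illfounded_lm[OF assms, of k] by blast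
    obtain j where j: "\<forall>c. (\<exists>x. Rn y c x) \<longleftrightarrow> c \<lhd> j" "\<forall>K\<in>set Ks. csat (Rn y) j K" "\<forall>x. Rn y r x \<longrightarrow> x = \<zero>"
      using n s(2) unfolding node_def by blast
    have "\<forall>c x. c \<lhd> k \<longrightarrow> (Rn y c x \<longleftrightarrow> pJ c x \<in> H)"
      using Hin[OF _ s(1)] s(3) unfolding Ag_def by blast
    moreover have "\<not> j \<lhd> k"
    proof
      assume *: "j \<lhd> k"
      then have "\<exists>x. Rn s j x" using s(1) unfolding lm_def by simp
      then have "\<exists>x. Rn y j x" using s(3) * unfolding Ag_def by simp
      then show False using j(1) by simp
    qed
    then have "k \<unlhd> j" using less_linear[of k j] by simp
    ultimately show ?thesis using j by (intro exI[of _ y] exI[of _ j] conjI)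
  qed
  have "pcon H K" if "K \<in> set Ks" for K
  proof -
    obtain m L Q where K: "K = (m, L, Q)" by (cases K)
    show ?thesis unfolding pcon_def K prod.case
    proof (intro allI impI)
      fix e assume e: "\<forall>(c, v)\<in>set L. pJ (mval M e c) (mval M e v) \<in> H"
      have "finite (e ` {..<m} \<union> (\<lambda>(c, v). mval M e c) ` set L)" by simp
      from finite_bound[OF this] obtain k where
        "\<forall>a\<in>e ` {..<m} \<union> (\<lambda>(c, v). mval M e c) ` set L. a \<lhd> k" ..
      then have k: "\<forall>i<m. e i \<lhd> k" "\<forall>(c, v)\<in>set L. mval M e c \<lhd> k" by auto
      obtain y j where y: "k \<unlhd> j" "\<forall>K\<in>set Ks. csat (Rn y) j K"
          "\<forall>c x. c \<lhd> k \<longrightarrow> (Rn y c x \<longleftrightarrow> pJ c x \<in> H)"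
        using ap[of k] by (elim exE conjE) (rule that)
      have "\<forall>i<m. e i \<lhd> j" using k(1) y(1) less_trans' by metis
      moreover have "\<forall>(c, v)\<in>set L. Rn y (mval M e c) (mval M e v)"
      proof clarify
        fix c v assume cv: "(c, v) \<in> set L"
        show "Rn y (mval M e c) (mval M e v)"
          using bspec[OF e cv] bspec[OF k(2) cv] y(3) by simp
      qed
      ultimately show "msat M e (\<lambda>_. {}) Q" using y(2) \<open>K \<in> set Ks\<close> unfolding csat_def K by blast
    qed
  qed
  \<comment> \<open>Length \<open>suc r\<close> is enough to include the root cell \<open>r\<close>,
    whose value in every node is 0 if defined.\<close>
  moreover have "pJ r \<zero> \<in> H"
    using ap[of "suc r"] tot unfolding total_def by (metis less_self_suc)
  ultimately show ?thesis unfolding path_def using tot by blast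
qed

end

section \<open>A normal form for arithmetical formulas\<close>

lemma tm_code_inj: "tm_code t = tm_code u \<Longrightarrow> t = u"
proof (induction t arbitrary: u)
  case (Var i) then show ?case by (cases u) auto
next
  case Zero then show ?case by (cases u) auto
next
  case One then show ?case by (cases u) auto
next
  case (Plus t1 t2) then show ?case by (cases u) auto
next
  case (Times t1 t2) then show ?case by (cases u) auto
qed

lemma tm_code_eq [simp]: "tm_code t = tm_code u \<longleftrightarrow> t = u"
  using tm_code_inj by blast

lemma fm_code_inj: "fm_code p = fm_code q \<Longrightarrow> p = q"
proof (induction p arbitrary: q)
  case (Equal t u) then show ?case by (cases q) auto
next
  case (Less t u) then show ?case by (cases q) auto
next
  case (Mem t i) then show ?case by (cases q) auto
next
  case Falsum then show ?case by (cases q) auto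
next
  case (Imp p1 p2) then show ?case by (cases q) auto
next
  case (AllN p) then show ?case by (cases q) auto
next
  case (AllS p) then show ?case by (cases q) auto
qed

lemma fm_code_eq [simp]: "fm_code p = fm_code q \<longleftrightarrow> p = q"
  using fm_code_inj by blast

text \<open>A path through the tree below is a function whose values are addressed by cells: the
  cells \<open>(0, i)\<close> hold a sequence \<open>f\<close>, the value at \<open>(1, (j, x))\<close> is 0 iff \<open>x\<close> is in the \<open>j\<close>-th set,
  and the cell of a formula \<open>p\<close> and a coded assignment \<open>\<epsilon>\<close> has value 0 iff \<open>p\<close> holds under \<open>\<epsilon>\<close>.
  If \<open>AllN p\<close> is false then its value is the successor of a counterexample.\<close>

definition fcell :: "fm \<Rightarrow> tm \<Rightarrow> tm" where
  "fcell p t = Jt (num (2 + fm_code p)) t"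

primrec lct :: "nat \<Rightarrow> nat \<Rightarrow> tm" where
  "lct i 0 = Zero"
| "lct i (Suc m) = Jt (Var i) (lct (Suc i) m)"

abbreviation isz :: "nat \<Rightarrow> fm" where "isz i \<equiv> Equal (Var i) Zero"

text \<open>\<open>N\<close> counts the number variables in scope. Equations, inequalities and
  membership use the variables themselves, hence spell the assignment out as \<open>lct 0 N\<close>
  and keep \<open>Var N\<close> for the value of the cell; elsewhere \<open>Var 0\<close> is the
  whole coded assignment. The two constraints for \<open>AllN\<close> treat the values 0 and
  successor, so no unbounded quantifier is left.\<close>

primrec cs :: "fm \<Rightarrow> nat \<Rightarrow> con list" where
  "cs (Equal t u) N = [(Suc N, [(fcell (Equal t u) (lct 0 N), Var N)], fIff (isz N) (Equal t u))]"
| "cs (Less t u) N = [(Suc N, [(fcell (Less t u) (lct 0 N), Var N)], fIff (isz N) (Less t u))]"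
| "cs (Mem t i) N = [(Suc (Suc N), [(fcell (Mem t i) (lct 0 N), Var N),
     (Jt One (Jt (num i) t), Var (Suc N))], fIff (isz N) (isz (Suc N)))]"
| "cs Falsum N = [(2, [(fcell Falsum (Var 0), Var 1)], Neg (isz 1))]"
| "cs (Imp p q) N = (4, [(fcell (Imp p q) (Var 0), Var 1), (fcell p (Var 0), Var 2),
     (fcell q (Var 0), Var 3)], fIff (isz 1) (Imp (isz 2) (isz 3))) # cs p N @ cs q N"
| "cs (AllN p) N = (4, [(fcell (AllN p) (Var 0), Var 1), (fcell p (Jt (Var 2) (Var 0)), Var 3)],
     Imp (isz 1) (isz 3)) # (3, [(fcell (AllN p) (Var 0), tsuc (Var 1)),
     (fcell p (Jt (Var 1) (Var 0)), Var 2)], Neg (isz 2)) # cs p (Suc N)"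
| "cs (AllS p) N = []"

text \<open>\<open>Var 0\<close> is a position i, \<open>Var 1\<close> and \<open>Var 2\<close> are
  f(i) and f(i+1), and \<open>Var 3\<close> is the value of the cell that decides whether the pair
  of f(i+1) and f(i) belongs to set \<open>z\<close>.\<close>

definition dcon :: "nat \<Rightarrow> con" where
  "dcon z = (4, [(Jt Zero (Var 0), Var 1), (Jt Zero (tsuc (Var 0)), Var 2),
     (Jt One (Jt (num z) (Jt (Var 2) (Var 1))), Var 3)], isz 3)"

lemma tm_bd_num [simp]: "tm_bd n (num k)"
  by (induction k) auto

lemma tm_bd_lct: "i + m \<le> n \<Longrightarrow> tm_bd n (lct i m)"
  by (induction m arbitrary: i) auto

lemma wf_dcon: "wf_con (dcon z)"
  by (simp add: wf_con_def dcon_def)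

lemma wf_cs: "fm_bd N s p \<Longrightarrow> K \<in> set (cs p N) \<Longrightarrow> wf_con K"
proof (induction p arbitrary: N)
  case (Equal t u)
  then show ?case by (auto simp: wf_con_def fcell_def tm_bd_lct intro: tm_bd_mono[of N])
next
  case (Less t u)
  then show ?case by (auto simp: wf_con_def fcell_def tm_bd_lct intro: tm_bd_mono[of N])
next
  case (Mem t i)
  then show ?case by (auto simp: wf_con_def fcell_def tm_bd_lct intro: tm_bd_mono[of N])
next
  case (Imp p q)
  have "wf_con (4, [(fcell (Imp p q) (Var 0), Var 1), (fcell p (Var 0), Var 2),
     (fcell q (Var 0), Var 3)], fIff (isz 1) (Imp (isz 2) (isz 3)))"
    by (auto simp: wf_con_def fcell_def)
  then show ?case using Imp by auto
next
  case (AllN p)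
  have "wf_con (4, [(fcell (AllN p) (Var 0), Var 1), (fcell p (Jt (Var 2) (Var 0)), Var 3)],
     Imp (isz 1) (isz 3))" "wf_con (3, [(fcell (AllN p) (Var 0), tsuc (Var 1)),
     (fcell p (Jt (Var 1) (Var 0)), Var 2)], Neg (isz 2))"
    by (auto simp: wf_con_def fcell_def)
  then show ?case using AllN by auto
qed (auto simp: wf_con_def fcell_def)

primrec subs :: "fm \<Rightarrow> fm set" where
  "subs (Equal t u) = {Equal t u}"
| "subs (Less t u) = {Less t u}"
| "subs (Mem t i) = {Mem t i}"
| "subs Falsum = {Falsum}"
| "subs (Imp p q) = insert (Imp p q) (subs p \<union> subs q)"
| "subs (AllN p) = insert (AllN p) (subs p)"
| "subs (AllS p) = {AllS p}"

lemma finite_subs [simp]: "finite (subs p)"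
  by (induction p) auto

lemma subs_refl [simp]: "p \<in> subs p"
  by (cases p) auto

lemma subs_trans: "q \<in> subs p \<Longrightarrow> subs q \<subseteq> subs p"
  by (induction p) auto

lemma subs_arithmetical: "q \<in> subs p \<Longrightarrow> arithmetical p \<Longrightarrow> arithmetical q"
  by (induction p) auto

context aca
begin

definition nv :: "nat \<Rightarrow> 'a" where
  "nv n = mval M (\<lambda>_. \<zero>) (num n)"

lemma mval_num [simp]: "mval M e (num n) = nv n"
  unfolding nv_def by (rule mval_cong[of 0]) auto

lemma nv_simps [simp]: "nv 0 = \<zero>" "nv (Suc n) = suc (nv n)"
  by (simp_all add: nv_def del: mval_num)

lemma nv_eq [simp]: "nv m = nv n \<longleftrightarrow> m = n"
proof (induction m arbitrary: n)
  case 0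
  then show ?case by (cases n) auto
next
  case (Suc m)
  then show ?case by (cases n) auto
qed

lemma nv_neq: "\<one> \<noteq> nv (Suc (Suc n))" "\<zero> \<noteq> nv (Suc n)" "nv (Suc (Suc n)) \<noteq> \<one>"
  using nv_eq[of 1 "Suc (Suc n)"] by (auto simp del: nv_eq)

text \<open>The offset 2 keeps the cells of formulas apart from those of the sequence (tag 0) and of
  the sets (tag 1).\<close>

definition tv :: "fm \<Rightarrow> 'a" where
  "tv p = nv (2 + fm_code p)"

lemma tv_simps [simp]: "tv p = tv q \<longleftrightarrow> p = q" "tv p \<noteq> \<zero>" "tv p \<noteq> \<one>" "\<zero> \<noteq> tv p" "\<one> \<noteq> tv p"
  using nv_neq[of "fm_code p"] nv_neq(2)[of "Suc (fm_code p)"] nv_eq[of "2 + fm_code p"]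
  by (simp_all add: tv_def del: nv_simps)

lemma mval_fcell [simp]: "mval M e (fcell p t) = pJ (tv p) (mval M e t)"
  by (simp add: fcell_def tv_def del: nv_simps num.simps)

primrec lcv :: "(nat \<Rightarrow> 'a) \<Rightarrow> nat \<Rightarrow> 'a" where
  "lcv e 0 = \<zero>"
| "lcv e (Suc n) = pJ (e 0) (lcv (\<lambda>i. e (Suc i)) n)"

lemma mval_lct: "mval M e (lct i n) = lcv (\<lambda>j. e (i + j)) n"
  by (induction n arbitrary: i) simp_all

lemma mval_lct_0 [simp]: "mval M e (lct 0 n) = lcv e n"
  by (simp add: mval_lct)

lemma lcv_cong: "(\<And>i. i < n \<Longrightarrow> e i = e' i) \<Longrightarrow> lcv e n = lcv e' n"
proof (induction n arbitrary: e e')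
  case (Suc n)
  have "lcv (\<lambda>i. e (Suc i)) n = lcv (\<lambda>i. e' (Suc i)) n" by (rule Suc.IH) (use Suc.prems in simp)
  then show ?case using Suc.prems[of 0] by simp
qed simp

subsection \<open>From paths to models of the formula\<close>

definition hv :: "'a set \<Rightarrow> 'a \<Rightarrow> 'a" where
  "hv H c = (THE x. pJ c x \<in> H)"

lemma hv: "total H \<Longrightarrow> pJ c x \<in> H \<longleftrightarrow> hv H c = x"
  unfolding hv_def total_def by (metis (mono_tags, lifting) theI')

definition sets_of :: "'a set \<Rightarrow> nat \<Rightarrow> 'a set" where
  "sets_of H i = {x. pJ (pJ \<one> (pJ (nv i) x)) \<zero> \<in> H}"

lemma sets_of_ms: "total H \<Longrightarrow> sets_of H i \<in> ms M"
  unfolding sets_of_def total_def by (intro compI dfn_intros tdf_pJ tdf_const) blast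

lemma pcon_E: "pcon H (m, L, Q) \<Longrightarrow> (\<forall>(c, v)\<in>set L. pJ (mval M e c) (mval M e v) \<in> H) \<Longrightarrow> msat M e (\<lambda>_. {}) Q"
  by (auto simp: pcon_def)

text \<open>The induction is on the actual formula, outside the model. For \<open>AllN\<close> a
  cell value is 0 or a successor: 0 forces all instances, and \<open>suc x\<close> names
  \<open>x\<close> as a counterexample.\<close>

lemma path_truth:
  assumes H: "total H"
  shows "arithmetical p \<Longrightarrow> fm_bd N s p \<Longrightarrow> \<forall>K\<in>set (cs p N). pcon H K \<Longrightarrow>
    hv H (pJ (tv p) (lcv e N)) = \<zero> \<longleftrightarrow> msat M e (sets_of H) p"
proof (induction p arbitrary: e N)
  case (Equal t u)
  \<comment> \<open>Index \<open>N\<close> does not occur in \<open>t\<close> and \<open>u\<close>,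
    so it is free to carry the value of the cell.\<close>
  let ?e = "e(N := hv H (pJ (tv (Equal t u)) (lcv e N)))"
  have "mval M ?e t = mval M e t" "mval M ?e u = mval M e u" "lcv ?e N = lcv e N"
    using Equal.prems by (auto intro!: mval_cong[of N] lcv_cong)
  then show ?case using Equal.prems pcon_E[of H _ _ _ ?e] by (fastforce simp: hv[OF H])
next
  case (Less t u)
  let ?e = "e(N := hv H (pJ (tv (Less t u)) (lcv e N)))"
  have "mval M ?e t = mval M e t" "mval M ?e u = mval M e u" "lcv ?e N = lcv e N"
    using Less.prems by (auto intro!: mval_cong[of N] lcv_cong)
  then show ?case using Less.prems pcon_E[of H _ _ _ ?e] by (fastforce simp: hv[OF H])
next
  case (Mem t i)
  let ?e = "e(N := hv H (pJ (tv (Mem t i)) (lcv e N)), Suc N := hv H (pJ \<one> (pJ (nv i) (mval M e t))))"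
  have "mval M ?e t = mval M e t" "lcv ?e N = lcv e N"
    using Mem.prems by (auto intro!: mval_cong[of N] lcv_cong)
  then show ?case using Mem.prems pcon_E[of H _ _ _ ?e] by (fastforce simp: hv[OF H] sets_of_def)
next
  case Falsum
  let ?e = "\<lambda>i. if i = 0 then lcv e N else hv H (pJ (tv Falsum) (lcv e N))"
  show ?case using Falsum.prems pcon_E[of H _ _ _ ?e] by (fastforce simp: hv[OF H])
next
  case (Imp p q)
  let ?h = "\<lambda>p. hv H (pJ (tv p) (lcv e N))"
  let ?e = "\<lambda>i. [lcv e N, ?h (Imp p q), ?h p, ?h q] ! i"
  have "pcon H (4, [(fcell (Imp p q) (Var 0), Var 1), (fcell p (Var 0), Var 2),
     (fcell q (Var 0), Var 3)], fIff (isz 1) (Imp (isz 2) (isz 3)))" using Imp.prems by simp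
  from pcon_E[OF this, of ?e] have "?h (Imp p q) = \<zero> \<longleftrightarrow> (?h p = \<zero> \<longrightarrow> ?h q = \<zero>)"
    by (simp add: hv[OF H])
  then show ?case using Imp by simp
next
  case (AllN p)
  let ?h = "\<lambda>p x. hv H (pJ (tv p) x)" and ?c = "lcv e N"
  have IH: "?h p (pJ x ?c) = \<zero> \<longleftrightarrow> msat M (case_nat x e) (sets_of H) p" for x
    using AllN.IH[of "Suc N" "case_nat x e"] AllN.prems by simp
  have 1: "pcon H (4, [(fcell (AllN p) (Var 0), Var 1), (fcell p (Jt (Var 2) (Var 0)), Var 3)],
     Imp (isz 1) (isz 3))" and 2: "pcon H (3, [(fcell (AllN p) (Var 0), tsuc (Var 1)),
     (fcell p (Jt (Var 1) (Var 0)), Var 2)], Neg (isz 2))" using AllN.prems by simp_all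
  have "?h (AllN p) ?c = \<zero> \<Longrightarrow> ?h p (pJ x ?c) = \<zero>" for x
    using pcon_E[OF 1, of "\<lambda>i. [?c, ?h (AllN p) ?c, x, ?h p (pJ x ?c)] ! i"] by (simp add: hv[OF H])
  moreover have "?h (AllN p) ?c = suc x \<Longrightarrow> ?h p (pJ x ?c) \<noteq> \<zero>" for x
    using pcon_E[OF 2, of "\<lambda>i. [?c, x, ?h p (pJ x ?c)] ! i"] by (simp add: hv[OF H])
  ultimately have "?h (AllN p) ?c = \<zero> \<longleftrightarrow> (\<forall>x. ?h p (pJ x ?c) = \<zero>)"
    using zero_or_suc[of "?h (AllN p) ?c"] by blast
  then show ?case unfolding IH by simp
qed simp

text \<open>\<open>F\<close> is the graph of the sequence. Strictness is left to \<open>Z\<close>: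
  this is the strict part of an order when used for \<open>boundedness\<close>, and may be the set
  of all numbers when no descent is to be enforced.\<close>

definition descending :: "'a set \<Rightarrow> 'a set \<Rightarrow> bool" where
  "descending F Z \<longleftrightarrow> total F \<and> (\<forall>i x y. pJ i x \<in> F \<longrightarrow> pJ (suc i) y \<in> F \<longrightarrow> pJ y x \<in> Z)"

lemma path_model:
  assumes "path (dcon z # cs p 1) (pJ (tv p) (pJ n \<zero>)) H" "arithmetical p" "fm_bd 1 s p"
  shows "\<exists>E F. range E \<subseteq> ms M \<and> msat M (\<lambda>_. n) E p \<and> descending F (E z)"
proof -
  have H: "total H" and c: "pcon H (dcon z)" "\<forall>K\<in>set (cs p 1). pcon H K"
    and r: "pJ (pJ (tv p) (pJ n \<zero>)) \<zero> \<in> H" using assms by (auto simp: path_def)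
  define F where "F = {y. \<exists>i x. y = pJ i x \<and> pJ (pJ \<zero> i) x \<in> H}"
  have F: "pJ i x \<in> F \<longleftrightarrow> hv H (pJ \<zero> i) = x" for i x
    by (auto simp: F_def hv[OF H])
  have "F \<in> ms M" unfolding F_def
    using H by (intro compI dfn_intros tdf_pJ tdf_const) (simp add: total_def)
  then have "total F" unfolding total_def F by auto
  moreover have "pJ y x \<in> sets_of H z" if "pJ i x \<in> F" "pJ (suc i) y \<in> F" for i x y
    using pcon_E[OF c(1)[unfolded dcon_def], of "\<lambda>j. [i, x, y, hv H (pJ \<one> (pJ (nv z) (pJ y x)))] ! j"] that
    unfolding F by (simp add: hv[OF H] sets_of_def)
  ultimately have "descending F (sets_of H z)" unfolding descending_def by blast
  moreover have "msat M (\<lambda>_. n) (sets_of H) p"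
    using path_truth[OF H assms(2,3) c(2), of "\<lambda>_. n"] r by (simp add: hv[OF H])
  ultimately show ?thesis using sets_of_ms[OF H] by blast
qed

subsection \<open>From models of the formula to paths\<close>

definition hdM :: "'a \<Rightarrow> 'a" where
  "hdM c = (if \<exists>x y. c = pJ x y then THE x. \<exists>y. c = pJ x y else \<zero>)"

definition tlM :: "'a \<Rightarrow> 'a" where
  "tlM c = (if \<exists>x y. c = pJ x y then THE y. \<exists>x. c = pJ x y else \<zero>)"

lemma hdM_tlM [simp]: "hdM (pJ x y) = x" "tlM (pJ x y) = y"
  by (auto simp: hdM_def tlM_def)

text \<open>With the default in \<open>hdM\<close> and \<open>tlM\<close> every number codes an
  assignment. So quantifying over a variable amounts to pairing, \<open>env_pJ\<close>, and truth is
  definable without a notion of valid code.\<close>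

definition env :: "'a \<Rightarrow> nat \<Rightarrow> 'a" where
  "env c i = hdM ((tlM ^^ i) c)"

lemma env_pJ [simp]: "env (pJ x c) = case_nat x (env c)"
  by (auto simp: env_def fun_eq_iff funpow_swap1 split: nat.split simp del: funpow.simps)
    (auto simp: funpow_swap1)

lemma env_lcv: "i < n \<Longrightarrow> env (lcv e n) i = e i"
  by (induction n arbitrary: e i) (auto split: nat.split)

lemma dfn_hdM: "dfn (\<lambda>e. hdM (e 0) = e (Suc 0))"
proof -
  have "(hdM c = v) \<longleftrightarrow> (\<exists>x y. c = pJ x y \<and> x = v) \<or> (\<not> (\<exists>x y. c = pJ x y) \<and> \<zero> = v)" for c v
    by (cases "\<exists>x y. c = pJ x y") (auto, auto simp: hdM_def)
  then show ?thesis by (simp only:) (intro dfn_intros tdf_pJ tdf_const)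
qed

lemma dfn_tlM: "dfn (\<lambda>e. tlM (e 0) = e (Suc 0))"
proof -
  have "(tlM c = v) \<longleftrightarrow> (\<exists>x y. c = pJ x y \<and> y = v) \<or> (\<not> (\<exists>x y. c = pJ x y) \<and> \<zero> = v)" for c v
    by (cases "\<exists>x y. c = pJ x y") (auto, auto simp: tlM_def)
  then show ?thesis by (simp only:) (intro dfn_intros tdf_pJ tdf_const)
qed

lemma dfn_tl_pow: "dfn (\<lambda>e. (tlM ^^ i) (e 0) = e (Suc 0))"
proof (induction i)
  case 0
  then show ?case by (simp add: dfn_eq tdf_var)
next
  case (Suc i)
  have "dfn (\<lambda>e. \<exists>w. (tlM ^^ i) (e 0) = w \<and> tlM w = e (Suc 0))"
    by (intro dfn_ex dfn_conj) (rule dfn2[OF Suc tdf_var tdf_var], rule dfn2[OF dfn_tlM tdf_var tdf_var])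
  then show ?case by simp
qed

lemma dfn_env: "dfn (\<lambda>e. env (e 0) i = e (Suc 0))"
proof -
  have "dfn (\<lambda>e. \<exists>w. (tlM ^^ i) (e 0) = w \<and> hdM w = e (Suc 0))"
    by (intro dfn_ex dfn_conj) (rule dfn2[OF dfn_tl_pow tdf_var tdf_var], rule dfn2[OF dfn_hdM tdf_var tdf_var])
  then show ?thesis by (simp add: env_def)
qed

lemma dfn_mval_env: "dfn (\<lambda>e. mval M (env (e 0)) t = e (Suc 0))"
proof (induction t)
  case (Var i)
  then show ?case by (simp add: dfn_env)
next
  case (Plus t u)
  have "dfn (\<lambda>e. \<exists>x y. mval M (env (e 0)) t = x \<and> mval M (env (e 0)) u = y \<and> x \<oplus> y = e (Suc 0))"
    by (rule dfn_ex, rule dfn_ex, rule dfn_conj, rule dfn2[OF Plus(1) tdf_var tdf_var], rule dfn_conj,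
        rule dfn2[OF Plus(2) tdf_var tdf_var], intro dfn_eq tdf_var tdf_add)
  then show ?case by simp
next
  case (Times t u)
  have "dfn (\<lambda>e. \<exists>x y. mval M (env (e 0)) t = x \<and> mval M (env (e 0)) u = y \<and> x \<otimes> y = e (Suc 0))"
    by (rule dfn_ex, rule dfn_ex, rule dfn_conj, rule dfn2[OF Times(1) tdf_var tdf_var], rule dfn_conj,
        rule dfn2[OF Times(2) tdf_var tdf_var], intro dfn_eq tdf_var tdf_mul)
  then show ?case by simp
qed (simp_all add: dfn_eq tdf_var tdf_const)

lemma dfn_msat_env:
  assumes E: "range E \<subseteq> ms M"
  shows "arithmetical p \<Longrightarrow> dfn (\<lambda>e. msat M (env (e 0)) E p)"
proof (induction p)
  case (Equal t u)
  have "dfn (\<lambda>e. \<exists>x y. mval M (env (e 0)) t = x \<and> mval M (env (e 0)) u = y \<and> x = y)"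
    by (rule dfn_ex, rule dfn_ex, rule dfn_conj, rule dfn2[OF dfn_mval_env tdf_var tdf_var], rule dfn_conj,
        rule dfn2[OF dfn_mval_env tdf_var tdf_var], intro dfn_eq tdf_var)
  then show ?case by simp
next
  case (Less t u)
  have "dfn (\<lambda>e. \<exists>x y. mval M (env (e 0)) t = x \<and> mval M (env (e 0)) u = y \<and> x \<lhd> y)"
    by (rule dfn_ex, rule dfn_ex, rule dfn_conj, rule dfn2[OF dfn_mval_env tdf_var tdf_var], rule dfn_conj,
        rule dfn2[OF dfn_mval_env tdf_var tdf_var], intro dfn_less tdf_var)
  then show ?case by simp
next
  case (Mem t i)
  have "dfn (\<lambda>e. \<exists>x. mval M (env (e 0)) t = x \<and> x \<in> E i)"
    by (intro dfn_ex dfn_conj dfn_mem tdf_var) (use E in auto, rule dfn2[OF dfn_mval_env tdf_var tdf_var])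
  then show ?case by simp
next
  case (AllN p)
  then have "dfn (\<lambda>e. msat M (env (e 0)) E p)" by simp
  then have "dfn (\<lambda>e. \<forall>x. msat M (env (pJ x (e 0))) E p)"
    by (intro dfn_all) (rule dfn1, assumption, intro tdf_pJ tdf_var)
  then show ?case by simp
qed (auto intro: dfn_const dfn_imp)

text \<open>The intended content of a formula cell. Taking the least counterexample makes the value
  unique and arithmetically definable.\<close>

definition val :: "(nat \<Rightarrow> 'a set) \<Rightarrow> fm \<Rightarrow> 'a \<Rightarrow> 'a \<Rightarrow> bool" where
  "val E p c v \<longleftrightarrow> (if msat M (env c) E p then v = \<zero> else
     (case p of AllN q \<Rightarrow> \<exists>w. v = suc w \<and> \<not> msat M (env (pJ w c)) E q \<and>
         (\<forall>x. \<not> msat M (env (pJ x c)) E q \<longrightarrow> w \<unlhd> x)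
      | _ \<Rightarrow> v = \<one>))"

lemma dfn_val:
  assumes E: "range E \<subseteq> ms M" and p: "arithmetical p"
  shows "dfn (\<lambda>e. val E p (e 0) (e (Suc 0)))"
proof -
  have a: "dfn (\<lambda>e. msat M (env (e 0)) E p)" by (rule dfn_msat_env[OF E p])
  have "dfn (\<lambda>e. case p of AllN q \<Rightarrow> \<exists>w. e (Suc 0) = suc w \<and> \<not> msat M (env (pJ w (e 0))) E q \<and>
         (\<forall>x. \<not> msat M (env (pJ x (e 0))) E q \<longrightarrow> w \<unlhd> x)
      | _ \<Rightarrow> e (Suc 0) = \<one>)"
  proof (cases p)
    case (AllN q)
    then have q: "dfn (\<lambda>e. msat M (env (e 0)) E q)" using p by (intro dfn_msat_env[OF E]) simp
    show ?thesis unfolding AllN fm.case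
      by (intro dfn_intros tdf_const) ((rule dfn1[OF q], intro tdf_pJ tdf_var)+)
  qed (auto intro!: dfn_eq tdf_var tdf_const)
  then have "dfn (\<lambda>e. (msat M (env (e 0)) E p \<longrightarrow> e (Suc 0) = \<zero>) \<and> (\<not> msat M (env (e 0)) E p \<longrightarrow>
     (case p of AllN q \<Rightarrow> \<exists>w. e (Suc 0) = suc w \<and> \<not> msat M (env (pJ w (e 0))) E q \<and>
         (\<forall>x. \<not> msat M (env (pJ x (e 0))) E q \<longrightarrow> w \<unlhd> x)
      | _ \<Rightarrow> e (Suc 0) = \<one>)))"
    using a by (intro dfn_conj dfn_imp dfn_neg dfn_eq tdf_var tdf_const)
  moreover have "val E p c v \<longleftrightarrow> (msat M (env c) E p \<longrightarrow> v = \<zero>) \<and> (\<not> msat M (env c) E p \<longrightarrow>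
     (case p of AllN q \<Rightarrow> \<exists>w. v = suc w \<and> \<not> msat M (env (pJ w c)) E q \<and>
         (\<forall>x. \<not> msat M (env (pJ x c)) E q \<longrightarrow> w \<unlhd> x)
      | _ \<Rightarrow> v = \<one>))" for c v by (simp add: val_def)
  ultimately show ?thesis by (simp only:)
qed

lemma val_ex1:
  assumes E: "range E \<subseteq> ms M" and p: "arithmetical p"
  shows "\<exists>!v. val E p c v"
proof (cases "msat M (env c) E p")
  case False
  show ?thesis
  proof (cases "\<exists>q. p = AllN q")
    case True
    then obtain q where q: "p = AllN q" by blast
    let ?P = "\<lambda>w. \<not> msat M (env (pJ w c)) E q"
    have "dfn (\<lambda>e. msat M (env (e 0)) E q)" using p q by (intro dfn_msat_env[OF E]) simp
    from dfn1[OF this] have d: "dfn (\<lambda>e. ?P (e 0))" by (intro dfn_neg) (blast intro: tdf_pJ tdf_var tdf_const)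
    obtain x where "?P x" using False q by auto
    from least[of ?P, OF d this] obtain w where w: "?P w" "\<And>z. ?P z \<Longrightarrow> w \<unlhd> z" by blast
    have "val E p c v \<longleftrightarrow> v = suc w" for v
    proof -
      have "val E p c v \<longleftrightarrow> (\<exists>w. v = suc w \<and> ?P w \<and> (\<forall>x. ?P x \<longrightarrow> w \<unlhd> x))"
        by (simp only: val_def q False[unfolded q] if_False fm.case)
      also have "\<dots> \<longleftrightarrow> v = suc w" using w leq_antisym by metis
      finally show ?thesis .
    qed
    then show ?thesis by simp
  qed (use False p in \<open>cases p; simp add: val_def\<close>)
qed (simp add: val_def)

lemma val_0: "val E p c v \<Longrightarrow> v = \<zero> \<longleftrightarrow> msat M (env c) E p"
  by (cases p) (auto simp: val_def split: if_splits)

lemma val_zero [simp]: "val E p c \<zero> \<longleftrightarrow> msat M (env c) E p"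
  by (cases p) (auto simp: val_def)

lemma model_total:
  assumes E: "range E \<subseteq> ms M" and F: "total F" and p: "arithmetical p"
  obtains H where "total H" "\<And>i v. pJ (pJ \<zero> i) v \<in> H \<longleftrightarrow> pJ i v \<in> F"
    "\<And>j x v. j < s \<Longrightarrow> pJ (pJ \<one> (pJ (nv j) x)) v \<in> H \<longleftrightarrow> v = (if x \<in> E j then \<zero> else \<one>)"
    "\<And>q c v. q \<in> subs p \<Longrightarrow> pJ (pJ (tv q) c) v \<in> H \<longleftrightarrow> val E q c v"
proof -
  define A where "A = (\<lambda>c. \<exists>i. c = pJ \<zero> i)"
  define B where "B = (\<lambda>c. \<exists>j\<in>{..<s}. \<exists>x. c = pJ \<one> (pJ (nv j) x))"
  define C where "C = (\<lambda>c. \<exists>q\<in>subs p. \<exists>d. c = pJ (tv q) d)"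
  define R where "R = (\<lambda>c v. (\<exists>i. c = pJ \<zero> i \<and> pJ i v \<in> F) \<or>
     (\<exists>j\<in>{..<s}. \<exists>x. c = pJ \<one> (pJ (nv j) x) \<and> (x \<in> E j \<and> v = \<zero> \<or> \<not> x \<in> E j \<and> v = \<one>)) \<or>
     (\<exists>q\<in>subs p. \<exists>d. c = pJ (tv q) d \<and> val E q d v) \<or>
     (\<not> A c \<and> \<not> B c \<and> \<not> C c \<and> v = \<zero>))"
  define H where "H = {y. \<exists>c v. y = pJ c v \<and> R c v}"
  have HR: "pJ c v \<in> H \<longleftrightarrow> R c v" for c v by (auto simp: H_def)
  have Ej: "E j \<in> ms M" for j using E by auto
  have Fm: "F \<in> ms M" using F by (simp add: total_def)
  have "dfn (\<lambda>e. R (e 0) (e (Suc 0)))"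
    unfolding R_def A_def B_def C_def
    by (intro dfn_disj dfn_conj dfn_neg dfn_ex dfn_bex finite_subs finite_lessThan dfn_eq dfn_mem
        Ej Fm tdf_pJ tdf_var tdf_const)
      (auto intro!: dfn2[OF dfn_val[OF E]] tdf_var subs_arithmetical[OF _ p])
  then have "H \<in> ms M"
    unfolding H_def by (intro compI dfn_ex dfn_conj dfn_eq tdf_var tdf_pJ) (rule dfn2, assumption, rule tdf_var, rule tdf_var)
  moreover have 1: "R (pJ \<zero> i) v \<longleftrightarrow> pJ i v \<in> F" for i v
    by (simp add: R_def A_def)
  moreover have 2: "R (pJ \<one> (pJ (nv j) x)) v \<longleftrightarrow> v = (if x \<in> E j then \<zero> else \<one>)" if "j < s" for j x v
    using that by (auto simp: R_def A_def B_def)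
  moreover have 3: "R (pJ (tv q) c) v \<longleftrightarrow> val E q c v" if "q \<in> subs p" for q c v
    using that by (auto simp: R_def A_def B_def C_def)
  moreover have "\<exists>!v. R c v" for c
  proof -
    consider "A c" | "B c" | "C c" | "\<not> A c" "\<not> B c" "\<not> C c" by blast
    then show ?thesis
    proof cases
      case 1
      then obtain i where i: "c = pJ \<zero> i" unfolding A_def by blast
      have "\<exists>!v. pJ i v \<in> F" using F by (simp add: total_def)
      then show ?thesis using \<open>\<And>v i. R (pJ \<zero> i) v \<longleftrightarrow> pJ i v \<in> F\<close> by (simp add: i)
    next
      case 2
      then obtain j x where "j < s" "c = pJ \<one> (pJ (nv j) x)" unfolding B_def by blast
      then show ?thesis using \<open>\<And>x v j. j < s \<Longrightarrow> R (pJ \<one> (pJ (nv j) x)) v \<longleftrightarrow> v = (if x \<in> E j then \<zero> else \<one>)\<close> by auto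
    next
      case 3
      then obtain q d where "q \<in> subs p" "c = pJ (tv q) d" unfolding C_def by blast
      then show ?thesis
        using \<open>\<And>v q c. q \<in> subs p \<Longrightarrow> R (pJ (tv q) c) v \<longleftrightarrow> val E q c v\<close> val_ex1[OF E subs_arithmetical[OF _ p]] by auto
    next
      case 4
      then have "R c v \<longleftrightarrow> v = \<zero>" for v by (auto simp: R_def A_def B_def C_def)
      then show ?thesis by simp
    qed
  qed
  ultimately show ?thesis using that[of H] unfolding total_def HR by blast
qed

lemma model_cs:
  assumes H: "\<And>j x v. j < s \<Longrightarrow> pJ (pJ \<one> (pJ (nv j) x)) v \<in> H \<longleftrightarrow> v = (if x \<in> E j then \<zero> else \<one>)"
    "\<And>q c v. q \<in> subs p \<Longrightarrow> pJ (pJ (tv q) c) v \<in> H \<longleftrightarrow> val E q c v"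
  shows "subs q \<subseteq> subs p \<Longrightarrow> fm_bd N s q \<Longrightarrow> K \<in> set (cs q N) \<Longrightarrow> pcon H K"
proof (induction q arbitrary: N)
  case (Equal t u)
  have "mval M (env (lcv e N)) t = mval M e t" "mval M (env (lcv e N)) u = mval M e u" for e
    using Equal.prems by (auto intro!: mval_cong[of N] env_lcv)
  then show ?case using Equal.prems by (auto simp: pcon_def H(2) dest!: val_0)
next
  case (Less t u)
  have "mval M (env (lcv e N)) t = mval M e t" "mval M (env (lcv e N)) u = mval M e u" for e
    using Less.prems by (auto intro!: mval_cong[of N] env_lcv)
  then show ?case using Less.prems by (auto simp: pcon_def H(2) dest!: val_0)
next
  case (Mem t i)
  have "mval M (env (lcv e N)) t = mval M e t" for e
    using Mem.prems by (auto intro!: mval_cong[of N] env_lcv)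
  then show ?case using Mem.prems by (auto simp: pcon_def H dest!: val_0 split: if_splits)
next
  case Falsum
  then show ?case by (auto simp: pcon_def H(2) dest!: val_0)
next
  case (Imp q1 q2)
  have "Imp q1 q2 \<in> subs p" "q1 \<in> subs p" "q2 \<in> subs p"
    using Imp.prems(1) subs_refl[of q1] subs_refl[of q2] by auto
  then have "pcon H (4, [(fcell (Imp q1 q2) (Var 0), Var 1), (fcell q1 (Var 0), Var 2),
     (fcell q2 (Var 0), Var 3)], fIff (isz 1) (Imp (isz 2) (isz 3)))"
    by (auto simp: pcon_def H(2) dest!: val_0)
  then show ?case using Imp by auto
next
  case (AllN q)
  have s: "AllN q \<in> subs p" "q \<in> subs p"
    using AllN.prems(1) subs_refl[of q] by auto
  have 1: "pcon H (4, [(fcell (AllN q) (Var 0), Var 1), (fcell q (Jt (Var 2) (Var 0)), Var 3)],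
     Imp (isz 1) (isz 3))"
    using s by (auto simp: pcon_def H(2) dest!: val_0)
  have 2: "pcon H (3, [(fcell (AllN q) (Var 0), tsuc (Var 1)),
     (fcell q (Jt (Var 1) (Var 0)), Var 2)], Neg (isz 2))"
  proof -
    have "\<not> msat M (env (pJ w c)) E q" if "val E (AllN q) c (suc w)" for w c
      using that by (simp add: val_def split: if_splits)
    then show ?thesis using s by (auto simp: pcon_def H(2) simp del: env_pJ)
  qed
  show ?case using AllN 1 2 by auto
qed auto

lemma model_path:
  assumes E: "range E \<subseteq> ms M" and p: "arithmetical p" "fm_bd 1 s p" and z: "z < s"
    and sat: "msat M (\<lambda>_. n) E p" and F: "descending F (E z)"
  shows "\<exists>H. path (dcon z # cs p 1) (pJ (tv p) (pJ n \<zero>)) H"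
proof -
  have "total F" using F by (simp add: descending_def)
  from model_total[OF E this p(1), of s] obtain H where H: "total H"
    "\<And>i v. pJ (pJ \<zero> i) v \<in> H \<longleftrightarrow> pJ i v \<in> F"
    "\<And>j x v. j < s \<Longrightarrow> pJ (pJ \<one> (pJ (nv j) x)) v \<in> H \<longleftrightarrow> v = (if x \<in> E j then \<zero> else \<one>)"
    "\<And>q c v. q \<in> subs p \<Longrightarrow> pJ (pJ (tv q) c) v \<in> H \<longleftrightarrow> val E q c v" by metis
  have "pcon H (dcon z)"
    using F by (auto simp: pcon_def dcon_def H(2) H(3)[OF z] descending_def)
  moreover have "\<forall>K\<in>set (cs p 1). pcon H K" using model_cs[OF H(3,4) order_refl p(2)] by blast
  moreover have "msat M (case_nat n (env \<zero>)) E p"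
    using sat msat_cong[OF p(2), of "case_nat n (env \<zero>)" "\<lambda>_. n" E E] by simp
  then have "pJ (pJ (tv p) (pJ n \<zero>)) \<zero> \<in> H" by (simp add: H(4) val_def)
  ultimately show ?thesis unfolding path_def using H(1) by auto
qed

end

section \<open>Countable ordinals\<close>

lemma otype_le: "Well_order r \<Longrightarrow> Well_order s \<Longrightarrow> otype r \<le> otype s \<longleftrightarrow> (r, s) \<in> ordLeq"
  by transfer simp

lemma otype_less: "Well_order r \<Longrightarrow> Well_order s \<Longrightarrow> otype r < otype s \<longleftrightarrow> (r, s) \<in> ordLess"
  by transfer simp

lemma otype_surj: "\<exists>r. Well_order r \<and> otype r = a"
proof -
  have "Quotient (\<lambda>r s. (r, s) \<in> ordIso) abs_ord rep_ord cr_ord" by (rule Quotient_ord)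
  then have "(rep_ord a, rep_ord a) \<in> ordIso" "abs_ord (rep_ord a) = a"
    using Quotient_rep_reflp Quotient_abs_rep by fastforce+
  moreover from this have "Well_order (rep_ord a)" by (simp add: ordIso_def)
  ultimately show ?thesis by (intro exI[of _ "rep_ord a"]) (simp add: otype_def)
qed

text \<open>The image need not be an initial segment, which makes such maps easier to produce than
  embeddings.\<close>

definition smono :: "('b \<Rightarrow> 'c) \<Rightarrow> 'b rel \<Rightarrow> 'c rel \<Rightarrow> bool" where
  "smono f r s \<longleftrightarrow> (\<forall>x y. (x, y) \<in> r \<longrightarrow> x \<noteq> y \<longrightarrow> (f x, f y) \<in> s \<and> f x \<noteq> f y) \<and> f ` Field r \<subseteq> Field s"

lemma wf_no_descent:
  assumes "Well_order r" "\<And>i. (a (Suc i), a i) \<in> r \<and> a (Suc i) \<noteq> a i" shows False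
proof -
  have "wf (r - Id)" using assms(1) by (simp add: well_order_on_def)
  then show False unfolding wf_iff_no_infinite_down_chain using assms(2) by blast
qed

lemma ordLess_smono:
  assumes "(r, s) \<in> ordLess"
  shows "\<exists>f z. smono f r s \<and> z \<in> Field s \<and> (\<forall>x\<in>Field r. (f x, z) \<in> s \<and> f x \<noteq> z)"
proof -
  have rs: "Well_order r" "Well_order s" using assms by (auto simp: ordLess_def)
  then obtain z where z: "z \<in> Field s" "(r, Restr s (underS s z)) \<in> ordIso"
    using ordLess_iff_ordIso_Restr assms by blast
  then obtain f where f: "iso r (Restr s (underS s z)) f" by (auto simp: ordIso_def)
  have F: "Field (Restr s (underS s z)) \<subseteq> underS s z" by (auto simp: Field_def)
  have bij: "bij_betw f (Field r) (Field (Restr s (underS s z)))" using f by (simp add: iso_def)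
  have img: "f ` Field r \<subseteq> underS s z" using bij F by (auto simp: bij_betw_def)
  have "(f x, f y) \<in> s \<and> f x \<noteq> f y" if "(x, y) \<in> r" "x \<noteq> y" for x y
  proof -
    have e: "embed r (Restr s (underS s z)) f" using f by (simp add: iso_def)
    have "compat r (Restr s (underS s z)) f" using e by (rule embed_compat)
    then have "(f x, f y) \<in> s" using that by (auto simp: compat_def)
    moreover have "x \<in> Field r" "y \<in> Field r" using that by (auto simp: Field_def)
    ultimately show ?thesis using bij that(2) by (auto simp: bij_betw_def inj_on_def)
  qed
  moreover have "underS s z \<subseteq> Field s" by (auto simp: underS_def Field_def)
  ultimately have "smono f r s" using img unfolding smono_def by blast
  then show ?thesis using z(1) img by (intro exI[of _ f] exI[of _ z]) (auto simp: underS_def)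
qed

lemma ordLeq_smono: assumes "(r, s) \<in> ordLeq" shows "\<exists>f. smono f r s"
proof (cases "(r, s) \<in> ordLess")
  case True
  then show ?thesis using ordLess_smono by blast
next
  case False
  then obtain f where f: "iso r s f" "Well_order r"
    using assms by (auto simp: ordLeq_iff_ordLess_or_ordIso ordIso_def)
  have bij: "bij_betw f (Field r) (Field s)" using f by (simp add: iso_def)
  have "(f x, f y) \<in> s \<and> f x \<noteq> f y" if "(x, y) \<in> r" "x \<noteq> y" for x y
  proof -
    have "compat r s f" using f by (simp add: iso_def embed_compat)
    then have "(f x, f y) \<in> s" using that by (auto simp: compat_def)
    moreover have "x \<in> Field r" "y \<in> Field r" using that by (auto simp: Field_def)
    ultimately show ?thesis using bij that(2) by (auto simp: bij_betw_def inj_on_def)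
  qed
  then show ?thesis using bij unfolding smono_def by (intro exI[of _ f]) (auto simp: bij_betw_def)
qed

text \<open>Otherwise \<open>s\<close> maps strictly below some \<open>z\<close> in
  \<open>r\<close>; composing with \<open>f\<close> and iterating from \<open>z\<close> descends
  forever in \<open>r\<close>.\<close>

lemma smono_ordLeq:
  assumes r: "Well_order r" and s: "Well_order s" and f: "smono f r s"
  shows "(r, s) \<in> ordLeq"
proof (rule ccontr)
  assume "(r, s) \<notin> ordLeq"
  then have "(s, r) \<in> ordLess" using not_ordLeq_iff_ordLess[OF s r] by blast
  then obtain g z where g: "smono g s r" "z \<in> Field r" "\<forall>x\<in>Field s. (g x, z) \<in> r \<and> g x \<noteq> z"
    using ordLess_smono by blast
  let ?h = "\<lambda>x. g (f x)"
  have h: "(x, y) \<in> r \<Longrightarrow> x \<noteq> y \<Longrightarrow> (?h x, ?h y) \<in> r \<and> ?h x \<noteq> ?h y" for x y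
    using f g(1) unfolding smono_def by blast
  have fz: "f z \<in> Field s" using f g(2) unfolding smono_def by blast
  have "((?h ^^ Suc i) z, (?h ^^ i) z) \<in> r \<and> (?h ^^ Suc i) z \<noteq> (?h ^^ i) z" for i
  proof (induction i)
    case 0
    then show ?case using g(3) fz by simp
  next
    case (Suc i)
    then show ?case using h by simp
  qed
  then show False using wf_no_descent[OF r, of "\<lambda>i. (?h ^^ i) z"] by blast
qed

section \<open>Ordered sums and bounds for countable sets of ordinals\<close>

definition osum :: "(nat \<Rightarrow> nat rel) \<Rightarrow> nat rel" where
  "osum R = {(prod_encode (i, x), prod_encode (j, y)) | i x j y. x \<in> Field (R i) \<and> y \<in> Field (R j) \<and>
     (i < j \<or> i = j \<and> (x, y) \<in> R i)}"

lemma osum_iff: "(prod_encode (i, x), prod_encode (j, y)) \<in> osum R \<longleftrightarrow>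
    x \<in> Field (R i) \<and> y \<in> Field (R j) \<and> (i < j \<or> i = j \<and> (x, y) \<in> R i)"
  by (auto simp: osum_def)

lemma wo_facts:
  assumes "Well_order r"
  shows "\<And>x. x \<in> Field r \<Longrightarrow> (x, x) \<in> r" "trans r" "antisym r"
    "\<And>x y. x \<in> Field r \<Longrightarrow> y \<in> Field r \<Longrightarrow> (x, y) \<in> r \<or> (y, x) \<in> r" "wf (r - Id)"
proof -
  have w: "refl_on (Field r) r" "trans r" "antisym r" "total_on (Field r) r" "wf (r - Id)"
    using assms by (auto simp: order_on_defs)
  show "\<And>x. x \<in> Field r \<Longrightarrow> (x, x) \<in> r" using w(1) by (auto simp: refl_on_def)
  then show "\<And>x y. x \<in> Field r \<Longrightarrow> y \<in> Field r \<Longrightarrow> (x, y) \<in> r \<or> (y, x) \<in> r"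
    using w(4) unfolding total_on_def by metis
qed (use assms in \<open>auto simp: order_on_defs\<close>)

lemma Well_orderI:
  assumes "\<And>x y. (x, y) \<in> r \<Longrightarrow> (x, x) \<in> r \<and> (y, y) \<in> r" "trans r" "antisym r"
    "\<And>x y. (x, x) \<in> r \<Longrightarrow> (y, y) \<in> r \<Longrightarrow> (x, y) \<in> r \<or> (y, x) \<in> r" "wf (r - Id)"
  shows "Well_order r"
proof -
  have F: "x \<in> Field r \<Longrightarrow> (x, x) \<in> r" for x using assms(1) by (auto simp: Field_def)
  then have "refl_on (Field r) r" by (auto simp: refl_on_def)
  moreover have "total_on (Field r) r" using F assms(4) by (auto simp: total_on_def)
  ultimately show ?thesis using assms(2,3,5)
    by (auto simp: order_on_defs intro: FieldI1 FieldI2)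
qed

lemma Well_order_osum:
  assumes R: "\<And>i. Well_order (R i)" shows "Well_order (osum R)"
proof (rule Well_orderI)
  note w = wo_facts[OF R]
  have dec: "\<exists>i x. n = prod_encode (i, x)" for n by (metis prod_decode_inverse surj_pair)
  show "(m, n) \<in> osum R \<Longrightarrow> (m, m) \<in> osum R \<and> (n, n) \<in> osum R" for m n
    using dec[of m] dec[of n] w(1) by (auto simp: osum_iff)
  show "trans (osum R)"
  proof (rule transI)
    fix l m n assume "(l, m) \<in> osum R" "(m, n) \<in> osum R"
    moreover obtain i x j y k z where "l = prod_encode (i, x)" "m = prod_encode (j, y)" "n = prod_encode (k, z)"
      using dec by metis
    ultimately show "(l, n) \<in> osum R" using w(2) by (auto simp: osum_iff dest: transD)
  qed
  show "antisym (osum R)"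
  proof (rule antisymI)
    fix l m assume "(l, m) \<in> osum R" "(m, l) \<in> osum R"
    moreover obtain i x j y where "l = prod_encode (i, x)" "m = prod_encode (j, y)" using dec by metis
    ultimately show "l = m" using w(3) by (auto simp: osum_iff dest: antisymD)
  qed
  show "(m, n) \<in> osum R \<or> (n, m) \<in> osum R" if "(m, m) \<in> osum R" "(n, n) \<in> osum R" for m n
  proof -
    obtain i x j y where "m = prod_encode (i, x)" "n = prod_encode (j, y)" using dec by metis
    then show ?thesis using that w(4)[of x i y] by (cases i j rule: linorder_cases) (auto simp: osum_iff)
  qed
  show "wf (osum R - Id)"
  proof (rule wf_subset)
    let ?S = "Sigma UNIV (\<lambda>i. R i - Id)"
    have "wf {((i, x), (j, y)). i < (j :: nat) \<or> i = j \<and> (x, y) \<in> R i - Id}"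
    proof -
      have "wf (same_fst (\<lambda>_. True) (\<lambda>i. R i - Id))" by (rule wf_same_fst) (use w(5) in auto)
      then have "wf (inv_image less_than fst \<union> same_fst (\<lambda>_. True) (\<lambda>i. R i - Id))"
        by (intro wf_union_compatible wf_inv_image wf_less_than) (auto simp: same_fst_def)
      then show ?thesis by (rule wf_subset) (auto simp: same_fst_def)
    qed
    then show "wf (inv_image {((i, x), (j, y)). i < (j :: nat) \<or> i = j \<and> (x, y) \<in> R i - Id} prod_decode)"
      by (rule wf_inv_image)
    show "osum R - Id \<subseteq> inv_image {((i, x), (j, y)). i < (j :: nat) \<or> i = j \<and> (x, y) \<in> R i - Id} prod_decode"
      by (auto simp: osum_def)
  qed
qed

lemma osum_le:
  assumes R: "\<And>i. Well_order (R i)" shows "otype (R i) \<le> otype (osum R)"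
proof -
  have "smono (\<lambda>x. prod_encode (i, x)) (R i) (osum R)"
    unfolding smono_def
  proof (intro conjI allI impI image_subsetI)
    fix x assume "x \<in> Field (R i)"
    then have "(prod_encode (i, x), prod_encode (i, x)) \<in> osum R"
      using wo_facts(1)[OF R] by (simp add: osum_iff)
    then show "prod_encode (i, x) \<in> Field (osum R)" by (auto simp: Field_def)
  qed (auto simp: osum_iff Field_def)
  then show ?thesis using R Well_order_osum[OF R] by (simp add: otype_le smono_ordLeq)
qed

definition osuc :: "nat rel \<Rightarrow> nat rel" where
  "osuc r = osum (\<lambda>i. if i = 0 then r else if i = 1 then {(0, 0)} else {})"

lemma Well_order_osuc_aux: "Well_order r \<Longrightarrow> Well_order (if i = 0 then r else if i = (1 :: nat) then {(0 :: nat, 0)} else {})"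
  by (auto simp: order_on_defs refl_on_def total_on_def trans_def antisym_def)

lemma Well_order_osuc: "Well_order r \<Longrightarrow> Well_order (osuc r)"
  unfolding osuc_def by (rule Well_order_osum) (rule Well_order_osuc_aux)

text \<open>A strictly monotone map from the prolonged order into \<open>r\<close> sends the last
  element to some \<open>a\<close> and moves \<open>a\<close> strictly down, so iteration from
  \<open>a\<close> descends forever.\<close>

lemma osuc_less: assumes r: "Well_order r" shows "otype r < otype (osuc r)"
proof (rule ccontr)
  assume "\<not> ?thesis"
  then have "(osuc r, r) \<in> ordLeq" using r by (simp add: otype_le[symmetric] Well_order_osuc)
  then obtain f where f: "smono f (osuc r) r" using ordLeq_smono by blast
  let ?h = "\<lambda>x. f (prod_encode (0, x))"
  have F: "x \<in> Field r \<Longrightarrow> (prod_encode (0, x), prod_encode (1, 0)) \<in> osuc r" for x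
    by (auto simp: osuc_def osum_iff Field_def)
  have F1: "(prod_encode (1, 0), prod_encode (1, 0)) \<in> osuc r"
    by (auto simp: osuc_def osum_iff Field_def)
  define a where "a = f (prod_encode (1, 0))"
  have a: "a \<in> Field r" using f F1 unfolding smono_def a_def by (blast intro: FieldI1)
  have h: "x \<in> Field r \<Longrightarrow> ?h x \<in> Field r" for x
    using f F unfolding smono_def by (blast intro: FieldI1)
  have "((?h ^^ Suc i) a, (?h ^^ i) a) \<in> r \<and> (?h ^^ Suc i) a \<noteq> (?h ^^ i) a \<and> (?h ^^ i) a \<in> Field r" for i
  proof (induction i)
    case 0
    then show ?case using f F[OF a] a unfolding smono_def by (simp add: a_def)
  next
    case (Suc i)
    have "x \<noteq> y \<Longrightarrow> (x, y) \<in> r \<Longrightarrow> (?h x, ?h y) \<in> r \<and> ?h x \<noteq> ?h y" for x y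
    proof -
      assume "x \<noteq> y" "(x, y) \<in> r"
      then have "(prod_encode (0, x), prod_encode (0, y)) \<in> osuc r"
        by (auto simp: osuc_def osum_iff Field_def)
      then show ?thesis using f \<open>x \<noteq> y\<close> unfolding smono_def by fastforce
    qed
    then show ?case using Suc h by simp
  qed
  then show False using wf_no_descent[OF r, of "\<lambda>i. (?h ^^ i) a"] by blast
qed

text \<open>The ordered sum of representatives, prolonged by a last element, is longer than each of
  them.\<close>

lemma ord_bound: assumes "countable (A :: ord set)" shows "\<exists>b. \<forall>a\<in>A. a < b"
proof (cases "A = {}")
  case False
  from otype_surj have "\<forall>a. \<exists>r. Well_order r \<and> otype r = a" by blast
  from choice[OF this] obtain r where r: "\<And>a :: ord. Well_order (r a)" "\<And>a. otype (r a) = a" by blast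
  let ?R = "\<lambda>i. r (from_nat_into A i)"
  have "a < otype (osuc (osum ?R))" if a: "a \<in> A" for a
  proof -
    obtain i where "from_nat_into A i = a" using from_nat_into_surj[OF assms a] by blast
    then have "a \<le> otype (osum ?R)" using osum_le[of ?R i] r by simp
    also have "\<dots> < otype (osuc (osum ?R))" by (intro osuc_less Well_order_osum r)
    finally show ?thesis .
  qed
  then show ?thesis by blast
qed simp

lemma presents_unique: "presents A r \<Longrightarrow> presents A s \<Longrightarrow> r = s"
  unfolding presents_def by (auto simp: set_eq_iff)

text \<open>\<open>LEAST\<close> is meaningful only if some bound exists. There are countably many
  formulas, and each presents at most one order.\<close>

lemma pt_ordinal_bound: "presents A r \<Longrightarrow> T \<turnstile> WO A \<Longrightarrow> otype r \<le> pt_ordinal T"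
proof -
  let ?P = "\<lambda>b. \<forall>A r. presents A r \<and> T \<turnstile> WO A \<longrightarrow> otype r \<le> b"
  let ?f = "\<lambda>A. otype (THE r. presents A r)"
  have "countable (range ?f)" by simp
  then obtain b where b: "\<forall>a\<in>range ?f. a < b" using ord_bound by blast
  have "presents A r \<Longrightarrow> otype r = ?f A" for A r
    using presents_unique by (intro arg_cong[of _ _ otype] the_equality[symmetric])
  then have "?P b" using b by (metis order_less_imp_le rangeI)
  then have "?P (pt_ordinal T)" unfolding pt_ordinal_def by (rule LeastI)
  then show "presents A r \<Longrightarrow> T \<turnstile> WO A \<Longrightarrow> otype r \<le> pt_ordinal T" by blast
qed

lemma pt_ordinal_le: "(\<And>A r. presents A r \<Longrightarrow> T \<turnstile> WO A \<Longrightarrow> otype r \<le> b) \<Longrightarrow> pt_ordinal T \<le> b"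
  unfolding pt_ordinal_def by (rule Least_le) blast

section \<open>Formal well-orders\<close>

definition arel :: "'a model \<Rightarrow> fm \<Rightarrow> 'a \<Rightarrow> 'a \<Rightarrow> bool" where
  "arel M A x y \<longleftrightarrow> msat M (case_nat x (\<lambda>_. y)) (\<lambda>_. {}) A"

definition LOm :: "('a \<Rightarrow> 'a \<Rightarrow> bool) \<Rightarrow> bool" where
  "LOm R \<longleftrightarrow> (\<forall>x y. R x y \<longrightarrow> R x x \<and> R y y) \<and> (\<forall>x y. R x y \<and> R y x \<longrightarrow> x = y) \<and>
     (\<forall>x y z. R x y \<and> R y z \<longrightarrow> R x z) \<and> (\<forall>x y. R x x \<and> R y y \<longrightarrow> R x y \<or> R y x)"

definition WOm :: "'a model \<Rightarrow> ('a \<Rightarrow> 'a \<Rightarrow> bool) \<Rightarrow> bool" where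
  "WOm M R \<longleftrightarrow> LOm R \<and> (\<forall>X\<in>ms M. (\<exists>x\<in>X. R x x) \<longrightarrow> (\<exists>x\<in>X. R x x \<and> (\<forall>y\<in>X. R y y \<longrightarrow> R x y)))"

lemma msat_inst2:
  assumes "fm_bd 2 0 A"
  shows "msat M e E (inst2 A t u) \<longleftrightarrow> arel M A (mval M e t) (mval M e u)"
  unfolding inst2_def msat_substN_0 unfolding fm_substN_fsub msat_fsub arel_def
  by (rule msat_cong[OF assms]) (auto simp: less_2_cases_iff)

lemma LO_f: "LO A =
  fAnd (AllN (AllN (Imp (inst2 A (Var 1) (Var 0)) (fAnd (inst2 A (Var 1) (Var 1)) (inst2 A (Var 0) (Var 0))))))
 (fAnd (AllN (AllN (Imp (fAnd (inst2 A (Var 1) (Var 0)) (inst2 A (Var 0) (Var 1))) (Equal (Var 1) (Var 0)))))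
 (fAnd (AllN (AllN (AllN (Imp (fAnd (inst2 A (Var 2) (Var 1)) (inst2 A (Var 1) (Var 0))) (inst2 A (Var 2) (Var 0))))))
   (AllN (AllN (Imp (fAnd (inst2 A (Var 1) (Var 1)) (inst2 A (Var 0) (Var 0)))
     (fOr (inst2 A (Var 1) (Var 0)) (inst2 A (Var 0) (Var 1))))))))"
  by (simp only: LO_def f_defs)

lemma WO_f: "WO A = AllS (fAnd (LO A)
     (Imp (fEx (fAnd (Mem (Var 0) 0) (inst2 A (Var 0) (Var 0))))
          (fEx (fAnd (fAnd (Mem (Var 0) 0) (inst2 A (Var 0) (Var 0)))
                    (AllN (Imp (fAnd (Mem (Var 0) 0) (inst2 A (Var 0) (Var 0)))
                               (inst2 A (Var 1) (Var 0))))))))"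
  by (simp only: WO_def f_defs)

lemma msat_LO:
  assumes "fm_bd 2 0 A" shows "msat M e E (LO A) \<longleftrightarrow> LOm (arel M A)"
  unfolding LO_f by (simp add: msat_inst2[OF assms] LOm_def numeral_2_eq_2)

lemma msat_WO:
  assumes "fm_bd 2 0 A" "ms M \<noteq> {}" shows "msat M e E (WO A) \<longleftrightarrow> WOm M (arel M A)"
proof -
  have "msat M e E (WO A) \<longleftrightarrow> (\<forall>X\<in>ms M. LOm (arel M A) \<and> ((\<exists>x. x \<in> X \<and> arel M A x x) \<longrightarrow>
     (\<exists>x. (x \<in> X \<and> arel M A x x) \<and> (\<forall>y. y \<in> X \<and> arel M A y y \<longrightarrow> arel M A x y))))"
    unfolding WO_f by (simp add: msat_LO[OF assms(1)] msat_inst2[OF assms(1)])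
  moreover have "(\<forall>X\<in>S. P \<and> Q X) \<longleftrightarrow> P \<and> (\<forall>X\<in>S. Q X)" if "S \<noteq> {}" for S P and Q :: "'a set \<Rightarrow> bool"
    using that by blast
  ultimately show ?thesis unfolding WOm_def Bex_def Ball_def using assms(2) by (simp add: conj_assoc imp_conjL)
qed

lemma tm_bd_tsub: "tm_bd n t \<Longrightarrow> (\<And>i. i < n \<Longrightarrow> tm_bd n' (\<tau> i)) \<Longrightarrow> tm_bd n' (tsub \<tau> t)"
  by (induction t) auto

lemma fm_bd_fsub:
  "fm_bd n s p \<Longrightarrow> (\<And>i. i < n \<Longrightarrow> tm_bd n' (\<tau> i)) \<Longrightarrow> (\<And>i. i < s \<Longrightarrow> \<upsilon> i < s') \<Longrightarrow> fm_bd n' s' (fsub \<tau> \<upsilon> p)"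
proof (induction p arbitrary: n s n' s' \<tau> \<upsilon>)
  case (Imp p q)
  then show ?case using Imp.IH[of n s n' \<tau> \<upsilon> s'] by auto
next
  case (AllN p)
  then show ?case
    using AllN.IH[of "Suc n" s "Suc n'" "upN \<tau>" \<upsilon> s'] by (auto simp: upN_def split: nat.split)
next
  case (AllS p)
  then show ?case
    using AllS.IH[of n "Suc s" n' \<tau> "upS \<upsilon>" "Suc s'"] by (auto simp: upS_def split: nat.split)
qed (auto intro: tm_bd_tsub)

lemma fm_bd_inst2 [simp]: "fm_bd 2 0 A \<Longrightarrow> tm_bd n t \<Longrightarrow> tm_bd n u \<Longrightarrow> fm_bd n s (inst2 A t u)"
proof -
  assume A: "fm_bd 2 0 A" and t: "tm_bd n t" and u: "tm_bd n u"
  have "fm_bd (Suc n) s (fm_substN 1 (tm_lift 0 u) A)"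
    unfolding fm_substN_fsub by (rule fm_bd_fsub[OF A]) (use u in \<open>auto simp: less_2_cases_iff\<close>)
  then show ?thesis unfolding inst2_def unfolding fm_substN_fsub[of 0]
    by (rule fm_bd_fsub) (use t in auto)
qed

lemma arithmetical_inst2 [simp]: "arithmetical (inst2 A t u) = arithmetical A"
  by (simp add: inst2_def fm_substN_fsub)

lemma sentence_WO: "fm_bd 2 0 A \<Longrightarrow> sentence (WO A)"
  by (simp add: sentence_def WO_def LO_def)

lemma Pi11_WO: "arithmetical A \<Longrightarrow> Pi11 (WO A)"
  unfolding WO_def by (intro Pi11.intros) (simp add: LO_def)

lemma Sigma01_arithmetical: "Sigma01 p \<Longrightarrow> arithmetical p"
  by (induction rule: Sigma01.induct) (auto simp: Delta00_arithmetical)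

lemma WOm_Well_order:
  assumes "WOm stdm R" shows "Well_order {(x, y). R x y}"
proof -
  have L: "\<And>x y. R x y \<Longrightarrow> R x x \<and> R y y" "\<And>x y. R x y \<Longrightarrow> R y x \<Longrightarrow> x = y"
    "\<And>x y z. R x y \<Longrightarrow> R y z \<Longrightarrow> R x z" "\<And>x y. R x x \<Longrightarrow> R y y \<Longrightarrow> R x y \<or> R y x"
    using assms unfolding WOm_def LOm_def by meson+
  have W: "\<And>X. (\<exists>x\<in>X. R x x) \<Longrightarrow> \<exists>x\<in>X. R x x \<and> (\<forall>y\<in>X. R y y \<longrightarrow> R x y)"
    using assms by (simp add: WOm_def)
  show ?thesis
  proof (rule Well_orderI)
    show "trans {(x, y). R x y}" "antisym {(x, y). R x y}"
      using L(2,3) unfolding trans_def antisym_def by blast+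
    show "wf ({(x, y). R x y} - Id)"
    proof (rule wfI_min)
      fix x and Q :: "nat set" assume x: "x \<in> Q"
      show "\<exists>z\<in>Q. \<forall>y. (y, z) \<in> {(x, y). R x y} - Id \<longrightarrow> y \<notin> Q"
      proof (cases "\<exists>x\<in>Q. R x x")
        case True
        from W[OF this] obtain z where z: "z \<in> Q" "\<forall>y\<in>Q. R y y \<longrightarrow> R z y" by blast
        have "y \<notin> Q" if "R y z" "y \<noteq> z" for y using z(2) L(1,2) that by blast
        then show ?thesis using z(1) by (intro bexI[of _ z]) auto
      next
        case False
        then have "R y x \<Longrightarrow> y \<notin> Q" for y using L(1) by blast
        then show ?thesis using x by (intro bexI[of _ x]) auto
      qed
    qed
  qed (use L(1,4) in auto)
qed

subsection \<open>The boundedness theorem\<close>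

text \<open>The root cell is that of \<open>p\<close> under the one-element assignment
  \<open>n\<close>; requiring the value 0 there searches for sets satisfying \<open>p\<close> with
  number variable 0 set to \<open>n\<close>.\<close>

definition Kf :: "fm \<Rightarrow> nat \<Rightarrow> tm \<Rightarrow> tm \<Rightarrow> tm \<Rightarrow> fm" where
  "Kf p z n u v = KB_fm (dcon z # cs p 1) (fcell p (Jt n Zero)) u v"

lemma Kf_props:
  assumes "fm_bd 1 s p"
  shows "Delta00 (Kf p z n u v)" "tm_bd N n \<Longrightarrow> tm_bd N u \<Longrightarrow> tm_bd N v \<Longrightarrow> fm_bd N S (Kf p z n u v)"
proof -
  have "\<forall>K\<in>set (dcon z # cs p 1). wf_con K" using wf_dcon wf_cs[OF assms] by auto
  then show "Delta00 (Kf p z n u v)" "tm_bd N n \<Longrightarrow> tm_bd N u \<Longrightarrow> tm_bd N v \<Longrightarrow> fm_bd N S (Kf p z n u v)"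
    unfolding Kf_def by (auto intro!: Delta00_KB_fm fm_bd_KB_fm simp: fcell_def simp del: num.simps)
qed

context aca
begin

definition KBr :: "fm \<Rightarrow> nat \<Rightarrow> 'a \<Rightarrow> 'a \<Rightarrow> 'a \<Rightarrow> bool" where
  "KBr p z n = KB (dcon z # cs p 1) (pJ (tv p) (pJ n \<zero>))"

lemma msat_Kf:
  assumes "fm_bd 1 s p"
  shows "msat M e E (Kf p z n u v) \<longleftrightarrow> KBr p z (mval M e n) (mval M e u) (mval M e v)"
proof -
  have "\<forall>K\<in>set (dcon z # cs p 1). wf_con K" using wf_dcon wf_cs[OF assms] by auto
  then show ?thesis unfolding Kf_def KBr_def by simp
qed

lemma LOm_KBr: "LOm (KBr p z n)"
proof -
  let ?N = "node (dcon z # cs p 1) (pJ (tv p) (pJ n \<zero>))"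
  have K: "KBr p z n u v \<longleftrightarrow> ?N u \<and> ?N v \<and> (kb u v \<or> u = v)" for u v by (simp add: KBr_def KB_def)
  show ?thesis unfolding LOm_def K
  proof (intro conjI allI impI)
    show "x = y" if "(?N x \<and> ?N y \<and> (kb x y \<or> x = y)) \<and> ?N y \<and> ?N x \<and> (kb y x \<or> y = x)" for x y
      using that kb_trans[of x y x] kb_irrefl[of x] by blast
    show "(?N x \<and> ?N y \<and> (kb x y \<or> x = y)) \<or> ?N y \<and> ?N x \<and> (kb y x \<or> y = x)"
      if "(?N x \<and> ?N x \<and> (kb x x \<or> x = x)) \<and> ?N y \<and> ?N y \<and> (kb y y \<or> y = y)" for x y
      using that kb_total[of _ _ x y] by blast
    show "kb x w \<or> x = w" if "(?N x \<and> ?N y \<and> (kb x y \<or> x = y)) \<and> ?N y \<and> ?N w \<and> (kb y w \<or> y = w)" for x y w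
      using that kb_trans[of x y w] by blast
  qed auto
qed

text \<open>A set of nodes without a least element is ill-founded by linearity. It yields a path,
  and the path yields exactly the sets and the sequence that are excluded by assumption.\<close>

lemma KBr_WOm:
  assumes p: "arithmetical p" "fm_bd 1 s p"
    and no: "\<And>E F. range E \<subseteq> ms M \<Longrightarrow> msat M (\<lambda>_. n) E p \<Longrightarrow> \<not> descending F (E z)"
  shows "WOm M (KBr p z n)"
  unfolding WOm_def
proof (intro conjI LOm_KBr ballI impI)
  let ?Ks = "dcon z # cs p 1" and ?r = "pJ (tv p) (pJ n \<zero>)"
  have wf: "\<forall>K\<in>set ?Ks. wf_con K" using wf_dcon wf_cs[OF p(2)] by auto
  fix X assume X: "X \<in> ms M" and x: "\<exists>x\<in>X. KBr p z n x x"
  show "\<exists>x\<in>X. KBr p z n x x \<and> (\<forall>y\<in>X. KBr p z n y y \<longrightarrow> KBr p z n x y)"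
  proof (rule ccontr)
    assume *: "\<not> ?thesis"
    define Y where "Y = {u. u \<in> {u. node ?Ks ?r u} \<and> u \<in> X}"
    have "Y \<in> ms M" unfolding Y_def by (intro compI dfn_conj dfn_mem tdf_var node_set wf X)
    moreover have "Y \<noteq> {}" using x by (auto simp: Y_def KBr_def KB_def)
    moreover have "\<forall>u\<in>Y. node ?Ks ?r u \<and> (\<exists>v\<in>Y. kb v u)"
    proof
      fix u assume u: "u \<in> Y"
      then obtain v where "v \<in> X" "KBr p z n v v" "\<not> KBr p z n u v"
        using * unfolding Y_def KBr_def KB_def by auto
      then show "node ?Ks ?r u \<and> (\<exists>v\<in>Y. kb v u)"
        using u kb_total unfolding Y_def KBr_def KB_def by blast
    qed
    ultimately obtain H where "path ?Ks ?r H" using illfounded_path by blast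
    from path_model[OF this p] show False using no by blast
  qed
qed

lemma KBr_illfounded:
  assumes p: "arithmetical p" "fm_bd 1 s p" "z < s" and E: "range E \<subseteq> ms M" "msat M (\<lambda>_. n) E p"
    and F: "descending F (E z)"
  shows "\<exists>Y\<in>ms M. Y \<noteq> {} \<and> (\<forall>u\<in>Y. \<exists>v\<in>Y. KBr p z n v u \<and> u \<noteq> v)"
proof -
  have wf: "\<forall>K\<in>set (dcon z # cs p 1). wf_con K" using wf_dcon wf_cs[OF p(2)] by auto
  obtain H where "path (dcon z # cs p 1) (pJ (tv p) (pJ n \<zero>)) H"
    using model_path[OF E(1) p(1,2,3) E(2) F] by blast
  from path_illfounded[OF wf this] obtain Y where Y: "Y \<in> ms M" "Y \<noteq> {}"
    "\<forall>u\<in>Y. node (dcon z # cs p 1) (pJ (tv p) (pJ n \<zero>)) u \<and> (\<exists>v\<in>Y. kb v u)" by blast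
  then show ?thesis unfolding KBr_def KB_def using kb_irrefl by (intro bexI[of _ Y]) metis+
qed

end

interpretation N: aca stdm by (rule mods_stdm)

lemma tm_val_N [simp]: "tm_val e (num n) = n" "tm_val e (Jt t u) = N.pJ (tm_val e t) (tm_val e u)"
  "N.nv n = n" "tm_val e (fcell p t) = N.pJ (N.tv p) (tm_val e t)"
proof -
  show *: "tm_val e (num n) = n" for e :: "nat \<Rightarrow> nat" by (induction n) auto
  show "N.nv n = n" unfolding N.nv_def by (simp add: *)
qed (use N.mval_Jt N.mval_fcell in simp_all)

text \<open>The order type of the Kleene--Brouwer order is at least that of the well-order through which
  its paths descend: otherwise a strictly monotone map \<open>\<rho>\<close> into a proper initial segment yields
  an infinite descending sequence, whose next member is the image under \<open>\<rho>\<close> of the node given by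
  the previous ones.\<close>

lemma KBr_otype:
  assumes p: "arithmetical p" "fm_bd 1 s p" "z < s" and sat: "sat (\<lambda>_. n) E p"
    and Z: "Well_order Z" "E z = {N.pJ x y | x y. (x, y) \<in> Z \<and> x \<noteq> y}"
    and G: "Well_order {(u, v). N.KBr p z n u v}"
  shows "otype Z \<le> otype {(u, v). N.KBr p z n u v}"
proof (rule ccontr)
  let ?G = "{(u, v). N.KBr p z n u v}"
  let ?Ks = "dcon z # cs p 1" and ?r = "N.pJ (N.tv p) (N.pJ n 0)"
  assume "\<not> ?thesis"
  then have "otype ?G < otype Z" by simp
  then have "(?G, Z) \<in> ordLess" by (simp only: otype_less[OF G Z(1)])
  then obtain \<rho> b where \<rho>: "smono \<rho> ?G Z" "b \<in> Field Z" "\<forall>u\<in>Field ?G. (\<rho> u, b) \<in> Z \<and> \<rho> u \<noteq> b"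
    using ordLess_smono by blast
  have E: "range E \<subseteq> ms stdm" by simp
  \<comment> \<open>The zero sequence is a placeholder; only the other cells of \<open>H\<close> are
    going to be kept.\<close>
  have "N.total {N.pJ i 0 | i. True}" by (auto simp: N.total_def)
  from N.model_total[OF E this p(1), of s] obtain H where H: "N.total H"
    "\<And>j x v. j < s \<Longrightarrow> N.pJ (N.pJ 1 (N.pJ (N.nv j) x)) v \<in> H \<longleftrightarrow> v = (if x \<in> E j then 0 else 1)"
    "\<And>q c v. q \<in> subs p \<Longrightarrow> N.pJ (N.pJ (N.tv q) c) v \<in> H \<longleftrightarrow> N.val E q c v"
    unfolding stdm_simps by metis
  \<comment> \<open>The true values for sets and formulas, with an arbitrary sequence
    \<open>f\<close> in the cells tagged 0. Only \<open>dcon\<close> constrains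
    \<open>f\<close>.\<close>
  define Hf where "Hf = (\<lambda>f. {N.pJ c v | c v. if \<exists>i. c = N.pJ 0 i then \<exists>i. c = N.pJ 0 i \<and> v = f i else N.pJ c v \<in> H})"
  have Hf: "N.pJ c v \<in> Hf f \<longleftrightarrow> (if \<exists>i. c = N.pJ 0 i then \<exists>i. c = N.pJ 0 i \<and> v = f i else N.pJ c v \<in> H)" for c v f
    unfolding Hf_def by (simp add: N.pJ_inj)
  have Hf0: "N.pJ (N.pJ 0 i) v \<in> Hf f \<longleftrightarrow> v = f i" for i v f by (simp add: Hf)
  have Hf1: "N.pJ (N.pJ (Suc 0) (N.pJ j x)) v \<in> Hf f \<longleftrightarrow> v = (if x \<in> E j then 0 else 1)" if "j < s" for j x v f
    using H(2)[OF that] by (simp add: Hf)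
  have Hf2: "N.pJ (N.pJ (N.tv q) c) v \<in> Hf f \<longleftrightarrow> N.val E q c v" if "q \<in> subs p" for q c v f
  proof -
    have "N.tv q \<noteq> 0" using N.tv_simps(2)[of q] by simp
    then show ?thesis using H(3)[OF that] by (simp add: Hf)
  qed
  have tot: "N.total (Hf f)" for f
    unfolding N.total_def
  proof (intro conjI allI)
    fix c show "\<exists>!x. N.pJ c x \<in> Hf f"
    proof (cases "\<exists>i. c = N.pJ 0 i")
      case True
      then show ?thesis by (auto simp: Hf0)
    next
      case False
      then show ?thesis using H(1) unfolding Hf N.total_def by simp
    qed
  qed simp
  have cs: "\<forall>K\<in>set (cs p 1). N.pcon (Hf f) K" for f
    using N.model_cs[of s "Hf f" E p p 1] Hf1 Hf2 p(2) by (simp add: subset_iff)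
  have root: "N.pJ ?r 0 \<in> Hf f" for f
  proof -
    have "sat (case_nat n (N.env 0)) E p"
      using sat msat_cong[OF p(2), of "case_nat n (N.env 0)" "\<lambda>_. n" E E stdm] by simp
    then show ?thesis using N.val_zero[of E p] by (simp add: Hf2)
  qed
  \<comment> \<open>A segment of this length contains the cells of f(0) to f(j) but not that of
    f(j+1). So it sees only the first j descents, and \<open>?dec f j\<close> suffices for
    \<open>dcon\<close>.\<close>
  define k where "k = (\<lambda>j. Suc (N.pJ 0 j))"
  have le: "N.pJ 0 i < k j \<longleftrightarrow> i \<le> j" for i j
  proof -
    have "i < j \<Longrightarrow> N.pJ 0 i < N.pJ 0 j" for i j using N.pJ_mono[of i j 0] by simp
    then show ?thesis unfolding k_def by (metis less_Suc_eq_le linorder_not_less nless_le order_le_less)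
  qed
  let ?dec = "\<lambda>f j. \<forall>i<j. (f (Suc i), f i) \<in> Z \<and> f (Suc i) \<noteq> f i"
  have dc: "N.csat (\<lambda>c v. c < k j \<and> N.pJ c v \<in> Hf f) (k j) (dcon z)" if "?dec f j" for f j
  proof -
    have "x \<in> E z" if "N.pJ 0 (Suc i) < k j" "x = N.pJ (f (Suc i)) (f i)" for i x
      using \<open>?dec f j\<close> that le[of "Suc i" j] unfolding Z(2) by auto
    then show ?thesis
      by (auto simp: N.csat_def dcon_def Hf0 Hf1[OF p(3)])
  qed
  have "\<exists>u. N.node ?Ks ?r u \<and> (\<forall>c x. N.Rn u c x \<longleftrightarrow> c < k j \<and> N.pJ c x \<in> Hf f)" if "?dec f j" for f j
  proof -
    have "\<forall>K\<in>set ?Ks. N.csat (\<lambda>c v. ml stdm c (k j) \<and> N.pJ c v \<in> Hf f) (k j) K"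
      using dc[OF that] cs N.pcon_csat by simp
    from N.node_of[OF tot this, of ?r] show ?thesis using root by simp
  qed
  note ex = this
  define U where "U = (\<lambda>f j. SOME u. N.node ?Ks ?r u \<and> (\<forall>c x. N.Rn u c x \<longleftrightarrow> c < k j \<and> N.pJ c x \<in> Hf f))"
  have U: "N.node ?Ks ?r (U f j)" "\<And>c x. N.Rn (U f j) c x \<longleftrightarrow> c < k j \<and> N.pJ c x \<in> Hf f"
    if "?dec f j" for f j
    using someI_ex[OF ex[OF that]] unfolding U_def by blast+
  \<comment> \<open>The two nodes agree below \<open>k j\<close>, and only the longer one is defined
    at \<open>k j\<close>; being an extension, it comes earlier.\<close>
  have kb: "N.kb (U g (Suc j)) (U f j)" if "?dec f j" "?dec g (Suc j)" "\<And>i. i \<le> j \<Longrightarrow> f i = g i" for f g j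
    unfolding N.kb_def
  proof (rule exI[of _ "k j"], intro conjI allI impI)
    fix d x assume d: "ml stdm d (k j)"
    have kk: "k j < k (Suc j)" unfolding k_def using N.pJ_mono[of j "Suc j" 0] by simp
    have "N.pJ d x \<in> Hf f \<longleftrightarrow> N.pJ d x \<in> Hf g"
      unfolding Hf using le[of _ j] d that(3) by auto
    then show "N.Rn (U g (Suc j)) d x \<longleftrightarrow> N.Rn (U f j) d x"
      unfolding U(2)[OF that(1)] U(2)[OF that(2)] using d kk by auto
  next
    have kk: "k j < k (Suc j)" unfolding k_def using N.pJ_mono[of j "Suc j" 0] by simp
    obtain x where "N.pJ (k j) x \<in> Hf g" using tot[of g] unfolding N.total_def by blast
    then show "\<exists>x. N.Rn (U g (Suc j)) (k j) x \<and> (\<forall>y. N.Rn (U f j) (k j) y \<longrightarrow> ml stdm x y)"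
      unfolding U(2)[OF that(1)] U(2)[OF that(2)] using kk by auto
  qed
  define fn where "fn = (\<lambda>L i. if i < length L then L ! i else (0 :: nat))"
  \<comment> \<open>Each new term is the image under \<open>\<rho>\<close> of the node built from
    the terms so far. The start \<open>b\<close> lies strictly above the whole image of
    \<open>\<rho>\<close>, so the first step descends too.\<close>
  define L where "L = rec_nat [b] (\<lambda>j L. L @ [\<rho> (U (fn L) j)])"
  have L: "L 0 = [b]" "\<And>j. L (Suc j) = L j @ [\<rho> (U (fn (L j)) j)]" by (simp_all add: L_def)
  have len: "length (L j) = Suc j" for j by (induction j) (simp_all add: L)
  define a where "a = (\<lambda>j. L j ! j)"
  have La: "i \<le> j \<Longrightarrow> L j ! i = a i" for i j
    by (induction j) (auto simp: L a_def nth_append len le_Suc_eq)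
  have fa: "i \<le> j \<Longrightarrow> fn (L j) i = a i" for i j
    by (simp add: fn_def len La)
  have a0: "a 0 = b" and aS: "a (Suc j) = \<rho> (U (fn (L j)) j)" for j
    by (simp_all add: a_def L nth_append len)
  have node: "?dec f j \<Longrightarrow> U f j \<in> Field ?G" for f j
    using U(1)[of j f] by (auto simp: Field_def N.KBr_def N.KB_def)
  have dec: "?dec a j" for j
  proof (induction j)
    case (Suc j)
    have d: "?dec (fn (L j)) j" using Suc fa by simp
    have "(a (Suc j), a j) \<in> Z \<and> a (Suc j) \<noteq> a j"
    proof (cases j)
      case 0
      then show ?thesis using \<rho>(3) node[OF d] by (simp add: a0 aS)
    next
      case (Suc i)
      have d': "?dec (fn (L i)) i" using \<open>?dec a j\<close> fa Suc by simp
      have "N.kb (U (fn (L j)) j) (U (fn (L i)) i)"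
        unfolding Suc by (rule kb[OF d']) (use d Suc fa in auto)
      then have "(U (fn (L j)) j, U (fn (L i)) i) \<in> ?G \<and> U (fn (L j)) j \<noteq> U (fn (L i)) i"
        using U(1)[OF d] U(1)[OF d'] by (auto simp: N.KBr_def N.KB_def)
      then show ?thesis using \<rho>(1) unfolding smono_def aS Suc by blast
    qed
    then show ?case using Suc by (auto simp: less_Suc_eq)
  qed simp
  then show False using wf_no_descent[OF Z(1), of a] by blast
qed

section \<open>Computability of bounded formulas\<close>

lemma tm_val_lift [simp]: "tm_val (case_nat x e) (tm_lift 0 t) = tm_val e t"
  by (induction t) auto

definition ev :: "nat list \<Rightarrow> nat \<Rightarrow> nat" where
  "ev xs i = (if i < length xs then xs ! i else 0)"

lemma ev_Cons: "ev (x # xs) = case_nat x (ev xs)"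
  by (auto simp: ev_def fun_eq_iff split: nat.split)

definition cmp :: "nat \<Rightarrow> (nat list \<Rightarrow> nat) \<Rightarrow> bool" where
  "cmp n F \<longleftrightarrow> (\<exists>f. \<forall>xs. length xs = n \<longrightarrow> computes f xs (F xs))"

lemma cmp_cong: "cmp n F \<Longrightarrow> (\<And>xs. length xs = n \<Longrightarrow> F xs = G xs) \<Longrightarrow> cmp n G"
  by (auto simp: cmp_def)

lemma cmp_proj: "i < n \<Longrightarrow> cmp n (\<lambda>xs. xs ! i)"
  unfolding cmp_def by (rule exI[of _ "Proj i"]) (auto intro: computes.intros)

lemma cmp_comp:
  assumes "cmp (length Gs) F" "\<forall>G\<in>set Gs. cmp n G"
  shows "cmp n (\<lambda>xs. F (map (\<lambda>G. G xs) Gs))"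
proof -
  obtain f where f: "\<And>xs. length xs = length Gs \<Longrightarrow> computes f xs (F xs)"
    using assms(1) by (auto simp: cmp_def)
  have "\<exists>gs. \<forall>xs. length xs = n \<longrightarrow> list_all2 (\<lambda>g y. computes g xs y) gs (map (\<lambda>G. G xs) Gs)"
    using assms(2)
  proof (induction Gs)
    case Nil
    then show ?case by (intro exI[of _ "[]"]) simp
  next
    case (Cons G Gs)
    then obtain gs g where "\<forall>xs. length xs = n \<longrightarrow> list_all2 (\<lambda>g y. computes g xs y) gs (map (\<lambda>G. G xs) Gs)"
      "\<forall>xs. length xs = n \<longrightarrow> computes g xs (G xs)" by (auto simp: cmp_def)
    then show ?case by (intro exI[of _ "g # gs"]) simp
  qed
  then obtain gs where "\<And>xs. length xs = n \<Longrightarrow> list_all2 (\<lambda>g y. computes g xs y) gs (map (\<lambda>G. G xs) Gs)"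
    by blast
  then show ?thesis unfolding cmp_def
    by (intro exI[of _ "Comp f gs"]) (auto intro!: computes.intros f)
qed

lemma cmp_1: "cmp 1 (\<lambda>xs. F (xs ! 0)) \<Longrightarrow> cmp n G \<Longrightarrow> cmp n (\<lambda>xs. F (G xs))"
  using cmp_comp[of "[G]" "\<lambda>xs. F (xs ! 0)" n] by simp

lemma cmp_2: "cmp (Suc 1) (\<lambda>xs. F (xs ! 0) (xs ! 1)) \<Longrightarrow> cmp n G \<Longrightarrow> cmp n H \<Longrightarrow> cmp n (\<lambda>xs. F (G xs) (H xs))"
  using cmp_comp[of "[G, H]" "\<lambda>xs. F (xs ! 0) (xs ! 1)" n] by simp

lemma cmp_zero: "cmp n (\<lambda>_. 0)"
  unfolding cmp_def by (rule exI[of _ ZeroF]) (auto intro: computes.intros)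

lemma cmp_Suc: "cmp n F \<Longrightarrow> cmp n (\<lambda>xs. Suc (F xs))"
proof -
  have "cmp 1 (\<lambda>xs. Suc (xs ! 0))"
    unfolding cmp_def
    by (rule exI[of _ SucF]) (auto simp: length_Suc_conv intro: computes.intros)
  then show "cmp n F \<Longrightarrow> cmp n (\<lambda>xs. Suc (F xs))" by (rule cmp_1)
qed

lemma cmp_rec:
  assumes "cmp n F" "cmp (Suc (Suc n)) (\<lambda>xs. G (xs ! 0) (xs ! 1) (drop 2 xs))"
  shows "cmp (Suc n) (\<lambda>xs. rec_nat (F (tl xs)) (\<lambda>i r. G i r (tl xs)) (hd xs))"
proof -
  obtain f where f: "\<And>xs. length xs = n \<Longrightarrow> computes f xs (F xs)" using assms(1) by (auto simp: cmp_def)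
  obtain g where g: "\<And>xs. length xs = Suc (Suc n) \<Longrightarrow> computes g xs (G (xs ! 0) (xs ! 1) (drop 2 xs))"
    using assms(2) by (auto simp: cmp_def)
  have "computes (PrimRec f g) (i # xs) (rec_nat (F xs) (\<lambda>i r. G i r xs) i)" if "length xs = n" for i xs
  proof (induction i)
    case 0
    then show ?case using f[OF that] by (auto intro: computes.intros)
  next
    case (Suc i)
    then show ?case using g[of "i # rec_nat (F xs) (\<lambda>i r. G i r xs) i # xs"] that
      by (auto intro: computes.intros simp: numeral_2_eq_2)
  qed
  then show ?thesis unfolding cmp_def
    by (intro exI[of _ "PrimRec f g"]) (auto simp: length_Suc_conv)
qed

lemma cmp_drop: "k + i < n \<Longrightarrow> cmp n (\<lambda>xs. drop k xs ! i)"
  by (rule cmp_cong[OF cmp_proj[of "k + i"]]) auto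

lemma cmp_add: "cmp n F \<Longrightarrow> cmp n G \<Longrightarrow> cmp n (\<lambda>xs. F xs + G xs)"
proof -
  have "cmp (Suc 1) (\<lambda>xs. rec_nat (tl xs ! 0) (\<lambda>i r. Suc r) (hd xs))"
    by (rule cmp_rec) (intro cmp_proj cmp_Suc, simp)+
  moreover have "rec_nat y (\<lambda>i r. Suc r) x = x + y" for x y by (induction x) auto
  ultimately have "cmp (Suc 1) (\<lambda>xs. xs ! 0 + xs ! 1)"
    by (elim cmp_cong[of "Suc 1"]) (auto simp: length_Suc_conv)
  then show "cmp n F \<Longrightarrow> cmp n G \<Longrightarrow> cmp n (\<lambda>xs. F xs + G xs)" by (rule cmp_2)
qed

lemma cmp_mult: "cmp n F \<Longrightarrow> cmp n G \<Longrightarrow> cmp n (\<lambda>xs. F xs * G xs)"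
proof -
  have "cmp (Suc 1) (\<lambda>xs. rec_nat 0 (\<lambda>i r. r + tl xs ! 0) (hd xs))"
    by (rule cmp_rec) (auto intro!: cmp_zero cmp_add cmp_proj cmp_drop)
  moreover have "rec_nat 0 (\<lambda>i r. r + y) x = x * y" for x y :: nat by (induction x) auto
  ultimately have "cmp (Suc 1) (\<lambda>xs. xs ! 0 * xs ! 1)"
    by (elim cmp_cong[of "Suc 1"]) (auto simp: length_Suc_conv)
  then show "cmp n F \<Longrightarrow> cmp n G \<Longrightarrow> cmp n (\<lambda>xs. F xs * G xs)" by (rule cmp_2)
qed

lemma cmp_pred: "cmp n F \<Longrightarrow> cmp n (\<lambda>xs. F xs - 1)"
proof -
  have "cmp (Suc 0) (\<lambda>xs. rec_nat 0 (\<lambda>i r. i) (hd xs))"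
    by (rule cmp_rec) (auto intro!: cmp_zero cmp_proj)
  moreover have "rec_nat 0 (\<lambda>i r. i) x = x - 1" for x :: nat by (induction x) auto
  ultimately have "cmp 1 (\<lambda>xs. xs ! 0 - 1)"
    unfolding One_nat_def by (elim cmp_cong[of "Suc 0"]) (auto simp: length_Suc_conv)
  then show "cmp n F \<Longrightarrow> cmp n (\<lambda>xs. F xs - 1)" by (rule cmp_1)
qed

lemma cmp_diff: "cmp n F \<Longrightarrow> cmp n G \<Longrightarrow> cmp n (\<lambda>xs. F xs - G xs)"
proof -
  have "cmp (Suc 1) (\<lambda>xs. rec_nat (tl xs ! 0) (\<lambda>i r. r - 1) (hd xs))"
    by (rule cmp_rec) (auto intro!: cmp_pred[simplified] cmp_proj)
  moreover have "rec_nat y (\<lambda>i r. r - 1) x = y - x" for x y :: nat by (induction x) auto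
  ultimately have "cmp (Suc 1) (\<lambda>xs. xs ! 1 - xs ! 0)"
    by (elim cmp_cong[of "Suc 1"]) (auto simp: length_Suc_conv)
  then show "cmp n F \<Longrightarrow> cmp n G \<Longrightarrow> cmp n (\<lambda>xs. F xs - G xs)"
    using cmp_2[of "\<lambda>x y. y - x" n G F] by blast
qed

lemma cmp_one: "cmp n (\<lambda>_. 1)"
  using cmp_Suc[OF cmp_zero] by simp

lemma cmp_tm: "tm_bd n t \<Longrightarrow> cmp n (\<lambda>xs. tm_val (ev xs) t)"
proof (induction t)
  case (Var i)
  then show ?case by (auto simp: ev_def intro: cmp_cong[OF cmp_proj])
qed (auto intro: cmp_zero cmp_one[simplified] cmp_add cmp_mult)

definition chi :: "nat \<Rightarrow> fm \<Rightarrow> bool" where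
  "chi n p \<longleftrightarrow> cmp n (\<lambda>xs. if sat (ev xs) (\<lambda>_. {}) p then 1 else 0)"

text \<open>Truth values are the numbers 0 and 1; a bounded universal quantifier is a product,
  computed by primitive recursion on the bound.\<close>

lemma Delta00_chi: "Delta00 p \<Longrightarrow> fm_bd n 0 p \<Longrightarrow> chi n p"
proof (induction arbitrary: n rule: Delta00.induct)
  case (1 t u)
  then have t: "cmp n (\<lambda>xs. tm_val (ev xs) t)" "cmp n (\<lambda>xs. tm_val (ev xs) u)" by (auto intro: cmp_tm)
  have "cmp n (\<lambda>xs. 1 - ((tm_val (ev xs) t - tm_val (ev xs) u) + (tm_val (ev xs) u - tm_val (ev xs) t)))"
    by (intro cmp_diff cmp_one cmp_add t)
  then show ?case unfolding chi_def by (rule cmp_cong) auto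
next
  case (2 t u)
  then have t: "cmp n (\<lambda>xs. tm_val (ev xs) t)" "cmp n (\<lambda>xs. tm_val (ev xs) u)" by (auto intro: cmp_tm)
  have "cmp n (\<lambda>xs. 1 - (1 - (tm_val (ev xs) u - tm_val (ev xs) t)))"
    by (intro cmp_diff cmp_one t)
  then show ?case unfolding chi_def by (rule cmp_cong) auto
next
  case (3 t i)
  then show ?case by simp
next
  case 4
  show ?case unfolding chi_def by (simp add: cmp_zero)
next
  case (5 p q)
  then have "chi n p" "chi n q" by auto
  then have "cmp n (\<lambda>xs. 1 - (if sat (ev xs) (\<lambda>_. {}) p then 1 else 0) * (1 - (if sat (ev xs) (\<lambda>_. {}) q then 1 else 0)))"
    unfolding chi_def by (intro cmp_diff cmp_mult cmp_one)
  then show ?case unfolding chi_def by (rule cmp_cong) auto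
next
  case (6 p t)
  then have t: "cmp n (\<lambda>xs. tm_val (ev xs) t)" and p: "chi (Suc n) p" by (auto intro: cmp_tm)
  let ?c = "\<lambda>i xs. if sat (ev (i # xs)) (\<lambda>_. {}) p then 1 else (0 :: nat)"
  have "cmp (Suc (Suc n)) (\<lambda>xs. (\<lambda>xs. if sat (ev xs) (\<lambda>_. {}) p then 1 else 0) (map (\<lambda>G. G xs) ((\<lambda>xs. xs ! 0) # map (\<lambda>i xs. xs ! (i + 2)) [0..<n])))"
    by (rule cmp_comp) (use p in \<open>auto simp: chi_def intro: cmp_proj\<close>)
  then have c: "cmp (Suc (Suc n)) (\<lambda>xs. ?c (xs ! 0) (drop 2 xs))"
  proof (rule cmp_cong)
    fix xs :: "nat list" assume "length xs = Suc (Suc n)"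
    then have "map (\<lambda>i. xs ! (i + 2)) [0..<n] = drop 2 xs" by (auto intro!: nth_equalityI)
    then show "(if sat (ev (map (\<lambda>G. G xs) ((\<lambda>xs. xs ! 0) # map (\<lambda>i xs. xs ! (i + 2)) [0..<n]))) (\<lambda>_. {}) p then 1 else 0)
       = ?c (xs ! 0) (drop 2 xs)" by (simp add: comp_def)
  qed
  have "cmp (Suc n) (\<lambda>xs. rec_nat 1 (\<lambda>i r. r * ?c i (tl xs)) (hd xs))"
    by (rule cmp_rec) (use c in \<open>auto intro!: cmp_one[simplified] cmp_mult cmp_proj\<close>)
  then have "cmp n (\<lambda>xs. (\<lambda>xs. rec_nat 1 (\<lambda>i r. r * ?c i (tl xs)) (hd xs))
      (map (\<lambda>G. G xs) ((\<lambda>xs. tm_val (ev xs) t) # map (\<lambda>i xs. xs ! i) [0..<n])))"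
    by (intro cmp_comp) (use t in \<open>auto intro: cmp_proj\<close>)
  then show ?case unfolding chi_def
  proof (rule cmp_cong)
    fix xs :: "nat list" assume "length xs = n"
    then have "map (\<lambda>i. xs ! i) [0..<n] = xs" by (auto intro!: nth_equalityI)
    moreover have "rec_nat 1 (\<lambda>i r. r * ?c i xs) k = (if \<forall>i<k. sat (ev (i # xs)) (\<lambda>_. {}) p then 1 else 0)" for k
      by (induction k) (auto simp: less_Suc_eq)
    ultimately show "(\<lambda>xs. rec_nat 1 (\<lambda>i r. r * ?c i (tl xs)) (hd xs))
      (map (\<lambda>G. G xs) ((\<lambda>xs. tm_val (ev xs) t) # map (\<lambda>i xs. xs ! i) [0..<n]))
      = (if sat (ev xs) (\<lambda>_. {}) (AllN (Imp (Less (Var 0) (tm_lift 0 t)) p)) then 1 else 0)"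
      using mval_lift[of stdm] by (simp add: comp_def ev_Cons)
  qed
qed

lemma Delta00_recursive: "Delta00 A \<Longrightarrow> fm_bd 2 0 A \<Longrightarrow> recursive_rel {(x, y). arel stdm A x y}"
proof -
  assume "Delta00 A" and A: "fm_bd 2 0 A"
  then obtain f where f: "\<And>xs. length xs = 2 \<Longrightarrow> computes f xs (if sat (ev xs) (\<lambda>_. {}) A then 1 else 0)"
    using Delta00_chi[of A 2] by (auto simp: chi_def cmp_def)
  have "sat (ev [x, y]) (\<lambda>_. {}) A \<longleftrightarrow> arel stdm A x y" for x y
    unfolding arel_def msat_stdm[symmetric]
    by (rule msat_cong[OF A]) (auto simp: ev_Cons less_2_cases_iff)
  then show ?thesis unfolding recursive_rel_def
  proof (intro exI[of _ f] allI)
    fix x y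
    show "computes f [x, y] (if (x, y) \<in> {(x, y). arel stdm A x y} then 1 else 0)"
      using f[of "[x, y]"] \<open>\<And>y x. sat (ev [x, y]) (\<lambda>_. {}) A \<longleftrightarrow> arel stdm A x y\<close> by simp
  qed
qed

section \<open>Recursively enumerable sets are \<open>\<Sigma>\<^sup>0\<^sub>1\<close>\<close>

definition td :: "((nat \<Rightarrow> nat) \<Rightarrow> nat) \<Rightarrow> bool" where
  "td f \<longleftrightarrow> (\<exists>t. \<forall>e. f e = tm_val e t)"

definition dd :: "((nat \<Rightarrow> nat) \<Rightarrow> bool) \<Rightarrow> bool" where
  "dd P \<longleftrightarrow> (\<exists>p n. Delta00 p \<and> fm_bd n 0 p \<and> (\<forall>e. P e = sat e (\<lambda>_. {}) p))"

lemma td_var: "td (\<lambda>e. e i)" and td_0: "td (\<lambda>e. 0)" and td_1: "td (\<lambda>e. Suc 0)"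
  unfolding td_def by (rule exI[of _ "Var i"], simp, rule exI[of _ Zero], simp, rule exI[of _ One], simp)

lemma td_add: "td f \<Longrightarrow> td g \<Longrightarrow> td (\<lambda>e. f e + g e)"
proof -
  assume "td f" "td g"
  then obtain t u where "\<forall>e. f e = tm_val e t" "\<forall>e. g e = tm_val e u" unfolding td_def by blast
  then show ?thesis unfolding td_def by (intro exI[of _ "Plus t u"]) simp
qed

lemma td_Suc: "td f \<Longrightarrow> td (\<lambda>e. Suc (f e))"
  using td_add[OF _ td_1] by simp

lemma Delta00_fsub: "Delta00 p \<Longrightarrow> Delta00 (fsub \<tau> \<upsilon> p)"
proof (induction arbitrary: \<tau> \<upsilon> rule: Delta00.induct)
  case (6 p t)
  have "tsub (upN \<tau>) (tm_lift 0 t) = tm_lift 0 (tsub \<tau> t)"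
    by (simp add: tm_lift_tsub tsub_tsub comp_def upN_def)
  then show ?case using 6 by (simp add: upN_def)
qed simp_all

lemma dd_sub: assumes "dd P" "\<And>i. td (\<tau> i)" shows "dd (\<lambda>e. P (\<lambda>i. \<tau> i e))"
proof -
  obtain p n where p: "Delta00 p" "fm_bd n 0 p" "\<And>e. P e = sat e (\<lambda>_. {}) p" using assms(1) by (auto simp: dd_def)
  obtain t where t: "\<And>i e. \<tau> i e = tm_val e (t i)" using assms(2) unfolding td_def by metis
  have "\<exists>m. \<forall>i<n. tm_bd m (t i)"
  proof (induction n)
    case (Suc n)
    then obtain m where "\<forall>i<n. tm_bd m (t i)" by blast
    moreover obtain k where "tm_bd k (t n)" using ex_tm_bd2 by blast
    ultimately show ?case by (intro exI[of _ "max m k"]) (auto simp: less_Suc_eq intro: tm_bd_mono)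
  qed simp
  then obtain m where "\<forall>i<n. tm_bd m (t i)" by blast
  then have "fm_bd m 0 (fsub t id p)" using p(2) by (intro fm_bd_fsub) auto
  moreover have "P (\<lambda>i. \<tau> i e) = sat e (\<lambda>_. {}) (fsub t id p)" for e
    using msat_fsub[of stdm e "\<lambda>_. {}" t id p] by (simp add: p(3) t)
  ultimately show ?thesis unfolding dd_def using Delta00_fsub[OF p(1)] by blast
qed

lemma dd_eq: "td f \<Longrightarrow> td g \<Longrightarrow> dd (\<lambda>e. f e = g e)"
proof -
  assume "td f" "td g"
  then obtain t u where "\<forall>e. f e = tm_val e t" "\<forall>e. g e = tm_val e u" unfolding td_def by blast
  moreover obtain n where "tm_bd n t \<and> tm_bd n u" using ex_tm_bd2 by blast
  ultimately show ?thesis unfolding dd_def by (intro exI[of _ "Equal t u"] exI[of _ n]) simp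
qed

lemma dd_imp: "dd P \<Longrightarrow> dd Q \<Longrightarrow> dd (\<lambda>e. P e \<longrightarrow> Q e)"
proof -
  assume "dd P" "dd Q"
  then obtain p n q m where "Delta00 p" "fm_bd n 0 p" "\<forall>e. P e = sat e (\<lambda>_. {}) p"
     "Delta00 q" "fm_bd m 0 q" "\<forall>e. Q e = sat e (\<lambda>_. {}) q" unfolding dd_def by metis
  then show ?thesis unfolding dd_def
    by (intro exI[of _ "Imp p q"] exI[of _ "max n m"]) (auto intro: fm_bd_mono)
qed

lemma dd_False: "dd (\<lambda>_. False)"
  unfolding dd_def by (intro exI[of _ Falsum] exI[of _ 0]) simp

lemma dd_neg: "dd P \<Longrightarrow> dd (\<lambda>e. \<not> P e)"
  using dd_imp[OF _ dd_False] by simp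

lemma dd_conj: "dd P \<Longrightarrow> dd Q \<Longrightarrow> dd (\<lambda>e. P e \<and> Q e)"
  using dd_neg[OF dd_imp[OF _ dd_neg]] by simp

lemma dd_ball: "td f \<Longrightarrow> dd (\<lambda>e. P (e 0) (\<lambda>i. e (Suc i))) \<Longrightarrow> dd (\<lambda>e. \<forall>x<f e. P x e)"
proof -
  assume "td f" "dd (\<lambda>e. P (e 0) (\<lambda>i. e (Suc i)))"
  then obtain p n t where p: "Delta00 p" "fm_bd n 0 p" "\<forall>e. P (e 0) (\<lambda>i. e (Suc i)) = sat e (\<lambda>_. {}) p"
     "\<forall>e. f e = tm_val e t" unfolding dd_def td_def by metis
  obtain m where "tm_bd m t" using ex_tm_bd2 by blast
  have "P x e = sat (case_nat x e) (\<lambda>_. {}) p" for x e using p(3)[rule_format, of "case_nat x e"] by simp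
  then show ?thesis unfolding dd_def using p \<open>tm_bd m t\<close> mval_lift[of stdm]
    by (intro exI[of _ "BAll t p"] exI[of _ "max n m"]) (auto intro: fm_bd_mono tm_bd_mono)
qed

lemma dd_bex: "td f \<Longrightarrow> dd (\<lambda>e. P (e 0) (\<lambda>i. e (Suc i))) \<Longrightarrow> dd (\<lambda>e. \<exists>x<f e. P x e)"
  using dd_neg[OF dd_ball[OF _ dd_neg, of f P]] by simp

lemma dd_Rn: "td f \<Longrightarrow> td g \<Longrightarrow> td h \<Longrightarrow> dd (\<lambda>e. N.Rn (f e) (g e) (h e))"
proof -
  assume "td f" "td g" "td h"
  then obtain t u v where "\<forall>e. f e = tm_val e t" "\<forall>e. g e = tm_val e u" "\<forall>e. h e = tm_val e v"
    unfolding td_def by metis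
  moreover obtain n m where "tm_bd n t \<and> tm_bd n u" "tm_bd m v" using ex_tm_bd2 by metis
  ultimately show ?thesis unfolding dd_def using N.msat_Rn_fm
    by (intro exI[of _ "Rn_fm t u v"] exI[of _ "max n m"]) (auto intro: tm_bd_mono)
qed

text \<open>A single unbounded quantifier over a Delta00 matrix. In the closure lemmas it bounds all
  witnesses at once, so they need not be coded into one number.\<close>

definition sd :: "((nat \<Rightarrow> nat) \<Rightarrow> bool) \<Rightarrow> bool" where
  "sd P \<longleftrightarrow> (\<exists>D. dd D \<and> (\<forall>e. P e \<longleftrightarrow> (\<exists>b. D (case_nat b e))))"

lemma dd_ren: "dd P \<Longrightarrow> dd (\<lambda>e. P (\<lambda>i. e (r i)))"
  by (rule dd_sub[of P "\<lambda>i e. e (r i)"]) (simp_all add: td_var)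

lemma sd_dd: "dd P \<Longrightarrow> sd P"
  unfolding sd_def by (rule exI[of _ "\<lambda>e. P (\<lambda>i. e (Suc i))"]) (simp add: dd_ren)

lemma dd_shift2: "dd D \<Longrightarrow> dd (\<lambda>e. D (case_nat (e 0) (\<lambda>i. e (Suc (Suc i)))))"
  using dd_ren[of D "\<lambda>i. case i of 0 \<Rightarrow> 0 | Suc i \<Rightarrow> Suc (Suc i)"]
  by (rule back_subst[of dd]) (auto simp: fun_eq_iff intro!: arg_cong[of _ _ D] split: nat.split)

lemma sd_conj: "sd P \<Longrightarrow> sd Q \<Longrightarrow> sd (\<lambda>e. P e \<and> Q e)"
proof -
  assume "sd P" "sd Q"
  then obtain C D where C: "dd C" "\<forall>e. P e \<longleftrightarrow> (\<exists>b. C (case_nat b e))" and D: "dd D" "\<forall>e. Q e \<longleftrightarrow> (\<exists>b. D (case_nat b e))"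
    unfolding sd_def by metis
  let ?F = "\<lambda>e. (\<exists>x<Suc (e 0). C (case_nat x (\<lambda>i. e (Suc i)))) \<and> (\<exists>x<Suc (e 0). D (case_nat x (\<lambda>i. e (Suc i))))"
  have "dd ?F" by (intro dd_conj dd_bex td_Suc td_var dd_shift2 C D)
  moreover have "P e \<and> Q e \<longleftrightarrow> (\<exists>b. ?F (case_nat b e))" for e
  proof
    assume "P e \<and> Q e"
    then obtain x y where "C (case_nat x e)" "D (case_nat y e)" using C D by blast
    then have "(\<exists>z<Suc (x + y). C (case_nat z e)) \<and> (\<exists>z<Suc (x + y). D (case_nat z e))"
      by (meson le_add1 le_add2 less_Suc_eq_le)
    then show "\<exists>b. ?F (case_nat b e)" by (intro exI[of _ "x + y"]) simp
  qed (use C D in auto)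
  ultimately show ?thesis unfolding sd_def by blast
qed

lemma dd_shift3: "dd D \<Longrightarrow> dd (\<lambda>e. D (case_nat (e 0) (case_nat (e (Suc 0)) (\<lambda>i. e (Suc (Suc (Suc i)))))))"
  using dd_ren[of D "\<lambda>i. case i of 0 \<Rightarrow> 0 | Suc i \<Rightarrow> (case i of 0 \<Rightarrow> Suc 0 | Suc i \<Rightarrow> Suc (Suc (Suc i)))"]
  by (rule back_subst[of dd]) (auto simp: fun_eq_iff intro!: arg_cong[of _ _ D] split: nat.split)

lemma sd_ex: "sd (\<lambda>e. P (e 0) (\<lambda>i. e (Suc i))) \<Longrightarrow> sd (\<lambda>e. \<exists>x. P x e)"
proof -
  assume "sd (\<lambda>e. P (e 0) (\<lambda>i. e (Suc i)))"
  then obtain D where D: "dd D" "\<forall>e. P (e 0) (\<lambda>i. e (Suc i)) \<longleftrightarrow> (\<exists>b. D (case_nat b e))"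
    unfolding sd_def by metis
  have P: "P x e \<longleftrightarrow> (\<exists>b. D (case_nat b (case_nat x e)))" for x e
    using D(2)[rule_format, of "case_nat x e"] by simp
  let ?F = "\<lambda>e. \<exists>x<Suc (e 0). \<exists>y<Suc (e 0). D (case_nat y (case_nat x (\<lambda>i. e (Suc i))))"
  have "dd ?F" by (intro dd_bex td_Suc td_var dd_shift3 D)
  moreover have "(\<exists>x. P x e) \<longleftrightarrow> (\<exists>b. ?F (case_nat b e))" for e
  proof
    assume "\<exists>x. P x e"
    then obtain x y where "D (case_nat y (case_nat x e))" using P by blast
    then show "\<exists>b. ?F (case_nat b e)"
      by (rule_tac exI[of _ "x + y"], rule_tac exI[of _ x], intro conjI, simp, rule_tac exI[of _ y], simp)
  qed (use P in auto)
  ultimately show ?thesis unfolding sd_def by blast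
qed

text \<open>Collection: finitely many witnesses have a common bound, found by induction on the range
  of the quantifier.\<close>

lemma sd_ball: "td f \<Longrightarrow> sd (\<lambda>e. P (e 0) (\<lambda>i. e (Suc i))) \<Longrightarrow> sd (\<lambda>e. \<forall>x<f e. P x e)"
proof -
  assume f: "td f" and "sd (\<lambda>e. P (e 0) (\<lambda>i. e (Suc i)))"
  then obtain D where D: "dd D" "\<forall>e. P (e 0) (\<lambda>i. e (Suc i)) \<longleftrightarrow> (\<exists>b. D (case_nat b e))"
    unfolding sd_def by metis
  have P: "P x e \<longleftrightarrow> (\<exists>b. D (case_nat b (case_nat x e)))" for x e
    using D(2)[rule_format, of "case_nat x e"] by simp
  let ?F = "\<lambda>e. \<forall>x<f (\<lambda>i. e (Suc i)). \<exists>y<Suc (e 0). D (case_nat y (case_nat x (\<lambda>i. e (Suc i))))"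
  have "td (\<lambda>e. f (\<lambda>i. e (Suc i)))"
  proof -
    obtain t where "\<forall>e. f e = tm_val e t" using f unfolding td_def by blast
    then show ?thesis unfolding td_def using mval_tsub[of stdm _ "Var \<circ> Suc" t]
      by (intro exI[of _ "tsub (Var \<circ> Suc) t"]) simp
  qed
  then have "dd ?F" by (intro dd_ball dd_bex td_Suc td_var dd_shift3 D)
  moreover have "(\<forall>x<f e. P x e) \<longleftrightarrow> (\<exists>b. ?F (case_nat b e))" for e
  proof
    assume *: "\<forall>x<f e. P x e"
    have "\<exists>b. \<forall>x<k. \<exists>y<Suc b. D (case_nat y (case_nat x e))" if "k \<le> f e" for k
      using that
    proof (induction k)
      case (Suc k)
      then obtain b where b: "\<forall>x<k. \<exists>y<Suc b. D (case_nat y (case_nat x e))" by auto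
      have "P k e" using * Suc.prems by simp
      then obtain y where "D (case_nat y (case_nat k e))" using P by blast
      moreover have "\<exists>y<Suc (b + c). D (case_nat y (case_nat x e))" if "x < k" for x c
        using b that by (meson less_le_trans Suc_le_mono le_add1)
      ultimately show ?case by (intro exI[of _ "b + y"]) (auto simp: less_Suc_eq intro!: exI[of _ y])
    qed simp
    then show "\<exists>b. ?F (case_nat b e)" by simp
  qed (use P in auto)
  ultimately show ?thesis unfolding sd_def by blast
qed

inductive_cases computes_cases [elim!]: "computes ZeroF xs y" "computes SucF xs y" "computes (Proj i) xs y"
  "computes (Comp f gs) xs y" "computes (PrimRec f g) [] y" "computes (PrimRec f g) (0 # xs) y"
  "computes (PrimRec f g) (Suc n # xs) y" "computes (Mu f) xs y"

lemma computes_PrimRec: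
  "computes (PrimRec f g) (n # xs) y \<longleftrightarrow> (\<exists>s. computes f xs (s 0) \<and>
     (\<forall>i<n. computes g (i # s i # xs) (s (Suc i))) \<and> s n = y)"
proof (induction n arbitrary: y)
  case 0
  show ?case by (auto intro: computes.intros)
next
  case (Suc n)
  show ?case
  proof
    assume "computes (PrimRec f g) (Suc n # xs) y"
    then obtain r where r: "computes (PrimRec f g) (n # xs) r" "computes g (n # r # xs) y" by auto
    then obtain s where s: "computes f xs (s 0)" "\<forall>i<n. computes g (i # s i # xs) (s (Suc i))" "s n = r"
      using Suc by blast
    then show "\<exists>s. computes f xs (s 0) \<and> (\<forall>i<Suc n. computes g (i # s i # xs) (s (Suc i))) \<and> s (Suc n) = y"
      using r by (intro exI[of _ "s(Suc n := y)"]) (auto simp: less_Suc_eq)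
  next
    assume "\<exists>s. computes f xs (s 0) \<and> (\<forall>i<Suc n. computes g (i # s i # xs) (s (Suc i))) \<and> s (Suc n) = y"
    then obtain s where s: "computes f xs (s 0)" "\<forall>i<Suc n. computes g (i # s i # xs) (s (Suc i))" "s (Suc n) = y"
      by blast
    then have "computes (PrimRec f g) (n # xs) (s n)" unfolding Suc by auto
    then show "computes (PrimRec f g) (Suc n # xs) y" using s by (auto intro: computes.intros)
  qed
qed

text \<open>The intermediate values are coded by one number \<open>u\<close>. Values are below their
  code, so single-valuedness needs only quantifiers bounded by \<open>u\<close> and remains
  Delta00.\<close>

lemma computes_PrimRec_code:
  "computes (PrimRec f g) (n # xs) y \<longleftrightarrow> (\<exists>u. (\<forall>c<Suc n. \<forall>a<u. \<forall>b<u. N.Rn u c a \<longrightarrow> N.Rn u c b \<longrightarrow> a = b) \<and>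
     (\<exists>r. N.Rn u 0 r \<and> computes f xs r) \<and>
     (\<forall>i<n. \<exists>a b. N.Rn u i a \<and> N.Rn u (Suc i) b \<and> computes g (i # a # xs) b) \<and> N.Rn u n y)"
proof
  assume "computes (PrimRec f g) (n # xs) y"
  then obtain s where s: "computes f xs (s 0)" "\<forall>i<n. computes g (i # s i # xs) (s (Suc i))" "s n = y"
    unfolding computes_PrimRec by blast
  have "N.funn {N.pJ i (s i) | i. True} (Suc n)" by (auto simp: N.funn_def)
  from N.Rn_fun[OF _ this] obtain u where u: "\<And>c x. N.Rn u c x \<longleftrightarrow> c < Suc n \<and> x = s c"
    by auto
  show "\<exists>u. (\<forall>c<Suc n. \<forall>a<u. \<forall>b<u. N.Rn u c a \<longrightarrow> N.Rn u c b \<longrightarrow> a = b) \<and>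
     (\<exists>r. N.Rn u 0 r \<and> computes f xs r) \<and>
     (\<forall>i<n. \<exists>a b. N.Rn u i a \<and> N.Rn u (Suc i) b \<and> computes g (i # a # xs) b) \<and> N.Rn u n y"
    by (rule exI[of _ u]) (use s in \<open>auto simp: u\<close>)
next
  assume "\<exists>u. (\<forall>c<Suc n. \<forall>a<u. \<forall>b<u. N.Rn u c a \<longrightarrow> N.Rn u c b \<longrightarrow> a = b) \<and>
     (\<exists>r. N.Rn u 0 r \<and> computes f xs r) \<and>
     (\<forall>i<n. \<exists>a b. N.Rn u i a \<and> N.Rn u (Suc i) b \<and> computes g (i # a # xs) b) \<and> N.Rn u n y"
  then obtain u r where u: "\<And>c a b. c < Suc n \<Longrightarrow> N.Rn u c a \<Longrightarrow> N.Rn u c b \<Longrightarrow> a = b"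
    "N.Rn u 0 r" "computes f xs r" "\<forall>i<n. \<exists>a b. N.Rn u i a \<and> N.Rn u (Suc i) b \<and> computes g (i # a # xs) b" "N.Rn u n y"
    using N.Rn_less(2) by (metis stdm_simps(5))
  define s where "s = (\<lambda>c. THE a. N.Rn u c a)"
  have s: "N.Rn u c a \<Longrightarrow> c < Suc n \<Longrightarrow> s c = a" for c a unfolding s_def using u(1) by (intro the_equality) auto
  have "\<forall>i<n. computes g (i # s i # xs) (s (Suc i))"
  proof (intro allI impI)
    fix i assume i: "i < n"
    then obtain a b where "N.Rn u i a" "N.Rn u (Suc i) b" "computes g (i # a # xs) b" using u(4) by blast
    then show "computes g (i # s i # xs) (s (Suc i))" using s[of i a] s[of "Suc i" b] i by simp
  qed
  then show "computes (PrimRec f g) (n # xs) y"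
    unfolding computes_PrimRec using s[OF u(2)] s[OF u(5)] u(3) by (intro exI[of _ s]) simp
qed

lemma sd_False: "sd (\<lambda>_. False)"
  by (intro sd_dd dd_False)

lemma sd_computes: "\<forall>t\<in>set ts. td t \<Longrightarrow> td y \<Longrightarrow> sd (\<lambda>e. computes f (map (\<lambda>t. t e) ts) (y e))"
proof (induction f arbitrary: ts y)
  case ZeroF
  have "computes ZeroF xs z \<longleftrightarrow> z = 0" for xs z by (auto intro: computes.intros)
  then show ?case using ZeroF by (simp add: sd_dd dd_eq td_0)
next
  case SucF
  show ?case
  proof (cases "\<exists>t. ts = [t]")
    case True
    then obtain t where "ts = [t]" by blast
    moreover have "computes SucF [x] z \<longleftrightarrow> z = Suc x" for x z by (auto intro: computes.intros)
    ultimately show ?thesis using SucF by (simp add: sd_dd dd_eq td_Suc)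
  next
    case False
    then have "\<not> computes SucF (map (\<lambda>t. t e) ts) (y e)" for e
      by (auto elim!: computes.cases[of SucF])
    then show ?thesis by (simp add: sd_False)
  qed
next
  case (Proj i)
  have c: "computes (Proj i) xs z \<longleftrightarrow> i < length xs \<and> z = xs ! i" for xs z by (auto intro: computes.intros)
  show ?case
  proof (cases "i < length ts")
    case True
    then show ?thesis using Proj by (simp add: c sd_dd dd_eq)
  qed (simp add: c sd_False)
next
  case (Comp f gs)
  let ?s = "\<lambda>h :: (nat \<Rightarrow> nat) \<Rightarrow> nat. \<lambda>e. h (\<lambda>i. e (Suc i))"
  have shift: "td h \<Longrightarrow> td (?s h)" for h
    unfolding td_def using mval_tsub[of stdm _ "Var \<circ> Suc"]
    by (elim exE, rule_tac x = "tsub (Var \<circ> Suc) t" in exI) simp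
  \<comment> \<open>The inner functions are evaluated one at a time; \<open>acc\<close> collects the
    results so far, each held by a quantified variable. This avoids quantifying over lists.\<close>
  have "sd (\<lambda>e. \<exists>ys. list_all2 (\<lambda>g. computes g (map (\<lambda>t. t e) ts)) hs ys \<and> computes f (map (\<lambda>t. t e) acc @ ys) (y e))"
    if "set hs \<subseteq> set gs" "\<forall>t\<in>set ts. td t" "\<forall>t\<in>set acc. td t" "td y" for hs ts acc y
    using that
  proof (induction hs arbitrary: ts acc y)
    case Nil
    then show ?case using Comp.IH(1) by simp
  next
    case (Cons h hs)
    have "sd (\<lambda>e. computes h (map (\<lambda>t. t e) (map ?s ts)) (e 0))"
      by (rule Comp.IH(2)) (use Cons.prems shift td_var in auto)
    moreover have "sd (\<lambda>e. \<exists>ys. list_all2 (\<lambda>g. computes g (map (\<lambda>t. t e) (map ?s ts))) hs ys \<and>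
        computes f (map (\<lambda>t. t e) (map ?s acc @ [\<lambda>e. e 0]) @ ys) (?s y e))"
      by (rule Cons.IH) (use Cons.prems shift td_var in auto)
    ultimately have "sd (\<lambda>e. \<exists>z. computes h (map (\<lambda>t. t e) ts) z \<and>
      (\<exists>ys. list_all2 (\<lambda>g. computes g (map (\<lambda>t. t e) ts)) hs ys \<and> computes f (map (\<lambda>t. t e) acc @ z # ys) (y e)))"
      by (intro sd_ex sd_conj) (simp_all add: comp_def)
    moreover have "(\<exists>ys. list_all2 R (h # hs) ys \<and> Q ys) \<longleftrightarrow> (\<exists>z. R h z \<and> (\<exists>ys. list_all2 R hs ys \<and> Q (z # ys)))"
      for R and Q :: "nat list \<Rightarrow> bool" by (auto simp: list_all2_Cons1)
    ultimately show ?case by (simp only:)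
  qed
  from this[of gs ts "[]" y] Comp.prems
  have "sd (\<lambda>e. \<exists>ys. list_all2 (\<lambda>g. computes g (map (\<lambda>t. t e) ts)) gs ys \<and> computes f ys (y e))" by simp
  moreover have "computes (Comp f gs) xs z \<longleftrightarrow> (\<exists>ys. list_all2 (\<lambda>g. computes g xs) gs ys \<and> computes f ys z)" for xs z
    by (auto intro: computes.intros)
  ultimately show ?case by simp
next
  case (PrimRec f g)
  let ?s = "\<lambda>k. \<lambda>h :: (nat \<Rightarrow> nat) \<Rightarrow> nat. \<lambda>e. h (\<lambda>i. e (i + k))"
  have shift: "td h \<Longrightarrow> td (?s k h)" for h k
    unfolding td_def using mval_tsub[of stdm _ "\<lambda>i. Var (i + k)"]
    by (elim exE, rule_tac x = "tsub (\<lambda>i. Var (i + k)) t" in exI) simp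
  show ?case
  proof (cases ts)
    case Nil
    then have "\<not> computes (PrimRec f g) (map (\<lambda>t. t e) ts) (y e)" for e by auto
    then show ?thesis by (simp add: sd_False)
  next
    case (Cons n xs)
    have n: "td n" and xs: "\<forall>t\<in>set xs. td t" and y: "td y" using PrimRec.prems Cons by auto
    have f: "sd (\<lambda>e. computes f (map (\<lambda>t. t (\<lambda>i. e (Suc (Suc i)))) xs) (e 0))"
      using PrimRec.IH(1)[of "map (?s 2) xs" "\<lambda>e. e 0"] shift[of _ 2] xs td_var by (simp add: comp_def)
    have g: "sd (\<lambda>e. computes g (e 2 # e (Suc 0) # map (\<lambda>t. t (\<lambda>i. e (Suc (Suc (Suc (Suc i)))))) xs) (e 0))"
      using PrimRec.IH(2)[of "(\<lambda>e. e 2) # (\<lambda>e. e (Suc 0)) # map (?s 4) xs" "\<lambda>e. e 0"] shift[of _ 4] xs td_var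
      by (simp add: comp_def numeral_Bit0)
    have "sd (\<lambda>e. \<exists>u. (\<forall>c<Suc (n e). \<forall>a<u. \<forall>b<u. N.Rn u c a \<longrightarrow> N.Rn u c b \<longrightarrow> a = b) \<and>
     (\<exists>r. N.Rn u 0 r \<and> computes f (map (\<lambda>t. t e) xs) r) \<and>
     (\<forall>i<n e. \<exists>a b. N.Rn u i a \<and> N.Rn u (Suc i) b \<and> computes g (i # a # map (\<lambda>t. t e) xs) b) \<and> N.Rn u (n e) (y e))"
      using shift[OF n, of 1] shift[OF y, of 1] f g
      by (intro sd_ex sd_conj sd_ball sd_dd[OF dd_Rn] td_Suc td_var td_0
          sd_dd[OF dd_ball[OF _ dd_ball[OF _ dd_ball]]] dd_imp dd_Rn dd_eq)
        (simp_all add: numeral_2_eq_2)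
    then show ?thesis unfolding Cons list.map computes_PrimRec_code .
  qed
next
  case (Mu f)
  let ?s = "\<lambda>k. \<lambda>h :: (nat \<Rightarrow> nat) \<Rightarrow> nat. \<lambda>e. h (\<lambda>i. e (i + k))"
  have shift: "td h \<Longrightarrow> td (?s k h)" for h k
    unfolding td_def using mval_tsub[of stdm _ "\<lambda>i. Var (i + k)"]
    by (elim exE, rule_tac x = "tsub (\<lambda>i. Var (i + k)) t" in exI) simp
  have "computes (Mu f) xs n \<longleftrightarrow> computes f (n # xs) 0 \<and> (\<forall>m<n. \<exists>z. computes f (m # xs) (Suc z))" for xs n
    by (auto intro: computes.intros)
  moreover have "sd (\<lambda>e. computes f (y e # map (\<lambda>t. t e) ts) 0)"
    using Mu.IH[of "y # ts" "\<lambda>_. 0"] Mu.prems td_0 by simp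
  moreover have "sd (\<lambda>e. \<forall>m<y e. \<exists>z. computes f (m # map (\<lambda>t. t e) ts) (Suc z))"
    using Mu.IH[of "(\<lambda>e. e (Suc 0)) # map (?s 2) ts" "\<lambda>e. Suc (e 0)"] Mu.prems shift[of _ 2] td_var td_Suc
    by (intro sd_ball sd_ex) (simp_all add: comp_def)
  ultimately show ?case by (simp add: sd_conj)
qed

theorem numerates_exists:
  assumes "rec_enumerable (fm_code ` S)" shows "\<exists>\<sigma>. numerates \<sigma> S"
proof -
  obtain f where f: "\<And>x. x \<in> fm_code ` S \<longleftrightarrow> (\<exists>y. computes f [x] y)"
    using assms unfolding rec_enumerable_def by blast
  have "sd (\<lambda>e. computes f [e (Suc 0)] (e 0))"
    using sd_computes[of "[\<lambda>e. e (Suc 0)]" "\<lambda>e. e 0" f] td_var by simp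
  then have "sd (\<lambda>e. \<exists>y. computes f [e 0] y)" by (intro sd_ex)
  then obtain D where D: "dd D" "\<And>e. (\<exists>y. computes f [e 0] y) \<longleftrightarrow> (\<exists>b. D (case_nat b e))"
    unfolding sd_def by blast
  then obtain p n where p: "Delta00 p" "fm_bd n 0 p" "\<And>e. D e = sat e (\<lambda>_. {}) p" unfolding dd_def by blast
  \<comment> \<open>Index 0 holds the unbounded witness. All other variables of \<open>p\<close> are
    identified with the single free number variable required by \<open>numerates\<close>.\<close>
  let ?r = "\<lambda>i. Var (if i = 0 then 0 else 1)"
  have "sat (case_nat b (\<lambda>_. x)) (\<lambda>_. {}) (fsub ?r id p) = sat (case_nat b (\<lambda>_. x)) (\<lambda>_. {}) p" for b x
  proof -
    have "(\<lambda>i. tm_val (case_nat b (\<lambda>_. x)) (?r i)) = case_nat b (\<lambda>_. x)"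
      by (auto simp: fun_eq_iff split: nat.split)
    then show ?thesis using msat_fsub[of stdm "case_nat b (\<lambda>_. x)" "\<lambda>_. {}" ?r id p] by simp
  qed
  then have "sat (\<lambda>_. x) (\<lambda>_. {}) (ExN (fsub ?r id p)) \<longleftrightarrow> x \<in> fm_code ` S" for x
    unfolding f D(2)[of "\<lambda>_. x", simplified] using p(3) D(2)[of "\<lambda>_. x"] by simp
  moreover have "Sigma01 (ExN (fsub ?r id p))" by (intro Sigma01.intros Delta00_fsub p)
  moreover have "fm_bd (Suc (Suc 0)) 0 (fsub ?r id p)" using p(2) by (rule fm_bd_fsub) auto
  ultimately show ?thesis unfolding numerates_def by (intro exI[of _ "ExN (fsub ?r id p)"]) simp
qed

lemma sound_extension_aca:
  assumes "\<forall>p\<in>ACA0. T \<turnstile> p" "mods M T" shows "aca M"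
proof
  show "mods M ACA0" unfolding mods_def
  proof (intro conjI ballI allI impI)
    show "ms M \<noteq> {}" using assms(2) by (simp add: mods_def)
    show "msat M e E q" if "q \<in> ACA0" "range E \<subseteq> ms M" for q e E
      using soundness[of T q M E e] assms that by blast
  qed
qed

text \<open>This subsumes the usual boundedness statement that a true \<open>\<Sigma>\<^sup>1\<^sub>1\<close> sentence does not help to
  prove well-foundedness: the formula \<open>p\<close> can describe the well-order \<open>Z\<close> with the help of
  arbitrary true sets.\<close>

theorem boundedness:
  assumes T: "sound_re_extension T" and p: "arithmetical p" "fm_bd 0 s p" "z < s"
    and sat: "sat (\<lambda>_. 0) E p"
    and Z: "Well_order Z" "E z = {N.pJ x y | x y. (x, y) \<in> Z \<and> x \<noteq> y}"
    and no: "\<And>(M :: nat model) e E F. mods M T \<Longrightarrow> aca M \<Longrightarrow> range E \<subseteq> ms M \<Longrightarrow> msat M e E p \<Longrightarrow>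
       \<not> aca.descending M F (E z)"
  shows "otype Z \<le> pt_ordinal T"
proof -
  define A where "A = Kf p z Zero (Var 0) (Var 1)"
  have p1: "fm_bd 1 s p" using p(2) by (rule fm_bd_mono) auto
  have A: "Delta00 A" "fm_bd 2 0 A" unfolding A_def by (rule Kf_props[OF p1])+ auto
  have Ts: "\<forall>p\<in>T. sentence p" and Ta: "\<forall>p\<in>ACA0. T \<turnstile> p" and Tp: "Pi11_sound T"
    using T by (auto simp: sound_re_extension_def)
  have "T \<turnstile> WO A"
  proof (rule completeness[OF Ts])
    show "\<forall>p\<in>basic_axioms. T \<turnstile> p" using Ta by (auto simp: ACA0_def)
    fix M :: "nat model" and e and E :: "nat \<Rightarrow> nat set" assume M: "mods M T" "range E \<subseteq> ms M"
    interpret aca M by (rule sound_extension_aca[OF Ta M(1)])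
    have "WOm M (KBr p z (mz M))"
      using no[OF M(1) aca_axioms] by (intro KBr_WOm[OF p(1) p1]) blast
    moreover have "arel M A = KBr p z (mz M)"
      by (simp add: fun_eq_iff arel_def A_def msat_Kf[OF p1])
    ultimately show "msat M e E (WO A)" using msat_WO[OF A(2) ms_ne] by simp
  qed
  \<comment> \<open>\<open>WO A\<close> is Pi11, so soundness makes the order really well-founded;
    only then does \<open>A\<close> present an order that counts for
    \<open>pt_ordinal T\<close>.\<close>
  moreover from this have "true_sentence (WO A)"
    using Tp Pi11_WO[OF Delta00_arithmetical[OF A(1)]] sentence_WO[OF A(2)] unfolding Pi11_sound_def by blast
  then have "msat stdm (\<lambda>_. 0) (\<lambda>_. {}) (WO A)" by (simp add: true_sentence_def)
  then have "WOm stdm (arel stdm A)" using msat_WO[OF A(2), of stdm] by simp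
  then have wo: "Well_order {(x, y). arel stdm A x y}" by (rule WOm_Well_order)
  have eq: "arel stdm A = N.KBr p z 0"
    by (simp add: fun_eq_iff arel_def A_def N.msat_Kf[OF p1, unfolded msat_stdm mval_stdm])
  have "presents A {(x, y). arel stdm A x y}"
    unfolding presents_def using wo A Delta00_recursive[OF A] Sigma01.intros(1)[OF A(1)] by (simp add: arel_def[abs_def])
  ultimately have "otype {(x, y). arel stdm A x y} \<le> pt_ordinal T" by (intro pt_ordinal_bound)
  moreover have "otype Z \<le> otype {(x, y). arel stdm A x y}"
    using KBr_otype[OF p(1) p1 p(3) sat Z] wo unfolding eq by blast
  ultimately show ?thesis by (rule order_trans[rotated])
qed

section \<open>Arithmetised syntax\<close>

definition isp :: "'a model \<Rightarrow> 'a \<Rightarrow> 'a \<Rightarrow> 'a \<Rightarrow> bool" where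
  "isp M z x y \<longleftrightarrow> mp M z z = mp M (mt M (mp M x y) (mp M (mp M x y) (mo M))) (mp M x x)"

lemma msat_pair_fm [simp]: "msat M e E (pair_fm z x y) \<longleftrightarrow> isp M (mval M e z) (mval M e x) (mval M e y)"
  by (simp add: pair_fm_def isp_def)

text \<open>Cantor pairing is only given by the equation \<open>pair_fm\<close>. That it is a total
  injective function is assumed here and supplied by \<open>facts_fm\<close>, which saves a
  development of halving inside models.\<close>

locale pm = aca M for M :: "'a model" +
  assumes pair_ex: "\<exists>z. isp M z x y"
    and pair_fun: "isp M z x y \<Longrightarrow> isp M z' x y \<Longrightarrow> z = z'"
    and pair_inj: "isp M z x y \<Longrightarrow> isp M z x' y' \<Longrightarrow> x = x' \<and> y = y'"
begin

definition pr :: "'a \<Rightarrow> 'a \<Rightarrow> 'a" where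
  "pr x y = (THE z. isp M z x y)"

lemma isp_pr [simp]: "isp M z x y \<longleftrightarrow> z = pr x y"
  unfolding pr_def using pair_ex[of x y] pair_fun by (metis (mono_tags, lifting) theI)

lemma pr_inj [simp]: "pr x y = pr x' y' \<longleftrightarrow> x = x' \<and> y = y'"
  using pair_inj[of "pr x y" x y x' y'] by auto

primrec patv :: "(nat \<Rightarrow> 'a) \<Rightarrow> pat \<Rightarrow> 'a" where
  "patv \<rho> (PV k) = \<rho> k"
| "patv \<rho> (PN c) = nv c"
| "patv \<rho> (PPlus p q) = patv \<rho> p \<oplus> patv \<rho> q"
| "patv \<rho> (PTimes p q) = patv \<rho> p \<otimes> patv \<rho> q"
| "patv \<rho> (PPair p q) = pr (patv \<rho> p) (patv \<rho> q)"

lemma msat_pat_fm [simp]: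
  "msat M e E (pat_fm p d u) \<longleftrightarrow> mval M e u = patv (\<lambda>k. e (d + k)) p"
  by (induction p arbitrary: d u e) (simp_all add: numeral_2_eq_2)

lemma patv_cong: "(\<And>k. k < pat_bound p \<Longrightarrow> \<rho> k = \<rho>' k) \<Longrightarrow> patv \<rho> p = patv \<rho>' p"
  by (induction p) auto

lemma msat_is_fm [simp]: "msat M e E (is_fm p k) \<longleftrightarrow> e k = patv e p"
  by (simp add: is_fm_def)

lemma msat_mem_fm [simp]: "msat M e E (mem_fm p i) \<longleftrightarrow> patv e p \<in> E i"
  by (simp add: mem_fm_def)

end

lemma fm_bd_pat_fm: "tm_bd n u \<Longrightarrow> d + pat_bound p \<le> n \<Longrightarrow> fm_bd n s (pat_fm p d u)"
  by (induction p arbitrary: d u n) (auto simp: numeral_2_eq_2 pair_fm_def)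

lemma fm_bd_ExN_pow: "fm_bd n s ((ExN ^^ m) p) = fm_bd (n + m) s p"
  by (induction m arbitrary: n) (auto simp: funpow_swap1)

lemma fm_bd_foldr_And: "fm_bd n s (foldr And ps q) \<longleftrightarrow> (\<forall>p\<in>set ps. fm_bd n s p) \<and> fm_bd n s q"
  by (induction ps) auto

lemma fm_bd_foldr_Or: "fm_bd n s (foldr Or ps q) \<longleftrightarrow> (\<forall>p\<in>set ps. fm_bd n s p) \<and> fm_bd n s q"
  by (induction ps) auto

lemma fm_bd_beta_fm: "tm_bd n a \<Longrightarrow> tm_bd n b \<Longrightarrow> tm_bd n i \<Longrightarrow> tm_bd n r \<Longrightarrow> fm_bd n s (beta_fm a b i r)"
  by (simp add: beta_fm_def Let_def)

lemma clause_bound: "p \<in> set (snd c # fst c) \<Longrightarrow> pat_bound p \<le> clause_bound c"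
proof -
  have "x \<in> set xs \<Longrightarrow> x \<le> foldr max xs 0" for x :: nat and xs by (induction xs) auto
  then show "p \<in> set (snd c # fst c) \<Longrightarrow> pat_bound p \<le> clause_bound c"
    unfolding clause_bound_def by (metis (no_types, lifting) image_eqI image_set)
qed

lemma fm_bd_clause_fm:
  "tm_bd n a \<Longrightarrow> tm_bd n b \<Longrightarrow> tm_bd n i \<Longrightarrow> tm_bd n g \<Longrightarrow> fm_bd n s (clause_fm a b i g c)"
proof -
  have "2 + pat_bound p \<le> Suc (Suc (n + clause_bound c))" "pat_bound p \<le> n + clause_bound c"
    if "p \<in> set (snd c # fst c)" for p
    using clause_bound[OF that] by simp_all
  then show "tm_bd n a \<Longrightarrow> tm_bd n b \<Longrightarrow> tm_bd n i \<Longrightarrow> tm_bd n g \<Longrightarrow> ?thesis"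
    unfolding clause_fm_def Let_def
    by (auto simp: fm_bd_ExN_pow fm_bd_foldr_And numeral_2_eq_2 intro!: fm_bd_beta_fm fm_bd_pat_fm)
qed

lemma fm_bd_derivable_fm: "fm_bd 1 0 G \<Longrightarrow> tm_bd n f \<Longrightarrow> fm_bd n s (derivable_fm G Cs f)"
proof -
  assume "fm_bd 1 0 G" "tm_bd n f"
  moreover from this(1) have "fm_bd (Suc (Suc (Suc (Suc (Suc n))))) s G" by (rule fm_bd_mono) auto
  ultimately show ?thesis unfolding derivable_fm_def
    by (auto simp: fm_bd_foldr_Or numeral_3_eq_3 intro!: fm_bd_beta_fm fm_bd_clause_fm)
qed

lemma fm_bd_rel_fm: "fm_bd 1 0 G \<Longrightarrow> pat_bound f \<le> n \<Longrightarrow> fm_bd n s (rel_fm G f)"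
  unfolding rel_fm_def by (auto intro!: fm_bd_pat_fm fm_bd_derivable_fm)

subsection \<open>Derivability in the standard model\<close>

lemma isp_stdm: "isp stdm z x y \<longleftrightarrow> z = prod_encode (x, y)"
proof -
  have "even ((x + y) * (x + y + 1))" by simp
  then have "2 * prod_encode (x, y) = (x + y) * (x + y + 1) + 2 * x"
    by (simp add: prod_encode_def triangle_def)
  then show ?thesis by (auto simp: isp_def)
qed

interpretation N: pm stdm
  by unfold_locales (auto simp: isp_stdm)

lemma N_pr [simp]: "N.pr x y = prod_encode (x, y)"
  using N.isp_pr[of "prod_encode (x, y)" x y] unfolding isp_stdm by simp

definition betav :: "nat \<Rightarrow> nat \<Rightarrow> nat \<Rightarrow> nat" where
  "betav a b i = a mod (1 + (i + 1) * b)"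

lemma sat_beta_fm [simp]:
  "sat e E (beta_fm a b i r) \<longleftrightarrow> tm_val e r = betav (tm_val e a) (tm_val e b) (tm_val e i)"
proof -
  have "x < m \<and> (\<exists>q. y = q * m + x) \<longleftrightarrow> x = y mod m" if "m > 0" for x y m :: nat
    using that by (auto simp: mult.commute) (metis mod_div_decomp mult.commute)
  from this[of "1 + (tm_val e i + 1) * tm_val e b" "tm_val e r" "tm_val e a"] show ?thesis
    unfolding beta_fm_def betav_def Let_def by (simp del: mult_Suc mult_Suc_right add_mult_distrib)
qed

text \<open>Goedel's lemma. The number \<open>n\<close> exceeds the length and every entry, so its
  factorial is divisible by all differences of positions, which makes the moduli coprime, and every
  modulus exceeds every entry. The Chinese remainder theorem gives \<open>a\<close>.\<close>

lemma betav_ex: "\<exists>a b. \<forall>i<length xs. betav a b i = xs ! i"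
proof -
  define n where "n = length xs + sum_list xs + 1"
  define b where "b = (fact n :: nat)"
  let ?m = "\<lambda>i. 1 + (i + 1) * b"
  have cop: "coprime (?m i) (?m j)" if "i < j" "j < length xs" for i j
  proof (rule ccontr)
    assume "\<not> coprime (?m i) (?m j)"
    then have "gcd (?m i) (?m j) \<noteq> 1" by (simp add: coprime_iff_gcd_eq_1)
    then obtain q where q: "prime q" "q dvd gcd (?m i) (?m j)" using prime_factor_nat by blast
    then have d: "q dvd ?m i" "q dvd ?m j" by auto
    have "?m j = ?m i + (j - i) * b" using that by (simp add: algebra_simps flip: add_mult_distrib)
    then have "q dvd (j - i) * b" using d dvd_add_right_iff by metis
    moreover have "q dvd b" if "q dvd (j - i)"
    proof -
      have "q \<le> j - i" using that \<open>i < j\<close> by (intro dvd_imp_le) auto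
      then have "q \<le> n" using \<open>j < length xs\<close> by (simp add: n_def)
      then show ?thesis unfolding b_def using q(1) by (simp add: prime_dvd_fact_iff)
    qed
    ultimately have "q dvd b" using q(1) prime_dvd_multD by blast
    then have "q dvd 1" using d(1) by (meson dvd_add_left_iff dvd_mult)
    then show False using q(1) by auto
  qed
  have "\<forall>i\<in>{..<length xs}. \<forall>j\<in>{..<length xs}. i \<noteq> j \<longrightarrow> coprime (?m i) (?m j)"
    using cop by (metis coprime_commute lessThan_iff linorder_neqE_nat)
  from chinese_remainder_nat[OF _ this, of "\<lambda>i. xs ! i"] obtain a where
    a: "\<forall>i\<in>{..<length xs}. [a = xs ! i] (mod ?m i)" by auto
  have "betav a b i = xs ! i" if "i < length xs" for i
  proof -
    have "xs ! i \<le> n" using member_le_sum_list[OF nth_mem[OF that]] by (simp add: n_def)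
    also have "n \<le> b" unfolding b_def by (rule fact_ge_self)
    also have "b < ?m i" by simp
    finally show ?thesis using a that by (simp add: betav_def cong_def)
  qed
  then show ?thesis by blast
qed

inductive drv :: "(nat \<Rightarrow> bool) \<Rightarrow> clause list \<Rightarrow> nat \<Rightarrow> bool" for g Cs where
  base: "g w \<Longrightarrow> drv g Cs w"
| step: "c \<in> set Cs \<Longrightarrow> \<forall>p\<in>set (fst c). drv g Cs (N.patv \<rho> p) \<Longrightarrow> drv g Cs (N.patv \<rho> (snd c))"

lemma sat_ExN_pow: "sat e E ((ExN ^^ m) q) \<longleftrightarrow> (\<exists>e'. (\<forall>i. e' (i + m) = e i) \<and> sat e' E q)"
proof (induction m arbitrary: e)
  case 0
  have "(\<forall>i. e' i = e i) \<longleftrightarrow> e' = e" for e' by (auto simp: fun_eq_iff)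
  then show ?case by simp
next
  case (Suc m)
  have *: "(\<forall>i. e' (i + m) = case_nat x e i) \<longleftrightarrow> e' m = x \<and> (\<forall>i. e' (i + Suc m) = e i)" for e' x
    by (auto split: nat.split)
  have "sat e E ((ExN ^^ Suc m) q) \<longleftrightarrow> (\<exists>x. sat (case_nat x e) E ((ExN ^^ m) q))"
    by (simp add: fEx_def[symmetric] msat_f(4)[of stdm, unfolded msat_stdm] del: sat.simps)
  then show ?case unfolding Suc * by auto
qed

lemma sat_foldr_And: "sat e E (foldr And ps q) \<longleftrightarrow> (\<forall>p\<in>set ps. sat e E p) \<and> sat e E q"
  by (induction ps) auto

lemma sat_foldr_Or: "sat e E (foldr Or ps q) \<longleftrightarrow> (\<exists>p\<in>set ps. sat e E p) \<or> sat e E q"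
  by (induction ps) auto

lemma sat_pat_fm [simp]: "sat e E (pat_fm p d u) \<longleftrightarrow> tm_val e u = N.patv (\<lambda>k. e (d + k)) p"
  using N.msat_pat_fm[of e E p d u] by simp

lemma tm_val_lifts: "(\<And>i. e' (i + m) = e i) \<Longrightarrow> tm_val e' (lifts m t) = tm_val e t"
  using N.mval_lifts[of e' m e t] by simp

lemma sat_clause_fm:
  "sat e E (clause_fm a b i g c) \<longleftrightarrow> (\<exists>\<rho>. (\<forall>p\<in>set (fst c). \<exists>j<tm_val e i.
     betav (tm_val e a) (tm_val e b) j = N.patv \<rho> p) \<and> tm_val e g = N.patv \<rho> (snd c))"
proof -
  let ?m = "clause_bound c"
  have l2: "tm_val (case_nat y (case_nat x e')) (lifts (?m + 2) t) = tm_val e t" if "\<forall>i. e' (i + ?m) = e i" for x y e' t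
    by (rule tm_val_lifts) (use that in \<open>simp add: numeral_2_eq_2\<close>)
  have l0: "tm_val e' (lifts ?m t) = tm_val e t" if "\<forall>i. e' (i + ?m) = e i" for e' t
    by (rule tm_val_lifts) (use that in simp)
  have "sat e E (clause_fm a b i g c) \<longleftrightarrow> (\<exists>e'. (\<forall>i. e' (i + ?m) = e i) \<and> (\<forall>p\<in>set (fst c). \<exists>j<tm_val e i.
     betav (tm_val e a) (tm_val e b) j = N.patv e' p) \<and> tm_val e g = N.patv e' (snd c))" (is "_ \<longleftrightarrow> ?R")
    unfolding clause_fm_def Let_def sat_ExN_pow
  proof (rule ex_cong1, rule conj_cong, rule refl)
    fix e' assume e': "\<forall>i. e' (i + ?m) = e i"
    let ?F = "\<lambda>p. ExN (ExN (And (Less (Var 1) (lifts (?m + 2) i))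
      (And (beta_fm (lifts (?m + 2) a) (lifts (?m + 2) b) (Var 1) (Var 0)) (pat_fm p 2 (Var 0)))))"
    have *: "sat e' E (?F p) \<longleftrightarrow>
      (\<exists>j<tm_val e i. betav (tm_val e a) (tm_val e b) j = N.patv e' p)" for p
      by (simp only: sat.simps sat_beta_fm sat_pat_fm l2[OF e'] tm_val.simps)
        (auto simp: numeral_2_eq_2)
    show "sat e' E (foldr And (map ?F (fst c)) (pat_fm (snd c) 0 (lifts ?m g))) \<longleftrightarrow>
      (\<forall>p\<in>set (fst c). \<exists>j<tm_val e i. betav (tm_val e a) (tm_val e b) j = N.patv e' p) \<and>
      tm_val e g = N.patv e' (snd c)"
      unfolding sat_foldr_And list.set_map ball_simps(9) * by (simp add: l0[OF e'])
  qed
  also have "\<dots> \<longleftrightarrow> (\<exists>\<rho>. (\<forall>p\<in>set (fst c). \<exists>j<tm_val e i.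
     betav (tm_val e a) (tm_val e b) j = N.patv \<rho> p) \<and> tm_val e g = N.patv \<rho> (snd c))" (is "_ \<longleftrightarrow> ?S")
  proof
    assume ?S
    then obtain \<rho> where \<rho>: "\<forall>p\<in>set (fst c). \<exists>j<tm_val e i. betav (tm_val e a) (tm_val e b) j = N.patv \<rho> p"
      "tm_val e g = N.patv \<rho> (snd c)" by blast
    define e' where "e' = (\<lambda>i. if i < ?m then \<rho> i else e (i - ?m))"
    have "N.patv e' p = N.patv \<rho> p" if "p \<in> set (snd c # fst c)" for p
      by (rule N.patv_cong) (use clause_bound[OF that] in \<open>auto simp: e'_def\<close>)
    then have "\<forall>p\<in>set (fst c). \<exists>j<tm_val e i. betav (tm_val e a) (tm_val e b) j = N.patv e' p"
      "tm_val e g = N.patv e' (snd c)" using \<rho> by simp_all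
    moreover have "\<forall>i. e' (i + ?m) = e i" by (simp add: e'_def)
    ultimately show ?R by blast
  qed blast
  finally show ?thesis .
qed

text \<open>From right to left a derivation tree is flattened: derivations of the premises are
  concatenated and the conclusion appended, which respects the demand that premises come earlier.
  The beta function then codes the list.\<close>

lemma derivable_iff:
  "(\<exists>a b n. betav a b n = w \<and> (\<forall>i<Suc n. g (betav a b i) \<or> (\<exists>c\<in>set Cs. \<exists>\<rho>.
     (\<forall>p\<in>set (fst c). \<exists>j<i. betav a b j = N.patv \<rho> p) \<and> betav a b i = N.patv \<rho> (snd c)))) \<longleftrightarrow> drv g Cs w"
  (is "?L \<longleftrightarrow> _")
proof
  assume ?L
  then obtain a b n where w: "betav a b n = w" and H: "\<And>i. i < Suc n \<Longrightarrow> g (betav a b i) \<or> (\<exists>c\<in>set Cs. \<exists>\<rho>.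
     (\<forall>p\<in>set (fst c). \<exists>j<i. betav a b j = N.patv \<rho> p) \<and> betav a b i = N.patv \<rho> (snd c))" by blast
  have "i < Suc n \<Longrightarrow> drv g Cs (betav a b i)" for i
  proof (induction i rule: less_induct)
    case (less i)
    from H[OF less.prems] show ?case
    proof (elim disjE bexE exE conjE)
      fix c \<rho> assume c: "c \<in> set Cs" "\<forall>p\<in>set (fst c). \<exists>j<i. betav a b j = N.patv \<rho> p" "betav a b i = N.patv \<rho> (snd c)"
      have "\<forall>p\<in>set (fst c). drv g Cs (N.patv \<rho> p)"
        using c(2) less by (metis less_trans)
      then show ?thesis using c drv.step by metis
    qed (rule drv.base)
  qed
  then show "drv g Cs w" using w by blast
next
  let ?ok = "\<lambda>xs. \<forall>i<length xs. g (xs ! i) \<or> (\<exists>c\<in>set Cs. \<exists>\<rho>.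
     (\<forall>p\<in>set (fst c). \<exists>j<i. xs ! j = N.patv \<rho> p) \<and> xs ! i = N.patv \<rho> (snd c))"
  have app: "?ok (xs @ ys)" if xs: "?ok xs" and ys: "?ok ys" for xs ys
  proof (intro allI impI)
    fix i assume i: "i < length (xs @ ys)"
    show "g ((xs @ ys) ! i) \<or> (\<exists>c\<in>set Cs. \<exists>\<rho>.
     (\<forall>p\<in>set (fst c). \<exists>j<i. (xs @ ys) ! j = N.patv \<rho> p) \<and> (xs @ ys) ! i = N.patv \<rho> (snd c))"
    proof (cases "i < length xs")
      case True
      then have e: "j \<le> i \<Longrightarrow> (xs @ ys) ! j = xs ! j" for j by (simp add: nth_append)
      show ?thesis using xs[rule_format, OF True] e by (metis less_imp_le_nat order_refl)
    next
      case False
      define k where "k = i - length xs"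
      have k: "k < length ys" "i = length xs + k" using False i by (auto simp: k_def)
      have e: "(xs @ ys) ! (length xs + j) = ys ! j" for j by simp
      show ?thesis using ys[rule_format, OF k(1)] unfolding k(2) e
        by (metis e add_less_cancel_left)
    qed
  qed
  assume "drv g Cs w"
  then have "\<exists>xs. ?ok xs \<and> w \<in> set xs"
  proof (induction rule: drv.induct)
    case (base w)
    then show ?case by (intro exI[of _ "[w]"]) auto
  next
    case (step c \<rho>)
    have "\<exists>xs. ?ok xs \<and> (\<forall>p\<in>set ps. N.patv \<rho> p \<in> set xs)" if "set ps \<subseteq> set (fst c)" for ps
      using that
    proof (induction ps)
      case Nil
      then show ?case by (intro exI[of _ "[]"]) simp
    next
      case (Cons p ps)
      then obtain xs where xs: "?ok xs" "\<forall>p\<in>set ps. N.patv \<rho> p \<in> set xs" by auto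
      moreover obtain ys where ys: "?ok ys" "N.patv \<rho> p \<in> set ys" using step.IH Cons.prems by auto
      ultimately show ?case using app[OF xs(1) ys(1)] by (intro exI[of _ "xs @ ys"]) auto
    qed
    from this[of "fst c"] obtain xs where xs: "?ok xs" "\<forall>p\<in>set (fst c). N.patv \<rho> p \<in> set xs" by auto
    have "?ok (xs @ [N.patv \<rho> (snd c)])"
    proof (intro allI impI)
      fix i assume i: "i < length (xs @ [N.patv \<rho> (snd c)])"
      show "g ((xs @ [N.patv \<rho> (snd c)]) ! i) \<or> (\<exists>c'\<in>set Cs. \<exists>\<rho>'.
     (\<forall>p\<in>set (fst c'). \<exists>j<i. (xs @ [N.patv \<rho> (snd c)]) ! j = N.patv \<rho>' p) \<and> (xs @ [N.patv \<rho> (snd c)]) ! i = N.patv \<rho>' (snd c'))"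
      proof (cases "i < length xs")
        case True
        then have e: "j \<le> i \<Longrightarrow> (xs @ [N.patv \<rho> (snd c)]) ! j = xs ! j" for j by (simp add: nth_append)
        show ?thesis using xs(1)[rule_format, OF True] e by (metis less_imp_le_nat order_refl)
      next
        case False
        then have i: "i = length xs" using i by simp
        have "\<forall>p\<in>set (fst c). \<exists>j<i. (xs @ [N.patv \<rho> (snd c)]) ! j = N.patv \<rho> p"
        proof
          fix p assume "p \<in> set (fst c)"
          then obtain j where "j < length xs" "xs ! j = N.patv \<rho> p" using xs(2) by (metis in_set_conv_nth)
          then show "\<exists>j<i. (xs @ [N.patv \<rho> (snd c)]) ! j = N.patv \<rho> p" by (intro exI[of _ j]) (simp add: i nth_append)
        qed
        moreover have "(xs @ [N.patv \<rho> (snd c)]) ! i = N.patv \<rho> (snd c)" by (simp add: i)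
        ultimately show ?thesis using step.hyps by blast
      qed
    qed
    then show ?case by (intro exI[of _ "xs @ [N.patv \<rho> (snd c)]"]) simp
  qed
  then obtain xs n where xs: "?ok xs" "n < length xs" "xs ! n = w" by (auto simp: in_set_conv_nth)
  obtain a b where ab: "\<And>i. i < length xs \<Longrightarrow> betav a b i = xs ! i" using betav_ex by blast
  have "g (betav a b i) \<or> (\<exists>c\<in>set Cs. \<exists>\<rho>.
     (\<forall>p\<in>set (fst c). \<exists>j<i. betav a b j = N.patv \<rho> p) \<and> betav a b i = N.patv \<rho> (snd c))" if "i < Suc n" for i
  proof -
    have "i < length xs" using that xs(2) by simp
    moreover have "j < i \<Longrightarrow> betav a b j = xs ! j" for j using ab \<open>i < length xs\<close> by simp
    ultimately show ?thesis using xs(1) ab[of i] by (metis (no_types, lifting))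
  qed
  then show ?L using ab[OF xs(2)] xs(3) by blast
qed

lemma sat_derivable_fm:
  assumes "fm_bd 1 0 G"
  shows "sat e E (derivable_fm G Cs f) \<longleftrightarrow> drv (\<lambda>w. sat (\<lambda>_. w) (\<lambda>_. {}) G) Cs (tm_val e f)"
proof -
  have G: "sat (case_nat w e') E' G = sat (\<lambda>_. w) (\<lambda>_. {}) G" for w e' E'
    using msat_cong[OF assms, of "case_nat w e'" "\<lambda>_. w" E' "\<lambda>_. {}" stdm] by simp
  show ?thesis unfolding derivable_iff[symmetric] derivable_fm_def
    by (simp add: sat_foldr_Or G sat_clause_fm numeral_3_eq_3 eval_nat_numeral eq_commute[of "tm_val e f"])
qed

subsection \<open>Correctness of the clauses\<close>

lemma nv_N [simp]: "N.nv c = c"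
  by (induction c) auto

lemma tm_code_inv:
  "prod_encode (0, i) = tm_code t \<longleftrightarrow> t = Var i"
  "prod_encode (Suc 0, 0) = tm_code t \<longleftrightarrow> t = Zero"
  "prod_encode (2, 0) = tm_code t \<longleftrightarrow> t = One"
  "prod_encode (3, prod_encode (x, y)) = tm_code t \<longleftrightarrow> (\<exists>u v. t = Plus u v \<and> x = tm_code u \<and> y = tm_code v)"
  "prod_encode (4, prod_encode (x, y)) = tm_code t \<longleftrightarrow> (\<exists>u v. t = Times u v \<and> x = tm_code u \<and> y = tm_code v)"
  by (cases t; auto)+

lemma fm_code_inv:
  "prod_encode (0, prod_encode (x, y)) = fm_code p \<longleftrightarrow> (\<exists>u v. p = Equal u v \<and> x = tm_code u \<and> y = tm_code v)"
  "prod_encode (Suc 0, prod_encode (x, y)) = fm_code p \<longleftrightarrow> (\<exists>u v. p = Less u v \<and> x = tm_code u \<and> y = tm_code v)"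
  "prod_encode (2, prod_encode (x, y)) = fm_code p \<longleftrightarrow> (\<exists>u. p = Mem u y \<and> x = tm_code u)"
  "prod_encode (3, 0) = fm_code p \<longleftrightarrow> p = Falsum"
  "prod_encode (4, prod_encode (x, y)) = fm_code p \<longleftrightarrow> (\<exists>q r. p = Imp q r \<and> x = fm_code q \<and> y = fm_code r)"
  "prod_encode (5, x) = fm_code p \<longleftrightarrow> (\<exists>q. p = AllN q \<and> x = fm_code q)"
  "prod_encode (6, x) = fm_code p \<longleftrightarrow> (\<exists>q. p = AllS q \<and> x = fm_code q)"
  by (cases p; auto)+

text \<open>Entry \<open>k\<close> of the list is the intended meaning of the relation tagged
  \<open>k\<close>; it serves as the invariant for derivations. The entries for lifting,
  substitution and subformulas are conditional because their clauses also apply to numbers that code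
  no syntax.\<close>

definition Sem :: "fm set \<Rightarrow> nat \<Rightarrow> bool" where
  "Sem T w = (case prod_decode w of (k, a) \<Rightarrow>
     (case prod_decode a of (x, b) \<Rightarrow> (case prod_decode b of (y, c) \<Rightarrow> (case prod_decode c of (z, v) \<Rightarrow>
       ([x < b,
         \<exists>t. b = tm_code t \<and> tm_bd x t,
         \<exists>p. c = fm_code p \<and> fm_bd x y p,
         \<exists>p. c = fm_code p \<and> fm_bd x y p \<and> arithmetical p,
         \<exists>k q. y = fm_code ((AllS ^^ k) q) \<and> c = fm_code q \<and> arithmetical q \<and> fm_bd 0 (x + k) q,
         \<forall>t. y = tm_code t \<longrightarrow> c = tm_code (tm_lift x t),
         \<forall>p. y = fm_code p \<longrightarrow> c = fm_code (fm_liftN x p),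
         \<forall>p. y = fm_code p \<longrightarrow> c = fm_code (fm_liftS x p),
         \<forall>r t. y = tm_code r \<longrightarrow> z = tm_code t \<longrightarrow> v = tm_code (tm_subst x r t),
         \<forall>r p. y = tm_code r \<longrightarrow> z = fm_code p \<longrightarrow> v = fm_code (fm_substN x r p),
         \<forall>p. z = fm_code p \<longrightarrow> v = fm_code (fm_substS x y p),
         y < length (list_decode x) \<and> list_decode x ! y = c,
         \<exists>t. x = tm_code t \<and> tm_bd (length (list_decode y)) t \<and> tm_val (nth (list_decode y)) t = c,
         \<forall>p. x = fm_code p \<longrightarrow> (\<exists>q\<in>subs p. b = fm_code q),
         \<exists>p. a = fm_code p \<and> T \<turnstile> p] ! k)))))"

lemma Sem_simps:
  "Sem T (prod_encode (0, prod_encode (x, y))) \<longleftrightarrow> x < y"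
  "Sem T (prod_encode (Suc 0, prod_encode (n, x))) \<longleftrightarrow> (\<exists>t. x = tm_code t \<and> tm_bd n t)"
  "Sem T (prod_encode (2, prod_encode (n, prod_encode (s, x)))) \<longleftrightarrow> (\<exists>p. x = fm_code p \<and> fm_bd n s p)"
  "Sem T (prod_encode (3, prod_encode (n, prod_encode (s, x)))) \<longleftrightarrow> (\<exists>p. x = fm_code p \<and> fm_bd n s p \<and> arithmetical p)"
  "Sem T (prod_encode (4, prod_encode (s, prod_encode (x, y)))) \<longleftrightarrow>
    (\<exists>k q. x = fm_code ((AllS ^^ k) q) \<and> y = fm_code q \<and> arithmetical q \<and> fm_bd 0 (s + k) q)"
  "Sem T (prod_encode (5, prod_encode (c, prod_encode (x, y)))) \<longleftrightarrow> (\<forall>t. x = tm_code t \<longrightarrow> y = tm_code (tm_lift c t))"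
  "Sem T (prod_encode (6, prod_encode (c, prod_encode (x, y)))) \<longleftrightarrow> (\<forall>t. x = fm_code t \<longrightarrow> y = fm_code (fm_liftN c t))"
  "Sem T (prod_encode (7, prod_encode (c, prod_encode (x, y)))) \<longleftrightarrow> (\<forall>t. x = fm_code t \<longrightarrow> y = fm_code (fm_liftS c t))"
  "Sem T (prod_encode (8, prod_encode (k, prod_encode (r', prod_encode (x, y))))) \<longleftrightarrow>
    (\<forall>r t. r' = tm_code r \<longrightarrow> x = tm_code t \<longrightarrow> y = tm_code (tm_subst k r t))"
  "Sem T (prod_encode (9, prod_encode (k, prod_encode (r', prod_encode (x, y))))) \<longleftrightarrow>
    (\<forall>r t. r' = tm_code r \<longrightarrow> x = fm_code t \<longrightarrow> y = fm_code (fm_substN k r t))"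
  "Sem T (prod_encode (10, prod_encode (k, prod_encode (j, prod_encode (x, y))))) \<longleftrightarrow>
    (\<forall>t. x = fm_code t \<longrightarrow> y = fm_code (fm_substS k j t))"
  "Sem T (prod_encode (11, prod_encode (e, prod_encode (n, x)))) \<longleftrightarrow>
    n < length (list_decode e) \<and> list_decode e ! n = x"
  "Sem T (prod_encode (12, prod_encode (t', prod_encode (e, x)))) \<longleftrightarrow>
    (\<exists>t. t' = tm_code t \<and> tm_bd (length (list_decode e)) t \<and> tm_val (nth (list_decode e)) t = x)"
  "Sem T (prod_encode (13, prod_encode (x, y))) \<longleftrightarrow> (\<forall>p. x = fm_code p \<longrightarrow> (\<exists>q\<in>subs p. y = fm_code q))"
  "Sem T (prod_encode (14, x)) \<longleftrightarrow> (\<exists>p. x = fm_code p \<and> T \<turnstile> p)"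
  by (simp_all add: Sem_def split: prod.split)

definition closed :: "(nat \<Rightarrow> bool) \<Rightarrow> clause list \<Rightarrow> bool" where
  "closed R Cs \<longleftrightarrow> (\<forall>c\<in>set Cs. \<forall>\<rho>. (\<forall>p\<in>set (fst c). R (N.patv \<rho> p)) \<longrightarrow> R (N.patv \<rho> (snd c)))"

lemma closed_drv: "closed (drv g Cs) Cs"
  unfolding closed_def using drv.step by blast

lemma drv_closed: "drv g Cs w \<Longrightarrow> closed R Cs \<Longrightarrow> (\<And>w. g w \<Longrightarrow> R w) \<Longrightarrow> R w"
  by (induction rule: drv.induct) (auto simp: closed_def)

lemma closed_simps:
  "closed R [] \<longleftrightarrow> True"
  "closed R ((ps, q) # Cs) \<longleftrightarrow> (\<forall>\<rho>. (\<forall>p\<in>set ps. R (N.patv \<rho> p)) \<longrightarrow> R (N.patv \<rho> q)) \<and> closed R Cs"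
  "closed R (Cs @ Ds) \<longleftrightarrow> closed R Cs \<and> closed R Ds"
  by (auto simp: closed_def)


lemma closed_lt: "closed (Sem T) lt_clauses"
  by (simp add: lt_clauses_def Let_def closed_simps Sem_simps)

lemma closed_bd: "closed (Sem T) bd_clauses"
proof -
  have "\<exists>k q'. fm_code p = fm_code ((AllS ^^ k) q') \<and> fm_code p = fm_code q' \<and> arithmetical q' \<and> fm_bd 0 (s + k) q'"
    if "fm_bd 0 s p" "arithmetical p" for s p
    using that by (intro exI[of _ 0] exI[of _ p]) simp
  moreover have "\<exists>k' q'. AllS ((AllS ^^ k) q) = (AllS ^^ k') q' \<and> q = q' \<and> arithmetical q' \<and> fm_bd 0 (s + k') q'"
    if "arithmetical q" "fm_bd 0 (Suc (s + k)) q" for k q s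
    using that by (intro exI[of _ "Suc k"] exI[of _ q]) simp
  ultimately show ?thesis
  by (simp add: bd_clauses_def Let_def closed_simps Sem_simps tm_code_inv fm_code_inv del: fm_code_eq, force)
qed

lemma closed_lift: "closed (Sem T) lift_clauses"
  by (simp add: lift_clauses_def Let_def closed_simps Sem_simps tm_code_inv fm_code_inv, (intro conjI; auto))

lemma closed_subst: "closed (Sem T) subst_clauses"
  by (simp add: subst_clauses_def Let_def closed_simps Sem_simps tm_code_inv fm_code_inv, (intro conjI; force))

lemma closed_val: "closed (Sem T) val_clauses"
  by (simp add: val_clauses_def Let_def closed_simps Sem_simps tm_code_inv fm_code_inv) fastforce

lemma closed_sub: "closed (Sem T) sub_clauses"
proof -
  have s: "Imp q r \<in> subs p \<Longrightarrow> q \<in> subs p \<and> r \<in> subs p" "AllN q \<in> subs p \<Longrightarrow> q \<in> subs p" for p q r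
    using subs_trans[of "Imp q r" p] subs_trans[of "AllN q" p] subs_refl[of q] subs_refl[of r] by auto
  have 1: "\<exists>q\<in>subs p. x = fm_code q" "\<exists>q\<in>subs p. y = fm_code q"
    if "\<forall>p. r = fm_code p \<longrightarrow> (\<exists>q\<in>subs p. \<exists>a b. q = Imp a b \<and> x = fm_code a \<and> y = fm_code b)" "r = fm_code p" for x y r p
    using that s by metis+
  have 2: "\<exists>q\<in>subs p. x = fm_code q"
    if "\<forall>p. r = fm_code p \<longrightarrow> (\<exists>q\<in>subs p. \<exists>a. q = AllN a \<and> x = fm_code a)" "r = fm_code p" for x r p
    using that s by metis
  show ?thesis
    by (simp add: sub_clauses_def Let_def closed_simps Sem_simps tm_code_inv fm_code_inv)
      (intro conjI allI impI; (erule (1) 1 | erule (1) 2))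
qed

lemma closed_prv: "closed (Sem T) prv_clauses"
  by (simp add: prv_clauses_def Let_def closed_simps Sem_simps tm_code_inv fm_code_inv)
    (intro conjI allI impI; clarsimp; auto intro: proves.intros)

lemma closed_clauses: "closed (Sem T) clauses"
  by (simp add: clauses_def closed_simps closed_lt closed_bd closed_lift closed_subst closed_val closed_sub closed_prv)

section \<open>Completeness of the clauses\<close>

abbreviation D :: "(nat \<Rightarrow> bool) \<Rightarrow> nat \<Rightarrow> bool" where
  "D g \<equiv> drv g clauses"

text \<open>Assignments written as explicit lists let the simplifier turn the closure conditions
  into the introduction rules \<open>ltI\<close> to \<open>prvI\<close>.\<close>

lemma closed_nth:
  "closed R Cs \<Longrightarrow> list_all (\<lambda>c. list_all (\<lambda>p. R (N.patv ((!) xs) p)) (fst c) \<longrightarrow> R (N.patv ((!) xs) (snd c))) Cs"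
  by (simp add: closed_def list_all_iff)

lemma closed_D: "closed (D g) lt_clauses" "closed (D g) bd_clauses" "closed (D g) lift_clauses"
  "closed (D g) subst_clauses" "closed (D g) val_clauses" "closed (D g) sub_clauses" "closed (D g) prv_clauses"
  using closed_drv[of g clauses] unfolding clauses_def closed_simps by auto

lemmas ltI = closed_nth[OF closed_D(1), where xs = "[x, y]" for x y, simplified lt_clauses_def Let_def, simplified]
lemmas bdI = closed_nth[OF closed_D(2), where xs = "[n, s, t, u, i, p, q]" for n s t u i p q, simplified bd_clauses_def Let_def, simplified]
lemmas liftI = closed_nth[OF closed_D(3), where xs = "[c, t, u, t', u', i, p, q, p', q']" for c t u t' u' i p q p' q', simplified lift_clauses_def Let_def, simplified]
lemmas substI = closed_nth[OF closed_D(4), where xs = "[k, r, t, u, t', u', i, p, q, p', q', r', j]" for k r t u t' u' i p q p' q' r' j, simplified subst_clauses_def Let_def, simplified]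
lemmas valI = closed_nth[OF closed_D(5), where xs = "[e, x, y, n, t, u]" for e x y n t u, simplified val_clauses_def Let_def, simplified]
lemmas subI = closed_nth[OF closed_D(6), where xs = "[r, p, q]" for r p q, simplified sub_clauses_def Let_def, simplified]
lemmas prvI = closed_nth[OF closed_D(7), where xs = "[n, s, p, q, r, t, u, i]" for n s p q r t u i, simplified prv_clauses_def Let_def, simplified]


lemma D_lt: "x < y \<Longrightarrow> D g (prod_encode (0, prod_encode (x, y)))"
proof (induction x arbitrary: y)
  case (0 y)
  then show ?case using ltI by (cases y) simp_all
next
  case (Suc x y)
  then show ?case using ltI by (cases y) simp_all
qed

lemma D_tm: "tm_bd n t \<Longrightarrow> D g (prod_encode (1, prod_encode (n, tm_code t)))"
  by (induction t) (simp_all add: bdI D_lt)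

lemma D_fm: "fm_bd n s p \<Longrightarrow> D g (prod_encode (2, prod_encode (n, prod_encode (s, fm_code p))))"
  using D_tm by (induction p arbitrary: n s) (simp_all add: bdI D_lt)

lemma D_ar: "fm_bd n s p \<Longrightarrow> arithmetical p \<Longrightarrow> D g (prod_encode (3, prod_encode (n, prod_encode (s, fm_code p))))"
  using D_tm by (induction p arbitrary: n s) (simp_all add: bdI D_lt)

lemma D_matrix:
  "fm_bd 0 (s + k) q \<Longrightarrow> arithmetical q \<Longrightarrow>
    D g (prod_encode (4, prod_encode (s, prod_encode (fm_code ((AllS ^^ k) q), fm_code q))))"
  by (induction k arbitrary: s) (simp_all add: bdI D_ar)

lemma D_lift: "D g (prod_encode (5, prod_encode (c, prod_encode (tm_code t, tm_code (tm_lift c t)))))"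
  by (induction t) (simp_all add: liftI D_lt)

lemma D_liftN: "D g (prod_encode (6, prod_encode (c, prod_encode (fm_code p, fm_code (fm_liftN c p)))))"
  by (induction p arbitrary: c) (simp_all add: liftI D_lt D_lift)

lemma D_liftS: "D g (prod_encode (7, prod_encode (c, prod_encode (fm_code p, fm_code (fm_liftS c p)))))"
  by (induction p arbitrary: c) (simp_all add: liftI D_lt)

lemma D_subst: "D g (prod_encode (8, prod_encode (k, prod_encode (tm_code r, prod_encode (tm_code t, tm_code (tm_subst k r t))))))"
proof (induction t)
  case (Var i)
  show ?case by (cases i) (auto simp: substI D_lt)
qed (simp_all add: substI)

lemma D_substN: "D g (prod_encode (9, prod_encode (k, prod_encode (tm_code r, prod_encode (fm_code p, fm_code (fm_substN k r p))))))"
proof (induction p arbitrary: k r)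
  case (AllN p)
  from D_lift AllN.IH[of "Suc k" "tm_lift 0 r"] show ?case
    using substI[where g = g and k = k and r = "tm_code r" and p = "fm_code p" and p' = "fm_code (fm_substN (Suc k) (tm_lift 0 r) p)" and r' = "tm_code (tm_lift 0 r)"] by simp
qed (simp_all add: substI D_lt D_subst)

lemma D_substS: "D g (prod_encode (10, prod_encode (k, prod_encode (j, prod_encode (fm_code p, fm_code (fm_substS k j p))))))"
proof (induction p arbitrary: k j)
  case (Mem t i)
  show ?case by (cases i) (auto simp: substI D_lt)
qed (simp_all add: substI)

lemma D_nth: "n < length l \<Longrightarrow> D g (prod_encode (11, prod_encode (list_encode l, prod_encode (n, l ! n))))"
proof (induction l arbitrary: n)
  case (Cons x l)
  then show ?case by (cases n) (simp_all add: valI)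
qed simp

lemma D_val:
  "tm_bd (length l) t \<Longrightarrow> D g (prod_encode (12, prod_encode (tm_code t, prod_encode (list_encode l, tm_val ((!) l) t))))"
  by (induction t) (simp_all add: valI D_nth)

text \<open>The bounds demanded by the axiom clauses merely ensure that the arguments code formulas
  and terms; \<open>ex_fm_bd\<close> always supplies some.\<close>

lemma D_prv:
  assumes "\<And>p. p \<in> T \<Longrightarrow> D g (prod_encode (14, fm_code p))"
  shows "T \<turnstile> p \<Longrightarrow> D g (prod_encode (14, fm_code p))"
proof (induction rule: proves.induct)
  case (Ax p)
  then show ?case by (rule assms)
next
  case (MP p q)
  then show ?case using prvI[where g = g and p = "fm_code p" and q = "fm_code q"] by simp
next
  case (AxK p q)
  obtain n s where "fm_bd n s (Imp p q)" using ex_fm_bd by blast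
  then show ?case using prvI[where g = g and n = n and s = s and p = "fm_code p" and q = "fm_code q"] by (simp add: D_fm)
next
  case (AxS p q r)
  obtain n s where "fm_bd n s (Imp p (Imp q r))" using ex_fm_bd by blast
  then show ?case using prvI[where g = g and n = n and s = s and p = "fm_code p" and q = "fm_code q" and r = "fm_code r"] by (simp add: D_fm)
next
  case (AxDN p)
  obtain n s where "fm_bd n s p" using ex_fm_bd by blast
  then show ?case using prvI[where g = g and n = n and s = s and p = "fm_code p"] by (simp add: D_fm)
next
  case (InstN p t)
  obtain n s where "fm_bd n s (Imp p (Equal t t))" using ex_fm_bd by blast
  then show ?case using prvI[where g = g and n = n and s = s and p = "fm_code p" and q = "fm_code (fm_substN 0 t p)" and t = "tm_code t"] by (simp add: D_fm D_tm[simplified] D_substN)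
next
  case (VacN p)
  obtain n s where "fm_bd n s p" using ex_fm_bd by blast
  then show ?case using prvI[where g = g and n = n and s = s and p = "fm_code p" and q = "fm_code (fm_liftN 0 p)"] by (simp add: D_fm D_liftN)
next
  case (DistN p q)
  obtain n s where "fm_bd n s (Imp p q)" using ex_fm_bd by blast
  then show ?case using prvI[where g = g and n = n and s = s and p = "fm_code p" and q = "fm_code q"] by (simp add: D_fm)
next
  case (InstS p i)
  obtain n s where "fm_bd n s p" using ex_fm_bd by blast
  then show ?case using prvI[where g = g and n = n and s = s and p = "fm_code p" and q = "fm_code (fm_substS 0 i p)" and i = i] by (simp add: D_fm D_substS)
next
  case (VacS p)
  obtain n s where "fm_bd n s p" using ex_fm_bd by blast
  then show ?case using prvI[where g = g and n = n and s = s and p = "fm_code p" and q = "fm_code (fm_liftS 0 p)"] by (simp add: D_fm D_liftS)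
next
  case (DistS p q)
  obtain n s where "fm_bd n s (Imp p q)" using ex_fm_bd by blast
  then show ?case using prvI[where g = g and n = n and s = s and p = "fm_code p" and q = "fm_code q"] by (simp add: D_fm)
next
  case (EqRefl t)
  obtain n s where "fm_bd n s (Equal t t)" using ex_fm_bd by blast
  then show ?case using prvI[where g = g and n = n and t = "tm_code t"] by (simp add: D_tm[simplified])
next
  case (EqSubst t u p)
  obtain n s where "fm_bd n s (Imp p (Equal t u))" using ex_fm_bd by blast
  then show ?case using prvI[where g = g and n = n and s = s and p = "fm_code p" and q = "fm_code (fm_substN 0 t p)" and r = "fm_code (fm_substN 0 u p)" and t = "tm_code t" and u = "tm_code u"]
    by (simp add: D_fm D_tm[simplified] D_substN)
next
  case (GenN p)
  then show ?case using prvI[where g = g and p = "fm_code p", THEN conjunct2, THEN conjunct1] by simp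
next
  case (GenS p)
  then show ?case using prvI[where g = g and p = "fm_code p", THEN conjunct2, THEN conjunct2, THEN conjunct1] by simp
qed

lemma D_Sem: "D g w \<Longrightarrow> (\<And>w. g w \<Longrightarrow> Sem T w) \<Longrightarrow> Sem T w"
  using drv_closed closed_clauses by blast

abbreviation DS :: "nat \<Rightarrow> bool" where
  "DS \<equiv> D (\<lambda>_. False)"

lemma DS_Sem: "DS w \<Longrightarrow> Sem {} w"
  using D_Sem[of "\<lambda>_. False" w] by simp

lemma DS_matrix: "DS (prod_encode (4, prod_encode (s, prod_encode (x, y)))) \<longleftrightarrow>
  (\<exists>k q. x = fm_code ((AllS ^^ k) q) \<and> y = fm_code q \<and> arithmetical q \<and> fm_bd 0 (s + k) q)"
  using DS_Sem D_matrix by (fastforce simp: Sem_simps)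

lemma DS_nth: "DS (prod_encode (11, prod_encode (e, prod_encode (n, x)))) \<longleftrightarrow> n < length (list_decode e) \<and> list_decode e ! n = x"
  using DS_Sem[of "prod_encode (11, prod_encode (e, prod_encode (n, x)))"] D_nth[of n "list_decode e"] by (auto simp: Sem_simps)

lemma DS_val: "DS (prod_encode (12, prod_encode (z, prod_encode (e, x)))) \<longleftrightarrow>
  (\<exists>t. z = tm_code t \<and> tm_bd (length (list_decode e)) t \<and> tm_val ((!) (list_decode e)) t = x)"
  using DS_Sem[of "prod_encode (12, prod_encode (z, prod_encode (e, x)))"] D_val[of "list_decode e"] by (auto simp: Sem_simps)

lemma DS_sub: "DS (prod_encode (13, prod_encode (fm_code p, z))) \<Longrightarrow> \<exists>q\<in>subs p. z = fm_code q"
  using DS_Sem[of "prod_encode (13, prod_encode (fm_code p, z))"] by (simp add: Sem_simps)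

lemma sat_rel_fm: "fm_bd 1 0 G \<Longrightarrow>
  sat e E (rel_fm G f) \<longleftrightarrow> D (\<lambda>w. sat (\<lambda>_. w) (\<lambda>_. {}) G) (N.patv e f)"
  by (simp add: rel_fm_def sat_derivable_fm)

lemma fm_bd_prv: "fm_bd 1 0 \<sigma> \<Longrightarrow> fm_bd 1 0 (ExN (And (pat_fm (rPrv (PV 0)) 0 (Var 1)) \<sigma>))"
  by (simp del: pat_fm.simps) (auto intro!: fm_bd_pat_fm intro: fm_bd_mono[of 1 0 \<sigma>] simp del: pat_fm.simps)

lemma sat_prv_fm:
  assumes "numerates \<sigma> S"
  shows "sat e E (prv_fm \<sigma>) \<longleftrightarrow> (\<exists>p. e 0 = fm_code p \<and> S \<turnstile> p)"
proof -
  let ?G = "ExN (And (pat_fm (rPrv (PV 0)) 0 (Var 1)) \<sigma>)"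
  have \<sigma>: "fm_bd 1 0 \<sigma>" "\<And>x. sat (\<lambda>_. x) (\<lambda>_. {}) \<sigma> \<longleftrightarrow> x \<in> fm_code ` S"
    using assms by (auto simp: numerates_def)
  have "sat (case_nat x e) E' \<sigma> \<longleftrightarrow> x \<in> fm_code ` S" for x e E'
    unfolding \<sigma>(2)[symmetric] using msat_cong[OF \<sigma>(1), of "case_nat x e" "\<lambda>_. x" E' "\<lambda>_. {}" stdm] by simp
  then have G: "sat (\<lambda>_. w) (\<lambda>_. {}) ?G \<longleftrightarrow> (\<exists>p\<in>S. w = prod_encode (14, fm_code p))" for w
    by (auto simp del: pat_fm.simps)
  have "D (\<lambda>w. sat (\<lambda>_. w) (\<lambda>_. {}) ?G) (prod_encode (14, x)) \<longleftrightarrow> (\<exists>p. x = fm_code p \<and> S \<turnstile> p)" for x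
    unfolding G
  proof
    assume "D (\<lambda>w. \<exists>p\<in>S. w = prod_encode (14, fm_code p)) (prod_encode (14, x))"
    then have "Sem S (prod_encode (14, x))"
      by (rule D_Sem) (auto simp: Sem_simps intro: proves.Ax)
    then show "\<exists>p. x = fm_code p \<and> S \<turnstile> p" by (simp add: Sem_simps)
  next
    assume "\<exists>p. x = fm_code p \<and> S \<turnstile> p"
    then show "D (\<lambda>w. \<exists>p\<in>S. w = prod_encode (14, fm_code p)) (prod_encode (14, x))"
      by (auto intro: D_prv[of S] drv.base)
  qed
  then show ?thesis unfolding prv_fm_def using fm_bd_prv[OF \<sigma>(1)] by (simp add: sat_rel_fm del: sat.simps)
qed

section \<open>Satisfaction classes in models\<close>

lemma arithmetical_pat_fm [simp]: "arithmetical (pat_fm p d u)"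
  by (induction p arbitrary: d u) (auto simp: pair_fm_def)

lemma arithmetical_foldr_Or: "arithmetical (foldr Or ps q) \<longleftrightarrow> (\<forall>p\<in>set ps. arithmetical p) \<and> arithmetical q"
  by (induction ps) auto

lemma arithmetical_foldr_And: "arithmetical (foldr And ps q) \<longleftrightarrow> (\<forall>p\<in>set ps. arithmetical p) \<and> arithmetical q"
  by (induction ps) auto

lemma arithmetical_ExN_pow: "arithmetical ((ExN ^^ m) p) = arithmetical p"
  by (induction m) auto

lemma arithmetical_derivable_fm [simp]: "arithmetical G \<Longrightarrow> arithmetical (derivable_fm G Cs f)"
  by (auto simp: derivable_fm_def beta_fm_def clause_fm_def Let_def arithmetical_foldr_Or
      arithmetical_foldr_And arithmetical_ExN_pow)

lemma arithmetical_rel_fm [simp]: "arithmetical G \<Longrightarrow> arithmetical (rel_fm G f)"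
  by (simp add: rel_fm_def)

lemma arithmetical_prv_fm [simp]: "arithmetical \<sigma> \<Longrightarrow> arithmetical (prv_fm \<sigma>)"
  by (simp add: prv_fm_def del: pat_fm.simps)

lemma arithmetical_is_mem_fm [simp]: "arithmetical (is_fm p k)" "arithmetical (mem_fm p i)"
  by (simp_all add: is_fm_def mem_fm_def)

lemma fm_bd_is_fm: "k < n \<Longrightarrow> pat_bound p \<le> n \<Longrightarrow> fm_bd n s (is_fm p k)"
  by (simp add: is_fm_def fm_bd_pat_fm)

lemma fm_bd_mem_fm: "i < s \<Longrightarrow> pat_bound p \<le> n \<Longrightarrow> fm_bd n s (mem_fm p i)"
  by (simp add: mem_fm_def fm_bd_pat_fm)

text \<open>The six conditions of \<open>satclass_fm\<close> on their own, since
  \<open>order_fm\<close> imposes them on a different collection of codes than the subformulas of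
  one formula.\<close>

definition tarski_fm :: fm where
  "tarski_fm =
     fAnd (AllN (AllN (Imp (is_fm (pEqual (PV 1) (PV 0)) 3)
            (fIff (mem_fm (PPair (PV 3) (PV 2)) 0)
                 (fEx (fAnd (syn_fm (rVal (PV 2) (PV 3) (PV 0)))
                           (syn_fm (rVal (PV 1) (PV 3) (PV 0)))))))))
     (fAnd (AllN (AllN (Imp (is_fm (pLess (PV 1) (PV 0)) 3)
            (fIff (mem_fm (PPair (PV 3) (PV 2)) 0)
                 (fEx (fEx (fAnd (syn_fm (rVal (PV 3) (PV 4) (PV 1)))
                           (fAnd (syn_fm (rVal (PV 2) (PV 4) (PV 0)))
                                (Less (Var 1) (Var 0))))))))))
     (fAnd (AllN (AllN (Imp (is_fm (pMem (PV 1) (PV 0)) 3)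
            (fIff (mem_fm (PPair (PV 3) (PV 2)) 0)
                 (fEx (fAnd (syn_fm (rVal (PV 2) (PV 3) (PV 0)))
                           (mem_fm (PPair (PV 1) (PV 0)) 1)))))))
     (fAnd (Imp (is_fm pFalsum 1) (Neg (mem_fm (PPair (PV 1) (PV 0)) 0)))
     (fAnd (AllN (AllN (Imp (is_fm (pImp (PV 1) (PV 0)) 3)
            (fIff (mem_fm (PPair (PV 3) (PV 2)) 0)
                 (Imp (mem_fm (PPair (PV 1) (PV 2)) 0) (mem_fm (PPair (PV 0) (PV 2)) 0))))))
          (AllN (Imp (is_fm (pAllN (PV 0)) 2)
            (fIff (mem_fm (PPair (PV 2) (PV 1)) 0)
                 (AllN (mem_fm (PPair (PV 1) (pCons (PV 0) (PV 2))) 0)))))))))"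

lemma satclass_tarski: "satclass_fm = AllN (AllN (Imp (syn_fm (rSub (PV 2) (PV 1))) tarski_fm))"
  by (simp only: satclass_fm_def tarski_fm_def f_defs)

lemma arithmetical_tarski [simp]: "arithmetical tarski_fm"
  by (simp add: tarski_fm_def)

lemma fm_bd_tarski: "fm_bd 2 2 tarski_fm"
  unfolding tarski_fm_def by (simp add: fm_bd_is_fm fm_bd_mem_fm fm_bd_rel_fm)

lemma arithmetical_satclass [simp]: "arithmetical satclass_fm"
  by (simp add: satclass_tarski)

lemma fm_bd_satclass: "fm_bd 1 2 satclass_fm"
  using fm_bd_tarski by (auto simp: satclass_tarski fm_bd_rel_fm numeral_2_eq_2 numeral_3_eq_3 intro: fm_bd_mono)

context pm
begin

lemma nv_add: "nv (m + n) = nv m \<oplus> nv n"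
  by (induction n) (simp_all add: add_suc)

lemma nv_mul: "nv (m * n) = nv m \<otimes> nv n"
  by (induction n) (simp_all add: mul_suc nv_add, simp add: add_comm)

text \<open>Doubled, the pairing is an equation between polynomials in standard numbers, and such
  equations transfer to \<open>M\<close>. Hence codes of actual formulas are built in
  \<open>M\<close> from the same components.\<close>

lemma nv_pair [simp]: "nv (prod_encode (a, b)) = pr (nv a) (nv b)"
proof -
  have "isp stdm (prod_encode (a, b)) a b" by (simp add: isp_stdm)
  then have "nv (prod_encode (a, b) + prod_encode (a, b)) = nv ((a + b) * (a + b + 1) + (a + a))"
    by (simp add: isp_def)
  then have "isp M (nv (prod_encode (a, b))) (nv a) (nv b)"
    unfolding nv_add nv_mul isp_def by simp
  then show ?thesis by simp
qed

lemma nv_01 [simp]: "nv n = \<zero> \<longleftrightarrow> n = 0" "\<zero> = nv n \<longleftrightarrow> n = 0" "nv n = \<one> \<longleftrightarrow> n = 1" "\<one> = nv n \<longleftrightarrow> n = 1"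
proof -
  have "nv 0 = \<zero>" "nv 1 = \<one>" by simp_all
  then show "nv n = \<zero> \<longleftrightarrow> n = 0" "\<zero> = nv n \<longleftrightarrow> n = 0" "nv n = \<one> \<longleftrightarrow> n = 1" "\<one> = nv n \<longleftrightarrow> n = 1"
    using nv_eq by metis+
qed

definition SY :: "'a \<Rightarrow> bool" where
  "SY w \<longleftrightarrow> msat M (\<lambda>_. w) (\<lambda>_. {}) (derivable_fm Falsum clauses (Var 0))"

lemma msat_syn_fm [simp]: "msat M e E (syn_fm f) \<longleftrightarrow> SY (patv e f)"
proof -
  have b: "fm_bd 1 0 (derivable_fm Falsum clauses (Var 0))" by (rule fm_bd_derivable_fm) simp_all
  have "msat M (case_nat w e) E (derivable_fm Falsum clauses (Var 0)) \<longleftrightarrow> SY w" for w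
    unfolding SY_def by (rule msat_cong[OF b]) auto
  then show ?thesis by (simp add: rel_fm_def)
qed

abbreviation Mat where "Mat s p q \<equiv> SY (pr (nv 4) (pr s (pr p q)))"
abbreviation Nth where "Nth e n x \<equiv> SY (pr (nv 11) (pr e (pr n x)))"
abbreviation Val where "Val t e x \<equiv> SY (pr (nv 12) (pr t (pr e x)))"
abbreviation Sub where "Sub p q \<equiv> SY (pr (nv 13) (pr p q))"
abbreviation cons where "cons x e \<equiv> suc (pr x e)"

definition tarski :: "'a set \<Rightarrow> 'a set \<Rightarrow> 'a \<Rightarrow> 'a \<Rightarrow> bool" where
  "tarski X C z e \<longleftrightarrow>
    (\<forall>t u. z = pr \<zero> (pr t u) \<longrightarrow> (pr z e \<in> C \<longleftrightarrow> (\<exists>v. Val t e v \<and> Val u e v))) \<and>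
    (\<forall>t u. z = pr \<one> (pr t u) \<longrightarrow> (pr z e \<in> C \<longleftrightarrow> (\<exists>v w. Val t e v \<and> Val u e w \<and> v \<lhd> w))) \<and>
    (\<forall>t i. z = pr (nv 2) (pr t i) \<longrightarrow> (pr z e \<in> C \<longleftrightarrow> (\<exists>v. Val t e v \<and> pr i v \<in> X))) \<and>
    (z = pr (nv 3) \<zero> \<longrightarrow> pr z e \<notin> C) \<and>
    (\<forall>x y. z = pr (nv 4) (pr x y) \<longrightarrow> (pr z e \<in> C \<longleftrightarrow> (pr x e \<in> C \<longrightarrow> pr y e \<in> C))) \<and>
    (\<forall>x. z = pr (nv 5) x \<longrightarrow> (pr z e \<in> C \<longleftrightarrow> (\<forall>a. pr x (cons a e) \<in> C)))"

definition satc :: "'a set \<Rightarrow> 'a set \<Rightarrow> 'a \<Rightarrow> bool" where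
  "satc X C q \<longleftrightarrow> (\<forall>z e. Sub q z \<longrightarrow> tarski X C z e)"

lemma msat_tarski [simp]: "msat M e E tarski_fm \<longleftrightarrow> tarski (E 1) (E 0) (e 1) (e 0)"
  unfolding tarski_fm_def tarski_def by simp

lemma msat_satclass [simp]: "msat M e E satclass_fm \<longleftrightarrow> satc (E 1) (E 0) (e 0)"
  by (simp add: satclass_tarski satc_def numeral_2_eq_2)

end

text \<open>True facts about the arithmetised syntax; which theories prove them is irrelevant, since
  they may be part of the true \<open>\<Sigma>\<^sup>1\<^sub>1\<close> sentence.\<close>

definition pairing_fm :: fm where
  "pairing_fm =
    fAnd (AllN (AllN (fEx (pair_fm (Var 0) (Var 2) (Var 1)))))
   (fAnd (AllN (AllN (AllN (AllN (Imp (pair_fm (Var 1) (Var 3) (Var 2)) (Imp (pair_fm (Var 0) (Var 3) (Var 2)) (Equal (Var 1) (Var 0))))))))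
      (AllN (AllN (AllN (AllN (AllN (Imp (pair_fm (Var 0) (Var 4) (Var 3)) (Imp (pair_fm (Var 0) (Var 2) (Var 1)) (fAnd (Equal (Var 4) (Var 2)) (Equal (Var 3) (Var 1)))))))))))"

definition syntax_fm :: fm where
  "syntax_fm =
    fAnd (AllN (syn_fm (rSub (PV 0) (PV 0))))
   (fAnd (AllN (AllN (AllN (Imp (syn_fm (rSub (PV 2) (pImp (PV 1) (PV 0)))) (fAnd (syn_fm (rSub (PV 2) (PV 1))) (syn_fm (rSub (PV 2) (PV 0))))))))
   (fAnd (AllN (AllN (Imp (syn_fm (rSub (PV 1) (pAllN (PV 0)))) (syn_fm (rSub (PV 1) (PV 0))))))
   (fAnd (AllN (AllN (fIff (syn_fm (rVal pZero (PV 1) (PV 0))) (Equal (Var 0) Zero))))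
   (fAnd (AllN (AllN (fIff (syn_fm (rVal pOne (PV 1) (PV 0))) (Equal (Var 0) One))))
   (fAnd (AllN (AllN (AllN (fIff (syn_fm (rVal (pVar (PV 2)) (PV 1) (PV 0))) (syn_fm (rNth (PV 1) (PV 2) (PV 0)))))))
   (fAnd (AllN (AllN (AllN (AllN (fIff (syn_fm (rVal (pPlus (PV 3) (PV 2)) (PV 1) (PV 0)))
      (fEx (fEx (fAnd (syn_fm (rVal (PV 5) (PV 3) (PV 1))) (fAnd (syn_fm (rVal (PV 4) (PV 3) (PV 0))) (Equal (Var 2) (Plus (Var 1) (Var 0))))))))))))
   (fAnd (AllN (AllN (AllN (AllN (fIff (syn_fm (rVal (pTimes (PV 3) (PV 2)) (PV 1) (PV 0)))
      (fEx (fEx (fAnd (syn_fm (rVal (PV 5) (PV 3) (PV 1))) (fAnd (syn_fm (rVal (PV 4) (PV 3) (PV 0))) (Equal (Var 2) (Times (Var 1) (Var 0))))))))))))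
   (fAnd (AllN (AllN (AllN (fIff (syn_fm (rNth (pCons (PV 2) (PV 1)) (PN 0) (PV 0))) (Equal (Var 0) (Var 2))))))
     (AllN (AllN (AllN (AllN (fIff (syn_fm (rNth (pCons (PV 3) (PV 2)) (pSuc (PV 1)) (PV 0))) (syn_fm (rNth (PV 2) (PV 1) (PV 0))))))))))))))))"

definition facts_fm :: fm where
  "facts_fm = fAnd pairing_fm syntax_fm"

lemma facts_props [simp]: "arithmetical facts_fm" "fm_bd n s facts_fm"
  by (simp_all add: facts_fm_def pairing_fm_def syntax_fm_def pair_fm_def fm_bd_rel_fm)

locale sy = pm +
  assumes sub_refl [simp]: "Sub q q"
    and sub_imp: "Sub q (pr (nv 4) (pr x y)) \<Longrightarrow> Sub q x \<and> Sub q y"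
    and sub_all: "Sub q (pr (nv 5) x) \<Longrightarrow> Sub q x"
    and Val_zero [simp]: "Val (pr \<one> \<zero>) e v \<longleftrightarrow> v = \<zero>"
    and Val_one [simp]: "Val (pr (nv 2) \<zero>) e v \<longleftrightarrow> v = \<one>"
    and Val_var [simp]: "Val (pr \<zero> n) e v \<longleftrightarrow> Nth e n v"
    and Val_plus [simp]: "Val (pr (nv 3) (pr t u)) e v \<longleftrightarrow> (\<exists>x y. Val t e x \<and> Val u e y \<and> v = x \<oplus> y)"
    and Val_times [simp]: "Val (pr (nv 4) (pr t u)) e v \<longleftrightarrow> (\<exists>x y. Val t e x \<and> Val u e y \<and> v = x \<otimes> y)"
    and Nth_0 [simp]: "Nth (cons x e) \<zero> v \<longleftrightarrow> v = x"
    and Nth_suc [simp]: "Nth (cons x e) (suc n) v \<longleftrightarrow> Nth e n v"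

lemma (in pm) msat_syntax: "msat M e E syntax_fm \<longleftrightarrow> sy_axioms M"
  by (simp add: syntax_fm_def sy_axioms_def)

context aca
begin

lemma facts_sy: assumes "msat M e E facts_fm" shows "sy M"
proof -
  have p: "msat M e E pairing_fm" and s: "msat M e E syntax_fm" using assms by (simp_all add: facts_fm_def)
  from p have "\<exists>z. isp M z x y" "isp M z x y \<Longrightarrow> isp M z' x y \<Longrightarrow> z = z'"
    "isp M z x y \<Longrightarrow> isp M z x' y' \<Longrightarrow> x = x' \<and> y = y'" for z z' x y x' y'
    by (simp_all add: pairing_fm_def)
  then interpret pm M by unfold_locales
  from s show ?thesis unfolding msat_syntax using pm_axioms by (rule sy.intro[rotated])
qed

lemma sy_facts: assumes "sy M" shows "msat M e E facts_fm"
proof -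
  interpret sy M by (rule assms)
  have "msat M e E pairing_fm" by (simp add: pairing_fm_def)
  moreover have "msat M e E syntax_fm" unfolding msat_syntax using assms by (simp add: sy_def)
  ultimately show ?thesis by (simp add: facts_fm_def)
qed

end

lemma N_SY [simp]: "N.SY w \<longleftrightarrow> DS w"
  unfolding N.SY_def using sat_derivable_fm[of Falsum "\<lambda>_. w" "\<lambda>_. {}" clauses "Var 0"] by simp

interpretation N: sy stdm
proof
  show "N.Sub q q" for q using subI by simp
  show "N.Sub q x \<and> N.Sub q y" if "N.Sub q (N.pr (N.nv 4) (N.pr x y))" for q x y
    using that subI[of _ q x y] by simp
  show "N.Sub q x" if "N.Sub q (N.pr (N.nv 5) x)" for q x
    using that subI[of _ q x] by simp
qed (auto simp: DS_val DS_nth tm_code_inv)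

context sy
begin

primrec lst :: "'a list \<Rightarrow> 'a" where
  "lst [] = \<zero>"
| "lst (x # xs) = cons x (lst xs)"

lemma Nth_lst: "n < length xs \<Longrightarrow> Nth (lst xs) (nv n) v \<longleftrightarrow> v = xs ! n"
proof (induction xs arbitrary: n)
  case (Cons x xs)
  then show ?case by (cases n) simp_all
qed simp

lemma Val_tm: "tm_bd (length xs) t \<Longrightarrow> Val (nv (tm_code t)) (lst xs) v \<longleftrightarrow> v = mval M ((!) xs) t"
  by (induction t arbitrary: v) (simp_all add: Nth_lst)

lemma nth_Cons_case: "(!) (x # xs) = case_nat x ((!) xs)"
  by (auto simp: fun_eq_iff split: nat.split)

text \<open>External induction on an actual formula, so an arbitrary satisfaction class of the model
  must agree with truth on it. Set variable \<open>i\<close> is read as the \<open>i\<close>-th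
  section of \<open>X\<close>.\<close>

lemma truth:
  assumes "satc X C q"
  shows "Sub q (nv (fm_code p)) \<Longrightarrow> arithmetical p \<Longrightarrow> fm_bd (length xs) s p \<Longrightarrow>
    pr (nv (fm_code p)) (lst xs) \<in> C \<longleftrightarrow> msat M ((!) xs) (\<lambda>i. {x. pr (nv i) x \<in> X}) p"
proof (induction p arbitrary: xs)
  case (Equal t u)
  then have "tarski X C (nv (fm_code (Equal t u))) (lst xs)" using assms unfolding satc_def by blast
  then show ?case using Equal by (auto simp: tarski_def Val_tm)
next
  case (Less t u)
  then have "tarski X C (nv (fm_code (Less t u))) (lst xs)" using assms unfolding satc_def by blast
  then show ?case using Less by (auto simp: tarski_def Val_tm)
next
  case (Mem t i)
  then have "tarski X C (nv (fm_code (Mem t i))) (lst xs)" using assms unfolding satc_def by blast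
  then show ?case using Mem by (auto simp: tarski_def Val_tm)
next
  case Falsum
  then have "tarski X C (nv (fm_code Falsum)) (lst xs)" using assms unfolding satc_def by blast
  then show ?case by (auto simp: tarski_def)
next
  case (Imp p1 p2)
  then have "tarski X C (nv (fm_code (Imp p1 p2))) (lst xs)" using assms unfolding satc_def by blast
  moreover have "Sub q (nv (fm_code p1))" "Sub q (nv (fm_code p2))"
    using sub_imp[of q "nv (fm_code p1)" "nv (fm_code p2)"] Imp.prems(1) by (auto simp del: sub_refl)
  ultimately show ?case using Imp by (simp add: tarski_def)
next
  case (AllN p)
  then have t: "tarski X C (nv (fm_code (AllN p))) (lst xs)" using assms unfolding satc_def by blast
  have "pr (nv (fm_code p)) (lst (x # xs)) \<in> C \<longleftrightarrow> msat M ((!) (x # xs)) (\<lambda>i. {x. pr (nv i) x \<in> X}) p" for x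
    using AllN.prems sub_all[of q] by (intro AllN.IH) simp_all
  then show ?case using t by (simp add: tarski_def nth_Cons_case)
qed simp

end

lemma msat_AllS_pow_iff:
  "msat M e E ((AllS ^^ k) p) \<longleftrightarrow> (\<forall>E'. (\<forall>i. E' (i + k) = E i) \<longrightarrow> (\<forall>i<k. E' i \<in> ms M) \<longrightarrow> msat M e E' p)"
proof (induction k arbitrary: E)
  case 0
  have "(\<forall>i. E' i = E i) \<longleftrightarrow> E' = E" for E' by (auto simp: fun_eq_iff)
  then show ?case by simp
next
  case (Suc k)
  have *: "(\<forall>i. E' (i + k) = case_nat X E i) \<longleftrightarrow> E' k = X \<and> (\<forall>i. E' (i + Suc k) = E i)" for E' X
    by (auto split: nat.split)
  show ?case by (simp add: Suc * less_Suc_eq del: add_Suc_right) blast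
qed

context pm
begin

lemma dfn_isp: "tdf f \<Longrightarrow> tdf g \<Longrightarrow> tdf h \<Longrightarrow> dfn (\<lambda>e. isp M (f e) (g e) (h e))"
  unfolding isp_def by (intro dfn_intros tdf_const)

lemma section_ms: "X \<in> ms M \<Longrightarrow> {x. pr a x \<in> X} \<in> ms M"
proof -
  assume X: "X \<in> ms M"
  have "{x. pr a x \<in> X} = {x. \<exists>z. isp M z a x \<and> z \<in> X}" by auto
  also have "\<dots> \<in> ms M" by (intro compI dfn_intros dfn_isp tdf_const X)
  finally show ?thesis .
qed

end

text \<open>The first \<open>k\<close> sections of \<open>X\<close> belong to the model and are
  therefore instances of the leading set quantifiers; on the standard matrix \<open>p\<close> the
  class \<open>C\<close> cannot deviate from truth.\<close>

lemma (in sy) no_counterexample: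
  assumes p: "arithmetical p" "fm_bd 0 k p" "msat M e E ((AllS ^^ k) p)"
    and X: "X \<in> ms M" and C: "satc X C (nv (fm_code p))"
  shows "pr (nv (fm_code p)) \<zero> \<in> C"
proof -
  let ?E = "\<lambda>i. if i < k then {x. pr (nv i) x \<in> X} else E (i - k)"
  have "msat M e ?E p"
    using p(3) section_ms[OF X] by (auto simp: msat_AllS_pow_iff simp del: nv_simps)
  then have "msat M ((!) []) (\<lambda>i. {x. pr (nv i) x \<in> X}) p"
    using msat_cong[OF p(2), of e "(!) []" ?E "\<lambda>i. {x. pr (nv i) x \<in> X}" M] by simp
  then show ?thesis using truth[OF C, of p "[]" k] p(1,2) by simp
qed

section \<open>Smaller ordinals reflect\<close>

lemma AllS_pow_inj: "(AllS ^^ k) p = (AllS ^^ l) q \<Longrightarrow> arithmetical p \<Longrightarrow> arithmetical q \<Longrightarrow> k = l \<and> p = q"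
proof (induction k arbitrary: l)
  case 0
  then show ?case by (cases l) auto
next
  case (Suc k)
  show ?case
  proof (cases l)
    case 0
    then have "arithmetical (AllS ((AllS ^^ k) p))" using Suc.prems by simp
    then show ?thesis by simp
  next
    case (Suc m)
    then show ?thesis using Suc.IH[of m] Suc.prems by simp
  qed
qed

lemma fm_bd_prv_fm: "fm_bd 1 0 \<sigma> \<Longrightarrow> 0 < n \<Longrightarrow> fm_bd n s (prv_fm \<sigma>)"
  unfolding prv_fm_def by (rule fm_bd_rel_fm[OF fm_bd_prv]) simp_all

lemma proves_refl: "T \<turnstile> Imp p p"
  by (rule proves.MP[OF proves.MP[OF proves.AxS proves.AxK] proves.AxK[of _ _ p]])

lemma proves_mono: "S \<turnstile> p \<Longrightarrow> S \<subseteq> T \<Longrightarrow> T \<turnstile> p"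
  by (induction rule: proves.induct) (auto intro: proves.intros)

text \<open>Failure of the reflection instance for number variable 0, with the class in set variable
  0 and the assignment in 1. Set variable 2 does not occur; it is reserved for the relation that the
  tree construction expects, so descent imposes nothing.\<close>

definition counterexample_fm :: "fm \<Rightarrow> fm" where
  "counterexample_fm \<sigma> = fAnd (prv_fm \<sigma>) (fEx (fAnd (syn_fm (rMatrix (PN 0) (PV 1) (PV 0)))
     (fAnd satclass_fm (Neg (mem_fm (PPair (PV 0) pNil) 0)))))"

lemma counterexample_props:
  assumes "numerates \<sigma> S"
  shows "arithmetical (counterexample_fm \<sigma>)" "fm_bd 1 3 (counterexample_fm \<sigma>)"
proof -
  have "arithmetical \<sigma>" "fm_bd 1 0 \<sigma>" using assms by (auto simp: numerates_def intro: Sigma01_arithmetical)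
  moreover have "fm_bd 2 3 satclass_fm" using fm_bd_satclass by (rule fm_bd_mono) simp_all
  ultimately show "arithmetical (counterexample_fm \<sigma>)" "fm_bd 1 3 (counterexample_fm \<sigma>)"
    by (simp_all add: counterexample_fm_def fm_bd_prv_fm fm_bd_rel_fm fm_bd_mem_fm numeral_2_eq_2)
qed

context pm
begin

definition PRV :: "fm \<Rightarrow> 'a \<Rightarrow> bool" where
  "PRV \<sigma> n \<longleftrightarrow> msat M (\<lambda>_. n) (\<lambda>_. {}) (prv_fm \<sigma>)"

lemma msat_prv_fm: "fm_bd 1 0 \<sigma> \<Longrightarrow> msat M e E (prv_fm \<sigma>) \<longleftrightarrow> PRV \<sigma> (e 0)"
  unfolding PRV_def by (rule msat_cong[OF fm_bd_prv_fm[of \<sigma> 1 0]]) auto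

lemma msat_counterexample:
  assumes "fm_bd 1 0 \<sigma>"
  shows "msat M e E (counterexample_fm \<sigma>) \<longleftrightarrow>
    PRV \<sigma> (e 0) \<and> (\<exists>q. Mat \<zero> (e 0) q \<and> satc (E 1) (E 0) q \<and> pr q \<zero> \<notin> E 0)"
  by (simp add: counterexample_fm_def msat_prv_fm[OF assms])

lemma msat_RFN:
  assumes "fm_bd 1 0 \<sigma>"
  shows "msat M e E (RFN_Pi11 \<sigma>) \<longleftrightarrow> (\<forall>n. PRV \<sigma> n \<longrightarrow>
    (\<forall>X\<in>ms M. \<forall>C\<in>ms M. \<forall>q. Mat \<zero> n q \<longrightarrow> satc X C q \<longrightarrow> pr q \<zero> \<in> C))"
  unfolding RFN_Pi11_def Pi11_sentence_fm_def Pi11_true_fm_def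
  by (simp add: msat_prv_fm[OF assms] fEx_def[symmetric]) blast

end

context aca
begin

lemma WOm_no_descent:
  assumes R: "WOm M R" and F: "descending F Z" and Z: "\<And>w. w \<in> Z \<Longrightarrow> \<exists>u v. w = pJ u v \<and> R u v \<and> u \<noteq> v"
  shows False
proof -
  define X where "X = {x. \<exists>i. pJ i x \<in> F}"
  have tot: "F \<in> ms M" "\<And>i. \<exists>x. pJ i x \<in> F" using F by (auto simp: descending_def total_def)
  have X: "X \<in> ms M" unfolding X_def by (intro compI dfn_intros tdf_pJ tdf_const tot)
  have step: "\<exists>y\<in>X. R y x \<and> y \<noteq> x" if x: "x \<in> X" for x
  proof -
    obtain i where i: "pJ i x \<in> F" using x by (auto simp: X_def)
    obtain y where y: "pJ (suc i) y \<in> F" using tot by blast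
    then have "pJ y x \<in> Z" using F i by (auto simp: descending_def)
    then show ?thesis using Z y by (fastforce simp: X_def)
  qed
  have L: "\<And>x y. R x y \<Longrightarrow> R x x \<and> R y y" "\<And>x y. R x y \<Longrightarrow> R y x \<Longrightarrow> x = y"
    using R unfolding WOm_def LOm_def by blast+
  have W: "\<And>X. X \<in> ms M \<Longrightarrow> \<exists>x\<in>X. R x x \<Longrightarrow> \<exists>x\<in>X. R x x \<and> (\<forall>y\<in>X. R y y \<longrightarrow> R x y)"
    using R unfolding WOm_def by blast
  obtain x where "x \<in> X" using tot(2) unfolding X_def by blast
  then have "\<exists>x\<in>X. R x x" using step L(1) by blast
  from W[OF X this] obtain x where x: "x \<in> X" "\<forall>y\<in>X. R y y \<longrightarrow> R x y" by blast
  obtain y where "y \<in> X" "R y x" "y \<noteq> x" using step[OF x(1)] by blast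
  then show False using x(2) L by blast
qed

text \<open>The image of \<open>Y\<close> is a nonempty set without least element. The map is a
  relation \<open>\<rho>\<close>, as given by a set of the model that is only known to be
  single-valued.\<close>

lemma embedding_wellfounded:
  assumes R: "WOm M R" and Y: "Y \<in> ms M" "Y \<noteq> {}"
    and \<rho>s: "{v. \<exists>u. u \<in> Y \<and> \<rho> u v} \<in> ms M"
    and fu: "\<And>u v v'. \<rho> u v \<Longrightarrow> \<rho> u v' \<Longrightarrow> v = v'"
    and desc: "\<And>u. u \<in> Y \<Longrightarrow> \<exists>u'\<in>Y. \<exists>v v'. \<rho> u v \<and> \<rho> u' v' \<and> R v' v \<and> v' \<noteq> v"
  shows False
proof -
  let ?X = "{v. \<exists>u. u \<in> Y \<and> \<rho> u v}"
  have L: "\<And>x y. R x y \<Longrightarrow> R x x \<and> R y y" "\<And>x y. R x y \<Longrightarrow> R y x \<Longrightarrow> x = y"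
    using R unfolding WOm_def LOm_def by blast+
  have W: "\<And>X. X \<in> ms M \<Longrightarrow> \<exists>x\<in>X. R x x \<Longrightarrow> \<exists>x\<in>X. R x x \<and> (\<forall>y\<in>X. R y y \<longrightarrow> R x y)"
    using R unfolding WOm_def by blast
  have "\<exists>x\<in>?X. R x x" using Y(2) desc L(1) by blast
  from W[OF \<rho>s this] obtain w u where w: "u \<in> Y" "\<rho> u w" "\<forall>y\<in>?X. R y y \<longrightarrow> R w y" by blast
  from desc[OF w(1)] obtain u' v v' where v: "u' \<in> Y" "\<rho> u v" "\<rho> u' v'" "R v' v" "v' \<noteq> v" by blast
  have "v = w" using fu v(2) w(2) by blast
  moreover have "R w v'" using w(3) v L(1) by blast
  ultimately show False using v L(2) by blast
qed

end

lemma (in pm) counterexample_false: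
  assumes "sy M" and \<sigma>: "fm_bd 1 0 \<sigma>" and p: "arithmetical p" "fm_bd 0 k p" "msat M e' E' ((AllS ^^ k) p)"
    and E: "range E \<subseteq> ms M"
    and fact: "\<And>q. PRV \<sigma> (e 0) \<Longrightarrow> Mat \<zero> (e 0) q \<Longrightarrow> q = nv (fm_code p)"
  shows "\<not> msat M e E (counterexample_fm \<sigma>)"
proof
  interpret sy M by fact
  assume "msat M e E (counterexample_fm \<sigma>)"
  then obtain q where q: "PRV \<sigma> (e 0)" "Mat \<zero> (e 0) q" "satc (E 1) (E 0) q" "pr q \<zero> \<notin> E 0"
    unfolding msat_counterexample[OF \<sigma>] by blast
  moreover have "E 1 \<in> ms M" using E by auto
  ultimately show False using no_counterexample[OF p] fact by metis
qed

text \<open>Gives each standard \<open>n\<close> a theorem of \<open>S\<close> that refutes the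
  counterexample with code \<open>n\<close>. The uniqueness of the matrix comes from
  \<open>arithmetical\<close> excluding a leading set quantifier.\<close>

lemma provable_matrix:
  assumes \<sigma>: "numerates \<sigma> S"
  shows "\<exists>k p. arithmetical p \<and> fm_bd 0 k p \<and> S \<turnstile> (AllS ^^ k) p \<and>
    (\<forall>q. N.PRV \<sigma> n \<longrightarrow> N.Mat 0 n q \<longrightarrow> q = fm_code p)"
proof -
  have prv: "N.PRV \<sigma> n \<longleftrightarrow> (\<exists>p. n = fm_code p \<and> S \<turnstile> p)"
    unfolding N.PRV_def msat_stdm sat_prv_fm[OF \<sigma>] ..
  have mat: "N.Mat 0 n q \<longleftrightarrow> (\<exists>k p. n = fm_code ((AllS ^^ k) p) \<and> q = fm_code p \<and> arithmetical p \<and> fm_bd 0 k p)" for q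
    by (simp add: DS_matrix)
  show ?thesis
  proof (cases "\<exists>k p. n = fm_code ((AllS ^^ k) p) \<and> arithmetical p \<and> fm_bd 0 k p \<and> S \<turnstile> (AllS ^^ k) p")
    case True
    then obtain k p where p: "n = fm_code ((AllS ^^ k) p)" "arithmetical p" "fm_bd 0 k p" "S \<turnstile> (AllS ^^ k) p" by blast
    have "q = fm_code p" if q: "N.Mat 0 n q" for q
    proof -
      obtain l r where r: "n = fm_code ((AllS ^^ l) r)" "q = fm_code r" "arithmetical r"
        using q unfolding mat by blast
      then have "(AllS ^^ k) p = (AllS ^^ l) r" using p(1) by simp
      then show ?thesis using AllS_pow_inj p(2) r by blast
    qed
    then show ?thesis using p by blast
  next
    case False
    have "\<not> (N.PRV \<sigma> n \<and> N.Mat 0 n q)" for q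
      using False unfolding prv mat by auto
    \<comment> \<open>If \<open>n\<close> codes no provable Pi11 sentence, any theorem will do,
      since the last condition is then vacuous.\<close>
    then show ?thesis
      by (intro exI[of _ 0] exI[of _ "Imp Falsum Falsum"]) (auto intro: proves_refl)
  qed
qed

lemma Pi11_AllS_pow: "arithmetical p \<Longrightarrow> Pi11 ((AllS ^^ k) p)"
  by (induction k) (auto intro: Pi11.intros)

lemma sentence_AllS_pow: "fm_bd 0 k p \<Longrightarrow> sentence ((AllS ^^ k) p)"
proof -
  have "fm_bd 0 (s + k) p \<Longrightarrow> fm_bd 0 s ((AllS ^^ k) p)" for s
    by (induction k arbitrary: s) simp_all
  then show "fm_bd 0 k p \<Longrightarrow> sentence ((AllS ^^ k) p)" by (simp add: sentence_def)
qed

text \<open>Well-foundedness of \<open>K n\<close> in models of \<open>S\<close> is obtained only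
  with the help of true facts about syntax and about \<open>n\<close>, which are not assumed
  provable in \<open>S\<close>. So \<open>boundedness\<close> is applied with the order itself as
  \<open>Z\<close>, and the facts go into the formula \<open>P\<close>.\<close>

lemma KB_below:
  assumes S: "sound_re_extension S" and \<sigma>: "numerates \<sigma> S"
  defines "K \<equiv> \<lambda>n. {(u, v). N.KBr (counterexample_fm \<sigma>) 2 n u v}"
  shows "Well_order (K n) \<and> otype (K n) \<le> pt_ordinal S"
proof -
  let ?c = "counterexample_fm \<sigma>"
  note c = counterexample_props[OF \<sigma>]
  have \<sigma>b: "fm_bd 1 0 \<sigma>" "arithmetical \<sigma>" using \<sigma> by (auto simp: numerates_def intro: Sigma01_arithmetical)
  have Sp: "Pi11_sound S" using S by (simp add: sound_re_extension_def)
  obtain k p where p: "arithmetical p" "fm_bd 0 k p" "S \<turnstile> (AllS ^^ k) p"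
    and fact: "\<And>q. N.PRV \<sigma> n \<Longrightarrow> N.Mat 0 n q \<Longrightarrow> q = fm_code p"
    using provable_matrix[OF \<sigma>, of n] by blast
  have "true_sentence ((AllS ^^ k) p)"
    using Sp p Pi11_AllS_pow[OF p(1)] sentence_AllS_pow[OF p(2)] unfolding Pi11_sound_def by blast
  then have tp: "msat stdm (\<lambda>_. 0) (\<lambda>_. {}) ((AllS ^^ k) p)" by (simp add: true_sentence_def)
  have "WOm stdm (N.KBr ?c 2 n)"
  proof (rule N.KBr_WOm[OF c])
    fix E F assume E: "range E \<subseteq> ms stdm" "msat stdm (\<lambda>_. n) E ?c"
    show "\<not> N.descending F (E 2)"
      using N.counterexample_false[OF N.sy_axioms \<sigma>b(1) p(1,2) tp E(1), of "\<lambda>_. n"] fact E(2) by simp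
  qed
  then have wo: "Well_order (K n)" unfolding K_def by (rule WOm_Well_order)
  \<comment> \<open>Set variable 0 is contained in the strict part of \<open>K n\<close>. The last
    conjunct fixes the matrix of \<open>n\<close>: a nonstandard model might otherwise believe in a
    spurious matrix, or a spurious proof, for the number \<open>n\<close>.\<close>
  define P where "P = fAnd facts_fm (fAnd
      (AllN (Imp (Mem (Var 0) 0) (fEx (fEx (fAnd (Equal (Var 2) (Jt (Var 1) (Var 0)))
        (fAnd (Kf ?c 2 (num n) (Var 1) (Var 0)) (Neg (Equal (Var 1) (Var 0)))))))))
      (AllN (Imp (Equal (Var 0) (num n)) (Imp (prv_fm \<sigma>)
        (AllN (Imp (syn_fm (rMatrix (PN 0) (PV 1) (PV 0))) (Equal (Var 0) (num (fm_code p)))))))))"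
  have P: "arithmetical P" "fm_bd 0 1 P"
    unfolding P_def using Delta00_arithmetical[OF Kf_props(1)[OF c(2)]] \<sigma>b
    by (simp_all add: fm_bd_prv_fm fm_bd_rel_fm Kf_props(2)[OF c(2)] Jt_def del: num.simps)
  have mP: "msat M e E P \<longleftrightarrow> msat M e E facts_fm \<and>
      (\<forall>w\<in>E 0. \<exists>u v. w = aca.pJ M u v \<and> aca.KBr M ?c 2 (aca.nv M n) u v \<and> u \<noteq> v) \<and>
      (pm.PRV M \<sigma> (aca.nv M n) \<longrightarrow> (\<forall>q. pm.SY M (pm.pr M (aca.nv M 4) (pm.pr M (mz M) (pm.pr M (aca.nv M n) q))) \<longrightarrow> q = aca.nv M (fm_code p)))"
    if "aca M" "pm M" for M :: "nat model" and e E
  proof -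
    interpret pm M by fact
    show ?thesis unfolding P_def by (simp add: msat_Kf[OF c(2)] msat_prv_fm[OF \<sigma>b(1)] Ball_def del: nv_simps(2) num.simps)
  qed
  let ?E = "\<lambda>i :: nat. {N.pJ u v | u v. (u, v) \<in> K n \<and> u \<noteq> v}"
  have "otype (K n) \<le> pt_ordinal S"
  proof (rule boundedness[OF S P])
    show "sat (\<lambda>_. 0) ?E P"
      unfolding msat_stdm[symmetric] mP[OF N.aca_axioms N.pm_axioms]
      using fact N.sy_facts[OF N.sy_axioms] by (auto simp: K_def)
    fix M :: "nat model" and e E F
    assume M: "mods M S" "aca M" and E: "range E \<subseteq> ms M" and s: "msat M e E P"
    interpret aca M by fact
    have "msat M e E facts_fm" using s by (simp add: P_def)
    then have sy: "sy M" by (rule facts_sy)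
    interpret sy M by (rule sy)
    note s' = s[unfolded mP[OF aca_axioms pm_axioms]]
    have "msat M (\<lambda>_. 0) E ((AllS ^^ k) p)" using soundness[OF p(3) M(1) E] .
    have "\<not> msat M (\<lambda>_. nv n) E' ?c" if "range E' \<subseteq> ms M" for E'
      by (rule counterexample_false[OF sy \<sigma>b(1) p(1,2) \<open>msat M (\<lambda>_. 0) E ((AllS ^^ k) p)\<close> that])
        (use s' in blast)
    then have "WOm M (KBr ?c 2 (nv n))" by (intro KBr_WOm[OF c]) blast
    from WOm_no_descent[OF this] s' show "\<not> descending F (E 0)" by blast
  qed (use wo in auto)
  then show ?thesis using wo by blast
qed

theorem less_ordinal_reflects:
  assumes S: "sound_re_extension S" and T: "sound_re_extension T" and less: "pt_ordinal S < pt_ordinal T"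
  shows "S \<prec>\<^sub>R T"
proof -
  have "\<exists>A r. presents A r \<and> T \<turnstile> WO A \<and> pt_ordinal S < otype r"
  proof (rule ccontr)
    assume "\<not> ?thesis"
    then have "pt_ordinal T \<le> pt_ordinal S" by (intro pt_ordinal_le) (meson not_less)
    then show False using less by simp
  qed
  then obtain A r where A: "presents A r" "T \<turnstile> WO A" "pt_ordinal S < otype r" by blast
  obtain \<sigma> where \<sigma>: "numerates \<sigma> S" using S numerates_exists unfolding sound_re_extension_def by blast
  then have \<sigma>b: "fm_bd 1 0 \<sigma>" by (simp add: numerates_def)
  let ?c = "counterexample_fm \<sigma>"
  note c = counterexample_props[OF \<sigma>]
  have Ab: "arithmetical A" "fm_bd 2 0 A" "Well_order r"
    and Ar: "\<And>x y. (x, y) \<in> r \<longleftrightarrow> arel stdm A x y"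
    using A(1) by (auto simp: presents_def arel_def intro: Sigma01_arithmetical)
  \<comment> \<open>Set variable 0 holds the triples of \<open>n\<close>, a node \<open>u\<close>
    and its image: for each \<open>n\<close> a strictly monotone map of the Kleene--Brouwer order
    for \<open>n\<close> into \<open>A\<close>.\<close>
  define \<theta> where "\<theta> = fAnd facts_fm (fAnd
      (AllN (AllN (AllN (Imp (fAnd (Kf ?c 2 (Var 2) (Var 1) (Var 0)) (Neg (Equal (Var 1) (Var 0))))
        (fEx (fEx (fAnd (Mem (Jt (Var 4) (Jt (Var 3) (Var 1))) 0) (fAnd (Mem (Jt (Var 4) (Jt (Var 2) (Var 0))) 0)
          (fAnd (inst2 A (Var 1) (Var 0)) (Neg (Equal (Var 1) (Var 0))))))))))))
      (AllN (AllN (AllN (AllN (Imp (Mem (Jt (Var 3) (Jt (Var 2) (Var 1))) 0)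
         (Imp (Mem (Jt (Var 3) (Jt (Var 2) (Var 0))) 0) (Equal (Var 1) (Var 0)))))))))"
  have \<theta>: "arithmetical \<theta>" "fm_bd 0 1 \<theta>"
    unfolding \<theta>_def using Delta00_arithmetical[OF Kf_props(1)[OF c(2)]] Ab
    by (simp_all add: Kf_props(2)[OF c(2)] Jt_def)
  have m\<theta>: "msat M e E \<theta> \<longleftrightarrow> msat M e E facts_fm \<and>
      (\<forall>n u u'. aca.KBr M ?c 2 n u u' \<and> u \<noteq> u' \<longrightarrow> (\<exists>v v'. aca.pJ M n (aca.pJ M u v) \<in> E 0 \<and>
         aca.pJ M n (aca.pJ M u' v') \<in> E 0 \<and> arel M A v v' \<and> v \<noteq> v')) \<and>
      (\<forall>n u v v'. aca.pJ M n (aca.pJ M u v) \<in> E 0 \<longrightarrow> aca.pJ M n (aca.pJ M u v') \<in> E 0 \<longrightarrow> v = v')"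
    if "aca M" for M :: "nat model" and e E
  proof -
    interpret aca M by fact
    show ?thesis unfolding \<theta>_def by (simp add: msat_Kf[OF c(2)] msat_inst2[OF Ab(2)])
  qed
  have "\<exists>f. \<forall>u u'. N.KBr ?c 2 n u u' \<and> u \<noteq> u' \<longrightarrow> (f u, f u') \<in> r \<and> f u \<noteq> f u'" for n
  proof -
    let ?K = "{(u, v). N.KBr ?c 2 n u v}"
    have K: "Well_order ?K" "otype ?K \<le> pt_ordinal S" using KB_below[OF S \<sigma>, of n] by auto
    have "otype ?K < otype r" using K(2) A(3) by (rule order_le_less_trans)
    then have "(?K, r) \<in> ordLess" using otype_less K(1) Ab(3) by blast
    then obtain f where "smono f ?K r" using ordLess_smono by blast
    then show ?thesis unfolding smono_def by (intro exI[of _ f]) auto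
  qed
  then obtain f where f: "\<And>n u u'. N.KBr ?c 2 n u u' \<Longrightarrow> u \<noteq> u' \<Longrightarrow> (f n u, f n u') \<in> r \<and> f n u \<noteq> f n u'" by metis
  let ?\<rho> = "{N.pJ n (N.pJ u (f n u)) | n u. True}"
  have "msat stdm (\<lambda>_. 0) (case_nat ?\<rho> (\<lambda>_. {})) \<theta>"
    unfolding m\<theta>[OF N.aca_axioms] using f N.sy_facts[OF N.sy_axioms] by (simp add: Ar)
  then have "true_sentence (ExS \<theta>)"
    using \<theta> by (auto simp: true_sentence_def sentence_def)
  moreover have "Sigma11 (ExS \<theta>)" using \<theta>(1) by (intro Sigma11.intros)
  moreover have "insert (ExS \<theta>) T \<turnstile> RFN_Pi11 \<sigma>"
  proof (rule completeness)
    have Ta: "\<forall>p\<in>ACA0. T \<turnstile> p" and Ts: "\<forall>p\<in>T. sentence p" using T by (auto simp: sound_re_extension_def)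
    show "\<forall>p\<in>insert (ExS \<theta>) T. sentence p" using Ts \<theta>(2) by (auto simp: sentence_def)
    show "\<forall>p\<in>basic_axioms. insert (ExS \<theta>) T \<turnstile> p"
      using Ta proves_mono[of T _ "insert (ExS \<theta>) T"] by (auto simp: ACA0_def)
    fix M :: "nat model" and e and E :: "nat \<Rightarrow> nat set" assume M: "mods M (insert (ExS \<theta>) T)" and E: "range E \<subseteq> ms M"
    have MT: "mods M T" using M by (simp add: mods_def)
    interpret aca M by (rule sound_extension_aca[OF Ta MT])
    have "msat M e E (ExS \<theta>)" using M E by (simp add: mods_def)
    then obtain \<rho> where \<rho>: "\<rho> \<in> ms M" "msat M e (case_nat \<rho> E) \<theta>" by auto
    have "msat M e (case_nat \<rho> E) facts_fm" using \<rho>(2) by (simp add: \<theta>_def)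
    then interpret sy M by (rule facts_sy)
    note \<rho>' = \<rho>(2)[unfolded m\<theta>[OF aca_axioms], simplified]
    have wo: "WOm M (arel M A)" using soundness[OF A(2) MT E, of e] msat_WO[OF Ab(2) ms_ne] by simp
    show "msat M e E (RFN_Pi11 \<sigma>)"
    proof (rule ccontr)
      assume "\<not> ?thesis"
      then obtain n X C q where n: "PRV \<sigma> n" "X \<in> ms M" "C \<in> ms M" "Mat (mz M) n q" "satc X C q" "pr q (mz M) \<notin> C"
        unfolding msat_RFN[OF \<sigma>b] by blast
      have U: "UNIV \<in> ms M" using compI[OF dfn_const[of True]] by simp
      \<comment> \<open>Set variable 2 is the set of all numbers, so the constant sequence
        \<open>F\<close> counts as descending and the counterexample alone yields a path.\<close>
      let ?E = "\<lambda>i :: nat. if i = 0 then C else if i = 1 then X else UNIV"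
      have "msat M (\<lambda>_. n) ?E ?c" unfolding msat_counterexample[OF \<sigma>b] using n by auto
      moreover have "range ?E \<subseteq> ms M" using n U by (auto simp del: One_nat_def)
      moreover define F where "F = {w. \<exists>i. w = pJ i (mz M)}"
      have "F \<in> ms M" unfolding F_def by (intro compI dfn_intros tdf_pJ tdf_const)
      then have "descending F (?E 2)" by (auto simp: descending_def total_def F_def)
      ultimately obtain Y where Y: "Y \<in> ms M" "Y \<noteq> {}" "\<forall>u\<in>Y. \<exists>v\<in>Y. KBr ?c 2 n v u \<and> u \<noteq> v"
        using KBr_illfounded[OF c, of 2 ?E n F] by auto
      \<comment> \<open>The index \<open>n\<close> may be nonstandard here. This is harmless, since
        \<open>\<rho>\<close> embeds the orders for all \<open>n\<close> of the model.\<close>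
      show False
      proof (rule embedding_wellfounded[OF wo Y(1,2), of "\<lambda>u v. pJ n (pJ u v) \<in> \<rho>"])
        show "{v. \<exists>u. u \<in> Y \<and> pJ n (pJ u v) \<in> \<rho>} \<in> ms M"
          by (intro compI dfn_intros tdf_pJ tdf_const Y(1) \<rho>(1))
        show "v = v'" if "pJ n (pJ u v) \<in> \<rho>" "pJ n (pJ u v') \<in> \<rho>" for u v v'
          using \<rho>' that by blast
        show "\<exists>u'\<in>Y. \<exists>v v'. pJ n (pJ u v) \<in> \<rho> \<and> pJ n (pJ u' v') \<in> \<rho> \<and> arel M A v' v \<and> v' \<noteq> v" if "u \<in> Y" for u
          using \<rho>' Y(3) that by metis
      qed
    qed
  qed
  ultimately show ?thesis unfolding reflects_def provesS11_def using S T \<sigma> by blast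
qed

section \<open>Reflection increases the ordinal\<close>

text \<open>Instead of \<open>WO A\<close> we reflect on a consequence whose matrix has a set variable in only one
  atomic formula. The codes below are those of the subformulas of the matrix that contain it,
  where \<open>a\<close> is the code of \<open>A\<close>.\<close>

definition descent_fm :: "fm \<Rightarrow> fm" where
  "descent_fm A = Imp (AllN (Imp (Mem (Var 0) 0) (Neg (AllN (Imp (Mem (Var 0) 0) (Imp A (Equal (Var 0) (Var 1))))))))
     (AllN (Neg (Mem (Var 0) 0)))"

abbreviation "pMX \<equiv> pMem (pVar (PN 0)) (PN 0)"

definition q1 where "q1 a = pImp a (pEqual (pVar (PN 0)) (pVar (PN 1)))"
definition q2 where "q2 a = pImp pMX (q1 a)"
definition q3 where "q3 a = pAllN (q2 a)"
definition q4 where "q4 a = pImp (q3 a) pFalsum"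
definition q5 where "q5 a = pImp pMX (q4 a)"
definition q6 where "q6 a = pAllN (q5 a)"
definition q7 where "q7 = pImp pMX pFalsum"
definition q8 where "q8 = pAllN q7"
definition q9 where "q9 a = pImp (q6 a) q8"

lemmas q_defs = q1_def q2_def q3_def q4_def q5_def q6_def q7_def q8_def q9_def

lemma pat_bound_q [simp]: "pat_bound (q1 a) = pat_bound a" "pat_bound (q2 a) = pat_bound a" "pat_bound (q3 a) = pat_bound a"
  "pat_bound (q4 a) = pat_bound a" "pat_bound (q5 a) = pat_bound a" "pat_bound (q6 a) = pat_bound a"
  "pat_bound q7 = 0" "pat_bound q8 = 0" "pat_bound (q9 a) = pat_bound a"
  by (simp_all add: q_defs)

context pm
begin

abbreviation "cMX \<equiv> pr (nv 2) (pr (pr \<zero> \<zero>) \<zero>)"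
abbreviation "cE \<equiv> pr \<zero> (pr (pr \<zero> \<zero>) (pr \<zero> \<one>))"
abbreviation "cF \<equiv> pr (nv 3) \<zero>"
abbreviation "cI x y \<equiv> pr (nv 4) (pr x y)"
abbreviation "cA x \<equiv> pr (nv 5) x"

definition h1 where "h1 a = cI a cE"
definition h2 where "h2 a = cI cMX (h1 a)"
definition h3 where "h3 a = cA (h2 a)"
definition h4 where "h4 a = cI (h3 a) cF"
definition h5 where "h5 a = cI cMX (h4 a)"
definition h6 where "h6 a = cA (h5 a)"
definition h7 where "h7 = cI cMX cF"
definition h8 where "h8 = cA h7"
definition h9 where "h9 a = cI (h6 a) h8"

lemmas h_defs = h1_def h2_def h3_def h4_def h5_def h6_def h7_def h8_def h9_def

lemma patv_q [simp]: "patv \<rho> (q1 a) = h1 (patv \<rho> a)" "patv \<rho> (q2 a) = h2 (patv \<rho> a)" "patv \<rho> (q3 a) = h3 (patv \<rho> a)"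
  "patv \<rho> (q4 a) = h4 (patv \<rho> a)" "patv \<rho> (q5 a) = h5 (patv \<rho> a)" "patv \<rho> (q6 a) = h6 (patv \<rho> a)"
  "patv \<rho> q7 = h7" "patv \<rho> q8 = h8" "patv \<rho> (q9 a) = h9 (patv \<rho> a)"
  by (simp_all add: q_defs h_defs)

lemma h9_inj: "h9 a = h9 b \<longleftrightarrow> a = b"
  by (simp add: h_defs)

lemma tarski_Imp: "tarski X C (cI x y) e \<longleftrightarrow> (pr (cI x y) e \<in> C \<longleftrightarrow> (pr x e \<in> C \<longrightarrow> pr y e \<in> C))"
  by (simp add: tarski_def)

lemma tarski_All: "tarski X C (cA x) e \<longleftrightarrow> (pr (cA x) e \<in> C \<longleftrightarrow> (\<forall>a. pr x (cons a e) \<in> C))"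
  by (simp add: tarski_def)

lemma tarski_Mem: "tarski X C (pr (nv 2) (pr t i)) e \<longleftrightarrow> (pr (pr (nv 2) (pr t i)) e \<in> C \<longleftrightarrow> (\<exists>v. Val t e v \<and> pr i v \<in> X))"
  by (simp add: tarski_def)

lemma dfn_SY: "tdf f \<Longrightarrow> dfn (\<lambda>e. SY (f e))"
proof -
  have b: "fm_bd 1 0 (derivable_fm Falsum clauses (Var 0))" by (rule fm_bd_derivable_fm) simp_all
  obtain X where X: "X \<in> ms M" using ms_ne by blast
  have "SY (e 0) \<longleftrightarrow> msat M (mix e c) E (derivable_fm Falsum clauses (Var 0))" for e c E
    unfolding SY_def by (rule msat_cong[OF b]) (auto simp: mix_def)
  then have "dfn (\<lambda>e. SY (e 0))" unfolding dfn_def using X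
    by (intro exI[of _ "derivable_fm Falsum clauses (Var 0)"] exI[of _ "\<lambda>_. \<zero>"] exI[of _ "\<lambda>_. X"]) auto
  then show "tdf f \<Longrightarrow> dfn (\<lambda>e. SY (f e))" by (rule dfn1)
qed

text \<open>Unlike \<open>pJ\<close>, the function \<open>pr\<close> is not a term of the language;
  definability goes through its graph \<open>isp\<close>.\<close>

lemma dfn_mem_pr: "Y \<in> ms M \<Longrightarrow> tdf f \<Longrightarrow> tdf g \<Longrightarrow> dfn (\<lambda>e. pr (f e) (g e) \<in> Y)"
proof -
  assume Y: "Y \<in> ms M"
  have "dfn (\<lambda>e. \<exists>z. isp M z (e 0) (e (Suc 0)) \<and> z \<in> Y)"
    by (intro dfn_intros dfn_isp Y)
  then have "dfn (\<lambda>e. pr (e 0) (e (Suc 0)) \<in> Y)" by simp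
  then show "tdf f \<Longrightarrow> tdf g \<Longrightarrow> dfn (\<lambda>e. pr (f e) (g e) \<in> Y)" by (rule dfn2)
qed

lemma dfn_all_cons: "dfn (\<lambda>e. P (e 0)) \<Longrightarrow> dfn (\<lambda>e. \<forall>u. P (cons u (e 0)))"
proof -
  assume P: "dfn (\<lambda>e. P (e 0))"
  have "dfn (\<lambda>e. \<forall>u w. isp M w u (e 0) \<longrightarrow> P (suc w))"
    by (intro dfn_intros dfn_isp dfn1[OF P] tdf_const)
  then show ?thesis by simp
qed

lemma dfn_Nth_mem: "X \<in> ms M \<Longrightarrow> dfn (\<lambda>e. \<exists>v. Nth (e 0) \<zero> v \<and> v \<in> X)"
proof -
  assume X: "X \<in> ms M"
  have "dfn (\<lambda>e. \<exists>v. (\<exists>w w' w''. isp M w \<zero> v \<and> isp M w' (e 0) w \<and> isp M w'' (nv 11) w' \<and> SY w'') \<and> v \<in> X)"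
    by (intro dfn_intros dfn_isp dfn_SY tdf_const X)
  then show ?thesis by simp
qed

end

context sy
begin

text \<open>The class for the set-free codes \<open>SF\<close> is extended to the finitely many
  subformulas that contain the set variable. Each of these has an explicit arithmetical definition
  from \<open>X\<close> and \<open>Z\<close>, even if \<open>a\<close> is nonstandard. On
  \<open>SF\<close> the set parameter \<open>X'\<close> can be exchanged because no membership atom
  occurs there.\<close>

lemma descent_class:
  assumes X: "X \<in> ms M" and SF: "SF \<in> ms M" and Z: "Z \<in> ms M"
    and sub: "\<And>z. Sub (h9 a) z \<Longrightarrow> z \<in> SF \<or> z \<in> {cMX, h2 a, h3 a, h4 a, h5 a, h6 a, h7, h8, h9 a}"
    and tar: "\<And>z e. z \<in> SF \<Longrightarrow> tarski X' Z z e"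
    and mem: "\<And>t i. pr (nv 2) (pr t i) \<notin> SF"
    and imp: "\<And>x y. cI x y \<in> SF \<Longrightarrow> x \<in> SF \<and> y \<in> SF" and all: "\<And>x. cA x \<in> SF \<Longrightarrow> x \<in> SF"
    and a: "h1 a \<in> SF" "cF \<in> SF"
  shows "\<exists>C\<in>ms M. satc {w. \<exists>x\<in>X. w = pr \<zero> x} C (h9 a) \<and>
    (pr (h9 a) \<zero> \<in> C \<longrightarrow> (\<forall>x\<in>X. \<exists>y\<in>X. y \<noteq> x \<and> pr a (cons y (cons x \<zero>)) \<in> Z) \<longrightarrow> X = {})"
proof -
  define SX where "SX e \<longleftrightarrow> (\<exists>v. Nth e \<zero> v \<and> v \<in> X)" for e
  define S2 where "S2 e \<longleftrightarrow> (SX e \<longrightarrow> pr (h1 a) e \<in> Z)" for e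
  define S3 where "S3 e \<longleftrightarrow> (\<forall>u. S2 (cons u e))" for e
  define S5 where "S5 e \<longleftrightarrow> (SX e \<longrightarrow> \<not> S3 e)" for e
  define S6 where "S6 e \<longleftrightarrow> (\<forall>u. S5 (cons u e))" for e
  define S8 where "S8 e \<longleftrightarrow> (\<forall>u. \<not> SX (cons u e))" for e
  define P where "P z e \<longleftrightarrow> z \<in> SF \<and> pr z e \<in> Z \<or> z = cMX \<and> SX e \<or> z = h2 a \<and> S2 e \<or> z = h3 a \<and> S3 e \<or>
    z = h4 a \<and> \<not> S3 e \<or> z = h5 a \<and> S5 e \<or> z = h6 a \<and> S6 e \<or> z = h7 \<and> \<not> SX e \<or> z = h8 \<and> S8 e \<or>
    z = h9 a \<and> (S6 e \<longrightarrow> S8 e)" for z e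
  have dSX: "dfn (\<lambda>e. SX (e 0))" unfolding SX_def by (rule dfn_Nth_mem[OF X])
  have dS2: "dfn (\<lambda>e. S2 (e 0))" unfolding S2_def by (intro dfn_intros dSX dfn_mem_pr Z tdf_const)
  have dS3: "dfn (\<lambda>e. S3 (e 0))" unfolding S3_def by (rule dfn_all_cons[OF dS2])
  have dS5: "dfn (\<lambda>e. S5 (e 0))" unfolding S5_def by (intro dfn_intros dSX dS3)
  have dS6: "dfn (\<lambda>e. S6 (e 0))" unfolding S6_def by (rule dfn_all_cons[OF dS5])
  have dS8: "dfn (\<lambda>e. S8 (e 0))" unfolding S8_def by (intro dfn_all_cons dfn_neg dSX)
  define C where "C = {w. \<exists>z e. isp M w z e \<and> P z e}"
  have "C \<in> ms M" unfolding C_def P_def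
    by (intro compI dfn_intros dfn_isp dfn_mem_pr tdf_const SF Z dfn1[OF dSX] dfn1[OF dS2] dfn1[OF dS3]
        dfn1[OF dS5] dfn1[OF dS6] dfn1[OF dS8])
  have C: "pr z e \<in> C \<longleftrightarrow> P z e" for z e by (auto simp: C_def)
  \<comment> \<open>\<open>SF\<close> is closed under components, and each of the new codes leads
    down to \<open>cMX\<close>; so the new definitions do not clash with the old class.\<close>
  have ne: "cMX \<notin> SF" "h2 a \<notin> SF" "h3 a \<notin> SF" "h4 a \<notin> SF" "h5 a \<notin> SF" "h6 a \<notin> SF" "h7 \<notin> SF" "h8 \<notin> SF" "h9 a \<notin> SF"
  proof -
    show 1: "cMX \<notin> SF" by (rule mem)
    show 2: "h2 a \<notin> SF" "h5 a \<notin> SF" "h7 \<notin> SF" using 1 imp unfolding h2_def h5_def h7_def by blast+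
    show 3: "h3 a \<notin> SF" "h6 a \<notin> SF" "h8 \<notin> SF" using 2 all unfolding h3_def h6_def h8_def by blast+
    show "h4 a \<notin> SF" "h9 a \<notin> SF" using 3 imp unfolding h4_def h9_def by blast+
  qed
  have di: "distinct [cMX, h2 a, h3 a, h4 a, h5 a, h6 a, h7, h8, h9 a]"
    by (simp add: h_defs)
  have CS: "pr z e \<in> C \<longleftrightarrow> pr z e \<in> Z" if "z \<in> SF" for z e
    using that ne unfolding C P_def by blast
  have CMX: "pr cMX e \<in> C \<longleftrightarrow> SX e" for e using ne di unfolding C P_def by auto
  have C2: "pr (h2 a) e \<in> C \<longleftrightarrow> S2 e" for e using ne di unfolding C P_def by auto
  have C3: "pr (h3 a) e \<in> C \<longleftrightarrow> S3 e" for e using ne di unfolding C P_def by auto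
  have C4: "pr (h4 a) e \<in> C \<longleftrightarrow> \<not> S3 e" for e using ne di unfolding C P_def by auto
  have C5: "pr (h5 a) e \<in> C \<longleftrightarrow> S5 e" for e using ne di unfolding C P_def by auto
  have C6: "pr (h6 a) e \<in> C \<longleftrightarrow> S6 e" for e using ne di unfolding C P_def by auto
  have C7: "pr h7 e \<in> C \<longleftrightarrow> \<not> SX e" for e using ne di unfolding C P_def by auto
  have C8: "pr h8 e \<in> C \<longleftrightarrow> S8 e" for e using ne di unfolding C P_def by auto
  have C9: "pr (h9 a) e \<in> C \<longleftrightarrow> (S6 e \<longrightarrow> S8 e)" for e using ne di unfolding C P_def by auto
  have CF: "pr cF e \<notin> C" for e using tar[OF a(2), of e] CS[OF a(2)] by (simp add: tarski_def)
  let ?X = "{w. \<exists>x\<in>X. w = pr \<zero> x}"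
  have "tarski ?X C z e" if z: "Sub (h9 a) z" for z e
  proof -
    consider "z \<in> SF" | "z = cMX" | "z = h2 a" | "z = h3 a" | "z = h4 a" | "z = h5 a" | "z = h6 a" | "z = h7" | "z = h8" | "z = h9 a"
      using sub[OF z] by blast
    then show ?thesis
    proof cases
      case 1
      have t: "tarski X' Z z e" by (rule tar[OF 1])
      show ?thesis unfolding tarski_def CS[OF 1]
      proof (intro conjI allI impI)
        show "pr z e \<in> Z \<longleftrightarrow> (\<exists>v. Val t e v \<and> Val u e v)" if "z = pr \<zero> (pr t u)" for t u
          using t that by (simp add: tarski_def)
        show "pr z e \<in> Z \<longleftrightarrow> (\<exists>v w. Val t e v \<and> Val u e w \<and> v \<lhd> w)" if "z = pr \<one> (pr t u)" for t u
          using t that by (simp add: tarski_def)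
        show "pr z e \<in> Z \<longleftrightarrow> (\<exists>v. Val t e v \<and> pr i v \<in> ?X)" if "z = pr (nv 2) (pr t i)" for t i
          using 1 mem that by blast
        show "pr z e \<notin> Z" if "z = cF" using t that by (simp add: tarski_def)
        show "pr z e \<in> Z \<longleftrightarrow> (pr x e \<in> C \<longrightarrow> pr y e \<in> C)" if "z = cI x y" for x y
          using t 1 imp[of x y] CS unfolding that tarski_Imp by blast
        show "pr z e \<in> Z \<longleftrightarrow> (\<forall>b. pr x (cons b e) \<in> C)" if "z = cA x" for x
          using t 1 all[of x] CS unfolding that tarski_All by blast
      qed
    next
      case 2
      show ?thesis unfolding 2 tarski_Mem CMX by (simp add: SX_def)
    next
      case 3
      show ?thesis using tarski_Imp[of ?X C cMX "h1 a" e, folded h2_def] unfolding 3 C2 CMX CS[OF a(1)] S2_def by blast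
    next
      case 4
      show ?thesis using tarski_All[of ?X C "h2 a" e, folded h3_def] unfolding 4 C3 C2 S3_def by blast
    next
      case 5
      show ?thesis using tarski_Imp[of ?X C "h3 a" cF e, folded h4_def] CF unfolding 5 C4 C3 by blast
    next
      case 6
      show ?thesis using tarski_Imp[of ?X C cMX "h4 a" e, folded h5_def] unfolding 6 C5 CMX C4 S5_def by blast
    next
      case 7
      show ?thesis using tarski_All[of ?X C "h5 a" e, folded h6_def] unfolding 7 C6 C5 S6_def by blast
    next
      case 8
      show ?thesis using tarski_Imp[of ?X C cMX cF e, folded h7_def] CF unfolding 8 C7 CMX by blast
    next
      case 9
      show ?thesis using tarski_All[of ?X C h7 e, folded h8_def] unfolding 9 C8 C7 S8_def by blast
    next
      case 10
      show ?thesis using tarski_Imp[of ?X C "h6 a" h8 e, folded h9_def] unfolding 10 C9 C6 C8 by blast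
    qed
  qed
  then have "satc ?X C (h9 a)" unfolding satc_def by blast
  \<comment> \<open>Truth of \<open>h9 a\<close> is decoded: progress from every \<open>x\<close>
    makes the premise \<open>S6\<close> true, and the conclusion \<open>S8\<close> says that
    \<open>X\<close> is empty.\<close>
  moreover have "X = {}" if t: "pr (h9 a) \<zero> \<in> C" and d: "\<forall>x\<in>X. \<exists>y\<in>X. y \<noteq> x \<and> pr a (cons y (cons x \<zero>)) \<in> Z"
  proof -
    have SXc: "SX (cons u e) \<longleftrightarrow> u \<in> X" for u e by (simp add: SX_def)
    have "\<not> S3 (cons x \<zero>)" if x: "x \<in> X" for x
    proof -
      obtain y where y: "y \<in> X" "y \<noteq> x" "pr a (cons y (cons x \<zero>)) \<in> Z" using d x by blast
      let ?e = "cons y (cons x \<zero>)"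
      have "cE \<in> SF" using imp a(1) unfolding h1_def by blast
      from tar[OF this, of ?e] have "pr cE ?e \<notin> Z"
        using y(2) Nth_suc[of y "cons x \<zero>" \<zero>] by (simp add: tarski_def del: Nth_suc)
      then have "pr (h1 a) ?e \<notin> Z" using tar[OF a(1), of ?e] y(3) unfolding h1_def tarski_Imp by blast
      then show ?thesis using y(1) unfolding S3_def S2_def SXc by blast
    qed
    then have "S6 \<zero>" unfolding S6_def S5_def SXc by blast
    then have "S8 \<zero>" using t unfolding C9 by blast
    then show ?thesis unfolding S8_def SXc by blast
  qed
  ultimately show ?thesis using \<open>C \<in> ms M\<close> by blast
qed

end

text \<open>Set variables of \<open>order_fm\<close>: 0 is a truth class for the formulas without set variables
  (codes in 3), 1 is the order of the sum, 2 its summands \<open>y <\<^sub>n x\<close> as triples \<open>(n, y, x)\<close>.\<close>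

definition order_fm :: "fm \<Rightarrow> fm" where
  "order_fm \<sigma> = fAnd facts_fm
    (fAnd (AllN (AllN (Imp (Mem (Jt (Var 1) (Var 0)) 1) (fEx (fEx (fAnd (is_fm (PPair (PN 0) (PPair (PV 1) (PV 0))) 3)
       (AllN (AllN (Imp (is_fm (PPair (PN 0) (PPair (PV 1) (PV 0))) 4)
         (fOr (Less (Var 3) (Var 1)) (fAnd (Equal (Var 3) (Var 1)) (Mem (Jt (Var 3) (Jt (Var 2) (Var 0))) 2))))))))))))
    (fAnd (AllN (AllN (AllN (Imp (Mem (Jt (Var 0) (Jt (Var 2) (Var 1))) 2) (fAnd (prv_fm \<sigma>)
       (fEx (fAnd (is_fm (pAllS (q9 (PV 0))) 1) (fAnd (syn_fm (rMatrix (PN 0) (PV 1) (q9 (PV 0))))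
         (fAnd (mem_fm (q1 (PV 0)) 3) (fAnd (Neg (Equal (Var 3) (Var 2)))
         (fAnd (mem_fm (PPair (PV 0) (pCons (PV 3) (pCons (PV 2) pNil))) 0)
         (AllN (Imp (syn_fm (rSub (q9 (PV 1)) (PV 0))) (fOr (Mem (Var 0) 3)
           (fOr (is_fm pMX 0) (fOr (is_fm (q2 (PV 1)) 0) (fOr (is_fm (q3 (PV 1)) 0) (fOr (is_fm (q4 (PV 1)) 0)
           (fOr (is_fm (q5 (PV 1)) 0) (fOr (is_fm (q6 (PV 1)) 0) (fOr (is_fm q7 0) (fOr (is_fm q8 0) (is_fm (q9 (PV 1)) 0)))))))))))))))))))))))
    (fAnd (AllN (AllN (Imp (Mem (Var 1) 3) tarski_fm)))
    (fAnd (mem_fm pFalsum 3)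
    ((AllN (Imp (Mem (Var 0) 3) (AllN (AllN (fAnd (Neg (is_fm (pMem (PV 1) (PV 0)) 2))
       (fAnd (Imp (is_fm (pImp (PV 1) (PV 0)) 2) (fAnd (Mem (Var 1) 3) (Mem (Var 0) 3)))
         (Imp (is_fm (pAllN (PV 0)) 2) (Mem (Var 0) 3)))))))))))))"

lemma order_props:
  assumes "numerates \<sigma> S"
  shows "arithmetical (order_fm \<sigma>)" "fm_bd 0 4 (order_fm \<sigma>)"
proof -
  have "arithmetical \<sigma>" "fm_bd 1 0 \<sigma>" using assms by (auto simp: numerates_def intro: Sigma01_arithmetical)
  moreover have "fm_bd 2 4 tarski_fm" using fm_bd_tarski by (rule fm_bd_mono) simp_all
  ultimately show "arithmetical (order_fm \<sigma>)" "fm_bd 0 4 (order_fm \<sigma>)"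
    by (simp_all add: order_fm_def fm_bd_prv_fm fm_bd_rel_fm fm_bd_mem_fm fm_bd_is_fm Jt_def numeral_2_eq_2)
qed

lemma (in pm) msat_order:
  assumes "fm_bd 1 0 \<sigma>"
  shows "msat M e E (order_fm \<sigma>) \<longleftrightarrow> msat M e E facts_fm \<and>
    (\<forall>a b. pJ a b \<in> E 1 \<longrightarrow> (\<exists>n x. a = pr \<zero> (pr n x) \<and> (\<forall>m y. b = pr \<zero> (pr m y) \<longrightarrow>
       n \<lhd> m \<or> n = m \<and> pJ n (pJ x y) \<in> E 2))) \<and>
    (\<forall>y x n. pJ n (pJ y x) \<in> E 2 \<longrightarrow> PRV \<sigma> n \<and> (\<exists>a. n = pr (nv 6) (h9 a) \<and> Mat \<zero> n (h9 a) \<and> h1 a \<in> E 3 \<and>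
       y \<noteq> x \<and> pr a (cons y (cons x \<zero>)) \<in> E 0 \<and> (\<forall>z. Sub (h9 a) z \<longrightarrow>
         z \<in> E 3 \<or> z = cMX \<or> z = h2 a \<or> z = h3 a \<or> z = h4 a \<or> z = h5 a \<or> z = h6 a \<or> z = h7 \<or> z = h8 \<or> z = h9 a))) \<and>
    (\<forall>z e. z \<in> E 3 \<longrightarrow> tarski (E 1) (E 0) z e) \<and> cF \<in> E 3 \<and>
    (\<forall>z. z \<in> E 3 \<longrightarrow> (\<forall>x y. z \<noteq> pr (nv 2) (pr x y) \<and> (z = cI x y \<longrightarrow> x \<in> E 3 \<and> y \<in> E 3) \<and> (z = cA y \<longrightarrow> y \<in> E 3)))"
  by (simp add: order_fm_def msat_prv_fm[OF assms])

text \<open>Along the sequence the summand index never increases. The terms with the least index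
  \<open>n\<close> form a set \<open>X\<close> in which every element has a predecessor, and
  reflection for the possibly nonstandard sentence \<open>n\<close> says that \<open>X\<close> is
  empty.\<close>

lemma (in sy) order_no_descent:
  assumes \<sigma>: "fm_bd 1 0 \<sigma>" and E: "range E \<subseteq> ms M" and s: "msat M e E (order_fm \<sigma>)"
    and rfn: "msat M e' E' (RFN_Pi11 \<sigma>)"
  shows "\<not> descending F (E 1)"
proof
  assume F: "descending F (E 1)"
  have Fm: "F \<in> ms M" "\<And>i. \<exists>!x. pJ i x \<in> F" using F by (auto simp: descending_def total_def)
  have dsc: "\<And>i x y. pJ i x \<in> F \<Longrightarrow> pJ (suc i) y \<in> F \<Longrightarrow> pJ y x \<in> E 1" using F by (simp add: descending_def)
  note s' = s[unfolded msat_order[OF \<sigma>]]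
  have f1: "\<And>a b. pJ a b \<in> E 1 \<Longrightarrow> \<exists>n x. a = pr \<zero> (pr n x) \<and> (\<forall>m y. b = pr \<zero> (pr m y) \<longrightarrow> n \<lhd> m \<or> n = m \<and> pJ n (pJ x y) \<in> E 2)"
    using s' by blast
  have w1: "\<And>y x n. pJ n (pJ y x) \<in> E 2 \<Longrightarrow> PRV \<sigma> n \<and> (\<exists>a. n = pr (nv 6) (h9 a) \<and> Mat \<zero> n (h9 a) \<and> h1 a \<in> E 3 \<and>
       y \<noteq> x \<and> pr a (cons y (cons x \<zero>)) \<in> E 0 \<and> (\<forall>z. Sub (h9 a) z \<longrightarrow>
         z \<in> E 3 \<or> z = cMX \<or> z = h2 a \<or> z = h3 a \<or> z = h4 a \<or> z = h5 a \<or> z = h6 a \<or> z = h7 \<or> z = h8 \<or> z = h9 a))"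
    using s' by blast
  have EX: "E i \<in> ms M" for i using E by auto
  \<comment> \<open>Position 0 is skipped because the first term may be the added last element;
    every later term lies in a summand.\<close>
  let ?in = "\<lambda>n x. \<exists>i. pJ (suc i) (pr \<zero> (pr n x)) \<in> F"
  have d: "dfn (\<lambda>e. ?in (e 0) (e (Suc 0)))"
  proof -
    have "dfn (\<lambda>e. \<exists>w w'. isp M w (e 0) (e (Suc 0)) \<and> isp M w' \<zero> w \<and> (\<exists>i. pJ (suc i) w' \<in> F))"
      by (intro dfn_intros dfn_isp tdf_pJ tdf_const Fm(1))
    then show ?thesis by simp
  qed
  have ex: "\<exists>n x. pJ (suc i) (pr \<zero> (pr n x)) \<in> F" for i
  proof -
    obtain x y where "pJ i x \<in> F" "pJ (suc i) y \<in> F"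
      using Fm(2)[of i] Fm(2)[of "suc i"] by blast
    from f1[OF dsc[OF this]] obtain n x' where "y = pr \<zero> (pr n x')" by blast
    then show ?thesis using \<open>pJ (suc i) y \<in> F\<close> by blast
  qed
  have dn: "dfn (\<lambda>e. \<exists>x. ?in (e 0) x)"
    by (intro dfn_ex dfn2[OF d] tdf_var)
  have "\<exists>n x. ?in n x" using ex[of \<zero>] by (elim exE) (intro exI)
  then obtain n0 where n0: "\<exists>x. ?in n0 x" by (elim exE) (rule that, intro exI)
  obtain n where n: "\<exists>x. ?in n x" and le: "\<And>m. \<exists>x. ?in m x \<Longrightarrow> n \<unlhd> m"
    by (rule least[OF dn n0]) (rule that)
  have least: "\<not> (\<exists>x. ?in m x)" if "m \<lhd> n" for m
  proof
    assume "\<exists>x. ?in m x"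
    from le[OF this] have "n \<lhd> n" using that less_trans'[of n m n] by (elim disjE) simp_all
    then show False by simp
  qed
  define X where "X = {x. ?in n x}"
  have X: "X \<in> ms M" unfolding X_def by (intro compI dfn2[OF d] tdf_var tdf_const)
  have step: "\<exists>y\<in>X. pJ n (pJ y x) \<in> E 2" if x: "x \<in> X" for x
  proof -
    obtain i where i: "pJ (suc i) (pr \<zero> (pr n x)) \<in> F" using x by (auto simp: X_def)
    obtain m y where m: "pJ (suc (suc i)) (pr \<zero> (pr m y)) \<in> F" using ex by blast
    then have "m \<lhd> n \<or> m = n \<and> pJ m (pJ y x) \<in> E 2" using f1[OF dsc[OF i m]] by auto
    then show ?thesis using least m unfolding X_def by blast
  qed
  obtain x0 y0 where x0: "x0 \<in> X" "pJ n (pJ y0 x0) \<in> E 2" using n step unfolding X_def by blast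
  from w1[OF x0(2)] obtain a where prv: "PRV \<sigma> n" and a: "n = pr (nv 6) (h9 a)" "Mat \<zero> n (h9 a)" "h1 a \<in> E 3"
    and sub: "\<And>z. Sub (h9 a) z \<Longrightarrow> z \<in> E 3 \<or> z \<in> {cMX, h2 a, h3 a, h4 a, h5 a, h6 a, h7, h8, h9 a}" by auto
  have "\<exists>C\<in>ms M. satc {w. \<exists>x\<in>X. w = pr \<zero> x} C (h9 a) \<and>
    (pr (h9 a) \<zero> \<in> C \<longrightarrow> (\<forall>x\<in>X. \<exists>y\<in>X. y \<noteq> x \<and> pr a (cons y (cons x \<zero>)) \<in> E 0) \<longrightarrow> X = {})"
  proof (rule descent_class[OF X EX[of 3] EX[of 0] sub])
    show "tarski (E 1) (E 0) z e" if "z \<in> E 3" for z e using s' that by blast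
    show "pr (nv 2) (pr t i) \<notin> E 3" for t i using s' by blast
    show "x \<in> E 3 \<and> y \<in> E 3" if "cI x y \<in> E 3" for x y using s' that by blast
    show "x \<in> E 3" if "cA x \<in> E 3" for x using s' that by blast
    show "h1 a \<in> E 3" by (rule a(3))
    show "cF \<in> E 3" using s' by blast
  qed
  then obtain C where C: "C \<in> ms M" "satc {w. \<exists>x\<in>X. w = pr \<zero> x} C (h9 a)"
    "pr (h9 a) \<zero> \<in> C \<Longrightarrow> (\<forall>x\<in>X. \<exists>y\<in>X. y \<noteq> x \<and> pr a (cons y (cons x \<zero>)) \<in> E 0) \<Longrightarrow> X = {}" by blast
  \<comment> \<open>An assignment codes its sets by sections, so \<open>X\<close> has to be
    presented as section 0.\<close>
  have "{w. \<exists>x. isp M w \<zero> x \<and> x \<in> X} \<in> ms M" by (intro compI dfn_intros dfn_isp tdf_const X)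
  moreover have "{w. \<exists>x. isp M w \<zero> x \<and> x \<in> X} = {w. \<exists>x\<in>X. w = pr \<zero> x}" by auto
  ultimately have "pr (h9 a) \<zero> \<in> C"
    using rfn[unfolded msat_RFN[OF \<sigma>]] prv C(1,2) a(2) by auto
  moreover have "\<exists>y\<in>X. y \<noteq> x \<and> pr a (cons y (cons x \<zero>)) \<in> E 0" if x: "x \<in> X" for x
  proof -
    obtain y where y: "y \<in> X" "pJ n (pJ y x) \<in> E 2" using step[OF x] by blast
    from w1[OF y(2)] obtain b where "n = pr (nv 6) (h9 b)" "y \<noteq> x" "pr b (cons y (cons x \<zero>)) \<in> E 0" by blast
    then show ?thesis using a(1) y(1) h9_inj by auto
  qed
  ultimately show False using C(3) x0(1) by blast
qed

section \<open>The sum of the provable well-orders\<close>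

lemma msat_descent:
  assumes A: "fm_bd 2 0 A" and M: "WOm M (arel M A)"
  shows "msat M e E (AllS (descent_fm A))"
proof -
  have L: "\<And>x y. arel M A x y \<Longrightarrow> arel M A x x \<and> arel M A y y" "\<And>x y. arel M A x y \<Longrightarrow> arel M A y x \<Longrightarrow> x = y"
    using M unfolding WOm_def LOm_def by blast+
  have W: "\<And>X. X \<in> ms M \<Longrightarrow> \<exists>x\<in>X. arel M A x x \<Longrightarrow> \<exists>x\<in>X. arel M A x x \<and> (\<forall>y\<in>X. arel M A y y \<longrightarrow> arel M A x y)"
    using M unfolding WOm_def by blast
  have c: "msat M (case_nat y (case_nat x e)) E' A \<longleftrightarrow> arel M A y x" for x y E'
    unfolding arel_def by (rule msat_cong[OF A]) (auto simp: less_2_cases_iff)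
  have *: "X = {}" if X: "X \<in> ms M" and d: "\<forall>x\<in>X. \<exists>y\<in>X. arel M A y x \<and> y \<noteq> x" for X
  proof (rule ccontr)
    assume "X \<noteq> {}"
    then have "\<exists>x\<in>X. arel M A x x" using d L(1) by blast
    from W[OF X this] obtain x where x: "x \<in> X" "\<forall>y\<in>X. arel M A y y \<longrightarrow> arel M A x y" by blast
    then obtain y where "y \<in> X" "arel M A y x" "y \<noteq> x" using d by blast
    then show False using x L by blast
  qed
  show ?thesis by (simp add: descent_fm_def c) (use * in blast)
qed

lemma descent_props:
  assumes "arithmetical A" "fm_bd 2 0 A" shows "arithmetical (descent_fm A)" "fm_bd 0 1 (descent_fm A)"
  using assms fm_bd_mono[of 2 0 A 2 1] by (simp_all add: descent_fm_def numeral_2_eq_2)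

definition setfree :: "fm \<Rightarrow> bool" where
  "setfree p \<longleftrightarrow> arithmetical p \<and> (\<exists>n. fm_bd n 0 p)"

lemma setfree_simps: "setfree (Equal t u)" "setfree (Less t u)" "\<not> setfree (Mem t i)" "setfree Falsum"
  "setfree (Imp p q) \<longleftrightarrow> setfree p \<and> setfree q" "setfree (AllN p) \<longleftrightarrow> setfree p" "\<not> setfree (AllS p)"
proof -
  show "setfree (Equal t u)" "setfree (Less t u)" using ex_tm_bd2[of t u] by (auto simp: setfree_def)
  show "\<not> setfree (Mem t i)" "setfree Falsum" "\<not> setfree (AllS p)" by (auto simp: setfree_def)
  have "\<exists>n. fm_bd n 0 p \<and> fm_bd n 0 q" if "fm_bd m 0 p" "fm_bd n 0 q" for m n
    using fm_bd_mono[OF that(1), of "max m n" 0] fm_bd_mono[OF that(2), of "max m n" 0] by auto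
  then show "setfree (Imp p q) \<longleftrightarrow> setfree p \<and> setfree q" by (auto simp: setfree_def)
  have "\<exists>n. fm_bd (Suc n) 0 p" if "fm_bd m 0 p" for m
    using fm_bd_mono[OF that, of "Suc m" 0] by auto
  then show "setfree (AllN p) \<longleftrightarrow> setfree p" by (auto simp: setfree_def)
qed

text \<open>Evaluation through \<open>N.Val\<close> instead of \<open>tm_val\<close>: the Tarski
  conditions are demanded at every number \<open>e\<close>, also when the list coded by
  \<open>e\<close> is too short for the free variables and terms have no value.\<close>

primrec tr :: "fm \<Rightarrow> nat \<Rightarrow> bool" where
  "tr (Equal t u) e \<longleftrightarrow> (\<exists>v. N.Val (tm_code t) e v \<and> N.Val (tm_code u) e v)"
| "tr (Less t u) e \<longleftrightarrow> (\<exists>v w. N.Val (tm_code t) e v \<and> N.Val (tm_code u) e w \<and> v < w)"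
| "tr (Mem t i) e \<longleftrightarrow> False"
| "tr Falsum e \<longleftrightarrow> False"
| "tr (Imp p q) e \<longleftrightarrow> (tr p e \<longrightarrow> tr q e)"
| "tr (AllN p) e \<longleftrightarrow> (\<forall>a. tr p (Suc (prod_encode (a, e))))"
| "tr (AllS p) e \<longleftrightarrow> False"

definition TC :: "nat set" where
  "TC = {prod_encode (fm_code p, e) | p e. setfree p \<and> tr p e}"

lemma TC_iff: "setfree p \<Longrightarrow> prod_encode (fm_code p, e) \<in> TC \<longleftrightarrow> tr p e"
  by (auto simp: TC_def)

lemmas TC_simps = TC_iff[of "Equal t u" for t u, simplified setfree_simps, simplified]
  TC_iff[of "Less t u" for t u, simplified setfree_simps, simplified]
  TC_iff[of Falsum, simplified setfree_simps, simplified]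
  TC_iff[of "Imp p q" for p q, simplified setfree_simps, simplified]
  TC_iff[of "AllN p" for p, simplified setfree_simps, simplified]

lemma tarski_TC: "setfree p \<Longrightarrow> N.tarski X TC (fm_code p) e"
  by (cases p) (auto simp: N.tarski_def setfree_simps TC_simps TC_iff fm_code_inv)

lemma setfree_subs: "q \<in> subs p \<Longrightarrow> setfree p \<Longrightarrow> setfree q"
  by (induction p) (auto simp: setfree_simps)

lemma TC_truth:
  assumes "arithmetical A" "fm_bd 2 0 A"
  shows "prod_encode (fm_code A, Suc (prod_encode (x, Suc (prod_encode (y, 0))))) \<in> TC \<longleftrightarrow> arel stdm A x y"
proof -
  have A: "setfree A" using assms by (auto simp: setfree_def)
  have "N.satc {} TC (fm_code A)"
    unfolding N.satc_def N_SY N_pr nv_N using DS_sub setfree_subs A tarski_TC by blast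
  moreover have "fm_bd (length [x, y]) 0 A" using assms(2) by (simp add: numeral_2_eq_2)
  moreover have "N.Sub (N.nv (fm_code A)) (N.nv (fm_code A))" by (rule N.sub_refl)
  ultimately have "N.pr (N.nv (fm_code A)) (N.lst [x, y]) \<in> TC \<longleftrightarrow> msat stdm ((!) [x, y]) (\<lambda>_. {}) A"
    using N.truth[of "{}" TC "fm_code A" A "[x, y]" 0] assms(1) by simp
  moreover have "msat stdm ((!) [x, y]) (\<lambda>_. {}) A = msat stdm (case_nat x (\<lambda>_. y)) (\<lambda>_. {}) A"
    by (rule msat_cong[OF assms(2)]) (auto simp: less_2_cases_iff)
  ultimately show ?thesis by (simp add: arel_def)
qed

lemma msat_ExS_pow:
  "msat M e E ((ExS ^^ k) p) \<longleftrightarrow> (\<exists>E'. (\<forall>i. E' (i + k) = E i) \<and> (\<forall>i<k. E' i \<in> ms M) \<and> msat M e E' p)"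
proof (induction k arbitrary: E)
  case 0
  have "(\<forall>i. E' i = E i) \<longleftrightarrow> E' = E" for E' by (auto simp: fun_eq_iff)
  then show ?case by simp
next
  case (Suc k)
  have *: "(\<forall>i. E' (i + k) = case_nat X E i) \<longleftrightarrow> E' k = X \<and> (\<forall>i. E' (i + Suc k) = E i)" for E' X
    by (auto split: nat.split)
  show ?case by (simp add: Suc * less_Suc_eq del: add_Suc_right) blast
qed

lemma Sigma11_ExS_pow: "Sigma11 p \<Longrightarrow> \<exists>k q. arithmetical q \<and> p = (ExS ^^ k) q"
proof (induction rule: Sigma11.induct)
  case (1 p)
  then show ?case by (intro exI[of _ 0] exI[of _ p]) simp
next
  case (2 p)
  then obtain k q where "arithmetical q" "p = (ExS ^^ k) q" by blast
  then show ?case by (intro exI[of _ "Suc k"] exI[of _ q]) simp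
qed

lemma fm_bd_ExS_pow: "fm_bd n s ((ExS ^^ k) q) \<longleftrightarrow> fm_bd n (s + k) q"
  by (induction k arbitrary: s) simp_all

text \<open>A summand is indexed by the code of the sentence that expresses its well-foundedness, so
  that the index found in a descending sequence is the very number to which reflection is applied.
  All other summands are empty.\<close>

definition family :: "fm set \<Rightarrow> nat \<Rightarrow> nat rel" where
  "family S n = {(x, y). \<exists>A r. presents A r \<and> S \<turnstile> WO A \<and> n = fm_code (AllS (descent_fm A)) \<and> (x, y) \<in> r}"

lemma family_eq: "presents A r \<Longrightarrow> S \<turnstile> WO A \<Longrightarrow> family S (fm_code (AllS (descent_fm A))) = r"
  using presents_unique unfolding family_def by (auto simp: descent_fm_def)

lemma Well_order_family: "Well_order (family S n)"
proof (cases "\<exists>A r. presents A r \<and> S \<turnstile> WO A \<and> n = fm_code (AllS (descent_fm A))")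
  case True
  then obtain A r where A: "presents A r" "S \<turnstile> WO A" "n = fm_code (AllS (descent_fm A))" by blast
  then have "family S n = r" using family_eq by blast
  moreover have "Well_order r" using A(1) by (simp add: presents_def)
  ultimately show ?thesis by simp
next
  case False
  then have "family S n = {}" by (auto simp: family_def)
  then show ?thesis by simp
qed

lemma pt_ordinal_le_family: "pt_ordinal S \<le> otype (osum (family S))"
proof (rule pt_ordinal_le)
  fix A r assume "presents A r" "S \<turnstile> WO A"
  then show "otype r \<le> otype (osum (family S))"
    using osum_le[of "family S" "fm_code (AllS (descent_fm A))"] Well_order_family family_eq by metis
qed

text \<open>The smaller of two distinct elements cannot be the added last one.\<close>

lemma osuc_descends:
  assumes "(a, b) \<in> osuc r" "a \<noteq> b"
  shows "\<exists>w. a = prod_encode (0, w) \<and> w \<in> Field r \<and> (\<forall>v. b = prod_encode (0, v) \<longrightarrow> (w, v) \<in> r)"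
  using assms unfolding osuc_def osum_def by (auto split: if_splits)

definition order_sets :: "fm set \<Rightarrow> nat \<Rightarrow> nat set" where
  "order_sets S i = (if i = 0 then TC else if i = 1 then {N.pJ x y | x y. (x, y) \<in> osuc (osum (family S)) \<and> x \<noteq> y}
     else if i = 2 then {N.pJ n (N.pJ y x) | n x y. (y, x) \<in> family S n \<and> y \<noteq> x} else {fm_code p | p. setfree p})"

lemma order_true:
  assumes S: "sound_re_extension S" and \<sigma>: "numerates \<sigma> S" and E: "\<And>i. i < 4 \<Longrightarrow> E i = order_sets S i"
  shows "sat e E (order_fm \<sigma>)"
proof -
  have \<sigma>b: "fm_bd 1 0 \<sigma>" using \<sigma> by (simp add: numerates_def)
  have Es: "E 0 = TC" "E (Suc 0) = {N.pJ x y | x y. (x, y) \<in> osuc (osum (family S)) \<and> x \<noteq> y}"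
    "E 2 = {N.pJ n (N.pJ y x) | n x y. (y, x) \<in> family S n \<and> y \<noteq> x}" "E 3 = {fm_code p | p. setfree p}"
    by (simp_all add: E order_sets_def)
  have f1: "\<exists>n x. a = N.pr 0 (N.pr n x) \<and> (\<forall>m y. b = N.pr 0 (N.pr m y) \<longrightarrow> n < m \<or> n = m \<and> N.pJ n (N.pJ x y) \<in> E 2)"
    if "N.pJ a b \<in> E 1" for a b
  proof -
    have "(a, b) \<in> osuc (osum (family S))" "a \<noteq> b" using that by (auto simp: Es)
    from osuc_descends[OF this] obtain w where w: "a = prod_encode (0, w)"
      "\<And>v. b = prod_encode (0, v) \<Longrightarrow> (w, v) \<in> osum (family S)" by blast
    obtain n x where nx: "w = prod_encode (n, x)" by (metis prod_decode_inverse surj_pair)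
    have "n < m \<or> n = m \<and> N.pJ n (N.pJ x y) \<in> E 2" if b: "b = prod_encode (0, prod_encode (m, y))" for m y
    proof -
      have "(prod_encode (n, x), prod_encode (m, y)) \<in> osum (family S)" using w(2) b nx by simp
      then have "n < m \<or> n = m \<and> (x, y) \<in> family S n" unfolding osum_iff by blast
      moreover have "x \<noteq> y" if "n = m" using \<open>a \<noteq> b\<close> w(1) nx b that by auto
      ultimately show ?thesis unfolding Es by blast
    qed
    then show ?thesis using w(1) nx by (intro exI[of _ n] exI[of _ x]) simp
  qed
  have w1: "N.PRV \<sigma> n \<and> (\<exists>a. n = N.pr 6 (N.h9 a) \<and> N.Mat 0 n (N.h9 a) \<and> N.h1 a \<in> E 3 \<and>
       y \<noteq> x \<and> N.pr a (N.cons y (N.cons x 0)) \<in> E 0 \<and> (\<forall>z. N.Sub (N.h9 a) z \<longrightarrow>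
         z \<in> E 3 \<or> z = N.cMX \<or> z = N.h2 a \<or> z = N.h3 a \<or> z = N.h4 a \<or> z = N.h5 a \<or> z = N.h6 a \<or> z = N.h7 \<or> z = N.h8 \<or> z = N.h9 a))"
    if "N.pJ n (N.pJ y x) \<in> E 2" for y x n
  proof -
    have "(y, x) \<in> family S n" "y \<noteq> x" using that by (auto simp: Es)
    then obtain A r where A: "presents A r" "S \<turnstile> WO A" "n = fm_code (AllS (descent_fm A))" "(y, x) \<in> r"
      by (auto simp: family_def)
    have Ab: "arithmetical A" "fm_bd 2 0 A" using A(1) by (auto simp: presents_def intro: Sigma01_arithmetical)
    have sf: "setfree A" using Ab by (auto simp: setfree_def)
    \<comment> \<open>Reflection needs a proof of the modified sentence, whereas \<open>A\<close>
      was chosen with a proof of \<open>WO A\<close>; completeness converts one into the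
      other.\<close>
    have "S \<turnstile> AllS (descent_fm A)"
    proof (rule completeness)
      have Sa: "\<forall>p\<in>ACA0. S \<turnstile> p" using S by (simp add: sound_re_extension_def)
      show "\<forall>p\<in>S. sentence p" using S by (simp add: sound_re_extension_def)
      show "\<forall>p\<in>basic_axioms. S \<turnstile> p" using Sa by (auto simp: ACA0_def)
      fix M :: "nat model" and e and E :: "nat \<Rightarrow> nat set" assume M: "mods M S" and E: "range E \<subseteq> ms M"
      interpret aca M by (rule sound_extension_aca[OF Sa M])
      have "WOm M (arel M A)" using soundness[OF A(2) M E, of e] msat_WO[OF Ab(2) ms_ne] by simp
      then show "msat M e E (AllS (descent_fm A))" by (rule msat_descent[OF Ab(2)])
    qed
    then have prv: "N.PRV \<sigma> n" unfolding N.PRV_def msat_stdm sat_prv_fm[OF \<sigma>] A(3) by blast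
    have h9: "N.h9 (fm_code A) = fm_code (descent_fm A)"
      by (simp add: N.h_defs descent_fm_def)
    have mat: "N.Mat 0 n (fm_code (descent_fm A))"
      using D_matrix[of 0 1 "descent_fm A" "\<lambda>_. False"] descent_props[OF Ab] by (simp add: A(3))
    have r: "(y, x) \<in> r \<longleftrightarrow> arel stdm A y x" using A(1) by (simp add: presents_def arel_def)
    have "z \<in> E 3 \<or> z = N.cMX \<or> z = N.h2 (fm_code A) \<or> z = N.h3 (fm_code A) \<or> z = N.h4 (fm_code A) \<or>
      z = N.h5 (fm_code A) \<or> z = N.h6 (fm_code A) \<or> z = N.h7 \<or> z = N.h8 \<or> z = N.h9 (fm_code A)"
      if z: "N.Sub (N.h9 (fm_code A)) z" for z
    proof -
      obtain q where q: "q \<in> subs (descent_fm A)" "z = fm_code q" using z DS_sub unfolding h9 by auto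
      have "setfree q' \<Longrightarrow> fm_code q' \<in> E 3" for q' by (auto simp: Es)
      moreover from this[of Falsum] this[of "Imp A (Equal (Var 0) (Var 1))"] this[of "Equal (Var 0) (Var 1)"]
      have "fm_code Falsum \<in> E 3" "fm_code (Imp A (Equal (Var 0) (Var 1))) \<in> E 3" "fm_code (Equal (Var 0) (Var 1)) \<in> E 3"
        using sf by (simp_all only: setfree_simps)
      moreover have "q' \<in> subs A \<Longrightarrow> setfree q'" for q' using setfree_subs sf by blast
      ultimately show ?thesis using q(1) sf unfolding q(2) descent_fm_def
        by (auto simp: N.h_defs setfree_simps)
    qed
    moreover have "N.h1 (fm_code A) \<in> E 3"
      using sf unfolding Es by (intro CollectI exI[of _ "Imp A (Equal (Var 0) (Var 1))"]) (simp add: N.h1_def setfree_simps)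
    moreover have "N.pr (fm_code A) (N.cons y (N.cons x 0)) \<in> E 0"
      using TC_truth[OF Ab] A(4) r by (simp add: Es)
    moreover have "n = N.pr 6 (N.h9 (fm_code A))" using A(3) h9 by simp
    ultimately show ?thesis using prv mat \<open>y \<noteq> x\<close> h9 by metis
  qed
  have mem: "setfree p \<Longrightarrow> fm_code p \<noteq> prod_encode (2, prod_encode (x, y))" for p x y
    using fm_code_inv(3)[of x y p] setfree_simps(3) by metis
  show ?thesis
    unfolding msat_stdm[symmetric] N.msat_order[OF \<sigma>b]
  proof (intro conjI allI impI)
    show "msat stdm e E facts_fm" by (rule N.sy_facts[OF N.sy_axioms])
  qed (use f1 w1 mem in \<open>auto simp: Es tarski_TC fm_code_inv setfree_simps\<close>)
qed

theorem reflects_less_ordinal: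
  assumes "S \<prec>\<^sub>R T"
  shows "pt_ordinal S < pt_ordinal T"
proof -
  obtain \<sigma> \<theta> where S: "sound_re_extension S" and T: "sound_re_extension T" and \<sigma>: "numerates \<sigma> S"
    and \<theta>: "Sigma11 \<theta>" "true_sentence \<theta>" "insert \<theta> T \<turnstile> RFN_Pi11 \<sigma>"
    using assms unfolding reflects_def provesS11_def by blast
  have \<sigma>b: "fm_bd 1 0 \<sigma>" using \<sigma> by (simp add: numerates_def)
  obtain k \<zeta> where \<zeta>: "arithmetical \<zeta>" "\<theta> = (ExS ^^ k) \<zeta>" using Sigma11_ExS_pow[OF \<theta>(1)] by blast
  have \<zeta>b: "fm_bd 0 k \<zeta>" using \<theta>(2) fm_bd_ExS_pow[of 0 0 k \<zeta>] by (simp add: true_sentence_def sentence_def \<zeta>(2))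
  have "msat stdm (\<lambda>_. 0) (\<lambda>_. {}) \<theta>" using \<theta>(2) by (simp add: true_sentence_def)
  then obtain E1 where E1: "sat (\<lambda>_. 0) E1 \<zeta>" unfolding \<zeta>(2) msat_ExS_pow by auto
  \<comment> \<open>The first four sets belong to \<open>order_fm\<close>; witnesses for the true
    Sigma11 sentence follow, shifted by 4. Putting them into the parameters of \<open>P\<close> is
    how the sentence is eliminated.\<close>
  define E where "E i = (if i < 4 then order_sets S i else E1 (i - 4))" for i
  define P where "P = fAnd (fsub Var (\<lambda>i. i + 4) \<zeta>) (order_fm \<sigma>)"
  have mP: "msat M e E P \<longleftrightarrow> msat M e (\<lambda>i. E (i + 4)) \<zeta> \<and> msat M e E (order_fm \<sigma>)" for M :: "nat model" and e E
    by (simp add: P_def msat_fsub)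
  have P: "arithmetical P" "fm_bd 0 (k + 4) P"
    using \<zeta>(1) order_props[OF \<sigma>] fm_bd_fsub[OF \<zeta>b, of 0 Var "\<lambda>i. i + 4" "k + 4"] fm_bd_mono[of 0 4 "order_fm \<sigma>" 0 "k + 4"]
    by (auto simp: P_def)
  let ?Z = "osuc (osum (family S))"
  have wo: "Well_order (osum (family S))" by (rule Well_order_osum[OF Well_order_family])
  have "otype ?Z \<le> pt_ordinal T"
  proof (rule boundedness[OF T P, of 1 E])
    have "msat stdm (\<lambda>_. 0) E P" unfolding mP using E1 order_true[OF S \<sigma>, of E] by (simp add: E_def)
    then show "sat (\<lambda>_. 0) E P" by simp
    show "Well_order ?Z" by (rule Well_order_osuc[OF wo])
    show "E 1 = {N.pJ x y | x y. (x, y) \<in> ?Z \<and> x \<noteq> y}" by (simp add: E_def order_sets_def)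
    fix M :: "nat model" and e :: "nat \<Rightarrow> nat" and E' F
    assume M: "mods M T" "aca M" and E': "range E' \<subseteq> ms M" and s: "msat M e E' P"
    interpret aca M by fact
    have s': "msat M e (\<lambda>i. E' (i + 4)) \<zeta>" "msat M e E' (order_fm \<sigma>)" using s by (simp_all add: mP)
    have "msat M e E' facts_fm" using s'(2) by (simp add: order_fm_def)
    then interpret sy M by (rule facts_sy)
    have sent: "sentence \<theta>" using \<theta>(2) by (simp add: true_sentence_def)
    \<comment> \<open>The sets from index 4 on witness \<open>\<theta>\<close> in \<open>M\<close>,
      so \<open>M\<close> is a model of the extended theory and reflection holds in it.\<close>
    have "msat M e E'' \<theta>" for E''
    proof -
      let ?E = "\<lambda>i. if i < k then E' (i + 4) else E'' (i - k)"
      have "msat M e ?E \<zeta>" using s'(1) msat_cong[OF \<zeta>b, of e e ?E "\<lambda>i. E' (i + 4)" M] by simp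
      then show ?thesis unfolding \<zeta>(2) msat_ExS_pow using E' by (intro exI[of _ ?E]) auto
    qed
    then have "msat M e'' E'' \<theta>" for e'' E''
      using msat_cong[of 0 0 \<theta> e'' e E'' E'' M] sent by (simp add: sentence_def)
    then have "mods M (insert \<theta> T)" using M(1) by (simp add: mods_def)
    from soundness[OF \<theta>(3) this E'] have "msat M e E' (RFN_Pi11 \<sigma>)" .
    then show "\<not> descending F (E' 1)" by (rule order_no_descent[OF \<sigma>b E' s'(2)])
  qed auto
  moreover have "otype (osum (family S)) < otype ?Z" by (rule osuc_less[OF wo])
  ultimately show ?thesis using pt_ordinal_le_family[of S] by order
qed

section \<open>Ranks\<close>

instance recf :: countable
  by countable_datatype

text \<open>Needed for ranks to exist as countable ordinals. A theory is determined by a recursive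
  function whose domain is its set of codes, since \<open>fm_code\<close> is injective.\<close>

lemma countable_extensions: "countable {S. sound_re_extension S}"
proof -
  have "\<exists>f. \<forall>x. x \<in> fm_code ` S \<longleftrightarrow> (\<exists>y. computes f [x] y)" if "sound_re_extension S" for S
    using that by (simp add: sound_re_extension_def rec_enumerable_def)
  then obtain g where g: "\<And>S x. sound_re_extension S \<Longrightarrow> x \<in> fm_code ` S \<longleftrightarrow> (\<exists>y. computes (g S) [x] y)" by metis
  have "inj_on g {S. sound_re_extension S}"
  proof (rule inj_onI)
    fix S T assume ST: "S \<in> {S. sound_re_extension S}" "T \<in> {S. sound_re_extension S}" "g S = g T"
    have "x \<in> fm_code ` S \<longleftrightarrow> x \<in> fm_code ` T" for x using g[of S x] g[of T x] ST by simp
    then have "fm_code ` S = fm_code ` T" by blast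
    then show "S = T" by (simp add: inj_image_eq_iff inj_def)
  qed
  moreover have "countable (UNIV :: recf set)" by (rule countableI_type)
  ultimately show ?thesis using countable_image_inj_on[of g] countable_subset[OF subset_UNIV] by blast
qed

lemma reflects_iff:
  assumes "sound_re_extension S" "sound_re_extension T"
  shows "S \<prec>\<^sub>R T \<longleftrightarrow> pt_ordinal S < pt_ordinal T"
  using assms less_ordinal_reflects reflects_less_ordinal by blast

text \<open>Well-foundedness of \<open>\<prec>\<^sub>R\<close>, needed to unfold the recursion,
  comes from \<open>reflects_less_ordinal\<close>: the relation maps into the order of the
  ordinals.\<close>

lemma rank_unfold: "reflection_rank T = (LEAST b. \<forall>S. S \<prec>\<^sub>R T \<longrightarrow> reflection_rank S < b)"
proof -
  have "{(S, T). S \<prec>\<^sub>R T} \<subseteq> inv_image {(a, b). a < b} pt_ordinal"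
    using reflects_less_ordinal by auto
  then have wf: "wf {(S, T). S \<prec>\<^sub>R T}"
    using wf_subset wf_inv_image wf by blast
  show ?thesis
    unfolding reflection_rank_def by (subst wfrec[OF wf]) (simp add: cut_def cong: conj_cong)
qed

lemma rank_less: assumes "S \<prec>\<^sub>R T" shows "reflection_rank S < reflection_rank T"
proof -
  have "countable {S. S \<prec>\<^sub>R T}"
    by (rule countable_subset[OF _ countable_extensions]) (auto simp: reflects_def)
  then have "countable (reflection_rank ` {S. S \<prec>\<^sub>R T})" by simp
  from ord_bound[OF this] obtain b where "\<forall>S. S \<prec>\<^sub>R T \<longrightarrow> reflection_rank S < b" by auto
  then have "\<forall>S. S \<prec>\<^sub>R T \<longrightarrow> reflection_rank S < (LEAST b. \<forall>S. S \<prec>\<^sub>R T \<longrightarrow> reflection_rank S < b)"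
    by (rule LeastI[of "\<lambda>b. \<forall>S. S \<prec>\<^sub>R T \<longrightarrow> reflection_rank S < b"])
  then show ?thesis using assms rank_unfold[of T] by simp
qed

theorem theorem3p15:
  fixes S T :: "fm set"
  assumes "sound_re_extension S" and "sound_re_extension T"
  shows "pt_ordinal S \<le> pt_ordinal T \<longleftrightarrow> reflection_rank S \<le> reflection_rank T"
proof
  assume "pt_ordinal S \<le> pt_ordinal T"
  then have sub: "\<And>U. U \<prec>\<^sub>R S \<Longrightarrow> U \<prec>\<^sub>R T"
    using assms reflects_iff by (meson order_less_le_trans reflects_def)
  show "reflection_rank S \<le> reflection_rank T"
    by (subst rank_unfold[of S]) (rule Least_le, intro allI impI rank_less sub)
next
  assume "reflection_rank S \<le> reflection_rank T"
  then have "\<not> T \<prec>\<^sub>R S" using rank_less[of T S] by auto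
  then show "pt_ordinal S \<le> pt_ordinal T" using reflects_iff assms by (meson not_less)
qed

end
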